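(* Let $E=\mathbb R^{p+q}$, $M=\mathbb R^p$, and let $\pi:E\to M$ be the canonical projection. For every natural number $n\ge1$, the mapping $\varphi_{n}:\mathbf{J}^{n}(\pi)\rightarrow\mathbb{J}^{D^{n}}(\pi)$ is bijective.
   Context: Everything takes place in the category of Fr\"olicher spaces; every "mapping" is smooth. For a Weil algebra $W=C^\infty(\mathbb R^k)/I$ and a Fr\"olicher space $X$, $X\otimes W$ is the quotient of $C^\infty(\mathbb R^k,X)$ by $f\sim g$ iff $h\circ f-h\circ g\in I$ for all smooth $h:X\to\mathbb R$; functorial in $X$ and $W$. Infinitesimal objects such as $D=\{d:d^2=0\}$, $D_m=\{d:d^{m+1}=0\}$, $D^n=D\times\dots\times D$ have Weil algebras $\mathcal W_{\mathbb D}$ of functions (quotient of $C^\infty(\mathbb R^k)$ by the ideal generated by the equations), and a polynomial map $f:\mathbb D\to\mathbb D'$ with $f(0)=0$ induces $\mathrm{id}_X\otimes\mathcal W_f:X\otimes\mathcal W_{\mathbb D'}\to X\otimes\mathcal W_{\mathbb D}$ ("composition with $f$"). $(X\otimes\mathcal W_{\mathbb D})_x$ is the fibre over $x$ of $X\otimes\mathcal W_{\mathbb D}\to X$. First approach. For a smooth map $\rho:Y\to M$ and $y\in Y$, $\mathbf J^1_y(\rho)$ is the set of mappings $\nabla_y:(M\otimes\mathcal W_D)_{\rho(y)}\to(Y\otimes\mathcal W_D)_y$ with $(\rho\otimes\mathrm{id})(\nabla_y(t))=t$, $\nabla_y(\alpha t)=\alpha\nabla_y(t)$ for $\alpha\in\mathbb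 R$, and, for all $m$ with $\mu:D\times D_m\to D$, $\mu(d,e)=ed$, $(\nabla_y\otimes\mathrm{id}_{\mathcal W_{D_m}})\circ(\mathrm{id}_M\otimes\mathcal W_\mu)=(\mathrm{id}_Y\otimes\mathcal W_\mu)\circ\nabla_y$. $\mathbf J^1(\rho)=\bigcup_y\mathbf J^1_y(\rho)$ has projections $\rho_{1,0}$ to $Y$ and $\rho_1=\rho\circ\rho_{1,0}$ to $M$, and the fibrewise mapping-space structure: a curve $c$ is smooth iff its base curve in $Y$ is smooth and $r\mapsto c(g(r))(t(r))$ is smooth for all smooth $g:\mathbb R\to\mathbb R$ and smooth $t:\mathbb R\to M\otimes\mathcal W_D$ for which this makes sense (the spaces $\mathbb J^{D^n}(\pi)$ below get the analogous structure over $E$). Put $\mathbf J^0(\pi)=E$, $\pi_0=\pi$. For $n\ge1$, $\mathbf J^{n+1}(\pi)\subset\mathbf J^1(\pi_n)$ consists of those $\nabla_x$, with $x=\nabla_y\in\mathbf J^n(\pi)$, such that: (i) $(\pi_{n,n-1}\otimes\mathrm{id}_{\mathcal W_D})(\nabla_x(t))=\nabla_y(t)$ for all $t$; (ii) $P(\gamma)=P(\gamma^\tau)^\tau$ for all $\gamma\in(M\otimes\mathcal W_{D^2})_{\pi_n(x)}$, where $\tau$ interchanges the variables of $D^2$ and $P(\gamma)\in\mathbf J^{n-1}(\pi)\otimes\mathcal W_{D^2}$ is $(d_1,d_2)\mapsto(\nabla_x(\gamma(\cdot,0))(d_1))(\gamma(d_1,\cdot))(d_2)$; formally, apply $\mathrm{ev}\otimes\mathrm{id}_{\mathcal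 W_D}$, $\mathrm{ev}(\nabla,t)=\nabla(t)$, to the pair of $\nabla_x(\gamma(\cdot,0))\in\mathbf J^n(\pi)\otimes\mathcal W_D$ and $\gamma$ viewed as $d_1\mapsto\gamma(d_1,\cdot)$ in $(M\otimes\mathcal W_D)\otimes\mathcal W_D$. Second approach. For $\gamma\in X\otimes\mathcal W_{D^n}$: $\alpha\underset{i}{\cdot}\gamma$ is the composition with $(d_1,\dots,d_n)\mapsto(d_1,\dots,\alpha d_i,\dots,d_n)$, and $\gamma^\sigma$ ($\sigma\in\mathbf S_n$) with $(d_1,\dots,d_n)\mapsto(d_{\sigma(1)},\dots,d_{\sigma(n)})$. A $D^n$-pseudotangential at $x\in E$ is a mapping $\nabla_x:(M\otimes\mathcal W_{D^n})_{\pi(x)}\to(E\otimes\mathcal W_{D^n})_x$ with: (1) $(\pi\otimes\mathrm{id})(\nabla_x(\gamma))=\gamma$; (2) $\nabla_x(\alpha\underset{i}{\cdot}\gamma)=\alpha\underset{i}{\cdot}\nabla_x(\gamma)$; (3) for all $m\ge1$, $1\le i\le n$, with $\mu_i(d_1,\dots,d_n,e)=(d_1,\dots,ed_i,\dots,d_n)$ on $D^n\times D_m$, $(\nabla_x\otimes\mathrm{id}_{\mathcal W_{D_m}})\circ(\mathrm{id}_M\otimes\mathcal W_{\mu_i})=(\mathrm{id}_E\otimes\mathcal W_{\mu_i})\circ\nabla_x$; (4) $\nabla_x(\gamma^\sigma)=(\nabla_x(\gamma))^\sigma$. For a $D^{n+1}$-pseudotangential $\nabla_x$, $\hat\pi_{n+1,n}(\nabla_x)(\gamma)$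 is the composition with $(d_1,\dots,d_n)\mapsto(d_1,\dots,d_n,0)$ of $\nabla_x$ applied to the composition of $\gamma$ with $(d_1,\dots,d_{n+1})\mapsto(d_1,\dots,d_n)$. A $D$-tangential is a $D$-pseudotangential; a $D^{n+1}$-tangential is a $D^{n+1}$-pseudotangential $\nabla_x$ such that $\hat\pi_{n+1,n}(\nabla_x)$ is a $D^n$-tangential and, with $\kappa(d_1,\dots,d_{n+1})=(d_1,\dots,d_{n-1},d_nd_{n+1})$, $\nabla_x((\mathrm{id}_M\otimes\mathcal W_\kappa)(\gamma))=(\mathrm{id}_E\otimes\mathcal W_\kappa)(\hat\pi_{n+1,n}(\nabla_x)(\gamma))$ for all $\gamma\in(M\otimes\mathcal W_{D^n})_{\pi(x)}$. $\mathbb J^{D^n}(\pi)$ is the set of all $D^n$-tangentials at all $x\in E$. The map $\varphi_n:\mathbf J^n(\pi)\to\mathbb J^{D^n}(\pi)$: $\varphi_1=\mathrm{id}$, and $\varphi_{n+1}(\nabla_x)(\gamma)$ is $(d_1,\dots,d_{n+1})\mapsto\varphi_n\big(\nabla_x(\gamma(0,\dots,0,\cdot))(d_{n+1})\big)\big(\gamma(\cdot,\dots,\cdot,d_{n+1})\big)(d_1,\dots,d_n)$ for $\gamma\in M\otimes\mathcal W_{D^{n+1}}$; formally, evaluate $(\varphi_n\otimes\mathrm{id}_{\mathcal W_D})(\nabla_x(\gamma(0,\dots,0,\cdot)))\in\mathbb J^{D^n}(\pi)\otimes\mathcal W_D$ on $\gamma$ viewed in $(M\otimes\mathcal W_{D^n})\otimes\mathcal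 W_D$, by the evaluation map prolonged by $\mathcal W_D$. *)

theory Defs
  imports "HOL-Analysis.Analysis" "HOL-Combinatorics.Permutations"
begin

section \<open>Froelicher spaces\<close>

definition smooth :: "(real \<Rightarrow> real) \<Rightarrow> bool" where
  "smooth f \<longleftrightarrow> (\<forall>n x. (deriv ^^ n) f differentiable (at x))"

text \<open>A space is stored as its points and its smooth curves; the smooth real functions are those
  determined by the curves. The space is Froelicher when conversely the functions determine the
  curves. Functions are only relevant on the points of a space.\<close>

record 'a space =
  points :: "'a set"
  curves :: "(real \<Rightarrow> 'a) set"

definition smooth_functions :: "'a space \<Rightarrow> ('a \<Rightarrow> real) set" where
  "smooth_functions X = {h. \<forall>c\<in>curves X. smooth (h \<circ> c)}"

definition froelicher :: "'a space \<Rightarrow> bool" where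
  "froelicher X \<longleftrightarrow>
     curves X = {c. range c \<subseteq> points X \<and> (\<forall>h\<in>smooth_functions X. smooth (h \<circ> c))}"

definition smooth_maps :: "'a space \<Rightarrow> 'b space \<Rightarrow> ('a \<Rightarrow> 'b) set" where
  "smooth_maps X Y = {f. f ` points X \<subseteq> points Y \<and> (\<forall>c\<in>curves X. f \<circ> c \<in> curves Y)}"

definition subspace :: "'a set \<Rightarrow> 'a space \<Rightarrow> 'a space" where
  "subspace A X = \<lparr>points = points X \<inter> A, curves = {c \<in> curves X. range c \<subseteq> A}\<rparr>"

definition fibre_product :: "'a space \<Rightarrow> 'b space \<Rightarrow> ('a \<Rightarrow> 'c) \<Rightarrow> ('b \<Rightarrow> 'c) \<Rightarrow> ('a \<times> 'b) space" where
  "fibre_product X Y f g =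
     \<lparr>points = {(a, b). a \<in> points X \<and> b \<in> points Y \<and> f a = g b},
      curves = {c. fst \<circ> c \<in> curves X \<and> snd \<circ> c \<in> curves Y \<and>
                   (\<forall>r. f (fst (c r)) = g (snd (c r)))}\<rparr>"

text \<open>Transport of structure along an injective map.\<close>

definition transport :: "('a \<Rightarrow> 'b) \<Rightarrow> 'a space \<Rightarrow> 'b space" where
  "transport f X = \<lparr>points = f ` points X, curves = (\<lambda>c. f \<circ> c) ` curves X\<rparr>"

text \<open>The Euclidean space of dimension \<open>k\<close>: coordinates are numbered from 0, and the
  coordinates from \<open>k\<close> on vanish.\<close>

definition rn :: "nat \<Rightarrow> (nat \<Rightarrow> real) space" where
  "rn k = \<lparr>points = {x. \<forall>i\<ge>k. x i = 0},
           curves = {c. (\<forall>r. \<forall>i\<ge>k. c r i = 0) \<and> (\<forall>i<k. smooth (\<lambda>r. c r i))}\<rparr>"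

text \<open>The space of smooth maps from \<open>rn k\<close> to \<open>X\<close>: a curve in it is smooth iff it is smooth
  jointly with the argument.\<close>

definition mapping_space :: "nat \<Rightarrow> 'a space \<Rightarrow> ((nat \<Rightarrow> real) \<Rightarrow> 'a) space" where
  "mapping_space k X =
     \<lparr>points = smooth_maps (rn k) X,
      curves = {c. range c \<subseteq> smooth_maps (rn k) X \<and>
                   (\<forall>g u. smooth g \<longrightarrow> u \<in> curves (rn k) \<longrightarrow> (\<lambda>r. c (g r) (u r)) \<in> curves X)}\<rparr>"


section \<open>Weil algebras and prolongations\<close>

text \<open>The pair \<open>(k, I)\<close> stands for the quotient of the algebra of smooth functions on \<open>rn k\<close>
  by the ideal \<open>I\<close>.\<close>

type_synonym weil = "nat \<times> ((nat \<Rightarrow> real) \<Rightarrow> real) set"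

definition ideal_generated :: "nat \<Rightarrow> ((nat \<Rightarrow> real) \<Rightarrow> real) set \<Rightarrow> ((nat \<Rightarrow> real) \<Rightarrow> real) set" where
  "ideal_generated k G =
     {f. \<exists>S a. finite S \<and> S \<subseteq> G \<and> (\<forall>g\<in>S. a g \<in> smooth_functions (rn k)) \<and>
               (\<forall>x\<in>points (rn k). f x = (\<Sum>g\<in>S. a g x * g x))}"

text \<open>The list \<open>[m1, \<dots>, mk]\<close> denotes the infinitesimal object that is the product of the
  objects of all \<open>d\<close> with \<open>d ^ (mi + 1) = 0\<close>.\<close>

definition weil :: "nat list \<Rightarrow> weil" where
  "weil ms = (length ms, ideal_generated (length ms) {\<lambda>x. x i ^ (ms ! i + 1) | i. i < length ms})"

abbreviation Dobj :: "nat \<Rightarrow> nat list" where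
  "Dobj n \<equiv> replicate n 1"

abbreviation WD :: "nat \<Rightarrow> weil" where
  "WD n \<equiv> weil (Dobj n)"

definition equiv_mod :: "'a space \<Rightarrow> weil \<Rightarrow> ((nat \<Rightarrow> real) \<Rightarrow> 'a) \<Rightarrow> ((nat \<Rightarrow> real) \<Rightarrow> 'a) \<Rightarrow> bool" where
  "equiv_mod X A f g \<longleftrightarrow> (\<forall>h\<in>smooth_functions X. (\<lambda>x. h (f x) - h (g x)) \<in> snd A)"

text \<open>An equivalence class is represented by a chosen element of it, see \<open>wclass_eq_iff\<close> below.
  Unlike sets of maps, these representatives permit the recursive datatype of iterated jets
  below. They also make \<open>\<gamma> d\<close> meaningful for an element \<open>\<gamma>\<close> of a prolongation.\<close>

definition wclass :: "'a space \<Rightarrow> weil \<Rightarrow> ((nat \<Rightarrow> real) \<Rightarrow> 'a) \<Rightarrow> ((nat \<Rightarrow> real) \<Rightarrow> 'a)" where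
  "wclass X A f = (SOME g. g \<in> smooth_maps (rn (fst A)) X \<and> equiv_mod X A f g)"

text \<open>The prolongation of \<open>X\<close> by a Weil algebra, with the quotient structure: a function is smooth
  iff its composite with the quotient map is.\<close>

definition tensor :: "'a space \<Rightarrow> weil \<Rightarrow> ((nat \<Rightarrow> real) \<Rightarrow> 'a) space" where
  "tensor X A =
     \<lparr>points = wclass X A ` smooth_maps (rn (fst A)) X,
      curves = {c. range c \<subseteq> wclass X A ` smooth_maps (rn (fst A)) X \<and>
                   (\<forall>h. h \<circ> wclass X A \<in> smooth_functions (mapping_space (fst A) X) \<longrightarrow> smooth (h \<circ> c))}\<rparr>"

definition base :: "((nat \<Rightarrow> real) \<Rightarrow> 'a) \<Rightarrow> 'a" where
  "base \<gamma> = \<gamma> (\<lambda>_. 0)"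

definition fibre :: "'a space \<Rightarrow> weil \<Rightarrow> 'a \<Rightarrow> ((nat \<Rightarrow> real) \<Rightarrow> 'a) space" where
  "fibre X A x = subspace {\<gamma>. base \<gamma> = x} (tensor X A)"

text \<open>Functoriality in the space (\<open>prolong Y A f\<close>, for \<open>f\<close> with values in \<open>Y\<close>) and in the Weil
  algebra (\<open>pull X A f\<close>, composition with \<open>f\<close>, where \<open>A\<close> belongs to the domain of \<open>f\<close>).\<close>

definition prolong :: "'b space \<Rightarrow> weil \<Rightarrow> ('a \<Rightarrow> 'b) \<Rightarrow> ((nat \<Rightarrow> real) \<Rightarrow> 'a) \<Rightarrow> ((nat \<Rightarrow> real) \<Rightarrow> 'b)" where
  "prolong Y A f \<gamma> = wclass Y A (f \<circ> \<gamma>)"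

definition pull :: "'a space \<Rightarrow> weil \<Rightarrow> ((nat \<Rightarrow> real) \<Rightarrow> (nat \<Rightarrow> real)) \<Rightarrow>
    ((nat \<Rightarrow> real) \<Rightarrow> 'a) \<Rightarrow> ((nat \<Rightarrow> real) \<Rightarrow> 'a)" where
  "pull X A f \<gamma> = wclass X A (\<gamma> \<circ> f)"

definition vappend :: "nat \<Rightarrow> (nat \<Rightarrow> real) \<Rightarrow> (nat \<Rightarrow> real) \<Rightarrow> (nat \<Rightarrow> real)" where
  "vappend k d e = (\<lambda>i. if i < k then d i else e (i - k))"

text \<open>The canonical comparison of a prolongation by \<open>weil (ms @ ns)\<close> with the prolongation by
  \<open>weil ns\<close> of the one by \<open>weil ms\<close>; the variables of \<open>ns\<close> come last and become the outer ones.\<close>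

definition wcurry :: "'a space \<Rightarrow> nat list \<Rightarrow> nat list \<Rightarrow> ((nat \<Rightarrow> real) \<Rightarrow> 'a) \<Rightarrow>
    ((nat \<Rightarrow> real) \<Rightarrow> (nat \<Rightarrow> real) \<Rightarrow> 'a)" where
  "wcurry X ms ns \<gamma> =
     wclass (tensor X (weil ms)) (weil ns)
       (\<lambda>e. wclass X (weil ms) (\<lambda>d. \<gamma> (vappend (length ms) d e)))"

definition wuncurry :: "'a space \<Rightarrow> nat list \<Rightarrow> nat list \<Rightarrow>
    ((nat \<Rightarrow> real) \<Rightarrow> (nat \<Rightarrow> real) \<Rightarrow> 'a) \<Rightarrow> ((nat \<Rightarrow> real) \<Rightarrow> 'a)" where
  "wuncurry X ms ns \<omega> =
     (THE \<gamma>. \<gamma> \<in> points (tensor X (weil (ms @ ns))) \<and> wcurry X ms ns \<gamma> = \<omega>)"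

text \<open>An element of the prolongation of \<open>X\<close> that comes from a subspace \<open>S\<close>, as an element of the
  prolongation of \<open>S\<close>.\<close>

definition to_subspace :: "'a space \<Rightarrow> 'a space \<Rightarrow> weil \<Rightarrow>
    ((nat \<Rightarrow> real) \<Rightarrow> 'a) \<Rightarrow> ((nat \<Rightarrow> real) \<Rightarrow> 'a)" where
  "to_subspace S X A \<gamma> = (THE \<zeta>. \<zeta> \<in> points (tensor S A) \<and> prolong X A (\<lambda>x. x) \<zeta> = \<gamma>)"

text \<open>The element of the prolongation of a fibre product with given components.\<close>

definition wpair :: "'a space \<Rightarrow> 'b space \<Rightarrow> ('a \<Rightarrow> 'c) \<Rightarrow> ('b \<Rightarrow> 'c) \<Rightarrow> weil \<Rightarrow>
    ((nat \<Rightarrow> real) \<Rightarrow> 'a) \<Rightarrow> ((nat \<Rightarrow> real) \<Rightarrow> 'b) \<Rightarrow> ((nat \<Rightarrow> real) \<Rightarrow> 'a \<times> 'b)" where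
  "wpair X Y f g A \<alpha> \<beta> =
     (THE \<zeta>. \<zeta> \<in> points (tensor (fibre_product X Y f g) A) \<and>
             prolong X A fst \<zeta> = \<alpha> \<and> prolong Y A snd \<zeta> = \<beta>)"


section \<open>Lifts of infinitesimals\<close>

definition scale :: "'a space \<Rightarrow> nat \<Rightarrow> nat \<Rightarrow> real \<Rightarrow> ((nat \<Rightarrow> real) \<Rightarrow> 'a) \<Rightarrow> ((nat \<Rightarrow> real) \<Rightarrow> 'a)" where
  "scale X n i \<alpha> \<gamma> = pull X (WD n) (\<lambda>d. d(i := \<alpha> * d i)) \<gamma>"

definition permute :: "'a space \<Rightarrow> nat \<Rightarrow> (nat \<Rightarrow> nat) \<Rightarrow> ((nat \<Rightarrow> real) \<Rightarrow> 'a) \<Rightarrow> ((nat \<Rightarrow> real) \<Rightarrow> 'a)" where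
  "permute X n \<sigma> \<gamma> = pull X (WD n) (\<lambda>d j. d (\<sigma> j)) \<gamma>"

abbreviation swap :: "'a space \<Rightarrow> ((nat \<Rightarrow> real) \<Rightarrow> 'a) \<Rightarrow> ((nat \<Rightarrow> real) \<Rightarrow> 'a)" where
  "swap X \<equiv> permute X 2 (Transposition.transpose 0 1)"

text \<open>A lift consists of its base point \<open>y\<close> and a mapping \<open>F\<close> on the fibre over \<open>\<rho> y\<close>, made
  unique as a HOL function by extensionality.\<close>

type_synonym ('m, 'y) lift = "'y \<times> (((nat \<Rightarrow> real) \<Rightarrow> 'm) \<Rightarrow> ((nat \<Rightarrow> real) \<Rightarrow> 'y))"

definition is_lift :: "'m space \<Rightarrow> 'y space \<Rightarrow> ('y \<Rightarrow> 'm) \<Rightarrow> weil \<Rightarrow> ('m, 'y) lift \<Rightarrow> bool" where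
  "is_lift M Y \<rho> A = (\<lambda>(y, F).
     y \<in> points Y \<and>
     F \<in> smooth_maps (fibre M A (\<rho> y)) (fibre Y A y) \<and>
     F \<in> extensional (points (fibre M A (\<rho> y))) \<and>
     (\<forall>t\<in>points (fibre M A (\<rho> y)). prolong M A \<rho> (F t) = t))"

definition homogeneous :: "'m space \<Rightarrow> 'y space \<Rightarrow> ('y \<Rightarrow> 'm) \<Rightarrow> nat \<Rightarrow> nat \<Rightarrow> ('m, 'y) lift \<Rightarrow> bool" where
  "homogeneous M Y \<rho> n i = (\<lambda>(y, F).
     \<forall>\<alpha>. \<forall>t\<in>points (fibre M (WD n) (\<rho> y)). F (scale M n i \<alpha> t) = scale Y n i \<alpha> (F t))"

text \<open>The variables of \<open>mu n i\<close> with numbers below \<open>n\<close> are those of the \<open>n\<close>-fold product; the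
  variable with number \<open>n\<close> is the additional factor.\<close>

definition mu :: "nat \<Rightarrow> nat \<Rightarrow> (nat \<Rightarrow> real) \<Rightarrow> (nat \<Rightarrow> real)" where
  "mu n i d = (\<lambda>j. if j = i then d n * d i else if j < n then d j else 0)"

text \<open>Both sides are compared in the prolongation by \<open>weil [m]\<close> of the one by \<open>WD n\<close>; on the left
  \<open>F\<close> is prolonged from the fibre, on which it is defined.\<close>

definition inf_homogeneous :: "'m space \<Rightarrow> 'y space \<Rightarrow> ('y \<Rightarrow> 'm) \<Rightarrow> nat \<Rightarrow> nat \<Rightarrow> nat \<Rightarrow> ('m, 'y) lift \<Rightarrow> bool" where
  "inf_homogeneous M Y \<rho> n i m = (\<lambda>(y, F).
     \<forall>t\<in>points (fibre M (WD n) (\<rho> y)).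
       prolong (tensor Y (WD n)) (weil [m]) F
         (to_subspace (fibre M (WD n) (\<rho> y)) (tensor M (WD n)) (weil [m])
           (wcurry M (Dobj n) [m] (pull M (weil (Dobj n @ [m])) (mu n i) t)))
       = wcurry Y (Dobj n) [m] (pull Y (weil (Dobj n @ [m])) (mu n i) (F t)))"

text \<open>The fibrewise mapping-space structure on a set \<open>S\<close> of lifts.\<close>

definition lift_space :: "'m space \<Rightarrow> 'y space \<Rightarrow> ('y \<Rightarrow> 'm) \<Rightarrow> weil \<Rightarrow> ('m, 'y) lift set \<Rightarrow> ('m, 'y) lift space" where
  "lift_space M Y \<rho> A S =
     \<lparr>points = S,
      curves = {c. range c \<subseteq> S \<and> fst \<circ> c \<in> curves Y \<and>
                   (\<forall>g t. smooth g \<longrightarrow> t \<in> curves (tensor M A) \<longrightarrow>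
                      (\<forall>r. base (t r) = \<rho> (fst (c (g r)))) \<longrightarrow>
                      (\<lambda>r. snd (c (g r)) (t r)) \<in> curves (tensor Y A))}\<rparr>"


section \<open>First approach: iterated jets\<close>

definition J1 :: "'m space \<Rightarrow> 'y space \<Rightarrow> ('y \<Rightarrow> 'm) \<Rightarrow> ('m, 'y) lift space" where
  "J1 M Y \<rho> = lift_space M Y \<rho> (WD 1)
     {F. is_lift M Y \<rho> (WD 1) F \<and> homogeneous M Y \<rho> 1 0 F \<and> (\<forall>m. inf_homogeneous M Y \<rho> 1 0 m F)}"

text \<open>All spaces of iterated jets live in one type: \<open>Pt\<close> embeds the total space, and \<open>Jet\<close>
  embeds the lifts to the previous space.\<close>

datatype ('m, 'e) jet =
    Pt 'e
  | Jet (jet_base: "('m, 'e) jet") (jet_fun: "((nat \<Rightarrow> real) \<Rightarrow> 'm) \<Rightarrow> ((nat \<Rightarrow> real) \<Rightarrow> ('m, 'e) jet)")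

primrec bottom :: "('m, 'e) jet \<Rightarrow> 'e" where
  "bottom (Pt e) = e"
| "bottom (Jet x F) = bottom x"

text \<open>\<open>X\<close> and \<open>Y\<close> are two successive jet spaces, \<open>\<rho>\<close> is the projection of \<open>X\<close> to \<open>M\<close>, and
  \<open>F\<close> takes values in the tangent vectors of \<open>X\<close>. As the outer variables of \<open>wcurry\<close> come last,
  viewing \<open>\<gamma>\<close> as the map from \<open>d1\<close> to \<open>\<gamma> (d1, _)\<close> involves a swap; so does the way back.\<close>

definition second_lift :: "'m space \<Rightarrow> ('m, 'e) jet space \<Rightarrow> ('m, 'e) jet space \<Rightarrow> (('m, 'e) jet \<Rightarrow> 'm) \<Rightarrow>
    (((nat \<Rightarrow> real) \<Rightarrow> 'm) \<Rightarrow> ((nat \<Rightarrow> real) \<Rightarrow> ('m, 'e) jet)) \<Rightarrow>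
    ((nat \<Rightarrow> real) \<Rightarrow> 'm) \<Rightarrow> ((nat \<Rightarrow> real) \<Rightarrow> ('m, 'e) jet)" where
  "second_lift M Y X \<rho> F \<gamma> =
     swap Y (wuncurry Y (Dobj 1) (Dobj 1)
       (prolong (tensor Y (WD 1)) (WD 1) (\<lambda>(x, t). jet_fun x t)
         (wpair X (tensor M (WD 1)) \<rho> base (WD 1)
           (F (pull M (WD 1) (\<lambda>d. d(1 := 0)) \<gamma>))
           (wcurry M (Dobj 1) (Dobj 1) (swap M \<gamma>)))))"

fun jets :: "'m space \<Rightarrow> 'e space \<Rightarrow> ('e \<Rightarrow> 'm) \<Rightarrow> nat \<Rightarrow> ('m, 'e) jet space" where
  "jets M E \<pi> 0 = transport Pt E"
| "jets M E \<pi> (Suc 0) = transport (\<lambda>(y, F). Jet y F) (J1 M (jets M E \<pi> 0) (\<pi> \<circ> bottom))"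
| "jets M E \<pi> (Suc (Suc n)) = transport (\<lambda>(x, F). Jet x F)
     (subspace
       {(x, F).
          (\<forall>t\<in>points (fibre M (WD 1) (\<pi> (bottom x))).
             prolong (jets M E \<pi> n) (WD 1) jet_base (F t) = jet_fun x t) \<and>
          (\<forall>\<gamma>\<in>points (fibre M (WD 2) (\<pi> (bottom x))).
             second_lift M (jets M E \<pi> n) (jets M E \<pi> (Suc n)) (\<pi> \<circ> bottom) F \<gamma> =
             swap (jets M E \<pi> n)
               (second_lift M (jets M E \<pi> n) (jets M E \<pi> (Suc n)) (\<pi> \<circ> bottom) F (swap M \<gamma>)))}
       (J1 M (jets M E \<pi> (Suc n)) (\<pi> \<circ> bottom)))"


section \<open>Second approach: tangentials\<close>

definition pseudotangential :: "'m space \<Rightarrow> 'e space \<Rightarrow> ('e \<Rightarrow> 'm) \<Rightarrow> nat \<Rightarrow> ('m, 'e) lift \<Rightarrow> bool" where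
  "pseudotangential M E \<pi> n = (\<lambda>(x, F).
     is_lift M E \<pi> (WD n) (x, F) \<and>
     (\<forall>i<n. homogeneous M E \<pi> n i (x, F)) \<and>
     (\<forall>m\<ge>1. \<forall>i<n. inf_homogeneous M E \<pi> n i m (x, F)) \<and>
     (\<forall>\<sigma>. \<sigma> permutes {..<n} \<longrightarrow>
        (\<forall>\<gamma>\<in>points (fibre M (WD n) (\<pi> x)). F (permute M n \<sigma> \<gamma>) = permute E n \<sigma> (F \<gamma>))))"

text \<open>As the coordinates outside the space vanish, \<open>\<lambda>d. d(n := 0)\<close> serves both as the inclusion
  of dimension \<open>n\<close> into dimension \<open>n + 1\<close> and as the projection back.\<close>

definition pihat :: "'m space \<Rightarrow> 'e space \<Rightarrow> ('e \<Rightarrow> 'm) \<Rightarrow> nat \<Rightarrow> ('m, 'e) lift \<Rightarrow> ('m, 'e) lift" where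
  "pihat M E \<pi> n = (\<lambda>(x, F).
     (x, \<lambda>\<gamma>\<in>points (fibre M (WD n) (\<pi> x)).
           pull E (WD n) (\<lambda>d. d(n := 0)) (F (pull M (WD (Suc n)) (\<lambda>d. d(n := 0)) \<gamma>))))"

definition kappa :: "nat \<Rightarrow> (nat \<Rightarrow> real) \<Rightarrow> (nat \<Rightarrow> real)" where
  "kappa n d = d(n - 1 := d (n - 1) * d n, n := 0)"

inductive tangential :: "'m space \<Rightarrow> 'e space \<Rightarrow> ('e \<Rightarrow> 'm) \<Rightarrow> nat \<Rightarrow> ('m, 'e) lift \<Rightarrow> bool"
  for M :: "'m space" and E :: "'e space" and \<pi> :: "'e \<Rightarrow> 'm" where
  one: "pseudotangential M E \<pi> 1 F \<Longrightarrow> tangential M E \<pi> 1 F"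
| step: "\<lbrakk>n \<ge> 1; pseudotangential M E \<pi> (Suc n) (x, F); tangential M E \<pi> n (pihat M E \<pi> n (x, F));
    \<forall>\<gamma>\<in>points (fibre M (WD n) (\<pi> x)).
      F (pull M (WD (Suc n)) (kappa n) \<gamma>) =
      pull E (WD (Suc n)) (kappa n) (snd (pihat M E \<pi> n (x, F)) \<gamma>)\<rbrakk>
   \<Longrightarrow> tangential M E \<pi> (Suc n) (x, F)"

definition tangentials :: "'m space \<Rightarrow> 'e space \<Rightarrow> ('e \<Rightarrow> 'm) \<Rightarrow> nat \<Rightarrow> ('m, 'e) lift space" where
  "tangentials M E \<pi> n = lift_space M E \<pi> (WD n) {F. tangential M E \<pi> n F}"


section \<open>The comparison map\<close>

text \<open>In the first equation \<open>bottom\<close> only removes the embedding \<open>Pt\<close>, so this is the identity.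
  The map is left unspecified at index 0.\<close>

fun phi :: "'m space \<Rightarrow> 'e space \<Rightarrow> ('e \<Rightarrow> 'm) \<Rightarrow> nat \<Rightarrow> ('m, 'e) jet \<Rightarrow> ('m, 'e) lift" where
  "phi M E \<pi> (Suc 0) j =
     (bottom j, \<lambda>\<gamma>\<in>points (fibre M (WD 1) (\<pi> (bottom j))). prolong E (WD 1) bottom (jet_fun j \<gamma>))"
| "phi M E \<pi> (Suc (Suc k)) j =
     (let n = Suc k in
      (bottom j, \<lambda>\<gamma>\<in>points (fibre M (WD (Suc n)) (\<pi> (bottom j))).
         wuncurry E (Dobj n) (Dobj 1)
           (prolong (tensor E (WD n)) (WD 1) (\<lambda>(T, s). snd T s)
             (wpair (tangentials M E \<pi> n) (tensor M (WD n)) (\<pi> \<circ> fst) base (WD 1)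
               (prolong (tangentials M E \<pi> n) (WD 1) (phi M E \<pi> (Suc k))
                 (jet_fun j (pull M (WD 1) (\<lambda>d i. if i = n then d 0 else 0) \<gamma>)))
               (wcurry M (Dobj n) (Dobj 1) \<gamma>)))))"

definition proj :: "nat \<Rightarrow> (nat \<Rightarrow> real) \<Rightarrow> (nat \<Rightarrow> real)" where
  "proj p x = (\<lambda>i. if i < p then x i else 0)"


section \<open>Sanity checks\<close>

lemma froelicherI:
  assumes "curves X = {c. range c \<subseteq> points X \<and> (\<forall>h\<in>H. smooth (h \<circ> c))}"
  shows "froelicher X"
proof -
  have "H \<subseteq> smooth_functions X"
    using assms by (auto simp: smooth_functions_def)
  then show ?thesis
    using assms unfolding froelicher_def by (auto simp: smooth_functions_def)
qed

lemma froelicher_rn: "froelicher (rn k)"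
proof (rule froelicherI)
  show "curves (rn k) = {c. range c \<subseteq> points (rn k) \<and> (\<forall>h\<in>{\<lambda>x. x i | i. i < k}. smooth (h \<circ> c))}"
    by (auto simp: rn_def o_def image_subset_iff)
qed

lemma froelicher_tensor: "froelicher (tensor X A)"
proof (rule froelicherI)
  show "curves (tensor X A) = {c. range c \<subseteq> points (tensor X A) \<and>
      (\<forall>h\<in>{h. h \<circ> wclass X A \<in> smooth_functions (mapping_space (fst A) X)}. smooth (h \<circ> c))}"
    by (simp add: tensor_def)
qed

lemma froelicher_subspace:
  assumes "froelicher X"
  shows "froelicher (subspace B X)"
proof (rule froelicherI)
  show "curves (subspace B X) = {c. range c \<subseteq> points (subspace B X) \<and>
      (\<forall>h\<in>smooth_functions X. smooth (h \<circ> c))}"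
    using assms unfolding froelicher_def by (auto simp: subspace_def)
qed

lemma froelicher_fibre_product:
  assumes X: "froelicher X" and Y: "froelicher Y"
  shows "froelicher (fibre_product X Y f g)"
proof (rule froelicherI)
  let ?H = "{h \<circ> fst | h. h \<in> smooth_functions X} \<union> {h \<circ> snd | h. h \<in> smooth_functions Y}"
  have X': "c \<in> curves X \<longleftrightarrow> range c \<subseteq> points X \<and> (\<forall>h\<in>smooth_functions X. smooth (h \<circ> c))" for c
    using X unfolding froelicher_def by blast
  have Y': "c \<in> curves Y \<longleftrightarrow> range c \<subseteq> points Y \<and> (\<forall>h\<in>smooth_functions Y. smooth (h \<circ> c))" for c
    using Y unfolding froelicher_def by blast
  have pts: "range c \<subseteq> points (fibre_product X Y f g) \<longleftrightarrow>
      range (fst \<circ> c) \<subseteq> points X \<and> range (snd \<circ> c) \<subseteq> points Y \<and> (\<forall>r. f (fst (c r)) = g (snd (c r)))" for c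
    by (auto simp: fibre_product_def image_subset_iff split_beta)
  have fns: "(\<forall>h\<in>?H. smooth (h \<circ> c)) \<longleftrightarrow>
      (\<forall>h\<in>smooth_functions X. smooth (h \<circ> (fst \<circ> c))) \<and>
      (\<forall>h\<in>smooth_functions Y. smooth (h \<circ> (snd \<circ> c)))" for c
    by (auto simp: o_assoc)
  have "c \<in> curves (fibre_product X Y f g) \<longleftrightarrow>
      fst \<circ> c \<in> curves X \<and> snd \<circ> c \<in> curves Y \<and> (\<forall>r. f (fst (c r)) = g (snd (c r)))" for c
    by (simp add: fibre_product_def)
  then show "curves (fibre_product X Y f g) =
      {c. range c \<subseteq> points (fibre_product X Y f g) \<and> (\<forall>h\<in>?H. smooth (h \<circ> c))}"
    unfolding X' Y' pts fns by blast
qed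

lemma smooth_const: "smooth (\<lambda>x. c)"
proof -
  have "(deriv ^^ n) (\<lambda>x. c) = (\<lambda>x. if n = 0 then c else 0)" for n
    by (induction n) auto
  then show ?thesis
    unfolding smooth_def by simp
qed

lemma smooth_add:
  assumes "smooth f" "smooth g"
  shows "smooth (\<lambda>x. f x + g x)"
proof -
  have d: "(deriv ^^ n) f field_differentiable at x" "(deriv ^^ n) g field_differentiable at x" for n x
    using assms unfolding smooth_def by (auto simp: real_differentiable_def field_differentiable_def)
  have "(deriv ^^ n) (\<lambda>x. f x + g x) = (\<lambda>x. (deriv ^^ n) f x + (deriv ^^ n) g x)" for n
    by (induction n) (auto simp: deriv_add d)
  then show ?thesis
    using assms unfolding smooth_def by simp
qed

lemma smooth_minus:
  assumes "smooth f"
  shows "smooth (\<lambda>x. - f x)"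
proof -
  have d: "(deriv ^^ n) f field_differentiable at x" for n x
    using assms unfolding smooth_def by (auto simp: real_differentiable_def field_differentiable_def)
  have "(deriv ^^ n) (\<lambda>x. - f x) = (\<lambda>x. - (deriv ^^ n) f x)" for n
    by (induction n) (auto simp: deriv_minus d)
  then show ?thesis
    using assms unfolding smooth_def by simp
qed

lemma ideal_generated_0: "(\<lambda>x. 0) \<in> ideal_generated k G"
  unfolding ideal_generated_def by (auto intro!: exI[of _ "{}"])

lemma ideal_generated_minus:
  assumes "f \<in> ideal_generated k G"
  shows "(\<lambda>x. - f x) \<in> ideal_generated k G"
proof -
  obtain S a where S: "finite S" "S \<subseteq> G" "\<forall>g\<in>S. a g \<in> smooth_functions (rn k)"
      "\<forall>x\<in>points (rn k). f x = (\<Sum>g\<in>S. a g x * g x)"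
    using assms unfolding ideal_generated_def by blast
  have "\<forall>g\<in>S. (\<lambda>x. - a g x) \<in> smooth_functions (rn k)"
    using S(3) smooth_minus by (fastforce simp: smooth_functions_def o_def)
  with S show ?thesis
    unfolding ideal_generated_def
    by (auto intro!: exI[of _ S] exI[of _ "\<lambda>g x. - a g x"] simp: sum_negf)
qed

lemma ideal_generated_add:
  assumes "f \<in> ideal_generated k G" "f' \<in> ideal_generated k G"
  shows "(\<lambda>x. f x + f' x) \<in> ideal_generated k G"
proof -
  obtain S a where S: "finite S" "S \<subseteq> G" "\<forall>g\<in>S. a g \<in> smooth_functions (rn k)"
      "\<forall>x\<in>points (rn k). f x = (\<Sum>g\<in>S. a g x * g x)"
    using assms(1) unfolding ideal_generated_def by blast
  obtain S' a' where S': "finite S'" "S' \<subseteq> G" "\<forall>g\<in>S'. a' g \<in> smooth_functions (rn k)"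
      "\<forall>x\<in>points (rn k). f' x = (\<Sum>g\<in>S'. a' g x * g x)"
    using assms(2) unfolding ideal_generated_def by blast
  define b where "b g x = (if g \<in> S then a g x else 0)" for g x
  define b' where "b' g x = (if g \<in> S' then a' g x else 0)" for g x
  have sm: "b g \<in> smooth_functions (rn k)" "b' g \<in> smooth_functions (rn k)" for g
    using S(3) S'(3)
    by (cases "g \<in> S"; cases "g \<in> S'";
        auto simp: b_def b'_def smooth_functions_def o_def smooth_const)+
  have "(\<Sum>g\<in>S \<union> S'. b g x * g x) = (\<Sum>g\<in>S. a g x * g x)" for x
    by (rule sum.mono_neutral_cong_right) (use S S' in \<open>auto simp: b_def\<close>)
  moreover have "(\<Sum>g\<in>S \<union> S'. b' g x * g x) = (\<Sum>g\<in>S'. a' g x * g x)" for x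
    by (rule sum.mono_neutral_cong_right) (use S S' in \<open>auto simp: b'_def\<close>)
  ultimately have "\<forall>x\<in>points (rn k). f x + f' x = (\<Sum>g\<in>S \<union> S'. (b g x + b' g x) * g x)"
    using S(4) S'(4) by (simp add: distrib_right sum.distrib)
  moreover have "\<forall>g\<in>S \<union> S'. (\<lambda>x. b g x + b' g x) \<in> smooth_functions (rn k)"
    using sm by (auto simp: smooth_functions_def o_def intro!: smooth_add)
  ultimately show ?thesis
    using S(1,2) S'(1,2) unfolding ideal_generated_def
    by (auto intro!: exI[of _ "S \<union> S'"] exI[of _ "\<lambda>g x. b g x + b' g x"])
qed

lemma equiv_mod_refl: "equiv_mod X (weil ms) f f"
  by (simp add: equiv_mod_def weil_def ideal_generated_0)

lemma equiv_mod_sym: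
  assumes "equiv_mod X (weil ms) f g"
  shows "equiv_mod X (weil ms) g f"
  using assms ideal_generated_minus unfolding equiv_mod_def weil_def by fastforce

lemma equiv_mod_trans:
  assumes "equiv_mod X (weil ms) f g" "equiv_mod X (weil ms) g h"
  shows "equiv_mod X (weil ms) f h"
  using assms ideal_generated_add unfolding equiv_mod_def weil_def by fastforce

lemma wclass_props:
  assumes "f \<in> smooth_maps (rn (length ms)) X"
  shows "wclass X (weil ms) f \<in> smooth_maps (rn (length ms)) X"
    and "equiv_mod X (weil ms) f (wclass X (weil ms) f)"
proof -
  have "\<exists>g. g \<in> smooth_maps (rn (fst (weil ms))) X \<and> equiv_mod X (weil ms) f g"
    using assms equiv_mod_refl by (auto simp: weil_def)
  from someI_ex[OF this]
  show "wclass X (weil ms) f \<in> smooth_maps (rn (length ms)) X"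
    and "equiv_mod X (weil ms) f (wclass X (weil ms) f)"
    unfolding wclass_def[symmetric] by (auto simp: weil_def)
qed

lemma wclass_eq_iff:
  assumes "f \<in> smooth_maps (rn (length ms)) X" "g \<in> smooth_maps (rn (length ms)) X"
  shows "wclass X (weil ms) f = wclass X (weil ms) g \<longleftrightarrow> equiv_mod X (weil ms) f g"
proof
  assume "wclass X (weil ms) f = wclass X (weil ms) g"
  then show "equiv_mod X (weil ms) f g"
    using wclass_props(2)[OF assms(1)] wclass_props(2)[OF assms(2)]
    by (metis equiv_mod_sym equiv_mod_trans)
next
  assume "equiv_mod X (weil ms) f g"
  then have "equiv_mod X (weil ms) f = equiv_mod X (weil ms) g"
    using equiv_mod_sym equiv_mod_trans by blast
  then show "wclass X (weil ms) f = wclass X (weil ms) g"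
    by (simp add: wclass_def)
qed

end

theory Submission
  imports Defs
begin

text \<open>Every jet and every tangential of order \<open>n\<close> is induced by a local section, which may be taken
  to be polynomial, and it is determined by the partial derivatives of order at most \<open>n\<close> of the
  section. As \<open>phi n\<close> maps the jet of a section to its tangential, it is bijective.

  Jets: a smooth homogeneous function is linear, so the lift of tangent vectors is a linear map,
  given by the derivatives of one more order; the two conditions on iterated jets say that these
  extend the lower derivatives and are symmetric.

  Tangentials: consider two of them with the same image in order \<open>n - 1\<close>. The difference of their
  coefficients of the product of all \<open>n\<close> variables is homogeneous in each variable. By homogeneity
  in two of them and the condition on \<open>kappa\<close> it does not depend on the coefficients of the
  argument that belong to monomials in several variables. So it is a multilinear function of the
  \<open>n\<close> axes of the argument, which is determined by its values on the basis vectors.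

  All spaces that occur are smooth retracts of Euclidean spaces. The analytic input is that partial
  derivatives of a function that is smooth along smooth curves are again smooth along smooth
  curves.\<close>


section \<open>Smooth functions\<close>

text \<open>Smoothness is only given along curves, and a point of a prolongation is a chosen
  representative of its class. So a value \<open>F t d\<close> with d different from 0 carries no
  information by itself; only the mixed derivatives at 0 survive the choice. Moreover
  \<open>wuncurry\<close>, \<open>to_subspace\<close> and \<open>wpair\<close> are definite
  descriptions, which say nothing until existence and uniqueness are known, and a curve in a
  quotient does not visibly come from a smooth family of maps. Coordinates (\<open>coords\<close>)
  remove these obstacles: equality of classes becomes equality of finitely many numbers, and the
  retraction supplies representatives that depend smoothly on these numbers. On jets and on
  tangentials the retraction rebuilds a polynomial section from Taylor coefficients; its centre
  varies with the point and is itself among the coordinates. Therefore \<open>phi\<close> is only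
  ever computed on jets of sections: even its smoothness, which has to be known before it can be
  prolonged to the next order, is derived from its values there.\<close>

text \<open>A class of functions that contains a derivative of each of its members is closed under
  iterated derivation. Thus smoothness can be proved from formulas for first derivatives
  alone.\<close>

lemma smoothI_coinduct:
  assumes "P f"
    and step: "\<And>f. P f \<Longrightarrow> \<exists>f'. (\<forall>x. (f has_real_derivative f' x) (at x)) \<and> P f'"
  shows "smooth f"
proof -
  have d: "P (deriv f) \<and> (\<forall>x. f differentiable at x)" if Pf: "P f" for f
  proof -
    obtain f' where f': "\<forall>x. (f has_real_derivative f' x) (at x)" "P f'"
      using step[OF Pf] by (elim exE conjE)
    then have "deriv f = f'" by (intro ext DERIV_imp_deriv) simp
    with f' show ?thesis by (auto simp: real_differentiable_def)
  qed
  have "P ((deriv ^^ n) f)" for n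
    by (induction n) (use assms(1) d in auto)
  then show ?thesis
    unfolding smooth_def using d by blast
qed

lemma smoothD: "smooth f \<Longrightarrow> (f has_real_derivative deriv f x) (at x)"
  unfolding smooth_def by (metis DERIV_deriv_iff_real_differentiable funpow_0)

lemma smooth_deriv: "smooth f \<Longrightarrow> smooth (deriv f)"
  unfolding smooth_def by (metis comp_apply funpow_Suc_right)

lemma smooth_deriv_n: "smooth f \<Longrightarrow> smooth ((deriv ^^ n) f)"
  by (induction n) (auto intro: smooth_deriv)

lemma smooth_continuous: "smooth f \<Longrightarrow> continuous_on S f"
  by (meson DERIV_isCont smoothD continuous_at_imp_continuous_on)

text \<open>The derivative of each constructor is again generated by the constructors.\<close>

inductive smooth_alg :: "(real \<Rightarrow> real) \<Rightarrow> bool" where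
  base: "smooth f \<Longrightarrow> smooth_alg f"
| add: "smooth_alg f \<Longrightarrow> smooth_alg g \<Longrightarrow> smooth_alg (\<lambda>x. f x + g x)"
| mult: "smooth_alg f \<Longrightarrow> smooth_alg g \<Longrightarrow> smooth_alg (\<lambda>x. f x * g x)"
| comp: "smooth f \<Longrightarrow> smooth_alg g \<Longrightarrow> smooth_alg (\<lambda>x. f (g x))"
| inv: "smooth_alg f \<Longrightarrow> (\<And>x. f x \<noteq> 0) \<Longrightarrow> smooth_alg (\<lambda>x. inverse (f x))"

lemma smooth_alg_imp_smooth:
  assumes "smooth_alg f" shows "smooth f"
proof (rule smoothI_coinduct[of smooth_alg, OF assms])
  fix f :: "real \<Rightarrow> real" assume "smooth_alg f"
  then show "\<exists>f'. (\<forall>x. (f has_real_derivative f' x) (at x)) \<and> smooth_alg f'"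
  proof induction
    case (base f)
    then show ?case
      by (intro exI[of _ "deriv f"]) (simp add: smoothD smooth_deriv smooth_alg.base)
  next
    case (add f g)
    from this(3,4) obtain f' g' where "\<forall>x. (f has_real_derivative f' x) (at x)" "smooth_alg f'"
      "\<forall>x. (g has_real_derivative g' x) (at x)" "smooth_alg g'" by (elim exE conjE)
    then show ?case
      by (intro exI[of _ "\<lambda>x. f' x + g' x"]) (simp add: DERIV_add smooth_alg.add)
  next
    case (mult f g)
    from this(3,4) obtain f' g' where "\<forall>x. (f has_real_derivative f' x) (at x)" "smooth_alg f'"
      "\<forall>x. (g has_real_derivative g' x) (at x)" "smooth_alg g'" by (elim exE conjE)
    with mult show ?case
      by (intro exI[of _ "\<lambda>x. f' x * g x + g' x * f x"])
        (simp add: DERIV_mult smooth_alg.add smooth_alg.mult)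
  next
    case (comp f g)
    from comp(3) obtain g' where "\<forall>x. (g has_real_derivative g' x) (at x)" "smooth_alg g'" by (elim exE conjE)
    with comp show ?case
      by (intro exI[of _ "\<lambda>x. deriv f (g x) * g' x"])
        (simp add: DERIV_chain2[of f] smoothD smooth_alg.mult smooth_alg.comp smooth_deriv)
  next
    case (inv f)
    from inv(3) obtain f' where f': "\<forall>x. (f has_real_derivative f' x) (at x)" "smooth_alg f'" by (elim exE conjE)
    have m: "smooth_alg (\<lambda>x. - 1)" by (intro smooth_alg.base smooth_const)
    have "smooth_alg (\<lambda>x. (- 1) * (inverse (f x) * f' x * inverse (f x)))"
      by (intro smooth_alg.mult m smooth_alg.inv inv f')
    moreover have "((\<lambda>x. inverse (f x)) has_real_derivative - (inverse (f x) * f' x * inverse (f x))) (at x)" for x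
      using f' inv.hyps(2) by (intro DERIV_inverse') auto
    ultimately show ?case
      by (intro exI[of _ "\<lambda>x. - (inverse (f x) * f' x * inverse (f x))"]) auto
  qed
qed

lemma smooth_mult: "smooth f \<Longrightarrow> smooth g \<Longrightarrow> smooth (\<lambda>x. f x * g x)"
  by (rule smooth_alg_imp_smooth, rule smooth_alg.mult) (auto intro: smooth_alg.base)

lemma smooth_compose: "smooth f \<Longrightarrow> smooth g \<Longrightarrow> smooth (\<lambda>x. f (g x))"
  by (rule smooth_alg_imp_smooth, rule smooth_alg.comp) (auto intro: smooth_alg.base)

lemma smooth_inverse: "smooth f \<Longrightarrow> (\<And>x. f x \<noteq> 0) \<Longrightarrow> smooth (\<lambda>x. inverse (f x))"
  by (rule smooth_alg_imp_smooth, rule smooth_alg.inv) (auto intro: smooth_alg.base)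

lemma smooth_derivs:
  fixes F :: "nat \<Rightarrow> real \<Rightarrow> real"
  assumes "\<And>k x. (F k has_real_derivative F (Suc k) x) (at x)"
  shows "smooth (F k)"
  by (rule smoothI_coinduct[of "\<lambda>f. \<exists>k. f = F k"]) (use assms in auto)

lemma smooth_ident: "smooth (\<lambda>x. x)"
  using smooth_derivs[of "\<lambda>k x. if k = 0 then x else if k = 1 then 1 else 0" 0] by auto

lemma smooth_diff: "smooth f \<Longrightarrow> smooth g \<Longrightarrow> smooth (\<lambda>x. f x - g x)"
  using smooth_add[of f "\<lambda>x. - g x"] smooth_minus[of g] by simp

lemma smooth_power: "smooth f \<Longrightarrow> smooth (\<lambda>x. f x ^ n)"
  by (induction n) (auto intro: smooth_const smooth_mult)

lemma smooth_sum: "(\<And>i. i \<in> A \<Longrightarrow> smooth (f i)) \<Longrightarrow> smooth (\<lambda>x. \<Sum>i\<in>A. f i x)"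
  by (induction A rule: infinite_finite_induct) (auto intro: smooth_const smooth_add)

lemma smooth_prod: "(\<And>i. i \<in> A \<Longrightarrow> smooth (f i)) \<Longrightarrow> smooth (\<lambda>x. \<Prod>i\<in>A. f i x)"
  by (induction A rule: infinite_finite_induct) (auto intro: smooth_const smooth_mult)

lemmas smooth_intros = smooth_const smooth_ident smooth_add smooth_minus smooth_diff smooth_mult
  smooth_power smooth_sum smooth_prod

lemma higher_deriv_eqI:
  fixes F :: "nat \<Rightarrow> real \<Rightarrow> real"
  assumes "\<And>k x. (F k has_real_derivative F (Suc k) x) (at x)"
  shows "(deriv ^^ k) (F 0) = F k"
  by (induction k) (auto intro!: ext DERIV_imp_deriv[OF assms])

lemma smooth_higher_deriv: "smooth f \<Longrightarrow> ((deriv ^^ k) f has_real_derivative (deriv ^^ Suc k) f x) (at x)"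
  using smoothD[OF smooth_deriv_n] by simp

text \<open>Termwise differentiation. The derivatives of the terms are passed as a whole hierarchy
  \<open>f n k\<close>, so that the differentiated series is of the same kind as the original one.
  The bounds are local: \<open>M\<close> may depend on the order and on the radius.\<close>

lemma smooth_series:
  fixes f :: "nat \<Rightarrow> nat \<Rightarrow> real \<Rightarrow> real"
  assumes d: "\<And>n k x. (f n k has_real_derivative f n (Suc k) x) (at x)"
    and b: "\<And>k R. \<exists>M. summable M \<and> (\<forall>n x. \<bar>x\<bar> \<le> R \<longrightarrow> \<bar>f n k x\<bar> \<le> M n)"
  shows "((\<lambda>x. \<Sum>n. f n k x) has_real_derivative (\<Sum>n. f n (Suc k) x)) (at x)"
    and "smooth (\<lambda>x. \<Sum>n. f n 0 x)"
proof -
  have main: "((\<lambda>x. \<Sum>n. f n k x) has_real_derivative (\<Sum>n. f n (Suc k) x)) (at x)" for k x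
  proof -
    let ?S = "ball (0::real) (\<bar>x\<bar> + 1)"
    obtain M where M: "summable M" "\<forall>n y. \<bar>y\<bar> \<le> \<bar>x\<bar> + 1 \<longrightarrow> \<bar>f n (Suc k) y\<bar> \<le> M n"
      using b by blast
    obtain M' where M': "summable M'" "\<forall>n y. \<bar>y\<bar> \<le> \<bar>x\<bar> + 1 \<longrightarrow> \<bar>f n k y\<bar> \<le> M' n"
      using b by blast
    have u: "uniformly_convergent_on ?S (\<lambda>n x. \<Sum>i<n. f i (Suc k) x)"
      by (rule Weierstrass_m_test'[OF _ M(1)]) (use M(2) in auto)
    have s: "summable (\<lambda>n. f n k x)"
      by (rule summable_comparison_test'[OF M'(1)]) (use M'(2) in auto)
    show ?thesis
      by (rule has_field_derivative_series'(2)[where f' = "\<lambda>n. f n (Suc k)" and f = "\<lambda>n. f n k", OF _ _ u _ s])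
        (use d in \<open>auto intro: has_field_derivative_at_within\<close>)
  qed
  then show "((\<lambda>x. \<Sum>n. f n k x) has_real_derivative (\<Sum>n. f n (Suc k) x)) (at x)" .
  show "smooth (\<lambda>x. \<Sum>n. f n 0 x)"
    using smooth_derivs[of "\<lambda>k x. \<Sum>n. f n k x" 0] main by simp
qed

section \<open>Flat functions and bump functions\<close>

lemma has_derivative_flat_at_0:
  fixes f :: "real \<Rightarrow> real"
  assumes "f 0 = 0" "((\<lambda>h. f h / h) \<longlongrightarrow> 0) (at_right 0)" "((\<lambda>h. f h / h) \<longlongrightarrow> 0) (at_left 0)"
  shows "(f has_real_derivative 0) (at 0)"
  using assms by (simp add: DERIV_def filterlim_at_split)

lemma poly_times_exp_tendsto_0:
  "((\<lambda>y::real. y ^ n * poly q y * exp (- y)) \<longlongrightarrow> 0) at_top"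
proof (induction q arbitrary: n)
  case 0
  then show ?case by simp
next
  case (pCons a q)
  have "((\<lambda>y. a * (y ^ n / exp y) + y ^ Suc n * poly q y * exp (- y)) \<longlongrightarrow> a * 0 + 0) at_top"
    by (intro tendsto_intros tendsto_power_div_exp_0 pCons.IH)
  then show ?case
    by (simp add: algebra_simps exp_minus divide_inverse)
qed

text \<open>The polynomial parameter turns the classical flat function exp (- 1 / x) into a family
  closed under differentiation, which is the shape that \<open>smoothI_coinduct\<close> asks
  for.\<close>

definition flat_exp :: "real poly \<Rightarrow> real \<Rightarrow> real" where
  "flat_exp p x = (if x > 0 then poly p (1 / x) * exp (- (1 / x)) else 0)"

text \<open>The product rule yields \<open>p - pderiv p\<close> at 1 / x with an additional factor 1
  / x^2; this factor is the double \<open>pCons 0\<close>. At 0 the exponential beats every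
  polynomial in 1 / x.\<close>

lemma flat_exp_deriv:
  "(flat_exp p has_real_derivative flat_exp (pCons 0 (pCons 0 (p - pderiv p))) x) (at x)"
proof -
  consider "x < 0" | "x = 0" | "x > 0" by linarith
  then show ?thesis
  proof cases
    case 1
    have "((\<lambda>x. 0) has_real_derivative 0) (at x)" by simp
    then have "(flat_exp p has_real_derivative 0) (at x)"
      by (rule has_field_derivative_transform_within_open[of _ _ _ "{..<0}"])
        (use 1 in \<open>auto simp: flat_exp_def\<close>)
    with 1 show ?thesis by (simp add: flat_exp_def)
  next
    case 3
    have "((\<lambda>x. poly p (1 / x) * exp (- (1 / x))) has_real_derivative
        (poly (pderiv p) (1 / x) * (- (1 / x\<^sup>2))) * exp (- (1 / x)) +
        (exp (- (1 / x)) * (1 / x\<^sup>2)) * poly p (1 / x)) (at x)"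
      by (rule DERIV_mult; (rule DERIV_chain2[OF poly_DERIV] DERIV_chain2[OF DERIV_exp])?)
        (use 3 in \<open>auto intro!: derivative_eq_intros simp: power2_eq_square\<close>)
    then have "(flat_exp p has_real_derivative
        (poly (pderiv p) (1 / x) * (- (1 / x\<^sup>2))) * exp (- (1 / x)) +
        (exp (- (1 / x)) * (1 / x\<^sup>2)) * poly p (1 / x)) (at x)"
      by (rule has_field_derivative_transform_within_open[of _ _ _ "{0<..}"])
        (use 3 in \<open>auto simp: flat_exp_def\<close>)
    with 3 show ?thesis
      by (simp add: flat_exp_def power2_eq_square algebra_simps)
  next
    case 2
    have "((\<lambda>h. (inverse h) ^ 1 * poly p (inverse h) * exp (- inverse h)) \<longlongrightarrow> 0) (at_right 0)"
      by (rule filterlim_compose[OF poly_times_exp_tendsto_0 filterlim_inverse_at_top_right])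
    then have "((\<lambda>h. flat_exp p h / h) \<longlongrightarrow> 0) (at_right 0)"
      by (rule Lim_transform_eventually)
        (auto simp: flat_exp_def eventually_at_right_less divide_inverse algebra_simps
          intro!: eventually_at_rightI[of 0 1])
    moreover have "((\<lambda>h. flat_exp p h / h) \<longlongrightarrow> 0) (at_left 0)"
      by (rule Lim_transform_eventually[of "\<lambda>_. 0"])
        (auto simp: flat_exp_def intro!: eventually_at_leftI[of "-1" 0])
    ultimately show ?thesis
      using 2 has_derivative_flat_at_0[of "flat_exp p"] by (simp add: flat_exp_def)
  qed
qed

lemma smooth_flat_exp: "smooth (flat_exp p)"
  by (rule smoothI_coinduct[of "\<lambda>f. \<exists>p. f = flat_exp p"]) (use flat_exp_deriv in blast)+

text \<open>The radii are made for the dyadic bumps of \<open>special_curve\<close>: if 2^m * t is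
  within 1/4 of 1, then for n different from m the number 2^n * t is at most 5/8 or at least 3/2,
  hence at distance at least 3/8 from 1. So at most one bump is alive there.\<close>

lemma bump_exists:
  obtains \<phi> where "smooth \<phi>" "\<And>x. \<bar>x\<bar> \<le> 1/4 \<Longrightarrow> \<phi> x = 1" "\<And>x. \<bar>x\<bar> \<ge> 3/8 \<Longrightarrow> \<phi> x = 0"
proof -
  define E where "E = flat_exp 1"
  have E: "smooth E" "\<And>x. x \<le> 0 \<Longrightarrow> E x = 0" "\<And>x. x > 0 \<Longrightarrow> E x > 0" "\<And>x. E x \<ge> 0"
    by (auto simp: E_def smooth_flat_exp flat_exp_def)
  define \<sigma> where "\<sigma> x = E x * inverse (E x + E (1 - x))" for x
  have pos: "E x + E (1 - x) \<noteq> 0" for x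
    using E(3)[of x] E(3)[of "1 - x"] E(4)[of x] E(4)[of "1 - x"] by (cases "x > 0") auto
  have sE: "smooth (\<lambda>x. E (1 - x))"
    by (rule smooth_compose[OF E(1)]) (intro smooth_intros)
  have "smooth \<sigma>"
    unfolding \<sigma>_def[abs_def] by (intro smooth_mult smooth_inverse smooth_add E(1) sE pos)
  \<comment> \<open>\<open>\<sigma>\<close> is a smooth step, 0 up to 0 and 1 from 1 on. Its
    argument is the affine function of x^2 that equals 1 at |x| = 1/4 and 0 at |x| = 3/8; the square
    avoids the corner of |x|.\<close>
  then have sm: "smooth (\<lambda>x. \<sigma> (9/5 - 64/5 * x\<^sup>2))"
    by (rule smooth_compose) (intro smooth_intros)
  have s1: "\<sigma> (9/5 - 64/5 * x\<^sup>2) = 1" if "\<bar>x\<bar> \<le> 1/4" for x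
  proof -
    have "x\<^sup>2 \<le> 1/16"
      using power_mono[OF that, of 2] by (simp add: power2_eq_square)
    then have "E (1 - (9/5 - 64/5 * x\<^sup>2)) = 0" by (intro E(2)) simp
    then show ?thesis using pos[of "9/5 - 64/5 * x\<^sup>2"] by (simp add: \<sigma>_def)
  qed
  have s0: "\<sigma> (9/5 - 64/5 * x\<^sup>2) = 0" if "\<bar>x\<bar> \<ge> 3/8" for x
  proof -
    have "x\<^sup>2 \<ge> 9/64"
      using power_mono[OF that, of 2] by (simp add: power2_eq_square)
    then have "E (9/5 - 64/5 * x\<^sup>2) = 0" by (intro E(2)) simp
    then show ?thesis by (simp add: \<sigma>_def)
  qed
  show ?thesis by (rule that[OF sm s1 s0])
qed

section \<open>Smooth curves through prescribed points at prescribed speeds\<close>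

lemma higher_deriv_cong_open:
  fixes f g :: "real \<Rightarrow> real"
  assumes "open S" "\<And>y. y \<in> S \<Longrightarrow> f y = g y" "x \<in> S"
  shows "(deriv ^^ k) f x = (deriv ^^ k) g x"
  using assms(3)
proof (induction k arbitrary: x)
  case (Suc k)
  have "eventually (\<lambda>y. (deriv ^^ k) f y = (deriv ^^ k) g y) (nhds x)"
    using Suc assms(1) by (auto simp: eventually_nhds)
  then show ?case by (simp add: deriv_cong_ev)
qed (use assms(2) in auto)

lemma bounded_higher_deriv:
  assumes "smooth P" "\<And>x. \<bar>x\<bar> \<ge> 1/2 \<Longrightarrow> P x = 0"
  obtains B where "\<And>x. \<bar>(deriv ^^ k) P x\<bar> \<le> B"
proof -
  have "bounded ((deriv ^^ k) P ` {-1..1})"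
    by (intro compact_imp_bounded compact_continuous_image smooth_continuous smooth_deriv_n assms)
      simp
  then obtain B where B: "\<And>x. \<bar>x\<bar> \<le> 1 \<Longrightarrow> \<bar>(deriv ^^ k) P x\<bar> \<le> B"
    by (fastforce simp: bounded_iff)
  have "(deriv ^^ k) P x = 0" if "\<bar>x\<bar> > 1/2" for x
  proof -
    have "(deriv ^^ k) P x = (deriv ^^ k) (\<lambda>x. 0) x"
      by (rule higher_deriv_cong_open[of "{x. \<bar>x\<bar> > 1/2}"])
        (use that assms(2) in \<open>auto intro!: open_Collect_less continuous_intros\<close>)
    also have "(deriv ^^ k) (\<lambda>x. 0 :: real) = (\<lambda>x. 0)"
      by (induction k) auto
    finally show ?thesis .
  qed
  then have "\<bar>(deriv ^^ k) P x\<bar> \<le> \<bar>B\<bar>" for x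
    using B[of x] by (cases "\<bar>x\<bar> > 1/2") auto
  then show ?thesis using that by blast
qed

text \<open>The k-th derivative of the n-th term costs a factor (2^n)^k, and the hypothesis on
  \<open>\<alpha>\<close> pays for it at every order.\<close>

lemma smooth_bump_series:
  assumes P: "smooth P" "\<And>x. \<bar>x\<bar> \<ge> 1/2 \<Longrightarrow> P x = 0"
    and \<alpha>: "\<And>k. summable (\<lambda>n. \<bar>\<alpha> n\<bar> * (2 ^ n) ^ k)"
  shows "smooth (\<lambda>t. \<Sum>n. \<alpha> n * P (2 ^ n * t - 1))"
proof -
  define f where "f n k t = \<alpha> n * (2 ^ n) ^ k * (deriv ^^ k) P (2 ^ n * t - 1)" for n k :: nat and t :: real
  have "(f n k has_real_derivative f n (Suc k) x) (at x)" for n k x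
    unfolding f_def
    by (rule DERIV_cong, rule DERIV_cmult, rule DERIV_chain2[OF smooth_higher_deriv[OF P(1)]])
      (auto intro!: derivative_eq_intros)
  moreover have "\<exists>M. summable M \<and> (\<forall>n x. \<bar>x\<bar> \<le> R \<longrightarrow> \<bar>f n k x\<bar> \<le> M n)" for k R
  proof -
    obtain B where B: "\<And>x. \<bar>(deriv ^^ k) P x\<bar> \<le> B"
      using bounded_higher_deriv[OF P] by blast
    then show ?thesis
      by (intro exI[of _ "\<lambda>n. \<bar>\<alpha> n\<bar> * (2 ^ n) ^ k * B"])
        (auto intro!: summable_mult2 \<alpha> mult_left_mono simp: f_def abs_mult)
  qed
  ultimately have "smooth (\<lambda>t. \<Sum>n. f n 0 t)"
    by (rule smooth_series(2))
  then show ?thesis by (simp add: f_def)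
qed

text \<open>The decay 2^(- n^2) beats every growth 2^(n k): as soon as n > k, the product is at most
  2^(- n).\<close>

lemma summable_square_exponent:
  assumes "\<And>n. \<bar>\<alpha> n\<bar> \<le> (1/2) ^ (n * n)"
  shows "summable (\<lambda>n. \<bar>\<alpha> n\<bar> * (2 ^ n) ^ k :: real)"
proof (rule summable_comparison_test_ev[OF _ summable_geometric[of "1/2 :: real"]])
  show "\<forall>\<^sub>F n in sequentially. norm (\<bar>\<alpha> n\<bar> * (2 ^ n) ^ k) \<le> (1/2) ^ n"
    using eventually_ge_at_top[of "Suc k"]
  proof eventually_elim
    case (elim n)
    have "\<bar>\<alpha> n\<bar> * (2 ^ n) ^ k \<le> (1/2) ^ (n * n) * (2 ^ n) ^ k"
      by (intro mult_right_mono assms) auto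
    also have "\<dots> = ((1/2) ^ n) ^ n * (2 ^ n) ^ k"
      by (simp add: power_mult)
    also have "\<dots> = ((1/2) ^ n) ^ (n - k) * (((1/2) ^ n) ^ k * (2 ^ n) ^ k)"
      using elim by (simp flip: power_add)
    also have "((1/2) ^ n) ^ k * (2 ^ n) ^ k = (1 :: real)"
      by (simp flip: power_mult_distrib)
    also have "((1/2 :: real) ^ n) ^ (n - k) * 1 \<le> ((1/2) ^ n) ^ 1"
      unfolding mult_1_right by (rule power_decreasing) (use elim in \<open>auto simp: power_le_one\<close>)
    finally show ?case by simp
  qed
qed simp

text \<open>Bumps at the points 2^(- m), which accumulate only at 0, let a single smooth curve visit
  infinitely many prescribed values. Near 2^(- m) it is affine with value \<open>\<alpha> m\<close>
  and slope \<open>\<eta> m * 2 ^ m\<close>; fast decay of both sequences makes it smooth at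
  0.\<close>

lemma special_curve:
  assumes \<alpha>: "\<And>n. \<bar>\<alpha> n\<bar> \<le> (1/2) ^ (n * n)" and \<eta>: "\<And>n. \<bar>\<eta> n\<bar> \<le> (1/2) ^ (n * n)"
  obtains a where "smooth a"
    "\<And>m. \<exists>S. open S \<and> (1/2) ^ m \<in> S \<and> (\<forall>t\<in>S. a t = \<alpha> m + \<eta> m * (2 ^ m * t - 1))"
proof -
  obtain \<phi> where \<phi>: "smooth \<phi>" "\<And>x. \<bar>x\<bar> \<le> 1/4 \<Longrightarrow> \<phi> x = 1" "\<And>x. \<bar>x\<bar> \<ge> 3/8 \<Longrightarrow> \<phi> x = 0"
    using bump_exists by blast
  define u where "u \<alpha> P t = (\<Sum>n. \<alpha> n * P (2 ^ n * t - 1))" for \<alpha> and P :: "real \<Rightarrow> real" and t :: real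
  have "smooth (u \<alpha> \<phi>)"
    unfolding u_def[abs_def] by (rule smooth_bump_series[OF \<phi>(1) _ summable_square_exponent[OF \<alpha>]]) (simp add: \<phi>)
  \<comment> \<open>Near 0 the function x * \<phi> x is the identity, so this series contributes the
    linear terms, while the previous one contributes the values.\<close>
  moreover have "smooth (u \<eta> (\<lambda>x. x * \<phi> x))"
    unfolding u_def[abs_def]
    by (rule smooth_bump_series[OF _ _ summable_square_exponent[OF \<eta>]])
      (auto intro!: smooth_mult smooth_ident \<phi>)
  ultimately have "smooth (\<lambda>t. u \<alpha> \<phi> t + u \<eta> (\<lambda>x. x * \<phi> x) t)"
    by (rule smooth_add)
  moreover
  have "\<exists>S. open S \<and> (1/2) ^ m \<in> S \<and>
      (\<forall>t\<in>S. u \<alpha> \<phi> t + u \<eta> (\<lambda>x. x * \<phi> x) t = \<alpha> m + \<eta> m * (2 ^ m * t - 1))" for m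
  proof -
    let ?S = "{t::real. \<bar>2 ^ m * t - 1\<bar> < 1/4}"
    have single: "u \<beta> P t = \<beta> m * P (2 ^ m * t - 1)"
      if t: "t \<in> ?S" and P: "\<And>x. \<bar>x\<bar> \<ge> 3/8 \<Longrightarrow> P x = 0" for \<beta> P t
    proof -
      have "P (2 ^ n * t - 1) = 0" if "n \<noteq> m" for n
      proof (rule P)
        have t': "3/4 < 2 ^ m * t" "2 ^ m * t < 5/4" using t unfolding mem_Collect_eq by linarith+
        show "3/8 \<le> \<bar>2 ^ n * t - 1\<bar>"
        proof (cases "n < m")
          case True
          then obtain d where "m = Suc (n + d)" using less_iff_Suc_add by blast
          then have eq: "2 ^ m * t = 2 ^ n * t * (2 * 2 ^ d)"
            by (simp add: power_add algebra_simps)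
          have "(2::real) * 1 \<le> 2 * 2 ^ d" by (intro mult_left_mono) auto
          moreover have "0 < 2 ^ m * t" using t' by linarith
          then have "2 ^ n * t \<ge> 0" by (simp add: zero_less_mult_iff)
          ultimately have "2 ^ n * t * 2 \<le> 2 ^ m * t" unfolding eq by (intro mult_left_mono) auto
          then show ?thesis using t' by linarith
        next
          case False
          with that obtain d where "n = Suc (m + d)" using less_iff_Suc_add by (metis linorder_neqE_nat)
          then have eq: "2 ^ n * t = 2 ^ m * t * (2 * 2 ^ d)"
            by (simp add: power_add algebra_simps)
          have "(2::real) * 1 \<le> 2 * 2 ^ d" by (intro mult_left_mono) auto
          then have "2 ^ m * t * 2 \<le> 2 ^ n * t" unfolding eq using t' by (intro mult_left_mono) auto
          then show ?thesis using t' by linarith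
        qed
      qed
      then have "u \<beta> P t = (\<Sum>n\<in>{m}. \<beta> n * P (2 ^ n * t - 1))"
        unfolding u_def by (intro suminf_finite) auto
      then show ?thesis by simp
    qed
    show ?thesis
      by (rule exI[of _ ?S])
        (auto simp: single \<phi> power_divide algebra_simps intro!: open_Collect_less continuous_intros)
  qed
  ultimately show ?thesis using that by blast
qed

section \<open>Functions of two variables that are smooth along curves\<close>

definition smooth2 :: "(real \<Rightarrow> real \<Rightarrow> real) \<Rightarrow> bool" where
  "smooth2 H \<longleftrightarrow> (\<forall>a b. smooth a \<longrightarrow> smooth b \<longrightarrow> smooth (\<lambda>t. H (a t) (b t)))"

lemma smooth2D: "smooth2 H \<Longrightarrow> smooth a \<Longrightarrow> smooth b \<Longrightarrow> smooth (\<lambda>t. H (a t) (b t))"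
  by (simp add: smooth2_def)

lemma smooth2_flip: "smooth2 H \<Longrightarrow> smooth2 (\<lambda>r s. H s r)"
  by (simp add: smooth2_def)

lemma smooth2_left: "smooth2 H \<Longrightarrow> smooth (\<lambda>r. H r s)"
  using smooth2D[of H "\<lambda>r. r" "\<lambda>_. s"] smooth_ident smooth_const by blast

lemma smooth2_right: "smooth2 H \<Longrightarrow> smooth (H r)"
  using smooth2D[of H "\<lambda>_. r" "\<lambda>s. s"] smooth_ident smooth_const by fastforce

lemma higher_deriv_affine:
  assumes "smooth f"
  shows "(deriv ^^ k) (\<lambda>t. f (c + u * t)) t = u ^ k * (deriv ^^ k) f (c + u * t)"
proof -
  have "(deriv ^^ k) (\<lambda>t. f (c + u * t)) = (\<lambda>t. u ^ k * (deriv ^^ k) f (c + u * t))"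
  proof (rule higher_deriv_eqI[of "\<lambda>k t. u ^ k * (deriv ^^ k) f (c + u * t)", simplified power_0 mult_1 funpow_0])
    fix k x
    show "((\<lambda>t. u ^ k * (deriv ^^ k) f (c + u * t)) has_real_derivative
        u ^ Suc k * (deriv ^^ Suc k) f (c + u * x)) (at x)"
      by (rule DERIV_cong, rule DERIV_cmult, rule DERIV_chain2[OF smooth_higher_deriv[OF assms]])
        (auto intro!: derivative_eq_intros)
  qed
  then show ?thesis by simp
qed

text \<open>Otherwise a smooth curve would pass through points where the derivative explodes,
  slowly enough to be smooth but fast enough for its composite with the function to be unbounded.\<close>

lemma smooth2_bounded_left:
  assumes H: "smooth2 H"
  shows "\<exists>C. \<forall>r s. \<bar>r\<bar> \<le> R \<longrightarrow> \<bar>s\<bar> \<le> R \<longrightarrow> \<bar>(deriv ^^ k) (\<lambda>r. H r s) r\<bar> \<le> C"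
proof (rule ccontr)
  let ?D = "\<lambda>z. (deriv ^^ k) (\<lambda>r. H r (snd z)) (fst z)"
  assume "\<not> ?thesis"
  then have n: "\<exists>r s. \<bar>r\<bar> \<le> R \<and> \<bar>s\<bar> \<le> R \<and> \<bar>(deriv ^^ k) (\<lambda>r. H r s) r\<bar> > real n" for n
    unfolding not_ex not_all not_imp not_le by blast
  have "\<exists>z. z \<in> {-R..R} \<times> {-R..R} \<and> \<bar>?D z\<bar> > real n" for n
  proof -
    obtain r s where "\<bar>r\<bar> \<le> R \<and> \<bar>s\<bar> \<le> R \<and> \<bar>(deriv ^^ k) (\<lambda>r. H r s) r\<bar> > real n"
      using n by blast
    then show ?thesis by (intro exI[of _ "(r, s)"]) (simp add: abs_le_iff)
  qed
  then have "\<exists>z. \<forall>n. z n \<in> {-R..R} \<times> {-R..R} \<and> \<bar>?D (z n)\<bar> > real n"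
    by (intro choice allI)
  then obtain z where z: "\<And>n. z n \<in> {-R..R} \<times> {-R..R}" "\<And>n. \<bar>?D (z n)\<bar> > real n"
    by auto
  have "compact ({-R..R} \<times> {-R..R})"
    by (intro compact_Times compact_Icc)
  then obtain l q where q: "strict_mono q" "(z \<circ> q) \<longlonglongrightarrow> l"
    using z(1) unfolding compact_eq_seq_compact_metric seq_compact_def by blast
  \<comment> \<open>The largest size that \<open>special_curve\<close> admits. It serves twice: as
    the permitted distance to the limit and as the speed in the first variable.\<close>
  define \<eta> :: "nat \<Rightarrow> real" where "\<eta> n = (1/2) ^ (n * n)" for n
  have \<eta>: "\<eta> n > 0" for n by (simp add: \<eta>_def)
  \<comment> \<open>The derivative is unbounded along the sequence, so far enough out it even
    outgrows the factor \<open>\<eta> n ^ k\<close> that the slow speed costs.\<close>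
  have "\<exists>m. dist (z (q m)) l < \<eta> n \<and> \<bar>?D (z (q m))\<bar> * \<eta> n ^ k > real n" for n
  proof -
    have "\<forall>\<^sub>F m in sequentially. dist (z (q m)) l < \<eta> n"
      using tendstoD[OF q(2) \<eta>[of n]] by simp
    moreover have "\<forall>\<^sub>F m in sequentially. real m \<ge> real n / \<eta> n ^ k"
      by (rule eventually_sequentiallyI[of "nat \<lceil>real n / \<eta> n ^ k\<rceil>"]) linarith
    ultimately have "\<forall>\<^sub>F m in sequentially. dist (z (q m)) l < \<eta> n \<and> \<bar>?D (z (q m))\<bar> * \<eta> n ^ k > real n"
    proof eventually_elim
      case (elim m)
      have "real n / \<eta> n ^ k < \<bar>?D (z (q m))\<bar>"
        using elim(2) z(2)[of "q m"] seq_suble[OF q(1), of m] by linarith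
      with elim(1) \<eta>[of n] show ?case by (simp add: field_simps)
    qed
    then show ?thesis
      unfolding eventually_sequentially by blast
  qed
  then have "\<exists>w. \<forall>n. dist (z (q (w n))) l < \<eta> n \<and> \<bar>?D (z (q (w n)))\<bar> * \<eta> n ^ k > real n"
    by (intro choice allI)
  then obtain w where w: "\<And>n. dist (z (q (w n))) l < \<eta> n" "\<And>n. \<bar>?D (z (q (w n)))\<bar> * \<eta> n ^ k > real n"
    by auto
  define y where "y n = z (q (w n))" for n
  have 1: "\<bar>fst (y n) - fst l\<bar> \<le> \<eta> n" "\<bar>snd (y n) - snd l\<bar> \<le> \<eta> n" for n
    using w(1)[of n] dist_fst_le[of "y n" l] dist_snd_le[of "y n" l]
    unfolding y_def dist_real_def by linarith+
  obtain a where a: "smooth a"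
    "\<And>m. \<exists>S. open S \<and> (1/2) ^ m \<in> S \<and> (\<forall>t\<in>S. a t = (fst (y m) - fst l) + \<eta> m * (2 ^ m * t - 1))"
    by (rule special_curve[of "\<lambda>n. fst (y n) - fst l" \<eta>]) (use 1(1) in \<open>auto simp: \<eta>_def\<close>)
  \<comment> \<open>Speed 0 freezes the second variable near each point (1/2)^m. There the composite
    is an affine reparametrisation in the first variable alone, so its k-th derivative is a multiple
    of the partial derivative in question.\<close>
  obtain b where b: "smooth b"
    "\<And>m. \<exists>S. open S \<and> (1/2) ^ m \<in> S \<and> (\<forall>t\<in>S. b t = (snd (y m) - snd l) + 0 * (2 ^ m * t - 1))"
    by (rule special_curve[of "\<lambda>n. snd (y n) - snd l" "\<lambda>_. 0"]) (use 1(2) in \<open>auto simp: \<eta>_def\<close>)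
  let ?h = "\<lambda>t. H (fst l + a t) (snd l + b t)"
  have h: "smooth ?h"
    by (rule smooth2D[OF H smooth_add[OF smooth_const a(1)] smooth_add[OF smooth_const b(1)]])
  have big: "\<bar>(deriv ^^ k) ?h ((1/2) ^ m)\<bar> \<ge> real m" for m
  proof -
    obtain S where S: "open S" "(1/2) ^ m \<in> S" "\<forall>t\<in>S. a t = (fst (y m) - fst l) + \<eta> m * (2 ^ m * t - 1)"
      using a(2)[of m] by (elim exE conjE)
    obtain S' where S': "open S'" "(1/2) ^ m \<in> S'" "\<forall>t\<in>S'. b t = (snd (y m) - snd l) + 0 * (2 ^ m * t - 1)"
      using b(2)[of m] by (elim exE conjE)
    let ?f = "\<lambda>r. H r (snd (y m))"
    have "(deriv ^^ k) ?h ((1/2) ^ m) =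
        (deriv ^^ k) (\<lambda>t. ?f ((fst (y m) - \<eta> m) + (\<eta> m * 2 ^ m) * t)) ((1/2) ^ m)"
    proof (rule higher_deriv_cong_open[of "S \<inter> S'"])
      fix t assume t: "t \<in> S \<inter> S'"
      have "fst l + a t = (fst (y m) - \<eta> m) + (\<eta> m * 2 ^ m) * t"
        using S(3)[rule_format, of t] t by (simp add: algebra_simps)
      moreover have "snd l + b t = snd (y m)"
        using S'(3)[rule_format, of t] t by simp
      ultimately show "?h t = ?f ((fst (y m) - \<eta> m) + (\<eta> m * 2 ^ m) * t)" by simp
    qed (use S S' in auto)
    also have "\<dots> = (\<eta> m * 2 ^ m) ^ k * (deriv ^^ k) ?f ((fst (y m) - \<eta> m) + (\<eta> m * 2 ^ m) * (1/2) ^ m)"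
      by (rule higher_deriv_affine[OF smooth2_left[OF H]])
    also have "(fst (y m) - \<eta> m) + (\<eta> m * 2 ^ m) * (1/2) ^ m = fst (y m)"
      by (simp add: power_divide)
    finally have "\<bar>(deriv ^^ k) ?h ((1/2) ^ m)\<bar> = (2 ^ m) ^ k * (\<bar>?D (y m)\<bar> * \<eta> m ^ k)"
      using \<eta>[of m] by (simp add: abs_mult power_mult_distrib)
    moreover have "1 * (\<bar>?D (y m)\<bar> * \<eta> m ^ k) \<le> (2 ^ m) ^ k * (\<bar>?D (y m)\<bar> * \<eta> m ^ k)"
      using \<eta>[of m] by (intro mult_right_mono) (auto simp: one_le_power)
    ultimately show ?thesis using w(2)[of m] by (simp add: y_def)
  qed
  have "bounded ((deriv ^^ k) ?h ` {0..1})"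
    by (intro compact_imp_bounded compact_continuous_image smooth_continuous smooth_deriv_n h) simp
  then obtain B where B: "\<And>t. t \<in> {0..1} \<Longrightarrow> \<bar>(deriv ^^ k) ?h t\<bar> \<le> B"
    by (fastforce simp: bounded_iff)
  obtain m where "real m > B" using reals_Archimedean2 by blast
  with big[of m] B[of "(1/2) ^ m"] show False by (simp add: power_le_one)
qed

lemma smooth2_bounded_right:
  assumes "smooth2 H"
  shows "\<exists>C. \<forall>r s. \<bar>r\<bar> \<le> R \<longrightarrow> \<bar>s\<bar> \<le> R \<longrightarrow> \<bar>(deriv ^^ k) (H r) s\<bar> \<le> C"
  using smooth2_bounded_left[OF smooth2_flip[OF assms], of R k] by blast

section \<open>Interpolation inequalities of Landau type\<close>

text \<open>Taylor expansion at \<open>x\<close>, evaluated at a point at distance exactly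
  \<open>\<delta>\<close> in the direction of the centre, so that it stays in the interval. The step
  \<open>\<delta>\<close> remains free and is balanced against the bounds later.\<close>

lemma landau_first_derivative:
  fixes u :: "real \<Rightarrow> real"
  assumes u: "smooth u" and U: "\<And>x. \<bar>x\<bar> \<le> R \<Longrightarrow> \<bar>u x\<bar> \<le> U0" "\<And>x. \<bar>x\<bar> \<le> R \<Longrightarrow> \<bar>(deriv ^^ 2) u x\<bar> \<le> U2"
    and \<delta>: "0 < \<delta>" "\<delta> \<le> R" and x: "\<bar>x\<bar> \<le> R"
  shows "\<bar>deriv u x\<bar> \<le> 2 * U0 / \<delta> + \<delta> * U2"
proof -
  have "\<exists>y. \<bar>y\<bar> \<le> R \<and> \<bar>y - x\<bar> = \<delta>"
  proof (cases "x \<ge> 0")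
    case True then show ?thesis by (intro exI[of _ "x - \<delta>"]) (use \<delta> x in linarith)
  next
    case False then show ?thesis by (intro exI[of _ "x + \<delta>"]) (use \<delta> x in linarith)
  qed
  then obtain y where y: "\<bar>y\<bar> \<le> R" "\<bar>y - x\<bar> = \<delta>" by blast
  have "\<exists>t. (if y < x then y < t \<and> t < x else x < t \<and> t < y) \<and>
      u y = (\<Sum>m<2. (deriv ^^ m) u x / fact m * (y - x) ^ m) + (deriv ^^ 2) u t / fact 2 * (y - x) ^ 2"
    by (rule Taylor[where a = "- R" and b = R and diff = "\<lambda>m. (deriv ^^ m) u"])
      (use u x y \<delta> in \<open>auto simp del: funpow.simps intro!: smooth_higher_deriv\<close>)
  then obtain t where t: "\<bar>t\<bar> \<le> R"
    "u y = (\<Sum>m<2. (deriv ^^ m) u x / fact m * (y - x) ^ m) + (deriv ^^ 2) u t / fact 2 * (y - x) ^ 2"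
    using x y by (auto simp: abs_le_iff split: if_splits) (metis (no_types, opaque_lifting) less_eq_real_def minus_le_iff order_trans)+
  then have "deriv u x * (y - x) = u y - u x - (deriv ^^ 2) u t / 2 * (y - x)\<^sup>2"
    by (simp add: numeral_2_eq_2)
  then have "\<bar>deriv u x\<bar> * \<delta> = \<bar>u y - u x - (deriv ^^ 2) u t / 2 * (y - x)\<^sup>2\<bar>"
    using y by (metis abs_mult)
  also have "\<dots> \<le> \<bar>u y\<bar> + \<bar>u x\<bar> + \<bar>(deriv ^^ 2) u t / 2 * (y - x)\<^sup>2\<bar>" by linarith
  also have "\<bar>(deriv ^^ 2) u t / 2 * (y - x)\<^sup>2\<bar> = \<bar>(deriv ^^ 2) u t\<bar> / 2 * \<delta>\<^sup>2"
    by (simp add: abs_mult flip: y(2))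
  also have "\<dots> \<le> U2 * \<delta>\<^sup>2"
    using U(2)[OF t(1)] by (intro mult_right_mono) auto
  also have "\<bar>u y\<bar> + \<bar>u x\<bar> \<le> 2 * U0"
    using U(1)[OF x] U(1)[OF y(1)] by linarith
  finally have "\<bar>deriv u x\<bar> * \<delta> \<le> 2 * U0 + U2 * \<delta>\<^sup>2" by linarith
  then show ?thesis
    using \<delta> by (simp add: field_simps power2_eq_square)
qed

text \<open>The induction hypothesis, applied to the derivative, bounds the second derivative by the
  maximum \<open>U1\<close> of the first and by the highest derivative. Inserted into
  \<open>landau_first_derivative\<close>, this gives an inequality with \<open>U1\<close> on both
  sides, and a suitable step makes its coefficient on the right 1/2.\<close>

lemma landau_interpolation:
  assumes R: "(R::real) > 0" and K: "K \<ge> 2"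
  shows "\<exists>C \<delta>0. C > 0 \<and> \<delta>0 > 0 \<and> (\<forall>u U0 UK \<delta> x. smooth u \<longrightarrow> (\<forall>x. \<bar>x\<bar> \<le> R \<longrightarrow> \<bar>u x\<bar> \<le> U0) \<longrightarrow>
    (\<forall>x. \<bar>x\<bar> \<le> R \<longrightarrow> \<bar>(deriv ^^ K) u x\<bar> \<le> UK) \<longrightarrow> 0 < \<delta> \<longrightarrow> \<delta> \<le> \<delta>0 \<longrightarrow> \<bar>x\<bar> \<le> R \<longrightarrow>
    \<bar>deriv u x\<bar> \<le> C * (U0 / \<delta> + \<delta> ^ (K - 1) * UK))"
  using K
proof (induction K rule: dec_induct)
  case base
  show ?case
  proof (rule exI[of _ 2], rule exI[of _ R], intro conjI allI impI)
    fix u U0 U2 \<delta> x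
    assume u: "smooth u" and U: "\<forall>x. \<bar>x\<bar> \<le> R \<longrightarrow> \<bar>u x\<bar> \<le> U0" "\<forall>x. \<bar>x\<bar> \<le> R \<longrightarrow> \<bar>(deriv ^^ 2) u x\<bar> \<le> U2"
      and \<delta>: "0 < \<delta>" "\<delta> \<le> R" and x: "\<bar>x\<bar> \<le> R"
    have "\<bar>deriv u x\<bar> \<le> 2 * U0 / \<delta> + \<delta> * U2"
      by (rule landau_first_derivative[OF u _ _ \<delta> x]) (use U in auto)
    moreover have "\<bar>(deriv ^^ 2) u x\<bar> \<le> U2" using U x by blast
    then have "0 \<le> \<delta> * U2" using \<delta> by (intro mult_nonneg_nonneg) linarith+
    ultimately show "\<bar>deriv u x\<bar> \<le> 2 * (U0 / \<delta> + \<delta> ^ (2 - 1) * U2)"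
      unfolding distrib_left by (simp del: funpow.simps)
  qed (use R in auto)
next
  case (step K)
  then obtain C \<delta>0 where C: "C > 0" "\<delta>0 > 0" and L: "\<And>u U0 UK \<delta> x. smooth u \<Longrightarrow> (\<And>x. \<bar>x\<bar> \<le> R \<Longrightarrow> \<bar>u x\<bar> \<le> U0) \<Longrightarrow>
    (\<And>x. \<bar>x\<bar> \<le> R \<Longrightarrow> \<bar>(deriv ^^ K) u x\<bar> \<le> UK) \<Longrightarrow> 0 < \<delta> \<Longrightarrow> \<delta> \<le> \<delta>0 \<Longrightarrow> \<bar>x\<bar> \<le> R \<Longrightarrow>
    \<bar>deriv u x\<bar> \<le> C * (U0 / \<delta> + \<delta> ^ (K - 1) * UK)"
    by auto
  show ?case
  proof (rule exI[of _ "4 + 2 * C * (2 * C) ^ (K - 1)"], rule exI[of _ "min R (\<delta>0 / (2 * C))"], intro conjI allI impI)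
    show "0 < 4 + 2 * C * (2 * C) ^ (K - 1)" using C by (simp add: add_pos_pos)
    show "0 < min R (\<delta>0 / (2 * C))" using R C by simp
    fix u U0 UK \<delta> x
    assume u: "smooth u" and U: "\<forall>x. \<bar>x\<bar> \<le> R \<longrightarrow> \<bar>u x\<bar> \<le> U0" "\<forall>x. \<bar>x\<bar> \<le> R \<longrightarrow> \<bar>(deriv ^^ Suc K) u x\<bar> \<le> UK"
      and \<delta>: "0 < \<delta>" "\<delta> \<le> min R (\<delta>0 / (2 * C))" and x: "\<bar>x\<bar> \<le> R"
    have "continuous_on {-R..R} (\<lambda>x. \<bar>deriv u x\<bar>)"
      by (intro continuous_on_rabs smooth_continuous smooth_deriv u)
    then obtain x0 where x0: "x0 \<in> {-R..R}" "\<forall>y\<in>{-R..R}. \<bar>deriv u y\<bar> \<le> \<bar>deriv u x0\<bar>"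
      using continuous_attains_sup[of "{-R..R}" "\<lambda>x. \<bar>deriv u x\<bar>"] R by auto
    define U1 where "U1 = \<bar>deriv u x0\<bar>"
    have U1: "\<bar>deriv u y\<bar> \<le> U1" if "\<bar>y\<bar> \<le> R" for y
      using x0(2)[rule_format, of y] that by (simp add: U1_def abs_le_iff)
    \<comment> \<open>The step for the hypothesis is chosen such that
      \<open>\<delta> * (C * (U1 / (2 * C * \<delta>)))\<close> is \<open>U1 / 2\<close>, which the
      left side absorbs; the bound on \<open>\<delta>\<close> keeps this step below
      \<open>\<delta>0\<close>.\<close>
    have \<eta>: "0 < 2 * C * \<delta>" "2 * C * \<delta> \<le> \<delta>0" using \<delta> C by (auto simp: field_simps)
    have "\<bar>deriv (deriv u) y\<bar> \<le> C * (U1 / (2 * C * \<delta>) + (2 * C * \<delta>) ^ (K - 1) * UK)" if "\<bar>y\<bar> \<le> R" for y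
      by (rule L[OF smooth_deriv[OF u] U1 _ \<eta> that]) (use U(2) in \<open>auto simp: funpow_swap1\<close>)
    then have "\<bar>deriv u x0\<bar> \<le> 2 * U0 / \<delta> + \<delta> * (C * (U1 / (2 * C * \<delta>) + (2 * C * \<delta>) ^ (K - 1) * UK))"
      by (intro landau_first_derivative[OF u]) (use U \<delta> x0(1) in \<open>auto simp: numeral_2_eq_2\<close>)
    also have "\<dots> = 2 * U0 / \<delta> + U1 / 2 + C * (2 * C) ^ (K - 1) * (\<delta> * \<delta> ^ (K - 1)) * UK"
      using C \<delta> by (simp add: field_simps power_mult_distrib)
    also have "\<delta> * \<delta> ^ (K - 1) = \<delta> ^ K"
      using step(1) by (simp flip: power_Suc)
    finally have "U1 \<le> 2 * (2 * U0 / \<delta> + C * (2 * C) ^ (K - 1) * \<delta> ^ K * UK)"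
      unfolding U1_def[symmetric] distrib_left by linarith
    then have "U1 \<le> 4 * (U0 / \<delta>) + (2 * C * (2 * C) ^ (K - 1)) * (\<delta> ^ K * UK)"
      by (simp add: algebra_simps)
    moreover have "0 \<le> U0 / \<delta>" "0 \<le> \<delta> ^ K * UK"
      using U(1)[rule_format, OF x] U(2)[rule_format, OF x] \<delta> by (auto intro!: divide_nonneg_pos mult_nonneg_nonneg)
    then have "0 \<le> (2 * C * (2 * C) ^ (K - 1)) * (U0 / \<delta>)" "0 \<le> 4 * (\<delta> ^ K * UK)"
      using C by (auto intro!: mult_nonneg_nonneg simp del: times_divide_eq_right)
    ultimately have "U1 \<le> (4 + 2 * C * (2 * C) ^ (K - 1)) * (U0 / \<delta> + \<delta> ^ K * UK)"
      unfolding distrib_left distrib_right by linarith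
    with U1[OF x] show "\<bar>deriv u x\<bar> \<le> (4 + 2 * C * (2 * C) ^ (K - 1)) * (U0 / \<delta> + \<delta> ^ (Suc K - 1) * UK)"
      by simp
  qed
qed

text \<open>Interpolate at order n + 2 with step \<delta>0 \<omega>^j, where \<omega> is the square
  root of \<theta>. The two terms then have sizes \<omega>^j and (2 \<omega>^(n + 1))^j. Choosing n
  with \<omega>^n < 1/2 makes both decay, so a high order defeats the growth 2^j.\<close>

lemma geometric_decay_deriv:
  fixes u :: "nat \<Rightarrow> real \<Rightarrow> real"
  assumes R: "R > 0" and u: "\<And>j. smooth (u j)"
    and \<theta>: "0 < \<theta>" "\<theta> < 1" and decay: "\<And>j x. \<bar>x\<bar> \<le> R \<Longrightarrow> \<bar>u j x\<bar> \<le> C * \<theta> ^ j"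
    and growth: "\<And>k. \<exists>C. \<forall>j x. \<bar>x\<bar> \<le> R \<longrightarrow> \<bar>(deriv ^^ k) (u j) x\<bar> \<le> C * 2 ^ j"
  shows "\<exists>C \<theta>. 0 < \<theta> \<and> \<theta> < 1 \<and> (\<forall>j x. \<bar>x\<bar> \<le> R \<longrightarrow> \<bar>deriv (u j) x\<bar> \<le> C * \<theta> ^ j)"
proof -
  define \<omega> where "\<omega> = sqrt \<theta>"
  have \<omega>: "0 < \<omega>" "\<omega> < 1" "\<theta> / \<omega> = \<omega>"
    using \<theta> by (auto simp: \<omega>_def real_div_sqrt)
  obtain n where n: "\<omega> ^ n < 1/2"
    using real_arch_pow_inv[of "1/2" \<omega>] \<omega> by auto
  have "\<omega> ^ Suc n * 2 < 1"
    using mult_strict_mono[OF \<omega>(2) n] \<omega> by simp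
  define \<theta>' where "\<theta>' = max \<omega> (\<omega> ^ Suc n * 2)"
  have \<theta>': "0 < \<theta>'" "\<theta>' < 1" "\<omega> \<le> \<theta>'" "\<omega> ^ Suc n * 2 \<le> \<theta>'"
    using \<omega> \<open>\<omega> ^ Suc n * 2 < 1\<close> by (auto simp: \<theta>'_def)
  obtain L \<delta>0 where L: "L > 0" "\<delta>0 > 0" and land: "\<And>u U0 UK \<delta> x. smooth u \<Longrightarrow> (\<And>x. \<bar>x\<bar> \<le> R \<Longrightarrow> \<bar>u x\<bar> \<le> U0) \<Longrightarrow>
    (\<And>x. \<bar>x\<bar> \<le> R \<Longrightarrow> \<bar>(deriv ^^ (n + 2)) u x\<bar> \<le> UK) \<Longrightarrow> 0 < \<delta> \<Longrightarrow> \<delta> \<le> \<delta>0 \<Longrightarrow> \<bar>x\<bar> \<le> R \<Longrightarrow>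
    \<bar>deriv u x\<bar> \<le> L * (U0 / \<delta> + \<delta> ^ (n + 2 - 1) * UK)"
    using landau_interpolation[OF R, of "n + 2"] by auto
  obtain CK where CK: "\<And>j x. \<bar>x\<bar> \<le> R \<Longrightarrow> \<bar>(deriv ^^ (n + 2)) (u j) x\<bar> \<le> CK * 2 ^ j"
    using growth[of "n + 2"] by blast
  have C0: "C \<ge> 0" using decay[of 0 0] R by auto
  have CK0: "CK \<ge> 0" using CK[of 0 0] R by auto
  have "\<bar>deriv (u j) x\<bar> \<le> L * (C / \<delta>0 + \<delta>0 ^ Suc n * CK) * \<theta>' ^ j" if x: "\<bar>x\<bar> \<le> R" for j x
  proof -
    have "\<bar>deriv (u j) x\<bar> \<le> L * (C * \<theta> ^ j / (\<delta>0 * \<omega> ^ j) + (\<delta>0 * \<omega> ^ j) ^ (n + 2 - 1) * (CK * 2 ^ j))"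
      by (rule land[OF u decay CK _ _ x]) (use L \<omega> in \<open>auto simp: mult_le_cancel_left1 power_le_one\<close>)
    also have "C * \<theta> ^ j / (\<delta>0 * \<omega> ^ j) = C / \<delta>0 * (\<theta> / \<omega>) ^ j"
      by (simp add: power_divide)
    also have "(\<delta>0 * \<omega> ^ j) ^ (n + 2 - 1) * (CK * 2 ^ j) = \<delta>0 ^ Suc n * CK * (\<omega> ^ Suc n * 2) ^ j"
      by (simp add: power_mult_distrib power_mult[symmetric] mult.commute algebra_simps)
    also have "C / \<delta>0 * (\<theta> / \<omega>) ^ j \<le> C / \<delta>0 * \<theta>' ^ j"
      unfolding \<omega>(3) using L C0 \<omega> \<theta>' by (intro mult_left_mono power_mono) auto
    also have "\<delta>0 ^ Suc n * CK * (\<omega> ^ Suc n * 2) ^ j \<le> \<delta>0 ^ Suc n * CK * \<theta>' ^ j"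
      using L CK0 \<omega> \<theta>' by (intro mult_left_mono power_mono) auto
    finally show ?thesis using L by (simp add: algebra_simps)
  qed
  with \<theta>' show ?thesis by blast
qed

text \<open>The growth condition concerns all orders and hence passes to derivatives, so the
  previous lemma can be iterated; only the rate \<open>\<theta>\<close> deteriorates.\<close>

lemma geometric_decay_higher_deriv:
  fixes u :: "nat \<Rightarrow> real \<Rightarrow> real"
  assumes R: "R > 0" and u: "\<And>j. smooth (u j)"
    and decay: "\<exists>C \<theta>. 0 < \<theta> \<and> \<theta> < 1 \<and> (\<forall>j x. \<bar>x\<bar> \<le> R \<longrightarrow> \<bar>u j x\<bar> \<le> C * \<theta> ^ j)"
    and growth: "\<And>k. \<exists>C. \<forall>j x. \<bar>x\<bar> \<le> R \<longrightarrow> \<bar>(deriv ^^ k) (u j) x\<bar> \<le> C * 2 ^ j"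
  shows "\<exists>C \<theta>. 0 < \<theta> \<and> \<theta> < 1 \<and> (\<forall>j x. \<bar>x\<bar> \<le> R \<longrightarrow> \<bar>(deriv ^^ k) (u j) x\<bar> \<le> C * \<theta> ^ j)"
proof (induction k)
  case (Suc k)
  then obtain C \<theta> where *: "0 < \<theta>" "\<theta> < 1" "\<And>j x. \<bar>x\<bar> \<le> R \<Longrightarrow> \<bar>(deriv ^^ k) (u j) x\<bar> \<le> C * \<theta> ^ j"
    by blast
  have "\<exists>C. \<forall>j x. \<bar>x\<bar> \<le> R \<longrightarrow> \<bar>(deriv ^^ i) ((deriv ^^ k) (u j)) x\<bar> \<le> C * 2 ^ j" for i
    using growth[of "i + k"] by (simp add: funpow_add)
  with geometric_decay_deriv[OF R smooth_deriv_n[OF u] *] show ?case by simp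
qed (use decay in simp)

text \<open>The difference quotients at the dyadic steps converge geometrically, while all their
  derivatives grow at most geometrically; by interpolation all derivatives converge.\<close>

lemma smooth_partial_at_0:
  assumes H: "smooth2 H"
  shows "smooth (\<lambda>r. deriv (H r) 0)"
proof -
  \<comment> \<open>The difference quotient with step 2^(- j). The differences \<open>u\<close> are
    the terms of a telescoping series whose sum is the partial derivative minus
    \<open>A 0\<close>.\<close>
  define A where "A j r = (H r ((1/2) ^ j) - H r 0) * 2 ^ j" for j :: nat and r
  define u where "u j r = A (Suc j) r - A j r" for j r
  have dA: "(deriv ^^ k) (A j) r =
      ((deriv ^^ k) (\<lambda>r. H r ((1/2) ^ j)) r - (deriv ^^ k) (\<lambda>r. H r 0) r) * 2 ^ j" for k j r
  proof -
    have "(deriv ^^ k) (A j) = (\<lambda>r. ((deriv ^^ k) (\<lambda>r. H r ((1/2) ^ j)) r - (deriv ^^ k) (\<lambda>r. H r 0) r) * 2 ^ j)"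
      unfolding A_def
      by (rule higher_deriv_eqI[of "\<lambda>k r. ((deriv ^^ k) (\<lambda>r. H r ((1/2) ^ j)) r - (deriv ^^ k) (\<lambda>r. H r 0) r) * 2 ^ j", simplified funpow_0])
        (intro DERIV_cmult_right DERIV_diff smooth_higher_deriv smooth2_left H)
    then show ?thesis by simp
  qed
  have sA: "smooth (A j)" for j
    unfolding A_def[abs_def] by (intro smooth_mult smooth_diff smooth_const smooth2_left H)
  have su: "smooth (u j)" for j
    unfolding u_def[abs_def] by (intro smooth_diff sA)
  have du: "(deriv ^^ k) (u j) r = (deriv ^^ k) (A (Suc j)) r - (deriv ^^ k) (A j) r" for k j r
  proof -
    have "(deriv ^^ k) (u j) = (\<lambda>r. (deriv ^^ k) (A (Suc j)) r - (deriv ^^ k) (A j) r)"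
      unfolding u_def
      by (rule higher_deriv_eqI[of "\<lambda>k r. (deriv ^^ k) (A (Suc j)) r - (deriv ^^ k) (A j) r", simplified funpow_0])
        (intro DERIV_diff smooth_higher_deriv sA)
    then show ?thesis by simp
  qed
  \<comment> \<open>The derivatives of \<open>H\<close> in the first variable are bounded on
    squares; the division by the step accounts for the factor 2^j.\<close>
  have growth: "\<exists>C. \<forall>j r. \<bar>r\<bar> \<le> R \<longrightarrow> \<bar>(deriv ^^ k) (u j) r\<bar> \<le> C * 2 ^ j" if R: "R \<ge> 1" for R k
  proof -
    obtain C where C: "\<And>r s. \<bar>r\<bar> \<le> R \<Longrightarrow> \<bar>s\<bar> \<le> R \<Longrightarrow> \<bar>(deriv ^^ k) (\<lambda>r. H r s) r\<bar> \<le> C"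
      using smooth2_bounded_left[OF H] by blast
    have a: "\<bar>(deriv ^^ k) (A j) r\<bar> \<le> 2 * C * 2 ^ j" if "\<bar>r\<bar> \<le> R" for j r
    proof -
      have "\<bar>(1/2) ^ j\<bar> \<le> R" using R power_le_one[of "1/2::real" j] by simp
      with C[OF that this] C[OF that, of 0] R
      have "\<bar>(deriv ^^ k) (\<lambda>r. H r ((1/2) ^ j)) r - (deriv ^^ k) (\<lambda>r. H r 0) r\<bar> \<le> 2 * C" by linarith
      then show ?thesis unfolding dA abs_mult by (intro mult_mono) auto
    qed
    have "\<bar>(deriv ^^ k) (u j) r\<bar> \<le> (6 * C) * 2 ^ j" if "\<bar>r\<bar> \<le> R" for j r
      using a[OF that, of j] a[OF that, of "Suc j"] unfolding du by simp
    then show ?thesis by blast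
  qed
  \<comment> \<open>Taylor's formula of order 2 in the second variable: the error of the quotient is
    half a second derivative times the step.\<close>
  have conv: "\<exists>C. \<forall>j r. \<bar>r\<bar> \<le> R \<longrightarrow> \<bar>A j r - deriv (H r) 0\<bar> \<le> C * (1/2) ^ j" if R: "R \<ge> 1" for R
  proof -
    obtain C where C: "\<And>r s. \<bar>r\<bar> \<le> R \<Longrightarrow> \<bar>s\<bar> \<le> R \<Longrightarrow> \<bar>(deriv ^^ 2) (H r) s\<bar> \<le> C"
      using smooth2_bounded_right[OF H] by blast
    have "\<bar>A j r - deriv (H r) 0\<bar> \<le> C * (1/2) ^ j" if r: "\<bar>r\<bar> \<le> R" for j r
    proof -
      define \<epsilon> :: real where "\<epsilon> = (1/2) ^ j"
      have \<epsilon>: "0 < \<epsilon>" "\<epsilon> \<le> 1" by (auto simp: \<epsilon>_def power_le_one)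
      have "\<exists>t>0. t < \<epsilon> \<and> H r \<epsilon> = (\<Sum>m<2. (deriv ^^ m) (H r) 0 / fact m * \<epsilon> ^ m) + (deriv ^^ 2) (H r) t / fact 2 * \<epsilon> ^ 2"
        by (rule Maclaurin) (use \<epsilon> smooth2_right[OF H] in \<open>auto simp del: funpow.simps intro!: smooth_higher_deriv\<close>)
      then obtain t where t: "0 < t" "t < \<epsilon>" "H r \<epsilon> = H r 0 + deriv (H r) 0 * \<epsilon> + (deriv ^^ 2) (H r) t / 2 * \<epsilon>\<^sup>2"
        by (auto simp: numeral_2_eq_2)
      have "2 ^ j = 1 / \<epsilon>" by (simp add: \<epsilon>_def power_divide)
      then have "A j r = (H r \<epsilon> - H r 0) / \<epsilon>" by (simp add: A_def \<epsilon>_def)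
      moreover have "H r \<epsilon> - H r 0 = (deriv (H r) 0 + (deriv ^^ 2) (H r) t / 2 * \<epsilon>) * \<epsilon>"
        using t(3) by (simp add: algebra_simps power2_eq_square)
      ultimately have "A j r - deriv (H r) 0 = (deriv ^^ 2) (H r) t / 2 * \<epsilon>"
        using \<epsilon> by simp
      then have "\<bar>A j r - deriv (H r) 0\<bar> = \<bar>(deriv ^^ 2) (H r) t / 2 * \<epsilon>\<bar>"
        by (rule arg_cong)
      also have "\<dots> = \<bar>(deriv ^^ 2) (H r) t\<bar> / 2 * \<epsilon>"
        using \<epsilon> by (simp add: abs_mult)
      also have "\<dots> \<le> C * \<epsilon>"
        using C[OF r, of t] t \<epsilon> R by (intro mult_right_mono) auto
      finally show ?thesis by (simp add: \<epsilon>_def)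
    qed
    then show ?thesis by blast
  qed
  have dec: "\<exists>C \<theta>. 0 < \<theta> \<and> \<theta> < 1 \<and> (\<forall>j r. \<bar>r\<bar> \<le> R \<longrightarrow> \<bar>(deriv ^^ k) (u j) r\<bar> \<le> C * \<theta> ^ j)" if R: "R \<ge> 1" for R k
  proof (rule geometric_decay_higher_deriv[OF _ su _ growth[OF R]])
    show "R > 0" using R by simp
    obtain C where C: "\<And>j r. \<bar>r\<bar> \<le> R \<Longrightarrow> \<bar>A j r - deriv (H r) 0\<bar> \<le> C * (1/2) ^ j"
      using conv[OF R] by blast
    have "\<bar>u j r\<bar> \<le> (3 / 2 * C) * (1/2) ^ j" if "\<bar>r\<bar> \<le> R" for j r
    proof -
      have "C * (1/2) ^ Suc j = C * (1/2) ^ j / 2" by simp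
      then show ?thesis
        using C[OF that, of j] C[OF that, of "Suc j"] unfolding u_def by linarith
    qed
    then have "0 < (1/2::real) \<and> 1/2 < (1::real) \<and> (\<forall>j r. \<bar>r\<bar> \<le> R \<longrightarrow> \<bar>u j r\<bar> \<le> (3 / 2 * C) * (1/2) ^ j)"
      by simp
    then show "\<exists>C \<theta>. 0 < \<theta> \<and> \<theta> < 1 \<and> (\<forall>j r. \<bar>r\<bar> \<le> R \<longrightarrow> \<bar>u j r\<bar> \<le> C * \<theta> ^ j)"
      by (intro exI)
  qed
  have "smooth (\<lambda>r. \<Sum>n. (deriv ^^ 0) (u n) r)"
  proof (rule smooth_series(2)[where f = "\<lambda>n k. (deriv ^^ k) (u n)"])
    fix k R
    obtain C \<theta> where "0 < \<theta>" "\<theta> < 1" "\<And>j r. \<bar>r\<bar> \<le> max R 1 \<Longrightarrow> \<bar>(deriv ^^ k) (u j) r\<bar> \<le> C * \<theta> ^ j"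
      using dec[of "max R 1" k] by auto
    then show "\<exists>M. summable M \<and> (\<forall>n x. \<bar>x\<bar> \<le> R \<longrightarrow> \<bar>(deriv ^^ k) (u n) x\<bar> \<le> M n)"
      by (intro exI[of _ "\<lambda>n. C * \<theta> ^ n"]) (auto intro!: summable_mult summable_geometric)
  qed (intro smooth_higher_deriv su)
  moreover have "(\<lambda>n. u n r) sums (deriv (H r) 0 - A 0 r)" for r
    unfolding u_def
  proof (rule telescope_sums)
    obtain C where C: "\<And>j. \<bar>A j r - deriv (H r) 0\<bar> \<le> C * (1/2) ^ j"
      using conv[of "max \<bar>r\<bar> 1"] by (meson max.cobounded1 max.cobounded2)
    have "(\<lambda>j. C * (1/2) ^ j) \<longlonglongrightarrow> C * 0"
      by (intro tendsto_intros LIMSEQ_realpow_zero) auto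
    then have "(\<lambda>j. C * (1/2) ^ j) \<longlonglongrightarrow> 0" by simp
    moreover have "\<forall>\<^sub>F j in sequentially. norm (A j r - deriv (H r) 0) \<le> C * (1/2) ^ j"
      using C by simp
    ultimately have "(\<lambda>j. A j r - deriv (H r) 0) \<longlonglongrightarrow> 0"
      by (rule Lim_null_comparison[rotated])
    then show "(\<lambda>j. A j r) \<longlonglongrightarrow> deriv (H r) 0"
      by (rule LIM_zero_cancel)
  qed
  then have "(\<Sum>n. (deriv ^^ 0) (u n) r) = deriv (H r) 0 - A 0 r" for r
    by (simp add: sums_iff)
  ultimately have "smooth (\<lambda>r. deriv (H r) 0 - A 0 r)" by simp
  then have "smooth (\<lambda>r. (deriv (H r) 0 - A 0 r) + A 0 r)"
    by (intro smooth_add sA)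
  then show ?thesis by simp
qed

text \<open>The derivative at 0 suffices, because the curves can be absorbed into the function:
  \<open>H (a t) (b t + \<sigma>)\<close> is again smooth in \<open>t\<close> and
  \<open>\<sigma>\<close>, and its derivative at \<open>\<sigma> = 0\<close> is the one
  wanted.\<close>

lemma smooth2_partial:
  assumes H: "smooth2 H"
  shows "smooth2 (\<lambda>r s. deriv (H r) s)"
  unfolding smooth2_def
proof (intro allI impI)
  fix a b assume a: "smooth a" and b: "smooth b"
  have "smooth2 (\<lambda>t \<sigma>. H (a t) (b t + \<sigma>))"
    unfolding smooth2_def
    by (intro allI impI smooth2D[OF H] smooth_add smooth_compose[OF a] smooth_compose[OF b])
  from smooth_partial_at_0[OF this] have "smooth (\<lambda>t. deriv (\<lambda>\<sigma>. H (a t) (b t + \<sigma>)) 0)" .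
  moreover have "deriv (\<lambda>\<sigma>. H (a t) (b t + \<sigma>)) 0 = deriv (H (a t)) (b t)" for t
    using higher_deriv_affine[OF smooth2_right[OF H, of "a t"], of 1 "b t" 1 0] by simp
  ultimately show "smooth (\<lambda>t. deriv (H (a t)) (b t))" by simp
qed

text \<open>Both partial derivatives are bounded on squares, so the function is locally
  Lipschitz.\<close>

lemma smooth2_continuous:
  assumes H: "smooth2 H"
  shows "continuous_on UNIV (\<lambda>(r, s). H r s)"
proof (rule continuous_at_imp_continuous_on, rule ballI)
  fix z :: "real \<times> real"
  obtain r0 s0 where z: "z = (r0, s0)" by fastforce
  define R where "R = max \<bar>r0\<bar> \<bar>s0\<bar> + 1"
  obtain C1 where C1: "\<And>r s. \<bar>r\<bar> \<le> R \<Longrightarrow> \<bar>s\<bar> \<le> R \<Longrightarrow> \<bar>deriv (\<lambda>r. H r s) r\<bar> \<le> C1"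
    using smooth2_bounded_left[OF H, of R 1] by auto
  obtain C2 where C2: "\<And>r s. \<bar>r\<bar> \<le> R \<Longrightarrow> \<bar>s\<bar> \<le> R \<Longrightarrow> \<bar>deriv (H r) s\<bar> \<le> C2"
    using smooth2_bounded_right[OF H, of R 1] by auto
  have b: "\<bar>H r s - H r0 s0\<bar> \<le> C1 * \<bar>r - r0\<bar> + C2 * \<bar>s - s0\<bar>" if r: "\<bar>r\<bar> \<le> R" and s: "\<bar>s\<bar> \<le> R" for r s
  proof -
    have 0: "\<bar>r0\<bar> \<le> R" "\<bar>s0\<bar> \<le> R" by (auto simp: R_def)
    have "norm (H r s - H r0 s) \<le> C1 * norm (r - r0)"
      by (rule field_differentiable_bound[of "{-R..R}" "\<lambda>r. H r s" "deriv (\<lambda>r. H r s)"])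
        (use r s 0 C1 in \<open>auto intro!: has_field_derivative_at_within smoothD smooth2_left H\<close>)
    moreover have "norm (H r0 s - H r0 s0) \<le> C2 * norm (s - s0)"
      by (rule field_differentiable_bound[of "{-R..R}" "H r0" "deriv (H r0)"])
        (use r s 0 C2 in \<open>auto intro!: has_field_derivative_at_within smoothD smooth2_right H\<close>)
    ultimately show ?thesis by simp
  qed
  have "((\<lambda>w. C1 * \<bar>fst w - r0\<bar> + C2 * \<bar>snd w - s0\<bar>) \<longlongrightarrow> C1 * \<bar>fst z - r0\<bar> + C2 * \<bar>snd z - s0\<bar>) (at z)"
    by (intro tendsto_intros)
  then have lim: "((\<lambda>w. C1 * \<bar>fst w - r0\<bar> + C2 * \<bar>snd w - s0\<bar>) \<longlongrightarrow> 0) (at z)"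
    by (simp add: z)
  have "\<forall>\<^sub>F w in at z. norm (H (fst w) (snd w) - H r0 s0) \<le> C1 * \<bar>fst w - r0\<bar> + C2 * \<bar>snd w - s0\<bar>"
  proof (rule eventually_at_ball'[THEN eventually_mono])
    show "(0::real) < 1" by simp
    fix w assume "w \<in> ball z 1 \<and> w \<noteq> z \<and> w \<in> UNIV"
    then have "dist w z < 1" by (simp add: dist_commute)
    then have "\<bar>fst w - r0\<bar> < 1" "\<bar>snd w - s0\<bar> < 1"
      using dist_fst_le[of w z] dist_snd_le[of w z] by (auto simp: z dist_real_def)
    then show "norm (H (fst w) (snd w) - H r0 s0) \<le> C1 * \<bar>fst w - r0\<bar> + C2 * \<bar>snd w - s0\<bar>"
      using b[of "fst w" "snd w"] by (simp add: R_def)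
  qed
  from LIM_zero_cancel[OF Lim_null_comparison[OF this lim]]
  show "isCont (\<lambda>(r, s). H r s) z"
    by (simp add: isCont_def z case_prod_beta')
qed

text \<open>Differentiation under the integral sign produces an integral of the same kind, hence
  coinduction. The Leibniz rule wants joint continuity of the integrand's derivative, which
  \<open>smooth2_partial\<close> and \<open>smooth2_continuous\<close> provide.\<close>

lemma smooth_integral:
  assumes "smooth2 \<Phi>"
  shows "smooth (\<lambda>r. integral {0..1} (\<Phi> r))"
proof (rule smoothI_coinduct[of "\<lambda>f. \<exists>\<Phi>. smooth2 \<Phi> \<and> f = (\<lambda>r. integral {0..1} (\<Phi> r))"])
  fix f :: "real \<Rightarrow> real"
  assume "\<exists>\<Phi>. smooth2 \<Phi> \<and> f = (\<lambda>r. integral {0..1} (\<Phi> r))"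
  then obtain \<Phi> where \<Phi>: "smooth2 \<Phi>" "f = (\<lambda>r. integral {0..1} (\<Phi> r))" by blast
  let ?\<Psi> = "\<lambda>r t. deriv (\<lambda>r. \<Phi> r t) r"
  have \<Psi>: "smooth2 ?\<Psi>"
    using smooth2_flip[OF smooth2_partial[OF smooth2_flip[OF \<Phi>(1)]]] .
  have "(f has_real_derivative integral (cbox 0 1) (?\<Psi> r)) (at r within UNIV)" for r
    unfolding \<Phi>(2) box_real[symmetric]
  proof (rule leibniz_rule_field_derivative)
    show "((\<lambda>r. \<Phi> r t) has_real_derivative ?\<Psi> r t) (at r within UNIV)" for r t
      using smoothD[OF smooth2_left[OF \<Phi>(1)]] .
    show "\<Phi> r integrable_on cbox 0 1" for r
      by (intro integrable_continuous smooth_continuous smooth2_right \<Phi>)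
    show "continuous_on (UNIV \<times> cbox 0 1) (\<lambda>(r, t). ?\<Psi> r t)"
      using smooth2_continuous[OF \<Psi>] by (rule continuous_on_subset) simp
  qed auto
  then show "\<exists>f'. (\<forall>x. (f has_real_derivative f' x) (at x)) \<and>
      (\<exists>\<Phi>. smooth2 \<Phi> \<and> f' = (\<lambda>r. integral {0..1} (\<Phi> r)))"
    using \<Psi> by (intro exI[of _ "\<lambda>r. integral {0..1} (?\<Psi> r)"]) (auto simp: box_real)
qed (use assms in blast)

lemma smooth2_partial_integral:
  assumes H: "smooth2 H"
  shows "H r s = H r 0 + s * integral {0..1} (\<lambda>t. deriv (H r) (t * s))"
proof -
  have "((\<lambda>t. s * deriv (H r) (t * s)) has_integral (H r (1 * s) - H r (0 * s))) {0..1}"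
  proof (rule fundamental_theorem_of_calculus)
    fix t :: real
    have "((\<lambda>t. H r (t * s)) has_real_derivative deriv (H r) (t * s) * s) (at t within {0..1})"
      by (rule has_field_derivative_at_within, rule DERIV_chain2[OF smoothD[OF smooth2_right[OF H]]])
        (auto intro!: derivative_eq_intros)
    then show "((\<lambda>t. H r (t * s)) has_vector_derivative s * deriv (H r) (t * s)) (at t within {0..1})"
      by (simp add: has_real_derivative_iff_has_vector_derivative mult.commute)
  qed simp
  from integral_unique[OF this] show ?thesis by simp
qed

subsection \<open>Smooth functions of several variables\<close>

abbreviation sf :: "nat \<Rightarrow> ((nat \<Rightarrow> real) \<Rightarrow> real) set" where
  "sf k \<equiv> smooth_functions (rn k)"

lemma sfD: "f \<in> sf k \<Longrightarrow> c \<in> curves (rn k) \<Longrightarrow> smooth (\<lambda>t. f (c t))"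
  by (simp add: smooth_functions_def o_def)

lemma sfI: "(\<And>c. c \<in> curves (rn k) \<Longrightarrow> smooth (\<lambda>t. f (c t))) \<Longrightarrow> f \<in> sf k"
  by (simp add: smooth_functions_def o_def)

lemma points_rn: "points (rn k) = {x. \<forall>i\<ge>k. x i = 0}"
  by (simp add: rn_def)

lemma zero_points: "(\<lambda>_. 0) \<in> points (rn k)"
  by (simp add: points_rn)

lemma curves_rn: "c \<in> curves (rn k) \<longleftrightarrow> (\<forall>r. c r \<in> points (rn k)) \<and> (\<forall>i. smooth (\<lambda>r. c r i))"
proof -
  have "smooth (\<lambda>r. c r i)" if "\<forall>r. \<forall>i\<ge>k. c r i = 0" "\<forall>i<k. smooth (\<lambda>r. c r i)" for i
    using that by (cases "i < k") (auto simp: smooth_const)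
  then show ?thesis by (auto simp: rn_def)
qed

lemma sf_const: "(\<lambda>x. c) \<in> sf k"
  by (rule sfI, rule smooth_const)

lemma sf_coord: "(\<lambda>x. x i) \<in> sf k"
  by (rule sfI) (simp add: curves_rn)

lemma sf_add: "f \<in> sf k \<Longrightarrow> g \<in> sf k \<Longrightarrow> (\<lambda>x. f x + g x) \<in> sf k"
  by (simp add: smooth_functions_def o_def smooth_add)

lemma sf_diff: "f \<in> sf k \<Longrightarrow> g \<in> sf k \<Longrightarrow> (\<lambda>x. f x - g x) \<in> sf k"
  by (simp add: smooth_functions_def o_def smooth_diff)

lemma sf_minus: "f \<in> sf k \<Longrightarrow> (\<lambda>x. - f x) \<in> sf k"
  by (simp add: smooth_functions_def o_def smooth_minus)

lemma sf_mult: "f \<in> sf k \<Longrightarrow> g \<in> sf k \<Longrightarrow> (\<lambda>x. f x * g x) \<in> sf k"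
  by (simp add: smooth_functions_def o_def smooth_mult)

lemma sf_power: "f \<in> sf k \<Longrightarrow> (\<lambda>x. f x ^ n) \<in> sf k"
  by (simp add: smooth_functions_def o_def smooth_power)

lemma sf_sum: "(\<And>i. i \<in> A \<Longrightarrow> f i \<in> sf k) \<Longrightarrow> (\<lambda>x. \<Sum>i\<in>A. f i x) \<in> sf k"
  by (simp add: smooth_functions_def o_def smooth_sum)

lemma sf_prod: "(\<And>i. i \<in> A \<Longrightarrow> f i \<in> sf k) \<Longrightarrow> (\<lambda>x. \<Prod>i\<in>A. f i x) \<in> sf k"
  by (simp add: smooth_functions_def o_def smooth_prod)

lemmas sf_intros = sf_const sf_coord sf_add sf_diff sf_minus sf_mult sf_power sf_sum sf_prod

lemma sf_compose:
  assumes f: "f \<in> sf k" and u: "\<And>x. x \<in> points (rn l) \<Longrightarrow> u x \<in> points (rn k)" "\<And>i. (\<lambda>x. u x i) \<in> sf l"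
  shows "(\<lambda>x. f (u x)) \<in> sf l"
proof (rule sfI)
  fix c assume c: "c \<in> curves (rn l)"
  then have "(\<lambda>t. u (c t)) \<in> curves (rn k)"
    unfolding curves_rn using u sfD[OF u(2) c] by (auto simp: curves_rn)
  from sfD[OF f this] show "smooth (\<lambda>t. f (u (c t)))" .
qed

lemma sf_cong:
  assumes "f \<in> sf k" "\<And>x. x \<in> points (rn k) \<Longrightarrow> f x = g x" shows "g \<in> sf k"
proof (rule sfI)
  fix c assume "c \<in> curves (rn k)"
  with sfD[OF assms(1) this] assms(2) show "smooth (\<lambda>t. g (c t))"
    by (simp add: curves_rn)
qed

lemma upd_points: "x \<in> points (rn k) \<Longrightarrow> i < k \<Longrightarrow> x(i := t) \<in> points (rn k)"
  by (simp add: points_rn)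

text \<open>The passage from several variables to two: the first variable is the time along
  \<open>c\<close>, the second one replaces coordinate \<open>i\<close>.\<close>

lemma sf_upd_smooth2:
  assumes f: "f \<in> sf k" and i: "i < k" and c: "c \<in> curves (rn k)"
  shows "smooth2 (\<lambda>r s. f ((c r)(i := s)))"
  unfolding smooth2_def
proof (intro allI impI sfD[OF f])
  fix a b assume a: "smooth a" and b: "smooth b"
  have "smooth (\<lambda>t. c (a t) j)" for j
    using c by (intro smooth_compose[OF _ a]) (simp add: curves_rn)
  then have "smooth (\<lambda>t. ((c (a t))(i := b t)) j)" for j
    using b by (cases "j = i") auto
  then show "(\<lambda>t. (c (a t))(i := b t)) \<in> curves (rn k)"
    using c i by (simp add: curves_rn upd_points)
qed

section \<open>Partial derivatives and Hadamard's lemma\<close>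

definition pd :: "nat \<Rightarrow> ((nat \<Rightarrow> real) \<Rightarrow> real) \<Rightarrow> (nat \<Rightarrow> real) \<Rightarrow> real" where
  "pd i f x = deriv (\<lambda>t. f (x(i := t))) (x i)"

lemma pd_sf:
  assumes f: "f \<in> sf k" and i: "i < k"
  shows "pd i f \<in> sf k"
proof (rule sfI)
  fix c assume c: "c \<in> curves (rn k)"
  have "smooth (\<lambda>t. deriv (\<lambda>s. f ((c t)(i := s))) (c t i))"
    using smooth2D[OF smooth2_partial[OF sf_upd_smooth2[OF f i c]] smooth_ident, of "\<lambda>t. c t i"] c
    by (simp add: curves_rn)
  then show "smooth (\<lambda>t. pd i f (c t))" by (simp add: pd_def)
qed

lemma const_curve: "x \<in> points (rn k) \<Longrightarrow> (\<lambda>_. x) \<in> curves (rn k)"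
  by (simp add: curves_rn smooth_const)

lemma sf_line: "f \<in> sf k \<Longrightarrow> i < k \<Longrightarrow> x \<in> points (rn k) \<Longrightarrow> smooth (\<lambda>t. f (x(i := t)))"
  using smooth2_right[OF sf_upd_smooth2[of f k i "\<lambda>_. x"]] const_curve by blast

lemma pd_has_derivative:
  "f \<in> sf k \<Longrightarrow> i < k \<Longrightarrow> x \<in> points (rn k) \<Longrightarrow>
    ((\<lambda>t. f (x(i := t))) has_real_derivative pd i f x) (at (x i))"
  unfolding pd_def by (intro smoothD sf_line)

text \<open>The quotient is the integral of the partial derivative over the segment from
  \<open>x(i := 0)\<close> to \<open>x\<close>, smooth by \<open>smooth_integral\<close>. Such
  quotients become the coefficients that witness membership in an ideal.\<close>

lemma hadamard:
  assumes f: "f \<in> sf k" and i: "i < k"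
  obtains g where "g \<in> sf k" "\<And>x. x \<in> points (rn k) \<Longrightarrow> f x = f (x(i := 0)) + x i * g x"
proof
  let ?g = "\<lambda>x. integral {0..1} (\<lambda>t. deriv (\<lambda>s. f (x(i := s))) (t * x i))"
  show "?g \<in> sf k"
  proof (rule sfI)
    fix c assume c: "c \<in> curves (rn k)"
    have P: "smooth2 (\<lambda>r s. deriv (\<lambda>s. f ((c r)(i := s))) s)"
      by (rule smooth2_partial[OF sf_upd_smooth2[OF f i c]])
    have "smooth2 (\<lambda>r t. deriv (\<lambda>s. f ((c r)(i := s))) (t * c r i))"
      unfolding smooth2_def
    proof (intro allI impI)
      fix a b assume a: "smooth a" and b: "smooth b"
      have "smooth (\<lambda>t. b t * c (a t) i)"
        using c by (intro smooth_mult b smooth_compose[OF _ a]) (simp add: curves_rn)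
      then show "smooth (\<lambda>t. deriv (\<lambda>s. f ((c (a t))(i := s))) (b t * c (a t) i))"
        by (rule smooth2D[OF P a])
    qed
    from smooth_integral[OF this]
    show "smooth (\<lambda>t. ?g (c t))" .
  qed
  fix x assume x: "x \<in> points (rn k)"
  show "f x = f (x(i := 0)) + x i * ?g x"
    using smooth2_partial_integral[OF sf_upd_smooth2[OF f i const_curve[OF x]], of "x i"] by simp
qed

lemma pd_eqI: "((\<lambda>t. f (x(i := t))) has_real_derivative D) (at (x i)) \<Longrightarrow> pd i f x = D"
  unfolding pd_def by (rule DERIV_imp_deriv)

lemma pd_cong:
  assumes "\<And>x. x \<in> points (rn k) \<Longrightarrow> f x = g x" "i < k" "x \<in> points (rn k)"
  shows "pd i f x = pd i g x"
  using assms by (simp add: pd_def upd_points)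

lemma pd_const: "pd i (\<lambda>x. c) x = 0"
  by (rule pd_eqI) simp

lemma pd_coord: "pd i (\<lambda>x. x j) x = (if i = j then 1 else 0)"
  by (rule pd_eqI) simp

lemma pd_add:
  assumes "f \<in> sf k" "g \<in> sf k" "i < k" "x \<in> points (rn k)"
  shows "pd i (\<lambda>x. f x + g x) x = pd i f x + pd i g x"
  by (rule pd_eqI, rule DERIV_add; rule pd_has_derivative[OF _ assms(3,4)]) (use assms in auto)

lemma pd_diff:
  assumes "f \<in> sf k" "g \<in> sf k" "i < k" "x \<in> points (rn k)"
  shows "pd i (\<lambda>x. f x - g x) x = pd i f x - pd i g x"
  by (rule pd_eqI, rule DERIV_diff; rule pd_has_derivative[OF _ assms(3,4)]) (use assms in auto)

lemma pd_mult:
  assumes "f \<in> sf k" "g \<in> sf k" "i < k" "x \<in> points (rn k)"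
  shows "pd i (\<lambda>x. f x * g x) x = pd i f x * g x + pd i g x * f x"
proof (rule pd_eqI)
  show "((\<lambda>t. f (x(i := t)) * g (x(i := t))) has_real_derivative pd i f x * g x + pd i g x * f x) (at (x i))"
    using DERIV_mult[OF pd_has_derivative[OF assms(1,3,4)] pd_has_derivative[OF assms(2,3,4)]] by simp
qed

lemma pd_sum:
  assumes "\<And>j. j \<in> A \<Longrightarrow> f j \<in> sf k" "i < k" "x \<in> points (rn k)"
  shows "pd i (\<lambda>x. \<Sum>j\<in>A. f j x) x = (\<Sum>j\<in>A. pd i (f j) x)"
  by (rule pd_eqI, rule DERIV_sum) (rule pd_has_derivative[OF assms(1) assms(2,3)])

text \<open>The chain rule for inner maps that translate a single coordinate \<open>m\<close> at
  unit speed when coordinate \<open>i\<close> of the argument moves. Shifts, concatenations,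
  permutations of variables and cubes with edges along the axes are all of this kind.\<close>

lemma pd_chain1:
  assumes f: "f \<in> sf k" and m: "m < k" and y: "A y \<in> points (rn k)"
    and A: "\<And>t. A (y(i := t)) = (A y)(m := A y m + (t - y i))"
  shows "pd i (\<lambda>y. f (A y)) y = pd m f (A y)"
proof (rule pd_eqI)
  have "((\<lambda>t. f ((A y)(m := A y m + (t - y i)))) has_real_derivative pd m f (A y) * 1) (at (y i))"
    by (rule DERIV_chain2[of "\<lambda>s. f ((A y)(m := s))"])
      (use pd_has_derivative[OF f m y] in \<open>auto intro!: derivative_eq_intros\<close>)
  then show "((\<lambda>t. f (A (y(i := t)))) has_real_derivative pd m f (A y)) (at (y i))"
    by (simp add: A)
qed

lemma pd_hadamard:
  assumes g: "g \<in> sf k" and fg: "\<And>x. x \<in> points (rn k) \<Longrightarrow> f x = f (x(i := 0)) + x i * g x"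
    and i: "i < k" and x: "x \<in> points (rn k)" "x i = 0"
  shows "pd i f x = g x"
proof (rule pd_eqI)
  have "((\<lambda>t. f (x(i := 0)) + t * g (x(i := t))) has_real_derivative 0 + (1 * g (x(i := x i)) + pd i g x * x i)) (at (x i))"
    by (rule DERIV_add[OF DERIV_const DERIV_mult[OF DERIV_ident pd_has_derivative[OF g i x(1)]]])
  moreover have "(\<lambda>t. f (x(i := t))) = (\<lambda>t. f (x(i := 0)) + t * g (x(i := t)))"
  proof
    fix t show "f (x(i := t)) = f (x(i := 0)) + t * g (x(i := t))"
      using fg[OF upd_points[OF x(1) i, of t]] unfolding fun_upd_upd fun_upd_same .
  qed
  moreover have "x(i := 0) = x" using x(2) by auto
  ultimately show "((\<lambda>t. f (x(i := t))) has_real_derivative g x) (at (x i))"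
    using x(2) by simp
qed

text \<open>Expand \<open>f\<close> along \<open>i\<close> with quotient \<open>g\<close>, and
  \<open>g\<close> along \<open>j\<close> with quotient \<open>h\<close>. Both mixed derivatives at
  the origin are \<open>h\<close> at the origin: \<open>pd i f\<close> is \<open>g\<close> on the
  hyperplane of vanishing coordinate \<open>i\<close>, and on the axis \<open>i\<close> the function
  \<open>pd j f\<close> is a constant plus the coordinate times \<open>h\<close>.\<close>

lemma pd_commute_0:
  assumes f: "f \<in> sf k" and i: "i < k" and j: "j < k"
  shows "pd i (pd j f) (\<lambda>_. 0) = pd j (pd i f) (\<lambda>_. 0)"
proof (cases "i = j")
  case False
  obtain g where g: "g \<in> sf k" "\<And>x. x \<in> points (rn k) \<Longrightarrow> f x = f (x(i := 0)) + x i * g x"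
    using hadamard[OF f i] by blast
  obtain h where h: "h \<in> sf k" "\<And>x. x \<in> points (rn k) \<Longrightarrow> g x = g (x(j := 0)) + x j * h x"
    using hadamard[OF g(1) j] by blast
  note 0 = zero_points[of k]
  have 1: "pd i f y = g y" if "y \<in> points (rn k)" "y i = 0" for y
    by (rule pd_hadamard[OF g i that])
  have "pd j (pd i f) (\<lambda>_. 0) = pd j g (\<lambda>_. 0)"
    unfolding pd_def[of j] using 1 False 0 j by (simp add: upd_points)
  also have "\<dots> = h (\<lambda>_. 0)"
    by (rule pd_hadamard[OF h j 0 refl])
  finally have A: "pd j (pd i f) (\<lambda>_. 0) = h (\<lambda>_. 0)" .
  have 2: "pd j f ((\<lambda>_. 0)(i := t)) = pd j f (\<lambda>_. 0) + t * h ((\<lambda>_. 0)(i := t))" for t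
  proof (rule pd_eqI)
    let ?y = "(\<lambda>_. 0)(i := t) :: nat \<Rightarrow> real"
    have y: "?y \<in> points (rn k)" "?y j = 0" using 0 i False by (auto simp: upd_points)
    have yy: "?y(j := s) = ((\<lambda>_. 0)(j := s))(i := t)" for s using False by auto
    have e: "f (?y(j := s)) = f ((\<lambda>_. 0)(j := s)) + t * g (?y(j := s))" for s
    proof -
      have z: "((\<lambda>_. 0)(j := s))(i := 0) = (\<lambda>_. 0::real)(j := s)" using False by auto
      show ?thesis
        using g(2)[OF upd_points[OF y(1) j, of s]] False unfolding yy fun_upd_upd z by simp
    qed
    have "((\<lambda>s. f ((\<lambda>_. 0)(j := s)) + t * g (?y(j := s))) has_real_derivative pd j f (\<lambda>_. 0) + t * pd j g ?y) (at 0)"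
      using pd_has_derivative[OF f j 0] pd_has_derivative[OF g(1) j y(1)] y(2)
      by (intro DERIV_add DERIV_cmult) simp_all
    moreover have "pd j g ?y = h ?y"
      by (rule pd_hadamard[OF h j y])
    ultimately show "((\<lambda>s. f (?y(j := s))) has_real_derivative pd j f (\<lambda>_. 0) + t * h ?y) (at (?y j))"
      unfolding y(2) e by simp
  qed
  have "pd i (pd j f) (\<lambda>_. 0) = h (\<lambda>_. 0)"
  proof (rule pd_eqI)
    have "((\<lambda>t. pd j f (\<lambda>_. 0) + t * h ((\<lambda>_. 0)(i := t))) has_real_derivative
        0 + (1 * h ((\<lambda>_. 0)(i := 0)) + pd i h (\<lambda>_. 0) * 0)) (at 0)"
      using pd_has_derivative[OF h(1) i 0] by (rule DERIV_add[OF DERIV_const DERIV_mult[OF DERIV_ident]])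
    moreover have "(\<lambda>_. 0)(i := 0) = (\<lambda>_. 0::real)" by auto
    ultimately show "((\<lambda>t. pd j f ((\<lambda>_. 0)(i := t))) has_real_derivative h (\<lambda>_. 0)) (at 0)"
      unfolding 2 by simp
  qed
  with A show ?thesis by simp
qed simp

lemma add_points: "x \<in> points (rn k) \<Longrightarrow> y \<in> points (rn k) \<Longrightarrow> (\<lambda>l. y l + x l) \<in> points (rn k)"
  by (simp add: points_rn)

lemma sf_shift: "f \<in> sf k \<Longrightarrow> x \<in> points (rn k) \<Longrightarrow> (\<lambda>y. f (\<lambda>l. y l + x l)) \<in> sf k"
  by (rule sf_compose) (auto intro: add_points sf_intros)

lemma pd_shift:
  assumes "f \<in> sf k" "x \<in> points (rn k)" "y \<in> points (rn k)" "i < k"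
  shows "pd i (\<lambda>y. f (\<lambda>l. y l + x l)) y = pd i f (\<lambda>l. y l + x l)"
  by (rule pd_chain1[where A = "\<lambda>y l. y l + x l", OF assms(1,4) add_points[OF assms(2,3)]]) auto

lemma pd_commute:
  assumes f: "f \<in> sf k" and i: "i < k" and j: "j < k" and x: "x \<in> points (rn k)"
  shows "pd i (pd j f) x = pd j (pd i f) x"
proof -
  let ?g = "\<lambda>y. f (\<lambda>l. y l + x l)"
  have "pd i (pd j ?g) (\<lambda>_. 0) = pd i (pd j f) x" if i: "i < k" and j: "j < k" for i j
  proof -
    have "pd i (pd j ?g) (\<lambda>_. 0) = pd i (\<lambda>y. pd j f (\<lambda>l. y l + x l)) (\<lambda>_. 0)"
      by (rule pd_cong[OF pd_shift[OF f x _ j] i zero_points])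
    also have "\<dots> = pd i (pd j f) (\<lambda>l. 0 + x l)"
      by (rule pd_shift[OF pd_sf[OF f j] x zero_points i])
    finally show ?thesis by simp
  qed
  from this[OF i j] this[OF j i] pd_commute_0[OF sf_shift[OF f x] i j] show ?thesis by simp
qed

section \<open>Iterated partial derivatives\<close>

text \<open>The head of the list is the derivative that is taken last.\<close>

primrec pds :: "nat list \<Rightarrow> ((nat \<Rightarrow> real) \<Rightarrow> real) \<Rightarrow> (nat \<Rightarrow> real) \<Rightarrow> real" where
  "pds [] f = f"
| "pds (i # L) f = pd i (pds L f)"

lemma pds_sf: "f \<in> sf k \<Longrightarrow> set L \<subseteq> {..<k} \<Longrightarrow> pds L f \<in> sf k"
  by (induction L) (auto intro: pd_sf)

lemma pds_append: "pds (L @ L') f = pds L (pds L' f)"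
  by (induction L) auto

lemma pds_cong:
  assumes "\<And>x. x \<in> points (rn k) \<Longrightarrow> f x = g x" "set L \<subseteq> {..<k}" "x \<in> points (rn k)"
  shows "pds L f x = pds L g x"
  using assms(2,3)
proof (induction L arbitrary: x)
  case (Cons i L)
  then show ?case using pd_cong[of k "pds L f" "pds L g" i x] by auto
qed (use assms(1) in auto)

lemma pds_swap:
  assumes "f \<in> sf k" "set L \<subseteq> {..<k}" "set L' \<subseteq> {..<k}" "i < k" "j < k" "x \<in> points (rn k)"
  shows "pds (L @ i # j # L') f x = pds (L @ j # i # L') f x"
  unfolding pds_append
  by (rule pds_cong[OF _ assms(2,6)]) (simp add: pd_commute[OF pds_sf[OF assms(1,3)] assms(4,5)])

lemma pds_move:
  assumes "f \<in> sf k" "set L \<subseteq> {..<k}" "set L' \<subseteq> {..<k}" "i < k" "x \<in> points (rn k)"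
  shows "pds (L @ i # L') f x = pds (i # L @ L') f x"
  using assms(2,5)
proof (induction L arbitrary: x)
  case (Cons j L)
  then have "pds ((j # L) @ i # L') f x = pd j (pds (i # L @ L') f) x"
    using assms by (auto intro!: pd_cong[of k])
  also have "\<dots> = pds (i # (j # L) @ L') f x"
    using pds_swap[of f k "[]" "L @ L'" j i x] assms Cons.prems by simp
  finally show ?case .
qed simp

lemma pds_perm:
  assumes "f \<in> sf k" "mset L = mset L'" "set L \<subseteq> {..<k}" "x \<in> points (rn k)"
  shows "pds L f x = pds L' f x"
  using assms(2-4)
proof (induction L arbitrary: L' x)
  case (Cons i L)
  then have "i \<in> set L'" by (metis list.set_intros(1) set_mset_mset)
  then obtain A B where L': "L' = A @ i # B" by (meson split_list)
  with Cons.prems have m: "mset L = mset (A @ B)" by simp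
  have s: "set L' \<subseteq> {..<k}" using Cons.prems(1,2) by (metis set_mset_mset)
  have "pds (i # L) f x = pd i (pds (A @ B) f) x"
    using Cons m by (auto intro!: pd_cong[of k])
  also have "\<dots> = pds L' f x"
    using pds_move[of f k A B i x] assms(1) s Cons.prems unfolding L' by simp
  finally show ?case .
qed simp

lemma pds_add:
  assumes "f \<in> sf k" "g \<in> sf k" "set L \<subseteq> {..<k}" "x \<in> points (rn k)"
  shows "pds L (\<lambda>x. f x + g x) x = pds L f x + pds L g x"
  using assms(3,4)
proof (induction L arbitrary: x)
  case (Cons i L)
  have "pds (i # L) (\<lambda>x. f x + g x) x = pd i (\<lambda>x. pds L f x + pds L g x) x"
    unfolding pds.simps by (rule pd_cong[of k]) (use Cons in auto)
  also have "\<dots> = pds (i # L) f x + pds (i # L) g x"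
    unfolding pds.simps by (rule pd_add) (use Cons.prems assms in \<open>auto intro: pds_sf\<close>)
  finally show ?case .
qed simp

lemma pds_diff:
  assumes "f \<in> sf k" "g \<in> sf k" "set L \<subseteq> {..<k}" "x \<in> points (rn k)"
  shows "pds L (\<lambda>x. f x - g x) x = pds L f x - pds L g x"
  using assms(3,4)
proof (induction L arbitrary: x)
  case (Cons i L)
  have "pds (i # L) (\<lambda>x. f x - g x) x = pd i (\<lambda>x. pds L f x - pds L g x) x"
    unfolding pds.simps by (rule pd_cong[of k]) (use Cons in auto)
  also have "\<dots> = pds (i # L) f x - pds (i # L) g x"
    unfolding pds.simps by (rule pd_diff) (use Cons.prems assms in \<open>auto intro: pds_sf\<close>)
  finally show ?case .
qed simp

lemma pds_const: "pds L (\<lambda>x. c) = (\<lambda>x. if L = [] then c else 0)"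
proof (induction L)
  case (Cons i L)
  then show ?case by (cases "L = []") (auto simp: pd_const)
qed simp

lemma pds_sum:
  assumes "\<And>j. j \<in> A \<Longrightarrow> f j \<in> sf k" "set L \<subseteq> {..<k}" "x \<in> points (rn k)"
  shows "pds L (\<lambda>x. \<Sum>j\<in>A. f j x) x = (\<Sum>j\<in>A. pds L (f j) x)"
  using assms(1)
proof (induction A rule: infinite_finite_induct)
  case (insert a A)
  then have "pds L (\<lambda>x. f a x + (\<Sum>j\<in>A. f j x)) x = pds L (f a) x + pds L (\<lambda>x. \<Sum>j\<in>A. f j x) x"
    by (intro pds_add[OF _ _ assms(2,3)] sf_sum) auto
  with insert show ?case by simp
qed (auto simp: pds_const)

section \<open>Smooth homogeneous functions\<close>

lemma smooth_const_off_0: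
  assumes "smooth g" "\<And>t. t \<noteq> 0 \<Longrightarrow> g t = c" shows "g 0 = c"
proof -
  have "(g \<longlongrightarrow> g 0) (at 0)"
    using smooth_continuous[OF assms(1), of UNIV] by (simp add: continuous_on_def)
  moreover have "(g \<longlongrightarrow> c) (at 0)"
    by (rule Lim_transform_eventually[OF tendsto_const]) (auto simp: eventually_at assms(2) intro!: exI[of _ 1])
  ultimately show ?thesis by (rule LIM_unique)
qed

lemma scale_curve: "v \<in> points (rn p) \<Longrightarrow> (\<lambda>t i. t * v i) \<in> curves (rn p)"
  by (auto simp: curves_rn points_rn intro: smooth_intros)

text \<open>Hadamard's lemma gives \<open>f v = f (v(i := 0)) + v i * g v\<close>. Scaling
  \<open>v\<close> by t and dividing by t shows that v i * g (t v) is the same for all t different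
  from 0, and by continuity it equals v i * g 0. So the coordinates can be split off one by one with
  constant coefficients.\<close>

lemma homogeneous_linear:
  assumes f: "f \<in> sf p" and h: "\<And>v t. v \<in> points (rn p) \<Longrightarrow> f (\<lambda>i. t * v i) = t * f v"
    and v: "v \<in> points (rn p)"
  shows "f v = (\<Sum>k<p. v k * f (\<lambda>i. if i = k then 1 else 0))"
proof -
  have "\<exists>G. \<forall>v\<in>points (rn p). f v = f (v(i := 0)) + v i * G" if i: "i < p" for i
  proof -
    obtain g where g: "g \<in> sf p" "\<And>x. x \<in> points (rn p) \<Longrightarrow> f x = f (x(i := 0)) + x i * g x"
      using hadamard[OF f i] by blast
    have "f v = f (v(i := 0)) + v i * g (\<lambda>_. 0)" if v: "v \<in> points (rn p)" for v
    proof -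
      have "f v = f (v(i := 0)) + v i * g (\<lambda>l. t * v l)" if t: "t \<noteq> 0" for t
      proof -
        have "(\<lambda>l. t * v l)(i := 0) = (\<lambda>l. t * (v(i := 0)) l)" by auto
        then have "t * f v = t * f (v(i := 0)) + t * v i * g (\<lambda>l. t * v l)"
          using g(2)[of "\<lambda>l. t * v l"] h[OF v] h[OF upd_points[OF v i], of t 0] v
          by (simp add: points_rn)
        then have "t * f v = t * (f (v(i := 0)) + v i * g (\<lambda>l. t * v l))" by (simp add: algebra_simps)
        then show ?thesis using t by simp
      qed
      then have "f (v(i := 0)) + v i * g (\<lambda>l. 0 * v l) = f v"
        by (intro smooth_const_off_0[of "\<lambda>t. f (v(i := 0)) + v i * g (\<lambda>l. t * v l)"])
          (auto intro!: smooth_add smooth_mult smooth_const sfD[OF g(1) scale_curve[OF v]])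
      then show ?thesis by simp
    qed
    then show ?thesis by blast
  qed
  then obtain G where G: "\<And>i v. i < p \<Longrightarrow> v \<in> points (rn p) \<Longrightarrow> f v = f (v(i := 0)) + v i * G i"
    by metis
  have lin: "f v = f (\<lambda>i. if i < m then 0 else v i) + (\<Sum>k<m. v k * G k)"
    if v: "v \<in> points (rn p)" and "m \<le> p" for v m
    using that(2)
  proof (induction m)
    case (Suc m)
    let ?w = "\<lambda>i. if i < m then 0 else v i"
    have "?w \<in> points (rn p)" using v by (simp add: points_rn)
    from G[OF _ this, of m] have "f ?w = f (?w(m := 0)) + v m * G m" using Suc by simp
    moreover have "?w(m := 0) = (\<lambda>i. if i < Suc m then 0 else v i)" by (auto simp: less_Suc_eq)
    ultimately show ?case using Suc by simp
  qed simp
  have z: "f (\<lambda>_. 0) = 0" using h[OF zero_points, of 0] by simp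
  have lin': "f v = (\<Sum>k<p. v k * G k)" if v: "v \<in> points (rn p)" for v
  proof -
    have "(\<lambda>i. if i < p then 0 else v i) = (\<lambda>_. 0)" using v by (auto simp: points_rn)
    with lin[OF v order_refl] z show ?thesis by simp
  qed
  have "f (\<lambda>i. if i = k then 1 else 0) = G k" if "k < p" for k
  proof -
    have "(\<lambda>i. if i = k then 1 else 0) \<in> points (rn p)" using that by (simp add: points_rn)
    from lin'[OF this] show ?thesis using that by (simp add: if_distrib[of "\<lambda>x. x * _"] sum.delta cong: if_cong)
  qed
  then show ?thesis using lin'[OF v] by simp
qed

subsection \<open>Ideals of infinitesimals\<close>

abbreviation weil_ideal :: "nat list \<Rightarrow> ((nat \<Rightarrow> real) \<Rightarrow> real) set" where
  "weil_ideal ms \<equiv> snd (weil ms)"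

lemma fst_weil: "fst (weil ms) = length ms"
  by (simp add: weil_def)

text \<open>Turns combinations over a finite set of generating functions into combinations over the
  indices of the variables, with one coefficient for each.\<close>

lemma weil_ideal_iff:
  "f \<in> weil_ideal ms \<longleftrightarrow> (\<exists>a. (\<forall>i<length ms. a i \<in> sf (length ms)) \<and>
    (\<forall>x\<in>points (rn (length ms)). f x = (\<Sum>i<length ms. a i x * x i ^ (ms ! i + 1))))"
proof -
  let ?n = "length ms" and ?g = "\<lambda>i (x::nat \<Rightarrow> real). x i ^ (ms ! i + 1)"
  have inj: "inj_on ?g A" for A
  proof (rule inj_onI)
    fix i j assume "?g i = ?g j"
    \<comment> \<open>At the i-th unit vector the generator of index i is 1 and every other one is
      0, so a generator determines its index.\<close>
    from fun_cong[OF this, of "\<lambda>l. if l = i then 1 else 0"] show "i = j" by (simp split: if_splits)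
  qed
  show ?thesis
  proof
    assume "f \<in> weil_ideal ms"
    then obtain S a where S: "finite S" "S \<subseteq> {?g i | i. i < ?n}" "\<forall>g\<in>S. a g \<in> sf ?n"
      "\<forall>x\<in>points (rn ?n). f x = (\<Sum>g\<in>S. a g x * g x)"
      by (auto simp: weil_def ideal_generated_def)
    define I where "I = {i. i < ?n \<and> ?g i \<in> S}"
    have SI: "S = ?g ` I" using S(2) by (auto simp: I_def)
    define b where "b i = (if i \<in> I then a (?g i) else (\<lambda>_. 0))" for i
    have "\<forall>i<?n. b i \<in> sf ?n" using S(3) by (auto simp: b_def I_def sf_const)
    moreover have "f x = (\<Sum>i<?n. b i x * ?g i x)" if "x \<in> points (rn ?n)" for x
    proof -
      have "f x = (\<Sum>g\<in>?g ` I. a g x * g x)"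
        using S(4) that unfolding SI by blast
      also have "\<dots> = (\<Sum>i\<in>I. a (?g i) x * ?g i x)"
        by (subst sum.reindex[OF inj]) (simp only: o_def)
      also have "\<dots> = (\<Sum>i<?n. b i x * ?g i x)"
        by (rule sum.mono_neutral_cong_left) (auto simp: I_def b_def)
      finally show ?thesis .
    qed
    ultimately show "\<exists>a. (\<forall>i<?n. a i \<in> sf ?n) \<and> (\<forall>x\<in>points (rn ?n). f x = (\<Sum>i<?n. a i x * ?g i x))"
      by blast
  next
    assume "\<exists>a. (\<forall>i<?n. a i \<in> sf ?n) \<and> (\<forall>x\<in>points (rn ?n). f x = (\<Sum>i<?n. a i x * ?g i x))"
    then obtain a where a: "\<forall>i<?n. a i \<in> sf ?n" "\<forall>x\<in>points (rn ?n). f x = (\<Sum>i<?n. a i x * ?g i x)"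
      by blast
    define b where "b = (\<lambda>g. a (the_inv_into {..<?n} ?g g))"
    have b: "b (?g i) = a i" if "i < ?n" for i
      using the_inv_into_f_f[OF inj, of i "{..<?n}"] that by (simp add: b_def)
    have "\<forall>g\<in>?g ` {..<?n}. b g \<in> sf ?n" using a b by auto
    moreover have "\<forall>x\<in>points (rn ?n). f x = (\<Sum>g\<in>?g ` {..<?n}. b g x * g x)"
      using a(2) b by (subst sum.reindex[OF inj]) (simp del: power_Suc add: o_def)
    ultimately have "f \<in> ideal_generated ?n {?g i | i. i < ?n}"
      unfolding ideal_generated_def by (intro CollectI exI[of _ "?g ` {..<?n}"] exI[of _ b]) auto
    then show "f \<in> weil_ideal ms" by (simp add: weil_def)
  qed
qed

lemma weil_ideal_0: "(\<lambda>x. 0) \<in> weil_ideal ms"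
  by (simp add: weil_def ideal_generated_0)

lemma weil_ideal_add: "f \<in> weil_ideal ms \<Longrightarrow> g \<in> weil_ideal ms \<Longrightarrow> (\<lambda>x. f x + g x) \<in> weil_ideal ms"
  by (simp add: weil_def ideal_generated_add)

lemma weil_ideal_minus: "f \<in> weil_ideal ms \<Longrightarrow> (\<lambda>x. - f x) \<in> weil_ideal ms"
  by (simp add: weil_def ideal_generated_minus)

lemma weil_ideal_sum: "(\<And>i. i \<in> A \<Longrightarrow> f i \<in> weil_ideal ms) \<Longrightarrow> (\<lambda>x. \<Sum>i\<in>A. f i x) \<in> weil_ideal ms"
  by (induction A rule: infinite_finite_induct) (auto simp: weil_ideal_0 weil_ideal_add)

lemma weil_ideal_cong: "f \<in> weil_ideal ms \<Longrightarrow> (\<And>x. x \<in> points (rn (length ms)) \<Longrightarrow> f x = g x) \<Longrightarrow> g \<in> weil_ideal ms"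
  unfolding weil_ideal_iff by simp

lemma weil_ideal_mult:
  assumes "f \<in> weil_ideal ms" "h \<in> sf (length ms)"
  shows "(\<lambda>x. h x * f x) \<in> weil_ideal ms"
proof -
  obtain a where a: "\<forall>i<length ms. a i \<in> sf (length ms)"
    "\<forall>x\<in>points (rn (length ms)). f x = (\<Sum>i<length ms. a i x * x i ^ (ms ! i + 1))"
    using assms(1) weil_ideal_iff by blast
  show ?thesis unfolding weil_ideal_iff
    by (rule exI[of _ "\<lambda>i x. h x * a i x"]) (use a assms(2) in \<open>auto simp: sf_mult sum_distrib_left mult.assoc\<close>)
qed

lemma weil_ideal_gen: "i < length ms \<Longrightarrow> (\<lambda>x. x i ^ (ms ! i + 1)) \<in> weil_ideal ms"
  unfolding weil_ideal_iff
  by (rule exI[of _ "\<lambda>j x. if j = i then 1 else 0"])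
    (auto simp: if_distrib[of "\<lambda>x. x * _"] sum.delta sf_const cong: if_cong)

lemma weil_ideal_at_0: "f \<in> weil_ideal ms \<Longrightarrow> f (\<lambda>_. 0) = 0"
  unfolding weil_ideal_iff using zero_points by fastforce

text \<open>\<open>ms'\<close> is the source and \<open>ms\<close> the target. The last clause says
  that pulling back along \<open>u\<close> sends the generators of the target's ideal into the ideal
  of the source.\<close>

definition inf_map :: "nat list \<Rightarrow> nat list \<Rightarrow> ((nat \<Rightarrow> real) \<Rightarrow> (nat \<Rightarrow> real)) \<Rightarrow> bool" where
  "inf_map ms' ms u \<longleftrightarrow> (\<forall>x\<in>points (rn (length ms')). u x \<in> points (rn (length ms))) \<and>
     (\<forall>i. (\<lambda>x. u x i) \<in> sf (length ms')) \<and>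
     (\<forall>i<length ms. (\<lambda>x. u x i ^ (ms ! i + 1)) \<in> weil_ideal ms')"

lemma weil_ideal_pull:
  assumes "f \<in> weil_ideal ms" "inf_map ms' ms u"
  shows "(\<lambda>x. f (u x)) \<in> weil_ideal ms'"
proof -
  obtain a where a: "\<forall>i<length ms. a i \<in> sf (length ms)"
    "\<forall>x\<in>points (rn (length ms)). f x = (\<Sum>i<length ms. a i x * x i ^ (ms ! i + 1))"
    using assms(1) weil_ideal_iff by blast
  have u: "\<And>x. x \<in> points (rn (length ms')) \<Longrightarrow> u x \<in> points (rn (length ms))"
    "\<And>i. (\<lambda>x. u x i) \<in> sf (length ms')"
    "\<And>i. i < length ms \<Longrightarrow> (\<lambda>x. u x i ^ (ms ! i + 1)) \<in> weil_ideal ms'"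
    using assms(2) by (auto simp: inf_map_def)
  have "(\<lambda>x. a i (u x) * u x i ^ (ms ! i + 1)) \<in> weil_ideal ms'" if "i < length ms" for i
    using weil_ideal_mult[OF u(3)[OF that] sf_compose[OF a(1)[rule_format, OF that] u(1,2)]] by simp
  then have "(\<lambda>x. \<Sum>i<length ms. a i (u x) * u x i ^ (ms ! i + 1)) \<in> weil_ideal ms'"
    by (intro weil_ideal_sum) auto
  then show ?thesis by (rule weil_ideal_cong) (use a(2) u(1) in auto)
qed

lemma inf_map_smooth_map:
  assumes "inf_map ms' ms u" shows "u \<in> smooth_maps (rn (length ms')) (rn (length ms))"
  using assms unfolding inf_map_def smooth_maps_def
  by (auto simp: curves_rn[of _ "length ms"] curves_rn[of _ "length ms'"] intro!: sfD[of "\<lambda>x. u x i" for i])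

subsection \<open>Normal forms modulo squares\<close>

text \<open>Descending, because \<open>normal_form\<close> treats the variables in increasing order
  and puts each new derivative in front of the earlier ones.\<close>

definition desc_list :: "nat \<Rightarrow> nat set \<Rightarrow> nat list" where
  "desc_list n S = rev (filter (\<lambda>i. i \<in> S) [0..<n])"

lemma set_desc_list: "S \<subseteq> {..<n} \<Longrightarrow> set (desc_list n S) = S"
  by (auto simp: desc_list_def)

lemma distinct_desc_list: "distinct (desc_list n S)"
  by (simp add: desc_list_def)

lemma desc_list_Suc: "desc_list (Suc n) S = (if n \<in> S then n # desc_list n S else desc_list n S)"
  by (simp add: desc_list_def)

lemma desc_list_insert: "n \<notin> S \<Longrightarrow> desc_list n (insert n S) = desc_list n S"
  unfolding desc_list_def by (auto intro!: arg_cong[of _ _ rev] filter_cong)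

definition cutoff :: "nat \<Rightarrow> (nat \<Rightarrow> real) \<Rightarrow> (nat \<Rightarrow> real)" where
  "cutoff n x = (\<lambda>i. if i < n then 0 else x i)"

lemma cutoff_points: "x \<in> points (rn N) \<Longrightarrow> cutoff n x \<in> points (rn N)"
  by (simp add: points_rn cutoff_def)

lemma sf_coord_if: "(\<lambda>x. if P then 0 else x i) \<in> sf k"
  by (cases P) (auto intro: sf_intros)

lemma sf_cutoff: "f \<in> sf N \<Longrightarrow> (\<lambda>x. f (cutoff n x)) \<in> sf N"
  by (rule sf_compose) (auto simp: cutoff_points, simp add: cutoff_def sf_coord_if)

lemma taylor_square:
  assumes f: "f \<in> sf N" and n: "n < N"
  obtains h where "h \<in> sf N"
    "\<And>x. x \<in> points (rn N) \<Longrightarrow> f x = f (x(n := 0)) + x n * pd n f (x(n := 0)) + h x * (x n)\<^sup>2"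
proof -
  obtain g where g: "g \<in> sf N" "\<And>x. x \<in> points (rn N) \<Longrightarrow> f x = f (x(n := 0)) + x n * g x"
    using hadamard[OF f n] by blast
  obtain h where h: "h \<in> sf N" "\<And>x. x \<in> points (rn N) \<Longrightarrow> g x = g (x(n := 0)) + x n * h x"
    using hadamard[OF g(1) n] by blast
  have "f x = f (x(n := 0)) + x n * pd n f (x(n := 0)) + h x * (x n)\<^sup>2" if x: "x \<in> points (rn N)" for x
  proof -
    have "pd n f (x(n := 0)) = g (x(n := 0))"
      by (rule pd_hadamard[OF g n upd_points[OF x n] fun_upd_same])
    with g(2)[OF x] h(2)[OF x] show ?thesis by (simp add: power2_eq_square algebra_simps)
  qed
  with h(1) that show ?thesis by blast
qed

text \<open>Treating one variable after the other by \<open>taylor_square\<close> leaves the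
  square-free monomials, which are indexed by sets of variables, and multiples of squares. Through
  \<open>cutoff\<close> the coefficients still depend on the variables that have not been treated;
  this makes the lemma usable for currying.\<close>

lemma normal_form:
  assumes f: "f \<in> sf N" and n: "n \<le> N"
  shows "\<exists>a. (\<forall>i<n. a i \<in> sf N) \<and> (\<forall>x\<in>points (rn N).
    f x = (\<Sum>S\<in>Pow {..<n}. (\<Prod>i\<in>S. x i) * pds (desc_list n S) f (cutoff n x)) + (\<Sum>i<n. a i x * (x i)\<^sup>2))"
  using n
proof (induction n)
  case 0
  have "cutoff 0 x = x" for x by (simp add: cutoff_def)
  then show ?case by (simp add: desc_list_def)
next
  case (Suc n)
  then obtain a where a: "\<forall>i<n. a i \<in> sf N" "\<And>x. x \<in> points (rn N) \<Longrightarrow>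
    f x = (\<Sum>S\<in>Pow {..<n}. (\<Prod>i\<in>S. x i) * pds (desc_list n S) f (cutoff n x)) + (\<Sum>i<n. a i x * (x i)\<^sup>2)"
    by auto
  have n: "n < N" using Suc.prems by simp
  have P: "pds (desc_list n S) f \<in> sf N" if "S \<subseteq> {..<n}" for S
    using that n by (intro pds_sf f) (auto simp: set_desc_list)
  have "\<forall>S\<in>Pow {..<n}. \<exists>h. h \<in> sf N \<and> (\<forall>x\<in>points (rn N). pds (desc_list n S) f (cutoff n x) =
      pds (desc_list n S) f (cutoff (Suc n) x) + x n * pds (n # desc_list n S) f (cutoff (Suc n) x) + h x * (x n)\<^sup>2)"
  proof
    fix S assume S: "S \<in> Pow {..<n}"
    then have "pds (desc_list n S) f \<in> sf N" using P by blast
    from taylor_square[OF this n] obtain h where h: "h \<in> sf N"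
      "\<And>x. x \<in> points (rn N) \<Longrightarrow> pds (desc_list n S) f x = pds (desc_list n S) f (x(n := 0)) +
          x n * pd n (pds (desc_list n S) f) (x(n := 0)) + h x * (x n)\<^sup>2" by blast
    have "(cutoff n x)(n := 0) = cutoff (Suc n) x" "cutoff n x n = x n" for x
      by (auto simp: cutoff_def fun_eq_iff)
    then show "\<exists>h. h \<in> sf N \<and> (\<forall>x\<in>points (rn N). pds (desc_list n S) f (cutoff n x) =
      pds (desc_list n S) f (cutoff (Suc n) x) + x n * pds (n # desc_list n S) f (cutoff (Suc n) x) + h x * (x n)\<^sup>2)"
      using h(2)[OF cutoff_points] by (intro exI[of _ "\<lambda>x. h (cutoff n x)"] conjI sf_cutoff h(1)) simp
  qed
  then obtain h where h: "\<And>S. S \<subseteq> {..<n} \<Longrightarrow> h S \<in> sf N"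
    "\<And>S x. S \<subseteq> {..<n} \<Longrightarrow> x \<in> points (rn N) \<Longrightarrow> pds (desc_list n S) f (cutoff n x) =
      pds (desc_list n S) f (cutoff (Suc n) x) + x n * pds (n # desc_list n S) f (cutoff (Suc n) x) + h S x * (x n)\<^sup>2"
    by (auto dest!: bchoice)
  let ?p = "\<lambda>S x. \<Prod>i\<in>S. x i :: real"
  \<comment> \<open>The quadratic remainders of all coefficients together form the new coefficient
    of the square of variable \<open>n\<close>.\<close>
  define b where "b = a(n := \<lambda>x. \<Sum>S\<in>Pow {..<n}. ?p S x * h S x)"
  have "b i \<in> sf N" if "i < Suc n" for i
  proof (cases "i = n")
    case True
    have "(\<lambda>x. \<Sum>S\<in>Pow {..<n}. ?p S x * h S x) \<in> sf N"
      using h(1) by (intro sf_sum sf_mult sf_prod sf_coord) auto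
    with True show ?thesis by (simp add: b_def)
  qed (use a that in \<open>auto simp: b_def\<close>)
  moreover have "f x = (\<Sum>S\<in>Pow {..<Suc n}. ?p S x * pds (desc_list (Suc n) S) f (cutoff (Suc n) x)) + (\<Sum>i<Suc n. b i x * (x i)\<^sup>2)"
    if x: "x \<in> points (rn N)" for x
  proof -
    let ?c = "cutoff (Suc n) x"
    \<comment> \<open>In the expansion of each coefficient in variable \<open>n\<close>, the value
      belongs to the sets without \<open>n\<close> and the derivative to those with
      \<open>n\<close>.\<close>
    have pow: "Pow {..<Suc n} = Pow {..<n} \<union> insert n ` Pow {..<n}"
      by (simp add: lessThan_Suc Pow_insert)
    have inj: "inj_on (insert n) (Pow {..<n})"
      by (rule inj_onI) (auto simp: insert_ident dest: subsetD)
    have disj: "Pow {..<n} \<inter> insert n ` Pow {..<n} = {}" by auto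
    have "(\<Sum>S\<in>Pow {..<Suc n}. ?p S x * pds (desc_list (Suc n) S) f ?c) =
        (\<Sum>S\<in>Pow {..<n}. ?p S x * pds (desc_list (Suc n) S) f ?c) +
        (\<Sum>S\<in>Pow {..<n}. ?p (insert n S) x * pds (desc_list (Suc n) (insert n S)) f ?c)"
      unfolding pow by (subst sum.union_disjoint) (auto simp: sum.reindex[OF inj] disj)
    also have "(\<Sum>S\<in>Pow {..<n}. ?p S x * pds (desc_list (Suc n) S) f ?c) = (\<Sum>S\<in>Pow {..<n}. ?p S x * pds (desc_list n S) f ?c)"
      by (rule sum.cong) (auto simp: desc_list_Suc)
    also have "(\<Sum>S\<in>Pow {..<n}. ?p (insert n S) x * pds (desc_list (Suc n) (insert n S)) f ?c) =
        (\<Sum>S\<in>Pow {..<n}. ?p S x * (x n * pds (n # desc_list n S) f ?c))"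
    proof (rule sum.cong)
      fix S assume "S \<in> Pow {..<n}"
      then have "n \<notin> S" "finite S" by (auto intro: finite_subset)
      then show "?p (insert n S) x * pds (desc_list (Suc n) (insert n S)) f ?c = ?p S x * (x n * pds (n # desc_list n S) f ?c)"
        by (simp add: desc_list_Suc desc_list_insert)
    qed simp
    finally have 1: "(\<Sum>S\<in>Pow {..<Suc n}. ?p S x * pds (desc_list (Suc n) S) f ?c) =
      (\<Sum>S\<in>Pow {..<n}. ?p S x * (pds (desc_list n S) f ?c + x n * pds (n # desc_list n S) f ?c))"
      by (simp add: sum.distrib[symmetric] distrib_left)
    have "(\<Sum>S\<in>Pow {..<n}. ?p S x * pds (desc_list n S) f (cutoff n x)) =
        (\<Sum>S\<in>Pow {..<n}. ?p S x * (pds (desc_list n S) f ?c + x n * pds (n # desc_list n S) f ?c) + (?p S x * h S x) * (x n)\<^sup>2)"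
      by (rule sum.cong) (auto simp: h(2)[OF _ x] algebra_simps)
    also have "\<dots> = (\<Sum>S\<in>Pow {..<n}. ?p S x * (pds (desc_list n S) f ?c + x n * pds (n # desc_list n S) f ?c)) +
        (\<Sum>S\<in>Pow {..<n}. ?p S x * h S x) * (x n)\<^sup>2"
      by (simp add: sum.distrib sum_distrib_right)
    finally have 2: "(\<Sum>S\<in>Pow {..<n}. ?p S x * pds (desc_list n S) f (cutoff n x)) =
       (\<Sum>S\<in>Pow {..<Suc n}. ?p S x * pds (desc_list (Suc n) S) f ?c) + b n x * (x n)\<^sup>2"
      unfolding 1 by (simp add: b_def)
    have "(\<Sum>i<n. a i x * (x i)\<^sup>2) = (\<Sum>i<n. b i x * (x i)\<^sup>2)"
      by (rule sum.cong) (auto simp: b_def)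
    with a(2)[OF x] 2 show ?thesis by simp
  qed
  ultimately show ?case by blast
qed

text \<open>The coefficient of the monomial with variables \<open>S\<close> in the class of
  \<open>f\<close> modulo squares. No variable is repeated, so no factorial occurs.\<close>

definition mixed :: "nat \<Rightarrow> nat set \<Rightarrow> ((nat \<Rightarrow> real) \<Rightarrow> real) \<Rightarrow> real" where
  "mixed n S f = pds (desc_list n S) f (\<lambda>_. 0)"

lemma set_desc_list_subset: "set (desc_list n S) \<subseteq> {..<n}"
  by (auto simp: desc_list_def)

text \<open>Each variable is differentiated at most once. As long as variable \<open>i\<close> has
  not been used, the square remains as a factor; afterwards one factor \<open>x i\<close> is left.
  Both stages are tracked because the induction passes from the one to the other.\<close>

lemma pds_square_multiple:
  assumes a: "a \<in> sf N" and i: "i < N" and f: "\<And>x. x \<in> points (rn N) \<Longrightarrow> f x = a x * (x i)\<^sup>2"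
    and L: "distinct L" "set L \<subseteq> {..<N}"
  shows "(\<exists>b\<in>sf N. \<forall>x\<in>points (rn N). pds L f x = b x * x i) \<and>
    (i \<notin> set L \<longrightarrow> (\<exists>b\<in>sf N. \<forall>x\<in>points (rn N). pds L f x = b x * (x i)\<^sup>2))"
  using L
proof (induction L)
  case Nil
  have "\<forall>x\<in>points (rn N). pds [] f x = (a x * x i) * x i" "\<forall>x\<in>points (rn N). pds [] f x = a x * (x i)\<^sup>2"
    using f by (auto simp: power2_eq_square)
  with a sf_mult[OF a sf_coord[of i]] show ?case
    by (intro conjI impI bexI[of _ "\<lambda>x. a x * x i"] bexI[of _ a])
next
  case (Cons j L)
  then have j: "j < N" and IH: "(\<exists>b\<in>sf N. \<forall>x\<in>points (rn N). pds L f x = b x * x i) \<and>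
    (i \<notin> set L \<longrightarrow> (\<exists>b\<in>sf N. \<forall>x\<in>points (rn N). pds L f x = b x * (x i)\<^sup>2))" by auto
  have sq: "(\<lambda>x. (x i)\<^sup>2) \<in> sf N" by (intro sf_power sf_coord)
  have pc: "pd j (\<lambda>x. (x i)\<^sup>2) x = (if i = j then 2 * x i else 0)" if "x \<in> points (rn N)" for x
    using pd_mult[OF sf_coord[of i] sf_coord[of i] j that] by (simp add: pd_coord power2_eq_square)
  show ?case
  proof (cases "i \<in> set L")
    case True
    then have ij: "i \<noteq> j" using Cons.prems by auto
    obtain b where b: "b \<in> sf N" "\<And>x. x \<in> points (rn N) \<Longrightarrow> pds L f x = b x * x i" using IH by blast
    have "pds (j # L) f x = pd j b x * x i" if x: "x \<in> points (rn N)" for x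
    proof -
      have "pds (j # L) f x = pd j (\<lambda>x. b x * x i) x"
        unfolding pds.simps by (rule pd_cong[OF b(2) j x])
      then show ?thesis using pd_mult[OF b(1) sf_coord[of i] j x] ij by (simp add: pd_coord)
    qed
    then show ?thesis using True pd_sf[OF b(1) j] by auto
  next
    case False
    then obtain b where b: "b \<in> sf N" "\<And>x. x \<in> points (rn N) \<Longrightarrow> pds L f x = b x * (x i)\<^sup>2" using IH by blast
    have e: "pds (j # L) f x = pd j b x * (x i)\<^sup>2 + (if i = j then 2 * x i else 0) * b x" if x: "x \<in> points (rn N)" for x
    proof -
      have "pds (j # L) f x = pd j (\<lambda>x. b x * (x i)\<^sup>2) x"
        unfolding pds.simps by (rule pd_cong[OF b(2) j x])
      then show ?thesis using pd_mult[OF b(1) sq j x] pc[OF x] by simp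
    qed
    have p: "pd j b \<in> sf N" by (rule pd_sf[OF b(1) j])
    have "(\<lambda>x. pd j b x * x i + (if i = j then 2 else 0) * b x) \<in> sf N"
      by (intro sf_add sf_mult p sf_coord sf_const b)
    moreover have "\<forall>x\<in>points (rn N). pds (j # L) f x = (pd j b x * x i + (if i = j then 2 else 0) * b x) * x i"
      using e by (simp add: power2_eq_square algebra_simps)
    ultimately have "\<exists>b\<in>sf N. \<forall>x\<in>points (rn N). pds (j # L) f x = b x * x i"
      by (intro bexI[of _ "\<lambda>x. pd j b x * x i + (if i = j then 2 else 0) * b x"])
    moreover have "\<exists>b\<in>sf N. \<forall>x\<in>points (rn N). pds (j # L) f x = b x * (x i)\<^sup>2" if "i \<noteq> j"
      using e that by (intro bexI[OF _ p]) simp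
    ultimately show ?thesis by auto
  qed
qed

lemma pds_square_multiple_0:
  assumes "a \<in> sf N" "i < N" "distinct L" "set L \<subseteq> {..<N}" "x \<in> points (rn N)" "x i = 0"
  shows "pds L (\<lambda>x. a x * (x i)\<^sup>2) x = 0"
  using pds_square_multiple[OF assms(1,2) refl assms(3,4)] assms(5,6) by auto

lemma cutoff_all: "x \<in> points (rn n) \<Longrightarrow> cutoff n x = (\<lambda>_. 0)"
  by (auto simp: points_rn cutoff_def)

lemma vappend_points: "d \<in> points (rn n) \<Longrightarrow> e \<in> points (rn l) \<Longrightarrow> vappend n d e \<in> points (rn (n + l))"
  by (auto simp: points_rn vappend_def)

lemma pds_vappend:
  assumes f: "f \<in> sf (n + l)" and L: "set L \<subseteq> {..<n}" and d: "d \<in> points (rn n)" and e: "e \<in> points (rn l)"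
  shows "pds L (\<lambda>d. f (vappend n d e)) d = pds L f (vappend n d e)"
  using L d
proof (induction L arbitrary: d)
  case (Cons i L)
  have "pds (i # L) (\<lambda>d. f (vappend n d e)) d = pd i (\<lambda>d. pds L f (vappend n d e)) d"
    unfolding pds.simps by (rule pd_cong[of n]) (use Cons in auto)
  also have "\<dots> = pds (i # L) f (vappend n d e)"
    unfolding pds.simps
    by (rule pd_chain1[where A = "\<lambda>d. vappend n d e", OF pds_sf[OF f] _ vappend_points[OF Cons.prems(2) e]])
      (use Cons.prems(1) in \<open>auto simp: vappend_def\<close>)
  finally show ?case .
qed simp

lemma sf_vappend_left: "f \<in> sf (n + l) \<Longrightarrow> e \<in> points (rn l) \<Longrightarrow> (\<lambda>d. f (vappend n d e)) \<in> sf n"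
proof (rule sf_compose[of f "n + l" n "\<lambda>d. vappend n d e"])
  show "(\<lambda>d. vappend n d e i) \<in> sf n" for i
    by (cases "i < n") (auto simp: vappend_def intro: sf_intros)
qed (auto intro: vappend_points)

lemma sf_vappend_right: "f \<in> sf (n + l) \<Longrightarrow> d \<in> points (rn n) \<Longrightarrow> (\<lambda>e. f (vappend n d e)) \<in> sf l"
proof (rule sf_compose[of f "n + l" l "\<lambda>e. vappend n d e"])
  show "(\<lambda>e. vappend n d e i) \<in> sf l" for i
    by (cases "i < n") (auto simp: vappend_def intro: sf_intros)
qed (auto intro: vappend_points)

lemma sum_lessThan_add:
  fixes g :: "nat \<Rightarrow> 'a::comm_monoid_add"
  shows "(\<Sum>i<n + l. g i) = (\<Sum>i<n. g i) + (\<Sum>j<l. g (n + j))"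
  by (induction l) (simp_all add: add.assoc)

text \<open>Extracting a coefficient in the first \<open>n\<close> variables maps the ideal of the
  product into the ideal of the remaining variables: the squares of the first variables contribute
  nothing by \<open>pds_square_multiple_0\<close>, and the other generators are constants for the
  derivatives along \<open>L\<close>.\<close>

lemma weil_ideal_curry:
  assumes f: "f \<in> weil_ideal (Dobj n @ ns)" and S: "set L \<subseteq> {..<n}" "distinct L"
  shows "(\<lambda>e. pds L f (vappend n (\<lambda>_. 0) e)) \<in> weil_ideal ns"
proof -
  let ?l = "length ns" and ?ms = "Dobj n @ ns"
  obtain a where a: "\<And>i. i < n + ?l \<Longrightarrow> a i \<in> sf (n + ?l)"
    "\<And>x. x \<in> points (rn (n + ?l)) \<Longrightarrow> f x = (\<Sum>i<n + ?l. a i x * x i ^ (?ms ! i + 1))"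
    using f unfolding weil_ideal_iff by (auto simp del: power_Suc)
  have sub: "set L \<subseteq> {..<n + ?l}" using S by auto
  have g: "(\<lambda>x. a i x * x i ^ (?ms ! i + 1)) \<in> sf (n + ?l)" if "i < n + ?l" for i
    by (rule sf_mult[OF a(1)[OF that] sf_power[OF sf_coord]])
  have e: "pds L f (vappend n (\<lambda>_. 0) e) =
      (\<Sum>j<?l. pds L (a (n + j)) (vappend n (\<lambda>_. 0) e) * e j ^ (ns ! j + 1))" if e: "e \<in> points (rn ?l)" for e
  proof -
    let ?x = "vappend n (\<lambda>_. 0) e"
    have x: "?x \<in> points (rn (n + ?l))" by (rule vappend_points[OF zero_points e])
    have "pds L f ?x = pds L (\<lambda>x. \<Sum>i<n + ?l. a i x * x i ^ (?ms ! i + 1)) ?x"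
      by (rule pds_cong[OF a(2) sub x])
    also have "\<dots> = (\<Sum>i<n + ?l. pds L (\<lambda>x. a i x * x i ^ (?ms ! i + 1)) ?x)"
      by (rule pds_sum[OF _ sub x]) (use g in auto)
    also have "\<dots> = (\<Sum>i<n. pds L (\<lambda>x. a i x * x i ^ (?ms ! i + 1)) ?x) +
        (\<Sum>j<?l. pds L (\<lambda>x. a (n + j) x * x (n + j) ^ (?ms ! (n + j) + 1)) ?x)"
      by (rule sum_lessThan_add)
    also have "(\<Sum>i<n. pds L (\<lambda>x. a i x * x i ^ (?ms ! i + 1)) ?x) = 0"
    proof (rule sum.neutral, rule ballI)
      fix i assume "i \<in> {..<n}"
      then have i: "i < n" by simp
      have "pds L (\<lambda>x. a i x * (x i)\<^sup>2) ?x = 0"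
        by (rule pds_square_multiple_0[OF a(1) _ S(2) sub x]) (use i in \<open>auto simp: vappend_def\<close>)
      with i show "pds L (\<lambda>x. a i x * x i ^ (?ms ! i + 1)) ?x = 0"
        by (simp add: nth_append power2_eq_square)
    qed
    also have "(\<Sum>j<?l. pds L (\<lambda>x. a (n + j) x * x (n + j) ^ (?ms ! (n + j) + 1)) ?x) =
        (\<Sum>j<?l. pds L (a (n + j)) ?x * e j ^ (ns ! j + 1))"
    proof (rule sum.cong)
      fix j assume "j \<in> {..<?l}"
      then have j: "n + j < n + ?l" by simp
      define q where "q = ns ! j + 1"
      have "pds L (\<lambda>x. a (n + j) x * x (n + j) ^ q) y = pds L (a (n + j)) y * y (n + j) ^ q"
        if "y \<in> points (rn (n + ?l))" for y
        using S(1) that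
      proof (induction L arbitrary: y)
        case (Cons i L)
        then have i: "i < n + ?l" "i \<noteq> n + j" by auto
        have pw: "pd i (\<lambda>x. x (n + j) ^ q) y = 0"
          by (rule pd_eqI) (use i in simp)
        have "pds (i # L) (\<lambda>x. a (n + j) x * x (n + j) ^ q) y = pd i (\<lambda>y. pds L (a (n + j)) y * y (n + j) ^ q) y"
          unfolding pds.simps by (rule pd_cong[OF _ i(1) Cons.prems(2)]) (use Cons in auto)
        also have "\<dots> = pds (i # L) (a (n + j)) y * y (n + j) ^ q"
          unfolding pds.simps
          by (subst pd_mult[where k = "n + ?l"])
            (use Cons.prems i pw j in \<open>auto intro!: pds_sf a(1) sf_power sf_coord\<close>)
        finally show ?case .
      qed simp
      from this[OF x] show "pds L (\<lambda>x. a (n + j) x * x (n + j) ^ (?ms ! (n + j) + 1)) ?x = pds L (a (n + j)) ?x * e j ^ (ns ! j + 1)"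
        by (simp add: nth_append q_def vappend_def)
    qed simp
    finally show ?thesis by simp
  qed
  show ?thesis
    unfolding weil_ideal_iff
  proof (intro exI[of _ "\<lambda>j e. pds L (a (n + j)) (vappend n (\<lambda>_. 0) e)"] conjI allI impI ballI)
    fix j assume "j < ?l"
    then show "(\<lambda>e. pds L (a (n + j)) (vappend n (\<lambda>_. 0) e)) \<in> sf ?l"
      by (intro sf_vappend_right pds_sf a(1) sub zero_points) simp
  qed (use e in auto)
qed

text \<open>The normal form writes \<open>f\<close> as a combination of its coefficients, which
  depend on the remaining variables only, and of squares. Together with
  \<open>weil_ideal_curry\<close> this is the isomorphism between the Weil algebra of a product and
  the tensor product of the Weil algebras.\<close>

lemma weil_ideal_uncurry:
  assumes f: "f \<in> sf (n + length ns)"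
    and c: "\<And>S. S \<subseteq> {..<n} \<Longrightarrow> (\<lambda>e. pds (desc_list n S) f (vappend n (\<lambda>_. 0) e)) \<in> weil_ideal ns"
  shows "f \<in> weil_ideal (Dobj n @ ns)"
proof -
  let ?l = "length ns" and ?ms = "Dobj n @ ns"
  let ?u = "\<lambda>x i. x (n + i) :: real"
  have len: "length ?ms = n + ?l" by simp
  have u: "inf_map ?ms ns ?u"
    unfolding inf_map_def
  proof (intro conjI allI impI ballI)
    fix i assume "i < ?l"
    then show "(\<lambda>x. x (n + i) ^ (ns ! i + 1)) \<in> weil_ideal ?ms"
      using weil_ideal_gen[of "n + i" ?ms] by (simp add: nth_append)
  qed (auto simp: points_rn sf_coord)
  obtain a where a: "\<forall>i<n. a i \<in> sf (n + ?l)" "\<forall>x\<in>points (rn (n + ?l)).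
    f x = (\<Sum>S\<in>Pow {..<n}. (\<Prod>i\<in>S. x i) * pds (desc_list n S) f (cutoff n x)) + (\<Sum>i<n. a i x * (x i)\<^sup>2)"
    using normal_form[OF f, of n] by auto
  have "(\<lambda>x. (\<Prod>i\<in>S. x i) * pds (desc_list n S) f (vappend n (\<lambda>_. 0) (?u x))) \<in> weil_ideal ?ms" if "S \<in> Pow {..<n}" for S
    using weil_ideal_mult[OF weil_ideal_pull[OF c u]] that by (simp add: sf_prod sf_coord)
  then have 1: "(\<lambda>x. \<Sum>S\<in>Pow {..<n}. (\<Prod>i\<in>S. x i) * pds (desc_list n S) f (vappend n (\<lambda>_. 0) (?u x))) \<in> weil_ideal ?ms"
    by (rule weil_ideal_sum)
  have "(\<lambda>x. a i x * (x i)\<^sup>2) \<in> weil_ideal ?ms" if "i \<in> {..<n}" for i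
    using weil_ideal_mult[OF weil_ideal_gen[of i ?ms]] a(1) that by (simp add: nth_append power2_eq_square)
  then have 2: "(\<lambda>x. \<Sum>i<n. a i x * (x i)\<^sup>2) \<in> weil_ideal ?ms"
    by (rule weil_ideal_sum)
  have cu: "vappend n (\<lambda>_. 0) (?u x) = cutoff n x" for x
    by (auto simp: vappend_def cutoff_def)
  show ?thesis
    by (rule weil_ideal_cong[OF weil_ideal_add[OF 1 2]]) (use a(2) in \<open>auto simp: cu\<close>)
qed

text \<open>The case without remaining variables. The only point of \<open>rn 0\<close> is the
  origin, so membership in the ideal of \<open>weil []\<close> means vanishing there.\<close>

lemma weil_ideal_WD_iff:
  assumes "f \<in> sf n"
  shows "f \<in> weil_ideal (Dobj n) \<longleftrightarrow> (\<forall>S\<subseteq>{..<n}. mixed n S f = 0)"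
proof
  assume "f \<in> weil_ideal (Dobj n)"
  then have "f \<in> weil_ideal (Dobj n @ [])" by simp
  from weil_ideal_curry[OF this set_desc_list_subset distinct_desc_list]
  have "(\<lambda>e. pds (desc_list n S) f (vappend n (\<lambda>_. 0) e)) \<in> weil_ideal []" for S .
  from weil_ideal_at_0[OF this] show "\<forall>S\<subseteq>{..<n}. mixed n S f = 0"
    by (simp add: mixed_def vappend_def)
next
  assume c: "\<forall>S\<subseteq>{..<n}. mixed n S f = 0"
  have "(\<lambda>e. pds (desc_list n S) f (vappend n (\<lambda>_. 0) e)) \<in> weil_ideal []" if "S \<subseteq> {..<n}" for S
  proof (rule weil_ideal_cong[OF weil_ideal_0])
    fix e :: "nat \<Rightarrow> real" assume "e \<in> points (rn (length []))"
    then have "vappend n (\<lambda>_. 0) e = (\<lambda>_. 0)" by (auto simp: points_rn vappend_def)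
    with c that show "0 = pds (desc_list n S) f (vappend n (\<lambda>_. 0) e)" by (simp add: mixed_def)
  qed
  from weil_ideal_uncurry[OF _ this] assms show "f \<in> weil_ideal (Dobj n)" by simp
qed

subsection \<open>Smooth retracts of Euclidean spaces\<close>

text \<open>The coordinates \<open>i\<close> embed \<open>X\<close> into a Euclidean space with axes \<open>I\<close>, and \<open>r\<close> retracts
  that space onto \<open>X\<close>.\<close>

definition coords :: "'a space \<Rightarrow> 'i set \<Rightarrow> ('a \<Rightarrow> 'i \<Rightarrow> real) \<Rightarrow> (('i \<Rightarrow> real) \<Rightarrow> 'a) \<Rightarrow> bool" where
  "coords X I i r \<longleftrightarrow> finite I \<and>
     (\<forall>c\<in>curves X. (\<forall>t. c t \<in> points X) \<and> (\<forall>k\<in>I. smooth (\<lambda>t. i (c t) k))) \<and>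
     (\<forall>C. (\<forall>k\<in>I. smooth (\<lambda>t. C t k)) \<longrightarrow> (\<lambda>t. r (C t)) \<in> curves X) \<and>
     (\<forall>x\<in>points X. r (i x) = x) \<and>
     (\<forall>c c'. (\<forall>k\<in>I. c k = c' k) \<longrightarrow> r c = r c')"

lemma coords_finite: "coords X I i r \<Longrightarrow> finite I"
  by (simp add: coords_def)

lemma coords_curve_points: "coords X I i r \<Longrightarrow> c \<in> curves X \<Longrightarrow> c t \<in> points X"
  by (simp add: coords_def)

lemma coords_curve_smooth: "coords X I i r \<Longrightarrow> c \<in> curves X \<Longrightarrow> k \<in> I \<Longrightarrow> smooth (\<lambda>t. i (c t) k)"
  by (simp add: coords_def)

lemma coords_retract_curve: "coords X I i r \<Longrightarrow> (\<And>k. k \<in> I \<Longrightarrow> smooth (\<lambda>t. C t k)) \<Longrightarrow> (\<lambda>t. r (C t)) \<in> curves X"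
  by (simp add: coords_def)

lemma coords_retract: "coords X I i r \<Longrightarrow> x \<in> points X \<Longrightarrow> r (i x) = x"
  by (simp add: coords_def)

lemma coords_cong: "coords X I i r \<Longrightarrow> (\<And>k. k \<in> I \<Longrightarrow> c k = c' k) \<Longrightarrow> r c = r c'"
  by (simp add: coords_def)

lemma coords_curve_iff:
  assumes "coords X I i r"
  shows "c \<in> curves X \<longleftrightarrow> (\<forall>t. c t \<in> points X) \<and> (\<forall>k\<in>I. smooth (\<lambda>t. i (c t) k))"
proof
  assume *: "(\<forall>t. c t \<in> points X) \<and> (\<forall>k\<in>I. smooth (\<lambda>t. i (c t) k))"
  then have "(\<lambda>t. r (i (c t))) \<in> curves X" by (intro coords_retract_curve[OF assms]) auto
  moreover have "(\<lambda>t. r (i (c t))) = c" using * coords_retract[OF assms] by auto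
  ultimately show "c \<in> curves X" by simp
qed (use coords_curve_points[OF assms] coords_curve_smooth[OF assms] in blast)

lemma coords_point: "coords X I i r \<Longrightarrow> r c \<in> points X"
  using coords_curve_points[of X I i r "\<lambda>_. r c" 0] coords_retract_curve[of X I i r "\<lambda>_. c"]
  by (auto intro: smooth_const)

lemma coords_eqI:
  assumes "coords X I i r" "x \<in> points X" "y \<in> points X" "\<And>k. k \<in> I \<Longrightarrow> i x k = i y k"
  shows "x = y"
proof -
  have "r (i x) = r (i y)" by (rule coords_cong[OF assms(1,4)])
  then show ?thesis
    by (simp add: coords_retract[OF assms(1,2)] coords_retract[OF assms(1,3)])
qed

lemma coords_smooth_maps_iff:
  assumes X: "coords X I i r"
  shows "f \<in> smooth_maps (rn n) X \<longleftrightarrow> (\<forall>x\<in>points (rn n). f x \<in> points X) \<and> (\<forall>k\<in>I. (\<lambda>x. i (f x) k) \<in> sf n)"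
  unfolding smooth_maps_def mem_Collect_eq coords_curve_iff[OF X]
  by (auto simp: smooth_functions_def o_def curves_rn)

lemma coords_smooth_map: "coords X I i r \<Longrightarrow> f \<in> smooth_maps (rn n) X \<Longrightarrow> k \<in> I \<Longrightarrow> (\<lambda>x. i (f x) k) \<in> sf n"
  by (simp add: coords_smooth_maps_iff)

lemma smooth_maps_point: "f \<in> smooth_maps X Y \<Longrightarrow> x \<in> points X \<Longrightarrow> f x \<in> points Y"
  by (auto simp: smooth_maps_def)

lemma smooth_maps_curve: "f \<in> smooth_maps X Y \<Longrightarrow> c \<in> curves X \<Longrightarrow> (\<lambda>t. f (c t)) \<in> curves Y"
  by (auto simp: smooth_maps_def o_def)

lemma smooth_mapsI:
  "(\<And>x. x \<in> points X \<Longrightarrow> f x \<in> points Y) \<Longrightarrow> (\<And>c. c \<in> curves X \<Longrightarrow> (\<lambda>t. f (c t)) \<in> curves Y) \<Longrightarrow> f \<in> smooth_maps X Y"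
  by (auto simp: smooth_maps_def o_def)

lemma smooth_maps_comp: "f \<in> smooth_maps X Y \<Longrightarrow> g \<in> smooth_maps Y Z \<Longrightarrow> g \<circ> f \<in> smooth_maps X Z"
  by (auto simp: smooth_maps_def comp_assoc image_subset_iff)

lemma smooth_maps_comp': "f \<in> smooth_maps X Y \<Longrightarrow> g \<in> smooth_maps Y Z \<Longrightarrow> (\<lambda>x. g (f x)) \<in> smooth_maps X Z"
  using smooth_maps_comp[of f X Y g Z] by (simp add: o_def)

lemma smooth_maps_cong:
  assumes "f \<in> smooth_maps (rn n) X" "\<And>x. x \<in> points (rn n) \<Longrightarrow> f x = g x"
  shows "g \<in> smooth_maps (rn n) X"
proof (rule smooth_mapsI)
  fix c assume c: "c \<in> curves (rn n)"
  then have "(\<lambda>t. f (c t)) = (\<lambda>t. g (c t))" using assms(2) by (auto simp: curves_rn)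
  with smooth_maps_curve[OF assms(1) c] show "(\<lambda>t. g (c t)) \<in> curves X" by simp
qed (use assms smooth_maps_point in fastforce)

lemma smooth_functions_pull: "g \<in> smooth_maps X Y \<Longrightarrow> h \<in> smooth_functions Y \<Longrightarrow> (\<lambda>x. h (g x)) \<in> smooth_functions X"
  by (auto simp: smooth_maps_def smooth_functions_def o_def)

lemma coord_smooth_function: "coords X I i r \<Longrightarrow> k \<in> I \<Longrightarrow> (\<lambda>x. i x k) \<in> smooth_functions X"
  using coords_curve_smooth by (fastforce simp: smooth_functions_def o_def)

lemma trunc_curve: "c \<in> curves (rn (Suc n)) \<Longrightarrow> (\<lambda>t. (c t)(n := 0)) \<in> curves (rn n)"
proof -
  assume c: "c \<in> curves (rn (Suc n))"
  have "smooth (\<lambda>t. ((c t)(n := 0)) j)" for j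
    using c by (cases "j = n") (auto simp: curves_rn smooth_const)
  then show ?thesis using c by (auto simp: curves_rn points_rn)
qed

text \<open>The test function is arbitrary, so the difference is obtained by exchanging the
  coordinates of \<open>u\<close> for those of \<open>v\<close> one at a time. Hadamard's lemma
  exhibits each exchange as a multiple of the difference of one coordinate, which lies in the
  ideal.\<close>

lemma coords_retract_equiv:
  assumes X: "coords X I i r"
    and u: "\<And>k. k \<in> I \<Longrightarrow> (\<lambda>x. u x k) \<in> sf (length ms)" and v: "\<And>k. k \<in> I \<Longrightarrow> (\<lambda>x. v x k) \<in> sf (length ms)"
    and uv: "\<And>k. k \<in> I \<Longrightarrow> (\<lambda>x. u x k - v x k) \<in> weil_ideal ms"
  shows "equiv_mod X (weil ms) (\<lambda>x. r (u x)) (\<lambda>x. r (v x))"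
  unfolding equiv_mod_def
proof
  let ?n = "length ms"
  fix h assume h: "h \<in> smooth_functions X"
  define mix where "mix J x = (\<lambda>k. if k \<in> J then v x k else u x k)" for J x
  have "(\<lambda>x. h (r (mix {} x)) - h (r (mix J x))) \<in> weil_ideal ms" if "finite J" "J \<subseteq> I" for J
    using that
  proof induction
    case empty
    then show ?case by (simp add: weil_ideal_0)
  next
    case (insert k J)
    \<comment> \<open>The additional variable number \<open>?n\<close> is the displacement of
      coordinate \<open>k\<close>. Hadamard's lemma in this variable compares displacement 0 with
      displacement \<open>d x\<close>.\<close>
    define G where "G y = h (r ((mix J (y(?n := 0)))(k := u (y(?n := 0)) k + y ?n)))" for y
    have G: "G \<in> sf (Suc ?n)"
    proof (rule sfI)
      fix c assume c: "c \<in> curves (rn (Suc ?n))"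
      note c' = trunc_curve[OF c]
      have "smooth (\<lambda>t. ((mix J ((c t)(?n := 0)))(k := u ((c t)(?n := 0)) k + c t ?n)) k')" if k': "k' \<in> I" for k'
        using sfD[OF u[OF k'] c'] sfD[OF v[OF k'] c'] c
        by (cases "k' = k"; cases "k' \<in> J") (simp_all add: mix_def curves_rn smooth_add)
      then have "(\<lambda>t. r ((mix J ((c t)(?n := 0)))(k := u ((c t)(?n := 0)) k + c t ?n))) \<in> curves X"
        by (rule coords_retract_curve[OF X])
      with h show "smooth (\<lambda>t. G (c t))"
        by (auto simp: smooth_functions_def o_def G_def)
    qed
    obtain H where H: "H \<in> sf (Suc ?n)" "\<And>y. y \<in> points (rn (Suc ?n)) \<Longrightarrow> G y = G (y(?n := 0)) + y ?n * H y"
      using hadamard[OF G, of ?n] by blast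
    define d where "d x = v x k - u x k" for x
    define w where "w x = x(?n := d x)" for x
    have d: "d \<in> weil_ideal ms"
      using weil_ideal_minus[OF uv[of k]] insert.prems unfolding d_def[abs_def] by simp
    have dsf: "d \<in> sf ?n"
      unfolding d_def[abs_def] using insert.prems by (intro sf_diff u v) auto
    have wsf: "(\<lambda>x. H (w x)) \<in> sf ?n"
    proof (rule sf_compose[OF H(1)])
      show "(\<lambda>x. w x j) \<in> sf ?n" for j
        unfolding w_def by (cases "j = ?n") (auto intro: dsf sf_coord)
    qed (auto simp: w_def points_rn)
    have eq: "h (r (mix J x)) - h (r (mix (insert k J) x)) = - (H (w x) * d x)" if x: "x \<in> points (rn ?n)" for x
    proof -
      have x0: "x(?n := 0) = x" using x by (auto simp: points_rn)
      have "w x \<in> points (rn (Suc ?n))" using x by (auto simp: w_def points_rn)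
      from H(2)[OF this] have "G (w x) = G x + d x * H (w x)"
        by (simp add: w_def x0)
      moreover have "G x = h (r (mix J x))"
        using insert.hyps x by (auto simp: G_def x0 mix_def points_rn fun_upd_idem)
      moreover have "(mix J x)(k := u x k + d x) = mix (insert k J) x"
        by (auto simp: mix_def d_def)
      then have "G (w x) = h (r (mix (insert k J) x))"
        by (simp add: G_def w_def x0)
      ultimately show ?thesis by simp
    qed
    have "(\<lambda>x. h (r (mix J x)) - h (r (mix (insert k J) x))) \<in> weil_ideal ms"
      by (rule weil_ideal_cong[OF weil_ideal_minus[OF weil_ideal_mult[OF d wsf]]]) (use eq in simp)
    from weil_ideal_add[OF insert.IH this] insert.prems show ?case by simp
  qed
  from this[OF coords_finite[OF X] order_refl]
  show "(\<lambda>x. h (r (u x)) - h (r (v x))) \<in> weil_ideal ms"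
  proof (rule weil_ideal_cong)
    fix x
    have "r (mix {} x) = r (u x)" "r (mix I x) = r (v x)"
      by (rule coords_cong[OF X], simp add: mix_def)+
    then show "h (r (mix {} x)) - h (r (mix I x)) = h (r (u x)) - h (r (v x))" by simp
  qed
qed

text \<open>Removes the quantifier over all smooth functions. In one direction the coordinates
  themselves are test functions; in the other \<open>coords_retract_equiv\<close> carries the
  differences through the retraction.\<close>

lemma coords_equiv_iff:
  assumes X: "coords X I i r" and f: "f \<in> smooth_maps (rn (length ms)) X" and g: "g \<in> smooth_maps (rn (length ms)) X"
  shows "equiv_mod X (weil ms) f g \<longleftrightarrow> (\<forall>k\<in>I. (\<lambda>x. i (f x) k - i (g x) k) \<in> weil_ideal ms)"
proof
  assume "equiv_mod X (weil ms) f g"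
  then have "\<forall>h\<in>smooth_functions X. (\<lambda>x. h (f x) - h (g x)) \<in> weil_ideal ms"
    by (simp add: equiv_mod_def)
  from bspec[OF this coord_smooth_function[OF X]]
  show "\<forall>k\<in>I. (\<lambda>x. i (f x) k - i (g x) k) \<in> weil_ideal ms" by simp
next
  assume k: "\<forall>k\<in>I. (\<lambda>x. i (f x) k - i (g x) k) \<in> weil_ideal ms"
  have e: "equiv_mod X (weil ms) (\<lambda>x. r (i (f x))) (\<lambda>x. r (i (g x)))"
    by (rule coords_retract_equiv[OF X]) (use k coords_smooth_map[OF X f] coords_smooth_map[OF X g] in auto)
  show "equiv_mod X (weil ms) f g"
    unfolding equiv_mod_def
  proof
    fix h assume "h \<in> smooth_functions X"
    with e have "(\<lambda>x. h (r (i (f x))) - h (r (i (g x)))) \<in> weil_ideal ms" by (simp add: equiv_mod_def)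
    then show "(\<lambda>x. h (f x) - h (g x)) \<in> weil_ideal ms"
      by (rule weil_ideal_cong) (simp add: coords_retract[OF X] smooth_maps_point[OF f] smooth_maps_point[OF g])
  qed
qed

subsection \<open>Prolongations\<close>

lemma equiv_mod_cong:
  assumes "\<And>x. x \<in> points (rn (length ms)) \<Longrightarrow> f x = g x"
  shows "equiv_mod X (weil ms) f g"
  unfolding equiv_mod_def by (auto intro!: weil_ideal_cong[OF weil_ideal_0] simp: assms)

lemma wclass_cong:
  assumes "f \<in> smooth_maps (rn (length ms)) X" "\<And>x. x \<in> points (rn (length ms)) \<Longrightarrow> f x = g x"
  shows "wclass X (weil ms) f = wclass X (weil ms) g"
  using wclass_eq_iff[OF assms(1) smooth_maps_cong[OF assms]] equiv_mod_cong[OF assms(2)] by simp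

lemma tensor_points: "f \<in> smooth_maps (rn (length ms)) X \<Longrightarrow> wclass X (weil ms) f \<in> points (tensor X (weil ms))"
  by (simp add: tensor_def fst_weil)

text \<open>A point of a prolongation is itself a map and represents its own class, so that
  statements about \<open>wclass\<close> of a map apply to every point.\<close>

lemma tensor_point_map:
  assumes "\<gamma> \<in> points (tensor X (weil ms))"
  shows "\<gamma> \<in> smooth_maps (rn (length ms)) X" "wclass X (weil ms) \<gamma> = \<gamma>"
proof -
  obtain f where f: "f \<in> smooth_maps (rn (length ms)) X" "\<gamma> = wclass X (weil ms) f"
    using assms by (auto simp: tensor_def fst_weil)
  show \<gamma>: "\<gamma> \<in> smooth_maps (rn (length ms)) X"
    using wclass_props(1)[OF f(1)] f(2) by simp
  show "wclass X (weil ms) \<gamma> = \<gamma>"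
    using wclass_eq_iff[OF f(1) \<gamma>] wclass_props(2)[OF f(1)] f(2) by simp
qed

text \<open>Test functions on \<open>Y\<close> pull back along \<open>g\<close>, so the result does
  not depend on the chosen representative. Prolongations are computed on any convenient
  representative by means of this lemma.\<close>

lemma prolong_wclass:
  assumes f: "f \<in> smooth_maps (rn (length ms)) X" and g: "g \<in> smooth_maps X Y"
  shows "prolong Y (weil ms) g (wclass X (weil ms) f) = wclass Y (weil ms) (\<lambda>x. g (f x))"
proof -
  let ?f = "wclass X (weil ms) f"
  have "equiv_mod Y (weil ms) (\<lambda>x. g (f x)) (\<lambda>x. g (?f x))"
    unfolding equiv_mod_def
  proof
    fix h assume "h \<in> smooth_functions Y"
    from smooth_functions_pull[OF g this] wclass_props(2)[OF f]
    show "(\<lambda>x. h (g (f x)) - h (g (?f x))) \<in> weil_ideal ms" unfolding equiv_mod_def by fast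
  qed
  then show ?thesis
    using wclass_eq_iff[OF smooth_maps_comp'[OF f g] smooth_maps_comp'[OF wclass_props(1)[OF f] g]]
    by (simp add: prolong_def o_def)
qed

lemma pull_wclass:
  assumes f: "f \<in> smooth_maps (rn (length ms)) X" and u: "inf_map ms' ms u"
  shows "pull X (weil ms') u (wclass X (weil ms) f) = wclass X (weil ms') (\<lambda>x. f (u x))"
proof -
  let ?f = "wclass X (weil ms) f"
  have "equiv_mod X (weil ms') (\<lambda>x. f (u x)) (\<lambda>x. ?f (u x))"
    unfolding equiv_mod_def
  proof
    fix h assume "h \<in> smooth_functions X"
    then have "(\<lambda>x. h (f x) - h (?f x)) \<in> weil_ideal ms"
      using wclass_props(2)[OF f] by (simp add: equiv_mod_def)
    from weil_ideal_pull[OF this u] show "(\<lambda>x. h (f (u x)) - h (?f (u x))) \<in> weil_ideal ms'" .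
  qed
  then show ?thesis
    using wclass_eq_iff[OF smooth_maps_comp'[OF inf_map_smooth_map[OF u] f]
        smooth_maps_comp'[OF inf_map_smooth_map[OF u] wclass_props(1)[OF f]]]
    by (simp add: pull_def o_def)
qed

lemma prolong_smooth:
  assumes g: "g \<in> smooth_maps X Y"
  shows "prolong Y (weil ms) g \<in> smooth_maps (tensor X (weil ms)) (tensor Y (weil ms))"
proof (rule smooth_mapsI)
  let ?n = "length ms"
  show P: "prolong Y (weil ms) g \<gamma> \<in> points (tensor Y (weil ms))" if "\<gamma> \<in> points (tensor X (weil ms))" for \<gamma>
    using smooth_maps_comp[OF tensor_point_map(1)[OF that] g] by (simp add: prolong_def tensor_points)
  fix c assume c: "c \<in> curves (tensor X (weil ms))"
  have cp: "c t \<in> points (tensor X (weil ms))" for t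
    using c by (auto simp: tensor_def fst_weil)
  show "(\<lambda>t. prolong Y (weil ms) g (c t)) \<in> curves (tensor Y (weil ms))"
    unfolding tensor_def[of Y] space.simps mem_Collect_eq
  proof (intro conjI allI impI)
    show "range (\<lambda>t. prolong Y (weil ms) g (c t)) \<subseteq> wclass Y (weil ms) ` smooth_maps (rn (fst (weil ms))) Y"
      using P[OF cp] by (auto simp: tensor_def)
    fix h assume h: "h \<circ> wclass Y (weil ms) \<in> smooth_functions (mapping_space (fst (weil ms)) Y)"
    let ?h = "\<lambda>\<gamma>. h (prolong Y (weil ms) g \<gamma>)"
    have "?h \<circ> wclass X (weil ms) \<in> smooth_functions (mapping_space (fst (weil ms)) X)"
      unfolding smooth_functions_def mem_Collect_eq
    proof
      fix C assume C: "C \<in> curves (mapping_space (fst (weil ms)) X)"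
      then have Cm: "C t \<in> smooth_maps (rn ?n) X" for t
        by (auto simp: mapping_space_def fst_weil)
      have "(\<lambda>t x. g (C t x)) \<in> curves (mapping_space (fst (weil ms)) Y)"
        using C smooth_maps_comp'[OF Cm g] smooth_maps_curve[OF g]
        by (auto simp: mapping_space_def fst_weil)
      then have "smooth (h \<circ> wclass Y (weil ms) \<circ> (\<lambda>t x. g (C t x)))"
        using h by (auto simp: smooth_functions_def)
      then show "smooth (?h \<circ> wclass X (weil ms) \<circ> C)"
        using prolong_wclass[OF Cm g] by (simp add: o_def)
    qed
    then have "smooth (?h \<circ> c)"
      using c by (auto simp: tensor_def)
    then show "smooth (h \<circ> (\<lambda>t. prolong Y (weil ms) g (c t)))" by (simp add: o_def)
  qed
qed

text \<open>Members of the ideal vanish at the origin, and the coordinates separate the points of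
  \<open>X\<close>. So the base point is the same for every representative.\<close>

lemma base_wclass:
  assumes X: "coords X I i r" and f: "f \<in> smooth_maps (rn (length ms)) X"
  shows "wclass X (weil ms) f (\<lambda>_. 0) = f (\<lambda>_. 0)"
proof (rule coords_eqI[OF X])
  show "wclass X (weil ms) f (\<lambda>_. 0) \<in> points X" "f (\<lambda>_. 0) \<in> points X"
    by (rule smooth_maps_point[OF wclass_props(1)[OF f] zero_points], rule smooth_maps_point[OF f zero_points])
  fix k assume "k \<in> I"
  then have "(\<lambda>x. i (f x) k - i (wclass X (weil ms) f x) k) \<in> weil_ideal ms"
    using coords_equiv_iff[OF X f wclass_props(1)[OF f]] wclass_props(2)[OF f] by blast
  from weil_ideal_at_0[OF this] show "i (wclass X (weil ms) f (\<lambda>_. 0)) k = i (f (\<lambda>_. 0)) k" by simp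
qed

text \<open>Otherwise the simplifier would turn \<open>Dobj 1\<close> into a list cons, hiding \<open>WD 1\<close>.\<close>

declare One_nat_def [simp del]

lemma len_Dobj: "length (Dobj n) = n"
  by simp

lemma mixed_diff: "f \<in> sf n \<Longrightarrow> g \<in> sf n \<Longrightarrow> mixed n S (\<lambda>d. f d - g d) = mixed n S f - mixed n S g"
  unfolding mixed_def by (rule pds_diff[OF _ _ set_desc_list_subset zero_points])

lemma mixed_cong: "(\<And>x. x \<in> points (rn n) \<Longrightarrow> f x = g x) \<Longrightarrow> mixed n S f = mixed n S g"
  unfolding mixed_def by (rule pds_cong[OF _ set_desc_list_subset zero_points])

lemma wclass_WD_eq_iff:
  assumes X: "coords X I i r" and f: "f \<in> smooth_maps (rn n) X" and g: "g \<in> smooth_maps (rn n) X"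
  shows "wclass X (WD n) f = wclass X (WD n) g \<longleftrightarrow>
    (\<forall>k\<in>I. \<forall>S\<subseteq>{..<n}. mixed n S (\<lambda>d. i (f d) k) = mixed n S (\<lambda>d. i (g d) k))"
proof -
  have f': "f \<in> smooth_maps (rn (length (Dobj n))) X" and g': "g \<in> smooth_maps (rn (length (Dobj n))) X"
    using f g by simp_all
  show ?thesis
    unfolding wclass_eq_iff[OF f' g'] coords_equiv_iff[OF X f' g']
    using coords_smooth_map[OF X f] coords_smooth_map[OF X g]
    by (simp add: weil_ideal_WD_iff sf_diff mixed_diff)
qed

lemma wclass_WD_map: "f \<in> smooth_maps (rn n) X \<Longrightarrow> wclass X (WD n) f \<in> smooth_maps (rn n) X"
  using wclass_props(1)[of f "Dobj n" X] by simp

lemma tensor_WD_map: "\<gamma> \<in> points (tensor X (WD n)) \<Longrightarrow> \<gamma> \<in> smooth_maps (rn n) X"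
  using tensor_point_map(1)[of \<gamma> X "Dobj n"] by simp

lemma tensor_WD_points: "f \<in> smooth_maps (rn n) X \<Longrightarrow> wclass X (WD n) f \<in> points (tensor X (WD n))"
  using tensor_points[of f "Dobj n" X] by simp

lemma wclass_WD_cong: "f \<in> smooth_maps (rn n) X \<Longrightarrow> (\<And>x. x \<in> points (rn n) \<Longrightarrow> f x = g x) \<Longrightarrow>
    wclass X (WD n) f = wclass X (WD n) g"
  using wclass_cong[of f "Dobj n" X g] by simp

lemma wclass_wclass: "f \<in> smooth_maps (rn n) X \<Longrightarrow> wclass X (WD n) (wclass X (WD n) f) = wclass X (WD n) f"
  using tensor_point_map(2)[OF tensor_WD_points] by blast

lemma mixed_wclass:
  assumes X: "coords X I i r" and f: "f \<in> smooth_maps (rn n) X" and "k \<in> I" "S \<subseteq> {..<n}"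
  shows "mixed n S (\<lambda>d. i (wclass X (WD n) f d) k) = mixed n S (\<lambda>d. i (f d) k)"
  using wclass_WD_eq_iff[OF X wclass_WD_map[OF f] f] wclass_wclass[OF f] assms by auto

lemma base_wclass_WD:
  "coords X I i r \<Longrightarrow> f \<in> smooth_maps (rn n) X \<Longrightarrow> base (wclass X (WD n) f) = f (\<lambda>_. 0)"
  unfolding base_def using base_wclass[of X I i r f "Dobj n"] by simp

lemma tensor_curve:
  assumes "C \<in> curves (mapping_space (length ms) X)"
  shows "(\<lambda>t. wclass X (weil ms) (C t)) \<in> curves (tensor X (weil ms))"
  using assms by (auto simp: tensor_def fst_weil mapping_space_def smooth_functions_def o_def)

lemma pds_last:
  assumes f: "f \<in> sf (Suc n)" and L: "set L \<subseteq> {..<n}" and d: "d \<in> points (rn n)"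
  shows "pds L (\<lambda>d. f (d(n := t))) d = pds L f (d(n := t))"
  using L d
proof (induction L arbitrary: d)
  case (Cons i L)
  have "pds (i # L) (\<lambda>d. f (d(n := t))) d = pd i (\<lambda>d. pds L f (d(n := t))) d"
    unfolding pds.simps by (rule pd_cong[OF Cons.IH]) (use Cons.prems in auto)
  also have "\<dots> = pds (i # L) f (d(n := t))"
    unfolding pds.simps
    by (rule pd_chain1[where A = "\<lambda>d. d(n := t)", OF pds_sf[OF f]])
      (use Cons.prems in \<open>auto simp: points_rn\<close>)
  finally show ?case .
qed simp

lemma append_last_curve: "u \<in> curves (rn n) \<Longrightarrow> smooth g \<Longrightarrow> (\<lambda>r. (u r)(n := g r)) \<in> curves (rn (Suc n))"
proof -
  assume u: "u \<in> curves (rn n)" and g: "smooth g"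
  have "smooth (\<lambda>r. ((u r)(n := g r)) j)" for j
    using u g by (cases "j = n") (auto simp: curves_rn)
  then show ?thesis using u by (simp add: curves_rn points_rn)
qed

text \<open>A curve of maps is encoded as one function of n + 1 variables: \<open>y n\<close> is the
  time, and \<open>y(n := 0)\<close> is the argument because coordinates outside the space
  vanish.\<close>

lemma mapping_curveI:
  assumes X: "coords X I i r" and p: "\<And>t d. d \<in> points (rn n) \<Longrightarrow> f t d \<in> points X"
    and s: "\<And>k. k \<in> I \<Longrightarrow> (\<lambda>y. i (f (y n) (y(n := 0))) k) \<in> sf (Suc n)"
  shows "f \<in> curves (mapping_space n X)"
proof -
  have c: "(\<lambda>r. f (g r) (u r)) \<in> curves X" if g: "smooth g" and u: "u \<in> curves (rn n)" for g u
    unfolding coords_curve_iff[OF X]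
  proof (intro conjI allI ballI)
    show "f (g t) (u t) \<in> points X" for t using p u by (simp add: curves_rn)
    fix k assume "k \<in> I"
    have e: "((u t)(n := g t))(n := 0) = u t" for t using u by (auto simp: curves_rn points_rn)
    show "smooth (\<lambda>t. i (f (g t) (u t)) k)"
      using sfD[OF s[OF \<open>k \<in> I\<close>] append_last_curve[OF u g]] unfolding e by simp
  qed
  have "f t \<in> smooth_maps (rn n) X" for t
    using p c[OF smooth_const] by (intro smooth_mapsI) auto
  with c show ?thesis by (auto simp: mapping_space_def)
qed

lemma mapping_curveD:
  assumes X: "coords X I i r" and f: "f \<in> curves (mapping_space n X)" and k: "k \<in> I"
  shows "(\<lambda>y. i (f (y n) (y(n := 0))) k) \<in> sf (Suc n)"
proof (rule sfI)
  fix c assume c: "c \<in> curves (rn (Suc n))"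
  then have "smooth (\<lambda>r. c r n)" by (simp add: curves_rn)
  with f trunc_curve[OF c] have "(\<lambda>r. f (c r n) ((c r)(n := 0))) \<in> curves X"
    by (simp add: mapping_space_def)
  from coords_curve_smooth[OF X this k] show "smooth (\<lambda>t. i (f (c t n) ((c t)(n := 0))) k)" .
qed

lemma mapping_curve_map: "f \<in> curves (mapping_space n X) \<Longrightarrow> f t \<in> smooth_maps (rn n) X"
  by (auto simp: mapping_space_def)

definition weil_coord :: "nat \<Rightarrow> ('a \<Rightarrow> 'i \<Rightarrow> real) \<Rightarrow> ((nat \<Rightarrow> real) \<Rightarrow> 'a) \<Rightarrow> nat set \<times> 'i \<Rightarrow> real" where
  "weil_coord n i \<gamma> = (\<lambda>(S, k). mixed n S (\<lambda>d. i (\<gamma> d) k))"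

definition wpoly :: "nat \<Rightarrow> (nat set \<times> 'i \<Rightarrow> real) \<Rightarrow> (nat \<Rightarrow> real) \<Rightarrow> 'i \<Rightarrow> real" where
  "wpoly n c d k = (\<Sum>S\<in>Pow {..<n}. c (S, k) * (\<Prod>j\<in>S. d j))"

lemma wpoly_mapping_curve:
  assumes X: "coords X I i r" and C: "\<And>S k. S \<subseteq> {..<n} \<Longrightarrow> k \<in> I \<Longrightarrow> smooth (\<lambda>t. C t (S, k))"
  shows "(\<lambda>t d. r (wpoly n (C t) d)) \<in> curves (mapping_space n X)"
proof (rule mapping_curveI[OF X coords_point[OF X]])
  fix k assume k: "k \<in> I"
  show "(\<lambda>y. i (r (wpoly n (C (y n)) (y(n := 0)))) k) \<in> sf (Suc n)"
  proof (rule sfI)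
    fix c assume c: "c \<in> curves (rn (Suc n))"
    have "smooth (\<lambda>t. wpoly n (C (c t n)) ((c t)(n := 0)) k')" if "k' \<in> I" for k'
      unfolding wpoly_def
    proof (rule smooth_sum, rule smooth_mult)
      fix S assume "S \<in> Pow {..<n}"
      then show "smooth (\<lambda>t. C (c t n) (S, k'))"
        using c that by (intro smooth_compose[OF C]) (auto simp: curves_rn)
      show "smooth (\<lambda>t. \<Prod>j\<in>S. ((c t)(n := 0)) j)"
        using trunc_curve[OF c] by (intro smooth_prod) (simp add: curves_rn)
    qed
    then show "smooth (\<lambda>t. i (r (wpoly n (C (c t n)) ((c t)(n := 0)))) k)"
      by (intro coords_curve_smooth[OF X coords_retract_curve[OF X] k])
  qed
qed

text \<open>By \<open>normal_form\<close> the coordinates of \<open>f\<close> agree with their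
  square-free polynomials modulo squares, and \<open>coords_retract_equiv\<close> carries this
  through the retraction.\<close>

lemma wpoly_weil_coord:
  assumes X: "coords X I i r" and f: "f \<in> smooth_maps (rn n) X"
  shows "wclass X (WD n) (\<lambda>d. r (wpoly n (weil_coord n i f) d)) = wclass X (WD n) f"
proof -
  let ?g = "\<lambda>d. r (wpoly n (weil_coord n i f) d)"
  have g: "?g \<in> smooth_maps (rn n) X"
    using mapping_curve_map[OF wpoly_mapping_curve[OF X smooth_const]] by fast
  have w: "(\<lambda>d. wpoly n (weil_coord n i f) d k) \<in> sf n" for k
    unfolding wpoly_def by (intro sf_sum sf_mult sf_const sf_prod sf_coord)
  have "(\<lambda>d. wpoly n (weil_coord n i f) d k - i (f d) k) \<in> weil_ideal (Dobj n)" if k: "k \<in> I" for k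
  proof -
    note s = coords_smooth_map[OF X f k]
    obtain a where a: "\<forall>i<n. a i \<in> sf n" "\<And>x. x \<in> points (rn n) \<Longrightarrow>
      i (f x) k = (\<Sum>S\<in>Pow {..<n}. (\<Prod>i\<in>S. x i) * pds (desc_list n S) (\<lambda>d. i (f d) k) (cutoff n x)) + (\<Sum>i<n. a i x * (x i)\<^sup>2)"
      using normal_form[OF s order_refl] by blast
    have "(\<lambda>x. a j x * (x j)\<^sup>2) \<in> weil_ideal (Dobj n)" if "j \<in> {..<n}" for j
      using weil_ideal_mult[OF weil_ideal_gen[of j "Dobj n"]] a(1) that by (simp add: power2_eq_square)
    then have "(\<lambda>x. \<Sum>j<n. a j x * (x j)\<^sup>2) \<in> weil_ideal (Dobj n)" by (rule weil_ideal_sum)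
    from weil_ideal_minus[OF this] show ?thesis
      by (rule weil_ideal_cong) (simp add: a(2) cutoff_all wpoly_def weil_coord_def mixed_def mult.commute)
  qed
  then have e: "equiv_mod X (WD n) ?g (\<lambda>d. r (i (f d)))"
    using coords_smooth_map[OF X f] w by (intro coords_retract_equiv[OF X]) simp_all
  have rf: "r (i (f d)) = f d" if "d \<in> points (rn n)" for d
    using coords_retract[OF X smooth_maps_point[OF f that]] .
  have f': "(\<lambda>d. r (i (f d))) \<in> smooth_maps (rn n) X"
    by (rule smooth_maps_cong[OF f]) (simp add: rf)
  have "wclass X (WD n) ?g = wclass X (WD n) (\<lambda>d. r (i (f d)))"
    using wclass_eq_iff[of ?g "Dobj n" X "\<lambda>d. r (i (f d))"] g f' e by simp
  also have "\<dots> = wclass X (WD n) f"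
    by (rule wclass_WD_cong[OF f']) (rule rf)
  finally show ?thesis .
qed

text \<open>Retracts are closed under prolongation: the coefficients of the coordinates are the new
  coordinates, and square-free polynomials followed by the retraction of \<open>X\<close> are the
  representatives.\<close>

lemma coords_tensor:
  assumes X: "coords X I i r"
  shows "coords (tensor X (WD n)) (Pow {..<n} \<times> I) (weil_coord n i) (\<lambda>c. wclass X (WD n) (\<lambda>d. r (wpoly n c d)))"
  unfolding coords_def
proof (intro conjI ballI allI impI)
  show "finite (Pow {..<n} \<times> I)" using coords_finite[OF X] by simp
next
  fix c t assume "c \<in> curves (tensor X (WD n))"
  then show "c t \<in> points (tensor X (WD n))" by (auto simp: tensor_def)
next
  fix c Sk assume c: "c \<in> curves (tensor X (WD n))" and "Sk \<in> Pow {..<n} \<times> I"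
  then obtain S k where Sk: "Sk = (S, k)" "S \<subseteq> {..<n}" "k \<in> I" by auto
  let ?h = "\<lambda>\<gamma>. mixed n S (\<lambda>d. i (\<gamma> d) k)"
  \<comment> \<open>The curves of the quotient are defined by the functions that are smooth after
    composition with the quotient map, so the coordinate must be shown to be one of these. Along a
    curve of maps it is an iterated derivative at the origin, with the time as an additional last
    variable.\<close>
  have "?h \<circ> wclass X (WD n) \<in> smooth_functions (mapping_space n X)"
    unfolding smooth_functions_def mem_Collect_eq
  proof
    fix C assume C: "C \<in> curves (mapping_space n X)"
    let ?\<Psi> = "\<lambda>y. i (C (y n) (y(n := 0))) k"
    have P: "?\<Psi> \<in> sf (Suc n)" by (rule mapping_curveD[OF X C Sk(3)])
    have "?h (wclass X (WD n) (C t)) = pds (desc_list n S) ?\<Psi> ((\<lambda>_. 0)(n := t))" for t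
    proof -
      have "?h (wclass X (WD n) (C t)) = mixed n S (\<lambda>d. i (C t d) k)"
        by (rule mixed_wclass[OF X mapping_curve_map[OF C] Sk(3,2)])
      also have "\<dots> = mixed n S (\<lambda>d. ?\<Psi> (d(n := t)))"
        by (rule mixed_cong) (simp add: points_rn fun_upd_idem)
      also have "\<dots> = pds (desc_list n S) ?\<Psi> ((\<lambda>_. 0)(n := t))"
        unfolding mixed_def by (rule pds_last[OF P set_desc_list_subset zero_points])
      finally show ?thesis .
    qed
    moreover have "smooth (\<lambda>t. pds (desc_list n S) ?\<Psi> ((\<lambda>_. 0)(n := t)))"
    proof (rule sfD[OF pds_sf[OF P]])
      show "set (desc_list n S) \<subseteq> {..<Suc n}" using set_desc_list_subset[of n S] by auto
      show "(\<lambda>t. (\<lambda>_. 0)(n := t)) \<in> curves (rn (Suc n))"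
        using append_last_curve[OF const_curve[OF zero_points] smooth_ident] .
    qed
    ultimately show "smooth (?h \<circ> wclass X (WD n) \<circ> C)" by (simp add: o_def)
  qed
  then have "smooth (?h \<circ> c)"
    using c by (auto simp: tensor_def fst_weil)
  then show "smooth (\<lambda>t. weil_coord n i (c t) Sk)" by (simp add: weil_coord_def Sk o_def)
next
  fix C :: "real \<Rightarrow> nat set \<times> _ \<Rightarrow> real"
  assume C: "\<forall>k\<in>Pow {..<n} \<times> I. smooth (\<lambda>t. C t k)"
  have "(\<lambda>t d. r (wpoly n (C t) d)) \<in> curves (mapping_space n X)"
    by (rule wpoly_mapping_curve[OF X]) (use C in auto)
  then show "(\<lambda>t. wclass X (WD n) (\<lambda>d. r (wpoly n (C t) d))) \<in> curves (tensor X (WD n))"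
    using tensor_curve[of _ "Dobj n" X] by simp
next
  fix \<gamma> assume g: "\<gamma> \<in> points (tensor X (WD n))"
  show "wclass X (WD n) (\<lambda>d. r (wpoly n (weil_coord n i \<gamma>) d)) = \<gamma>"
    using wpoly_weil_coord[OF X tensor_WD_map[OF g]] tensor_point_map(2)[OF g] by simp
next
  fix c c' :: "nat set \<times> _ \<Rightarrow> real" assume e: "\<forall>k\<in>Pow {..<n} \<times> I. c k = c' k"
  have "r (wpoly n c d) = r (wpoly n c' d)" for d
    by (rule coords_cong[OF X]) (use e in \<open>auto simp: wpoly_def intro!: sum.cong\<close>)
  then show "wclass X (WD n) (\<lambda>d. r (wpoly n c d)) = wclass X (WD n) (\<lambda>d. r (wpoly n c' d))" by simp
qed

text \<open>The quotient structure only tests curves by functions. The lift exists because the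
  polynomial representatives depend smoothly on the coordinates.\<close>

lemma tensor_curve_lift:
  assumes X: "coords X I i r" and c: "c \<in> curves (tensor X (WD n))"
  obtains f where "f \<in> curves (mapping_space n X)" "\<And>t. c t = wclass X (WD n) (f t)"
proof
  show "(\<lambda>t d. r (wpoly n (weil_coord n i (c t)) d)) \<in> curves (mapping_space n X)"
    by (rule wpoly_mapping_curve[OF X])
      (use coords_curve_smooth[OF coords_tensor[OF X] c] in auto)
  show "c t = wclass X (WD n) (\<lambda>d. r (wpoly n (weil_coord n i (c t)) d))" for t
    using coords_retract[OF coords_tensor[OF X] coords_curve_points[OF coords_tensor[OF X] c]] by simp
qed

lemma tensor_WD_curve: "C \<in> curves (mapping_space n X) \<Longrightarrow> (\<lambda>t. wclass X (WD n) (C t)) \<in> curves (tensor X (WD n))"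
  using tensor_curve[of C "Dobj n" X] by simp

lemma smooth_maps_vappend_left:
  assumes X: "coords X I i r" and F: "F \<in> smooth_maps (rn (n + l)) X" and e: "e \<in> points (rn l)"
  shows "(\<lambda>d. F (vappend n d e)) \<in> smooth_maps (rn n) X"
  unfolding coords_smooth_maps_iff[OF X]
  using vappend_points[OF _ e] smooth_maps_point[OF F] sf_vappend_left[OF coords_smooth_map[OF X F] e]
  by blast

lemma weil_coord_family:
  assumes X: "coords X I i r" and F: "F \<in> smooth_maps (rn (n + l)) X" and e: "e \<in> points (rn l)"
    and k: "k \<in> I" and S: "S \<subseteq> {..<n}"
  shows "weil_coord n i (wclass X (WD n) (\<lambda>d. F (vappend n d e))) (S, k) =
    pds (desc_list n S) (\<lambda>y. i (F y) k) (vappend n (\<lambda>_. 0) e)"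
  using mixed_wclass[OF X smooth_maps_vappend_left[OF X F e] k S]
    pds_vappend[OF coords_smooth_map[OF X F k] set_desc_list_subset zero_points e]
  by (simp add: weil_coord_def mixed_def)

lemma tensor_family:
  assumes X: "coords X I i r" and F: "F \<in> smooth_maps (rn (n + l)) X"
  shows "(\<lambda>e. wclass X (WD n) (\<lambda>d. F (vappend n d e))) \<in> smooth_maps (rn l) (tensor X (WD n))"
  unfolding coords_smooth_maps_iff[OF coords_tensor[OF X]]
proof (intro conjI ballI)
  fix e assume "e \<in> points (rn l)"
  then show "wclass X (WD n) (\<lambda>d. F (vappend n d e)) \<in> points (tensor X (WD n))"
    by (intro tensor_WD_points smooth_maps_vappend_left[OF X F])
next
  fix Sk assume "Sk \<in> Pow {..<n} \<times> I"
  then obtain S k where Sk: "Sk = (S, k)" "S \<subseteq> {..<n}" "k \<in> I" by auto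
  have "pds (desc_list n S) (\<lambda>y. i (F y) k) \<in> sf (n + l)"
    using set_desc_list_subset[of n S] by (intro pds_sf coords_smooth_map[OF X F] Sk) auto
  from sf_vappend_right[OF this zero_points]
  show "(\<lambda>e. weil_coord n i (wclass X (WD n) (\<lambda>d. F (vappend n d e))) Sk) \<in> sf l"
    by (rule sf_cong) (simp add: weil_coord_family[OF X F _ Sk(3,2)] Sk(1))
qed

text \<open>The classes are compared coefficient by coefficient, and the two implications are
  \<open>weil_ideal_uncurry\<close> and \<open>weil_ideal_curry\<close>. This gives the injectivity
  of currying and its independence of representatives at once.\<close>

lemma wcurry_eq_iff:
  assumes X: "coords X I i r"
    and F: "F \<in> smooth_maps (rn (n + length ns)) X" and G: "G \<in> smooth_maps (rn (n + length ns)) X"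
  shows "wclass (tensor X (WD n)) (weil ns) (\<lambda>e. wclass X (WD n) (\<lambda>d. F (vappend n d e))) =
      wclass (tensor X (WD n)) (weil ns) (\<lambda>e. wclass X (WD n) (\<lambda>d. G (vappend n d e))) \<longleftrightarrow>
    wclass X (weil (Dobj n @ ns)) F = wclass X (weil (Dobj n @ ns)) G"
proof -
  let ?l = "length ns"
  note tF = tensor_family[OF X F] and tG = tensor_family[OF X G]
  have F': "F \<in> smooth_maps (rn (length (Dobj n @ ns))) X" and G': "G \<in> smooth_maps (rn (length (Dobj n @ ns))) X"
    using F G by simp_all
  have eq: "weil_coord n i (wclass X (WD n) (\<lambda>d. F (vappend n d e))) (S, k) - weil_coord n i (wclass X (WD n) (\<lambda>d. G (vappend n d e))) (S, k)
    = pds (desc_list n S) (\<lambda>y. i (F y) k - i (G y) k) (vappend n (\<lambda>_. 0) e)"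
    if "e \<in> points (rn ?l)" "S \<subseteq> {..<n}" "k \<in> I" for e S k
  proof -
    have "set (desc_list n S) \<subseteq> {..<n + ?l}" using set_desc_list_subset[of n S] by auto
    then show ?thesis
      using that by (simp add: weil_coord_family[OF X F] weil_coord_family[OF X G]
          pds_diff[OF coords_smooth_map[OF X F] coords_smooth_map[OF X G] _ vappend_points[OF zero_points]])
  qed
  have main: "(\<forall>S\<subseteq>{..<n}. (\<lambda>e. weil_coord n i (wclass X (WD n) (\<lambda>d. F (vappend n d e))) (S, k) -
        weil_coord n i (wclass X (WD n) (\<lambda>d. G (vappend n d e))) (S, k)) \<in> weil_ideal ns) \<longleftrightarrow>
      (\<lambda>y. i (F y) k - i (G y) k) \<in> weil_ideal (Dobj n @ ns)" if k: "k \<in> I" for k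
  proof
    assume a: "\<forall>S\<subseteq>{..<n}. (\<lambda>e. weil_coord n i (wclass X (WD n) (\<lambda>d. F (vappend n d e))) (S, k) -
        weil_coord n i (wclass X (WD n) (\<lambda>d. G (vappend n d e))) (S, k)) \<in> weil_ideal ns"
    show "(\<lambda>y. i (F y) k - i (G y) k) \<in> weil_ideal (Dobj n @ ns)"
    proof (rule weil_ideal_uncurry)
      show "(\<lambda>y. i (F y) k - i (G y) k) \<in> sf (n + ?l)"
        by (intro sf_diff coords_smooth_map[OF X] F G k)
      fix S assume S: "S \<subseteq> {..<n}"
      with a have "(\<lambda>e. weil_coord n i (wclass X (WD n) (\<lambda>d. F (vappend n d e))) (S, k) -
        weil_coord n i (wclass X (WD n) (\<lambda>d. G (vappend n d e))) (S, k)) \<in> weil_ideal ns" by blast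
      then show "(\<lambda>e. pds (desc_list n S) (\<lambda>y. i (F y) k - i (G y) k) (vappend n (\<lambda>_. 0) e)) \<in> weil_ideal ns"
        by (rule weil_ideal_cong) (rule eq[OF _ S k])
    qed
  next
    assume a: "(\<lambda>y. i (F y) k - i (G y) k) \<in> weil_ideal (Dobj n @ ns)"
    show "\<forall>S\<subseteq>{..<n}. (\<lambda>e. weil_coord n i (wclass X (WD n) (\<lambda>d. F (vappend n d e))) (S, k) -
        weil_coord n i (wclass X (WD n) (\<lambda>d. G (vappend n d e))) (S, k)) \<in> weil_ideal ns"
    proof (intro allI impI)
      fix S assume S: "S \<subseteq> {..<n}"
      show "(\<lambda>e. weil_coord n i (wclass X (WD n) (\<lambda>d. F (vappend n d e))) (S, k) -
        weil_coord n i (wclass X (WD n) (\<lambda>d. G (vappend n d e))) (S, k)) \<in> weil_ideal ns"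
        by (rule weil_ideal_cong[OF weil_ideal_curry[OF a set_desc_list_subset distinct_desc_list]]) (rule eq[OF _ S k, symmetric])
    qed
  qed
  have prod: "(\<forall>Sk\<in>Pow {..<n} \<times> I. P Sk) \<longleftrightarrow> (\<forall>k\<in>I. \<forall>S\<subseteq>{..<n}. P (S, k))" for P
    by auto
  show ?thesis
    unfolding wclass_eq_iff[OF tF tG] wclass_eq_iff[OF F' G'] coords_equiv_iff[OF coords_tensor[OF X] tF tG]
      coords_equiv_iff[OF X F' G'] prod
    by (rule ball_cong[OF refl main])
qed

lemma wcurry_wclass:
  assumes X: "coords X I i r" and F: "F \<in> smooth_maps (rn (n + length ns)) X"
  shows "wcurry X (Dobj n) ns (wclass X (weil (Dobj n @ ns)) F) =
    wclass (tensor X (WD n)) (weil ns) (\<lambda>e. wclass X (WD n) (\<lambda>d. F (vappend n d e)))"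
proof -
  let ?G = "wclass X (weil (Dobj n @ ns)) F"
  have F': "F \<in> smooth_maps (rn (length (Dobj n @ ns))) X" using F by simp
  have "?G \<in> smooth_maps (rn (n + length ns)) X" using wclass_props(1)[OF F'] by simp
  from wcurry_eq_iff[OF X this F] tensor_point_map(2)[OF tensor_points[OF F']]
  show ?thesis by (simp add: wcurry_def)
qed

text \<open>Injectivity of currying makes the description in \<open>wuncurry\<close> denote, for
  every class that comes from a joint map.\<close>

lemma wuncurry_wclass:
  assumes X: "coords X I i r" and F: "F \<in> smooth_maps (rn (n + length ns)) X"
  shows "wuncurry X (Dobj n) ns (wclass (tensor X (WD n)) (weil ns) (\<lambda>e. wclass X (WD n) (\<lambda>d. F (vappend n d e)))) =
    wclass X (weil (Dobj n @ ns)) F"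
  unfolding wuncurry_def
proof (rule the_equality)
  have F': "F \<in> smooth_maps (rn (length (Dobj n @ ns))) X" using F by simp
  show "wclass X (weil (Dobj n @ ns)) F \<in> points (tensor X (weil (Dobj n @ ns))) \<and>
    wcurry X (Dobj n) ns (wclass X (weil (Dobj n @ ns)) F) =
    wclass (tensor X (WD n)) (weil ns) (\<lambda>e. wclass X (WD n) (\<lambda>d. F (vappend n d e)))"
    using wcurry_wclass[OF X F] tensor_points[OF F'] by simp
  fix \<gamma> assume g: "\<gamma> \<in> points (tensor X (weil (Dobj n @ ns))) \<and> wcurry X (Dobj n) ns \<gamma> =
    wclass (tensor X (WD n)) (weil ns) (\<lambda>e. wclass X (WD n) (\<lambda>d. F (vappend n d e)))"
  have G: "\<gamma> \<in> smooth_maps (rn (n + length ns)) X" and w: "wclass X (weil (Dobj n @ ns)) \<gamma> = \<gamma>"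
    using tensor_point_map[OF conjunct1[OF g]] by simp_all
  from g wcurry_eq_iff[OF X G F] w show "\<gamma> = wclass X (weil (Dobj n @ ns)) F"
    by (simp add: wcurry_def)
qed

subsection \<open>Fibres and fibre products\<close>

lemma coords_retract_space:
  assumes Y: "coords Y I i r" and j: "j \<in> smooth_maps X Y" and \<rho>: "\<rho> \<in> smooth_maps Y X"
    and id: "\<And>x. x \<in> points X \<Longrightarrow> \<rho> (j x) = x" and pts: "\<And>c t. c \<in> curves X \<Longrightarrow> c t \<in> points X"
  shows "coords X I (\<lambda>x. i (j x)) (\<lambda>c. \<rho> (r c))"
  unfolding coords_def
proof (intro conjI ballI allI impI)
  fix C :: "real \<Rightarrow> _ \<Rightarrow> real" assume "\<forall>k\<in>I. smooth (\<lambda>t. C t k)"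
  then have "(\<lambda>t. r (C t)) \<in> curves Y" by (intro coords_retract_curve[OF Y]) blast
  then show "(\<lambda>t. \<rho> (r (C t))) \<in> curves X" by (rule smooth_maps_curve[OF \<rho>])
next
  fix x assume "x \<in> points X"
  then show "\<rho> (r (i (j x))) = x"
    using coords_retract[OF Y smooth_maps_point[OF j]] id by simp
next
  fix c c' :: "_ \<Rightarrow> real" assume "\<forall>k\<in>I. c k = c' k"
  then have "r c = r c'" by (intro coords_cong[OF Y]) blast
  then show "\<rho> (r c) = \<rho> (r c')" by simp
qed (use coords_finite[OF Y] pts coords_curve_smooth[OF Y smooth_maps_curve[OF j]] in auto)

lemma coords_rn: "coords (rn k) {..<k} (\<lambda>x j. x j) (\<lambda>c j. if j < k then c j else 0)"
  unfolding coords_def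
proof (intro conjI ballI allI impI)
  fix C :: "real \<Rightarrow> nat \<Rightarrow> real"
  assume "\<forall>j\<in>{..<k}. smooth (\<lambda>t. C t j)"
  then have "smooth (\<lambda>t. if j < k then C t j else 0)" for j
    by (cases "j < k") (auto simp: smooth_const)
  then show "(\<lambda>t j. if j < k then C t j else 0) \<in> curves (rn k)"
    by (simp add: curves_rn points_rn)
qed (auto simp: curves_rn points_rn fun_eq_iff)

text \<open>Translation in the vector space that moves the base point to \<open>b\<close>. It
  provides the retractions onto fibres and, with a varying \<open>b\<close>, onto fibre
  products.\<close>

definition recentre :: "nat \<Rightarrow> nat \<Rightarrow> (nat \<Rightarrow> real) \<Rightarrow> ((nat \<Rightarrow> real) \<Rightarrow> (nat \<Rightarrow> real)) \<Rightarrow> ((nat \<Rightarrow> real) \<Rightarrow> (nat \<Rightarrow> real))" where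
  "recentre p n b \<gamma> = wclass (rn p) (WD n) (\<lambda>d j. \<gamma> d j - \<gamma> (\<lambda>_. 0) j + b j)"

lemma recentre_map:
  assumes "f \<in> smooth_maps (rn n) (rn p)" "b \<in> points (rn p)"
  shows "(\<lambda>d j. f d j - f (\<lambda>_. 0) j + b j) \<in> smooth_maps (rn n) (rn p)"
  unfolding coords_smooth_maps_iff[OF coords_rn]
  using assms coords_smooth_map[OF coords_rn assms(1)] smooth_maps_point[OF assms(1)] zero_points
  by (auto simp: points_rn intro!: sf_add sf_diff sf_const)

lemma recentre_wclass:
  assumes f: "f \<in> smooth_maps (rn n) (rn p)" and b: "b \<in> points (rn p)"
  shows "recentre p n b (wclass (rn p) (WD n) f) = wclass (rn p) (WD n) (\<lambda>d j. f d j - f (\<lambda>_. 0) j + b j)"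
proof -
  let ?f = "wclass (rn p) (WD n) f"
  have f': "?f \<in> smooth_maps (rn n) (rn p)" by (rule wclass_WD_map[OF f])
  have b0: "?f (\<lambda>_. 0) = f (\<lambda>_. 0)"
    using base_wclass_WD[OF coords_rn f] by (simp add: base_def)
  have "mixed n S (\<lambda>d. ?f d j - ?f (\<lambda>_. 0) j + b j) = mixed n S (\<lambda>d. f d j - f (\<lambda>_. 0) j + b j)"
    if j: "j < p" and S: "S \<subseteq> {..<n}" for j S
  proof -
    have e: "g d j - f (\<lambda>_. 0) j + b j = g d j - (f (\<lambda>_. 0) j - b j)" for g :: "(nat \<Rightarrow> real) \<Rightarrow> nat \<Rightarrow> real" and d by simp
    have "mixed n S (\<lambda>d. ?f d j) = mixed n S (\<lambda>d. f d j)"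
      by (rule mixed_wclass[OF coords_rn f]) (use j S in auto)
    then show ?thesis
      using j coords_smooth_map[OF coords_rn f] coords_smooth_map[OF coords_rn f']
      unfolding b0 e by (simp add: mixed_diff sf_const)
  qed
  then show ?thesis
    unfolding recentre_def
    by (subst wclass_WD_eq_iff[OF coords_rn recentre_map[OF f' b] recentre_map[OF f b]]) auto
qed

lemma recentre_curve:
  assumes b: "b \<in> curves (rn p)" and c: "c \<in> curves (tensor (rn p) (WD n))"
  shows "(\<lambda>t. recentre p n (b t) (c t)) \<in> curves (tensor (rn p) (WD n))"
proof -
  obtain f where f: "f \<in> curves (mapping_space n (rn p))" "\<And>t. c t = wclass (rn p) (WD n) (f t)"
    using tensor_curve_lift[OF coords_rn c] by blast
  have "(\<lambda>t d j. f t d j - f t (\<lambda>_. 0) j + b t j) \<in> curves (mapping_space n (rn p))"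
  proof (rule mapping_curveI[OF coords_rn])
    show "(\<lambda>j. f t d j - f t (\<lambda>_. 0) j + b t j) \<in> points (rn p)" if "d \<in> points (rn n)" for t d
      using smooth_maps_point[OF recentre_map[OF mapping_curve_map[OF f(1)]] that] b by (simp add: curves_rn)
    fix k assume k: "k \<in> {..<p}"
    note m = mapping_curveD[OF coords_rn f(1) k]
    have z: "(\<lambda>i. if i = n then y n else 0)(n := 0) = (\<lambda>_. 0)" for y :: "nat \<Rightarrow> real" by auto
    have "(\<lambda>y. if i = n then y n else 0) \<in> sf (Suc n)" for i
      by (cases "i = n") (simp_all add: sf_const sf_coord)
    then have "(\<lambda>y. f ((\<lambda>i. if i = n then y n else 0) n) ((\<lambda>i. if i = n then y n else 0)(n := 0)) k) \<in> sf (Suc n)"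
      by (intro sf_compose[OF m, where u = "\<lambda>y i. if i = n then y n else 0"]) (auto simp: points_rn)
    then have m0: "(\<lambda>y. f (y n) (\<lambda>_. 0) k) \<in> sf (Suc n)"
      by (simp only: z if_True refl)
    have mb: "(\<lambda>y. b (y n) k) \<in> sf (Suc n)"
    proof (rule sfI)
      fix c' assume "c' \<in> curves (rn (Suc n))"
      then show "smooth (\<lambda>t. b (c' t n) k)"
        using b smooth_compose[of "\<lambda>r. b r k" "\<lambda>t. c' t n"] by (simp add: curves_rn)
    qed
    show "(\<lambda>y. f (y n) (y(n := 0)) k - f (y n) (\<lambda>_. 0) k + b (y n) k) \<in> sf (Suc n)"
      by (rule sf_add[OF sf_diff[OF m m0] mb])
  qed
  from tensor_WD_curve[OF this] show ?thesis
    using b by (simp add: f(2) recentre_wclass[OF mapping_curve_map[OF f(1)]] curves_rn)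
qed

lemma recentre_point: "\<gamma> \<in> points (tensor (rn p) (WD n)) \<Longrightarrow> b \<in> points (rn p) \<Longrightarrow> recentre p n b \<gamma> \<in> points (tensor (rn p) (WD n))"
  unfolding recentre_def by (intro tensor_WD_points recentre_map tensor_WD_map)

lemma base_recentre:
  assumes "\<gamma> \<in> points (tensor (rn p) (WD n))" "b \<in> points (rn p)" shows "base (recentre p n b \<gamma>) = b"
  unfolding recentre_def using base_wclass_WD[OF coords_rn recentre_map[OF tensor_WD_map[OF assms(1)] assms(2)]]
  by simp

lemma recentre_base:
  assumes "\<gamma> \<in> points (tensor (rn p) (WD n))" shows "recentre p n (base \<gamma>) \<gamma> = \<gamma>"
  using tensor_point_map(2)[OF assms] by (simp add: recentre_def base_def)

lemma fibre_points: "\<gamma> \<in> points (fibre X A b) \<longleftrightarrow> \<gamma> \<in> points (tensor X A) \<and> base \<gamma> = b"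
  by (auto simp: fibre_def subspace_def)

lemma fibre_curves: "c \<in> curves (fibre X A b) \<longleftrightarrow> c \<in> curves (tensor X A) \<and> (\<forall>t. base (c t) = b)"
  by (auto simp: fibre_def subspace_def)

text \<open>The retraction onto the fibre is \<open>recentre\<close>; the coordinates remain those
  of the ambient prolongation.\<close>

lemma coords_fibre:
  assumes b: "b \<in> points (rn p)"
  shows "\<exists>r. coords (fibre (rn p) (WD n) b) (Pow {..<n} \<times> {..<p}) (weil_coord n (\<lambda>x j. x j)) r"
proof -
  note T = coords_tensor[OF coords_rn[of p], of n]
  have "coords (fibre (rn p) (WD n) b) (Pow {..<n} \<times> {..<p}) (\<lambda>\<gamma>. weil_coord n (\<lambda>x j. x j) \<gamma>)
    (\<lambda>c. recentre p n b (wclass (rn p) (WD n) (\<lambda>d j. if j < p then wpoly n c d j else 0)))"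
  proof (rule coords_retract_space[OF T])
    show "(\<lambda>\<gamma>. \<gamma>) \<in> smooth_maps (fibre (rn p) (WD n) b) (tensor (rn p) (WD n))"
      by (rule smooth_mapsI) (auto simp: fibre_points fibre_curves)
    show "recentre p n b \<in> smooth_maps (tensor (rn p) (WD n)) (fibre (rn p) (WD n) b)"
      using recentre_curve[OF const_curve[OF b]] recentre_point base_recentre b coords_curve_points[OF T]
      by (intro smooth_mapsI) (auto simp: fibre_points fibre_curves)
    show "c t \<in> points (fibre (rn p) (WD n) b)" if "c \<in> curves (fibre (rn p) (WD n) b)" for c t
      using that coords_curve_points[OF T] by (simp add: fibre_points fibre_curves)
  qed (auto simp: fibre_points recentre_base)
  then show ?thesis by blast
qed

text \<open>The description has a unique witness: the fibre and the ambient prolongation share their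
  coordinates, so equivalence of maps into the one is the same condition as into the other.\<close>

lemma to_subspace_wclass:
  assumes b: "b \<in> points (rn p)" and F: "F \<in> smooth_maps (rn (length ms)) (fibre (rn p) (WD n) b)"
  shows "to_subspace (fibre (rn p) (WD n) b) (tensor (rn p) (WD n)) (weil ms) (wclass (tensor (rn p) (WD n)) (weil ms) F) =
    wclass (fibre (rn p) (WD n) b) (weil ms) F"
  unfolding to_subspace_def
proof (rule the_equality)
  let ?S = "fibre (rn p) (WD n) b" and ?T = "tensor (rn p) (WD n)"
  have inc: "(\<lambda>\<gamma>. \<gamma>) \<in> smooth_maps ?S ?T"
    by (rule smooth_mapsI) (auto simp: fibre_points fibre_curves)
  show "wclass ?S (weil ms) F \<in> points (tensor ?S (weil ms)) \<and>
    prolong ?T (weil ms) (\<lambda>x. x) (wclass ?S (weil ms) F) = wclass ?T (weil ms) F"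
    using tensor_points[OF F] prolong_wclass[OF F inc] by simp
  fix \<zeta> assume z: "\<zeta> \<in> points (tensor ?S (weil ms)) \<and> prolong ?T (weil ms) (\<lambda>x. x) \<zeta> = wclass ?T (weil ms) F"
  note zm = tensor_point_map[OF conjunct1[OF z]]
  obtain r where S: "coords ?S (Pow {..<n} \<times> {..<p}) (weil_coord n (\<lambda>x j. x j)) r"
    using coords_fibre[OF b] by blast
  note T = coords_tensor[OF coords_rn[of p], of n]
  have "wclass ?T (weil ms) \<zeta> = wclass ?T (weil ms) F"
    using z by (simp add: prolong_def o_def)
  then have "equiv_mod ?T (weil ms) \<zeta> F"
    using wclass_eq_iff[OF smooth_maps_comp'[OF zm(1) inc] smooth_maps_comp'[OF F inc]] by simp
  then have "equiv_mod ?S (weil ms) \<zeta> F"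
    unfolding coords_equiv_iff[OF S zm(1) F]
      coords_equiv_iff[OF T smooth_maps_comp'[OF zm(1) inc] smooth_maps_comp'[OF F inc]] .
  then show "\<zeta> = wclass ?S (weil ms) F"
    using wclass_eq_iff[OF zm(1) F] zm(2) by simp
qed

text \<open>The constraint is met by retracting the first component freely and recentring the second
  one at the image of the first under \<open>\<rho>\<close>.\<close>

lemma coords_fibre_product:
  assumes X: "coords X I i r" and \<rho>: "\<rho> \<in> smooth_maps X (rn p)"
  shows "\<exists>R. coords (fibre_product X (tensor (rn p) (WD n)) \<rho> base) (I <+> (Pow {..<n} \<times> {..<p}))
    (\<lambda>(x, \<gamma>). case_sum (i x) (weil_coord n (\<lambda>x j. x j) \<gamma>)) R"
proof -
  note T = coords_tensor[OF coords_rn[of p], of n]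
  let ?T = "tensor (rn p) (WD n)" and ?J = "Pow {..<n} \<times> {..<p}"
  let ?rT = "\<lambda>c. wclass (rn p) (WD n) (\<lambda>d j. if j < p then wpoly n c d j else 0)"
  define R where "R c = (let x = r (\<lambda>k. c (Inl k)) in (x, recentre p n (\<rho> x) (?rT (\<lambda>k. c (Inr k)))))" for c
  have "coords (fibre_product X ?T \<rho> base) (I <+> ?J) (\<lambda>(x, \<gamma>). case_sum (i x) (weil_coord n (\<lambda>x j. x j) \<gamma>)) R"
    unfolding coords_def
  proof (intro conjI ballI allI impI)
    show "finite (I <+> ?J)" using coords_finite[OF X] by simp
  next
    fix c t assume c: "c \<in> curves (fibre_product X ?T \<rho> base)"
    then show "c t \<in> points (fibre_product X ?T \<rho> base)"
      using coords_curve_points[OF X, of "fst \<circ> c" t] coords_curve_points[OF T, of "snd \<circ> c" t]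
      by (auto simp: fibre_product_def split_beta)
  next
    fix c k assume c: "c \<in> curves (fibre_product X ?T \<rho> base)" and "k \<in> I <+> ?J"
    then show "smooth (\<lambda>t. (case c t of (x, \<gamma>) \<Rightarrow> case_sum (i x) (weil_coord n (\<lambda>x j. x j) \<gamma>)) k)"
      using coords_curve_smooth[OF X, of "fst \<circ> c"] coords_curve_smooth[OF T, of "snd \<circ> c"]
      by (auto simp: fibre_product_def split_beta)
  next
    fix C :: "real \<Rightarrow> _ + _ \<Rightarrow> real" assume C: "\<forall>k\<in>I <+> ?J. smooth (\<lambda>t. C t k)"
    have 1: "(\<lambda>t. r (\<lambda>k. C t (Inl k))) \<in> curves X"
      by (rule coords_retract_curve[OF X]) (use C in auto)
    have 2: "(\<lambda>t. ?rT (\<lambda>k. C t (Inr k))) \<in> curves ?T"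
      by (rule coords_retract_curve[OF T]) (use C in auto)
    note 3 = smooth_maps_curve[OF \<rho> 1]
    show "(\<lambda>t. R (C t)) \<in> curves (fibre_product X ?T \<rho> base)"
      using 1 recentre_curve[OF 3 2] 3 coords_curve_points[OF T 2]
      by (auto simp: fibre_product_def R_def Let_def o_def base_recentre curves_rn)
  next
    fix z assume z: "z \<in> points (fibre_product X ?T \<rho> base)"
    then obtain x \<gamma> where x: "z = (x, \<gamma>)" "x \<in> points X" "\<gamma> \<in> points ?T" "\<rho> x = base \<gamma>"
      by (auto simp: fibre_product_def)
    then show "R (case z of (x, \<gamma>) \<Rightarrow> case_sum (i x) (weil_coord n (\<lambda>x j. x j) \<gamma>)) = z"
      using coords_retract[OF X x(2)] coords_retract[OF T x(3)]
      by (simp add: R_def Let_def recentre_base cong: if_cong)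
  next
    fix c c' :: "_ + _ \<Rightarrow> real" assume e: "\<forall>k\<in>I <+> ?J. c k = c' k"
    have "r (\<lambda>k. c (Inl k)) = r (\<lambda>k. c' (Inl k))"
      by (rule coords_cong[OF X]) (use e in auto)
    moreover have "?rT (\<lambda>k. c (Inr k)) = ?rT (\<lambda>k. c' (Inr k))"
      by (rule coords_cong[OF T]) (use e in auto)
    ultimately show "R c = R c'" by (simp add: R_def)
  qed
  then show ?thesis by blast
qed

text \<open>The coordinates of the fibre product are those of its factors side by side, so
  equivalence into it is equivalence of both components. This makes the description in
  \<open>wpair\<close> denote.\<close>

lemma wpair_wclass:
  assumes X: "coords X I i r" and \<rho>: "\<rho> \<in> smooth_maps X (rn p)"
    and f: "f \<in> smooth_maps (rn (length ms)) X" and g: "g \<in> smooth_maps (rn (length ms)) (tensor (rn p) (WD n))"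
    and fg: "\<And>e. e \<in> points (rn (length ms)) \<Longrightarrow> \<rho> (f e) = base (g e)"
  shows "wpair X (tensor (rn p) (WD n)) \<rho> base (weil ms) (wclass X (weil ms) f) (wclass (tensor (rn p) (WD n)) (weil ms) g) =
    wclass (fibre_product X (tensor (rn p) (WD n)) \<rho> base) (weil ms) (\<lambda>e. (f e, g e))"
    and "(\<lambda>e. (f e, g e)) \<in> smooth_maps (rn (length ms)) (fibre_product X (tensor (rn p) (WD n)) \<rho> base)"
proof -
  let ?T = "tensor (rn p) (WD n)" and ?P = "fibre_product X (tensor (rn p) (WD n)) \<rho> base"
  note T = coords_tensor[OF coords_rn[of p], of n]
  show fgm: "(\<lambda>e. (f e, g e)) \<in> smooth_maps (rn (length ms)) ?P"
  proof (rule smooth_mapsI)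
    fix e assume "e \<in> points (rn (length ms))"
    then show "(f e, g e) \<in> points ?P"
      using smooth_maps_point[OF f] smooth_maps_point[OF g] fg by (simp add: fibre_product_def)
  next
    fix c assume "c \<in> curves (rn (length ms))"
    then show "(\<lambda>t. (f (c t), g (c t))) \<in> curves ?P"
      using smooth_maps_curve[OF f] smooth_maps_curve[OF g] fg by (simp add: fibre_product_def o_def curves_rn)
  qed
  have p1: "fst \<in> smooth_maps ?P X" and p2: "snd \<in> smooth_maps ?P ?T"
    by (auto intro!: smooth_mapsI simp: fibre_product_def o_def)
  show "wpair X ?T \<rho> base (weil ms) (wclass X (weil ms) f) (wclass ?T (weil ms) g) = wclass ?P (weil ms) (\<lambda>e. (f e, g e))"
    unfolding wpair_def
  proof (rule the_equality)
    show "wclass ?P (weil ms) (\<lambda>e. (f e, g e)) \<in> points (tensor ?P (weil ms)) \<and>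
      prolong X (weil ms) fst (wclass ?P (weil ms) (\<lambda>e. (f e, g e))) = wclass X (weil ms) f \<and>
      prolong ?T (weil ms) snd (wclass ?P (weil ms) (\<lambda>e. (f e, g e))) = wclass ?T (weil ms) g"
      using tensor_points[OF fgm] prolong_wclass[OF fgm p1] prolong_wclass[OF fgm p2] by simp
    fix \<zeta> assume z: "\<zeta> \<in> points (tensor ?P (weil ms)) \<and>
      prolong X (weil ms) fst \<zeta> = wclass X (weil ms) f \<and> prolong ?T (weil ms) snd \<zeta> = wclass ?T (weil ms) g"
    note zm = tensor_point_map[OF conjunct1[OF z]]
    note z1 = smooth_maps_comp'[OF zm(1) p1] and z2 = smooth_maps_comp'[OF zm(1) p2]
    obtain R where P: "coords ?P (I <+> (Pow {..<n} \<times> {..<p})) (\<lambda>(x, \<gamma>). case_sum (i x) (weil_coord n (\<lambda>x j. x j) \<gamma>)) R"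
      using coords_fibre_product[OF X \<rho>] by blast
    have "wclass X (weil ms) (\<lambda>e. fst (\<zeta> e)) = wclass X (weil ms) f"
      "wclass ?T (weil ms) (\<lambda>e. snd (\<zeta> e)) = wclass ?T (weil ms) g"
      using z by (simp_all add: prolong_def o_def)
    then have "equiv_mod X (weil ms) (\<lambda>e. fst (\<zeta> e)) f" "equiv_mod ?T (weil ms) (\<lambda>e. snd (\<zeta> e)) g"
      using wclass_eq_iff[OF z1 f] wclass_eq_iff[OF z2 g] by simp_all
    then have "equiv_mod ?P (weil ms) \<zeta> (\<lambda>e. (f e, g e))"
      unfolding coords_equiv_iff[OF P zm(1) fgm] coords_equiv_iff[OF X z1 f] coords_equiv_iff[OF T z2 g]
      by (auto simp: split_beta)
    then show "\<zeta> = wclass ?P (weil ms) (\<lambda>e. (f e, g e))"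
      using wclass_eq_iff[OF zm(1) fgm] zm(2) by simp
  qed
qed

subsection \<open>Maps of infinitesimal objects\<close>

text \<open>A multiple of a square-zero variable is square-zero. Scalings, permutations, inclusions,
  projections, \<open>kappa\<close> and \<open>mu\<close> all have components of this form.\<close>

lemma inf_map_DobjI:
  assumes p: "\<And>x. x \<in> points (rn (length ms)) \<Longrightarrow> u x \<in> points (rn n)"
    and s: "\<And>i. (\<lambda>x. u x i) \<in> sf (length ms)"
    and q: "\<And>i. i < n \<Longrightarrow> (\<exists>j h. j < length ms \<and> ms ! j = 1 \<and> h \<in> sf (length ms) \<and>
      (\<forall>x\<in>points (rn (length ms)). u x i = h x * x j)) \<or> (\<forall>x\<in>points (rn (length ms)). u x i = 0)"
  shows "inf_map ms (Dobj n) u"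
  unfolding inf_map_def
proof (intro conjI ballI allI impI)
  fix i assume "i < length (Dobj n)"
  then have i: "i < n" by simp
  from q[OF i] show "(\<lambda>x. u x i ^ (Dobj n ! i + 1)) \<in> weil_ideal ms"
  proof
    assume "\<exists>j h. j < length ms \<and> ms ! j = 1 \<and> h \<in> sf (length ms) \<and> (\<forall>x\<in>points (rn (length ms)). u x i = h x * x j)"
    then obtain j h where j: "j < length ms" "ms ! j = 1" "h \<in> sf (length ms)"
      "\<And>x. x \<in> points (rn (length ms)) \<Longrightarrow> u x i = h x * x j" by blast
    show ?thesis
      by (rule weil_ideal_cong[OF weil_ideal_mult[OF weil_ideal_gen[OF j(1)] sf_power[OF j(3), of 2]]])
        (use i j(2,4) in \<open>simp add: power_mult_distrib numeral_2_eq_2\<close>)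
  next
    assume "\<forall>x\<in>points (rn (length ms)). u x i = 0"
    then show ?thesis by (intro weil_ideal_cong[OF weil_ideal_0]) (simp add: i)
  qed
qed (use p s in auto)

lemma inf_map_coordI:
  assumes p: "\<And>x. x \<in> points (rn m) \<Longrightarrow> u x \<in> points (rn n)"
    and q: "\<And>i. (\<exists>j h. j < m \<and> h \<in> sf m \<and> (\<forall>x. u x i = h x * x j)) \<or> (\<forall>x\<in>points (rn m). u x i = 0)"
  shows "inf_map (Dobj m) (Dobj n) u"
proof (rule inf_map_DobjI)
  show "(\<lambda>x. u x i) \<in> sf (length (Dobj m))" for i
    using q[of i]
  proof
    assume "\<exists>j h. j < m \<and> h \<in> sf m \<and> (\<forall>x. u x i = h x * x j)"
    then obtain j h where j: "h \<in> sf m" "\<And>x. u x i = h x * x j" by blast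
    show ?thesis using sf_mult[OF j(1) sf_coord[of j]] by (simp add: j(2))
  next
    assume "\<forall>x\<in>points (rn m). u x i = 0"
    then show ?thesis by (intro sf_cong[OF sf_const[of 0]]) simp
  qed
  fix i assume "i < n"
  from q[of i] show "(\<exists>j h. j < length (Dobj m) \<and> Dobj m ! j = 1 \<and> h \<in> sf (length (Dobj m)) \<and>
      (\<forall>x\<in>points (rn (length (Dobj m))). u x i = h x * x j)) \<or> (\<forall>x\<in>points (rn (length (Dobj m))). u x i = 0)"
    by (elim disjE exE) auto
qed (use p in simp)

lemma inf_map_scale: "i < n \<Longrightarrow> inf_map (Dobj n) (Dobj n) (\<lambda>d. d(i := \<alpha> * d i))"
proof (rule inf_map_coordI)
  assume i: "i < n"
  show "(\<exists>j' h. j' < n \<and> h \<in> sf n \<and> (\<forall>x. (x(i := \<alpha> * x i)) j = h x * x j')) \<or> (\<forall>x\<in>points (rn n). (x(i := \<alpha> * x i)) j = 0)" for j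
  proof (cases "j < n")
    case True
    have "(\<lambda>x. if j = i then \<alpha> else 1) \<in> sf n" by (rule sf_const)
    moreover have "\<forall>x. (x(i := \<alpha> * x i)) j = (if j = i then \<alpha> else 1) * x j" by simp
    ultimately show ?thesis using True by blast
  qed (use i in \<open>auto simp: points_rn\<close>)
qed (auto simp: points_rn)

lemma inf_map_coord_map:
  assumes "\<And>x. x \<in> points (rn m) \<Longrightarrow> u x \<in> points (rn n)" "\<And>i. i < n \<Longrightarrow> (\<exists>j<m. \<forall>x. u x i = x j) \<or> (\<forall>x\<in>points (rn m). u x i = 0)"
  shows "inf_map (Dobj m) (Dobj n) u"
proof (rule inf_map_coordI[OF assms(1)])
  show "(\<exists>j h. j < m \<and> h \<in> sf m \<and> (\<forall>x. u x i = h x * x j)) \<or> (\<forall>x\<in>points (rn m). u x i = 0)" for i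
  proof (cases "i < n")
    case True
    from assms(2)[OF this] show ?thesis
    proof
      assume "\<exists>j<m. \<forall>x. u x i = x j"
      then obtain j where "j < m" "\<forall>x. u x i = 1 * x j" by auto
      with sf_const[of 1 m] show ?thesis by blast
    qed blast
  qed (use assms(1) in \<open>auto simp: points_rn\<close>)
qed

lemma inf_map_permute: "\<sigma> permutes {..<n} \<Longrightarrow> inf_map (Dobj n) (Dobj n) (\<lambda>d j. d (\<sigma> j))"
proof (rule inf_map_coord_map)
  assume s: "\<sigma> permutes {..<n}"
  show "(\<lambda>j. x (\<sigma> j)) \<in> points (rn n)" if "x \<in> points (rn n)" for x
    using that permutes_not_in[OF s] by (auto simp: points_rn)
  show "(\<exists>j<n. \<forall>x. x (\<sigma> i) = x j) \<or> (\<forall>x\<in>points (rn n). x (\<sigma> i) = 0)" if "i < n" for i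
    using permutes_in_image[OF s, of i] that by auto
qed

lemma inf_map_include: "inf_map (Dobj n) (Dobj (Suc n)) (\<lambda>d. d(n := 0))"
  by (rule inf_map_coord_map) (auto simp: points_rn less_Suc_eq)

lemma inf_map_project: "inf_map (Dobj (Suc n)) (Dobj n) (\<lambda>d. d(n := 0))"
  by (rule inf_map_coord_map) (auto simp: points_rn less_Suc_eq)

lemma inf_map_last: "inf_map (Dobj 1) (Dobj (Suc n)) (\<lambda>d i. if i = n then d 0 else 0)"
  by (rule inf_map_coord_map) (auto simp: points_rn)

lemma inf_map_kappa: "n \<ge> 1 \<Longrightarrow> inf_map (Dobj (Suc n)) (Dobj n) (kappa n)"
proof (rule inf_map_coordI)
  assume n: "n \<ge> 1"
  show "(\<exists>j h. j < Suc n \<and> h \<in> sf (Suc n) \<and> (\<forall>x. kappa n x i = h x * x j)) \<or> (\<forall>x\<in>points (rn (Suc n)). kappa n x i = 0)" for i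
  proof -
    consider "i < n - 1" | "i = n - 1" | "i \<ge> n" by linarith
    then show ?thesis
    proof cases
      case 1
      then have "\<forall>x. kappa n x i = 1 * x i" by (simp add: kappa_def)
      with 1 sf_const[of 1 "Suc n"] show ?thesis by (intro disjI1 exI[of _ i] exI[of _ "\<lambda>x. 1"]) auto
    next
      case 2
      then have "\<forall>x. kappa n x i = x (n - 1) * x n" using n by (simp add: kappa_def)
      with sf_coord[of "n - 1" "Suc n"] show ?thesis
        by (intro disjI1 exI[of _ n] exI[of _ "\<lambda>x. x (n - 1)"]) auto
    next
      case 3
      then show ?thesis using n by (auto simp: kappa_def points_rn)
    qed
  qed
  show "kappa n x \<in> points (rn n)" if "x \<in> points (rn (Suc n))" for x
    using that n by (auto simp: kappa_def points_rn)
qed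

lemma inf_map_mu: "i < n \<Longrightarrow> inf_map (Dobj n @ [m]) (Dobj n) (mu n i)"
proof (rule inf_map_DobjI)
  assume i: "i < n"
  let ?ms = "Dobj n @ [m]"
  show "mu n i x \<in> points (rn n)" if "x \<in> points (rn (length ?ms))" for x
    using i by (auto simp: mu_def points_rn)
  show "(\<lambda>x. mu n i x j) \<in> sf (length ?ms)" for j
    by (cases "j = i"; cases "j < n") (simp_all add: mu_def sf_coord sf_mult sf_const)
  fix j assume j: "j < n"
  have "(\<lambda>x. if j = i then x n else 1) \<in> sf (length ?ms)"
    by (cases "j = i") (simp_all add: sf_coord sf_const)
  moreover have "mu n i x j = (if j = i then x n else 1) * x j" for x
    using j by (simp add: mu_def)
  moreover have "?ms ! j = 1" using j by (simp add: nth_append)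
  ultimately show "(\<exists>j' h. j' < length ?ms \<and> ?ms ! j' = 1 \<and> h \<in> sf (length ?ms) \<and>
      (\<forall>x\<in>points (rn (length ?ms)). mu n i x j = h x * x j')) \<or> (\<forall>x\<in>points (rn (length ?ms)). mu n i x j = 0)"
    using j by (intro disjI1 exI[of _ j] exI[of _ "\<lambda>x. if j = i then x n else 1"]) auto
qed

lemma inf_map_WD_map: "inf_map (Dobj m) (Dobj n) u \<Longrightarrow> u \<in> smooth_maps (rn m) (rn n)"
  using inf_map_smooth_map[of "Dobj m" "Dobj n" u] by simp

lemma pull_WD: "f \<in> smooth_maps (rn n) X \<Longrightarrow> inf_map (Dobj m) (Dobj n) u \<Longrightarrow>
    pull X (WD m) u (wclass X (WD n) f) = wclass X (WD m) (\<lambda>x. f (u x))"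
  using pull_wclass[of f "Dobj n" X "Dobj m" u] by simp

lemma prolong_WD: "f \<in> smooth_maps (rn n) X \<Longrightarrow> g \<in> smooth_maps X Y \<Longrightarrow>
    prolong Y (WD n) g (wclass X (WD n) f) = wclass Y (WD n) (\<lambda>x. g (f x))"
  using prolong_wclass[of f "Dobj n" X g Y] by simp

lemma prolong_pull:
  assumes \<gamma>: "\<gamma> \<in> points (tensor X (WD n))" and g: "g \<in> smooth_maps X Y" and u: "inf_map (Dobj m) (Dobj n) u"
  shows "prolong Y (WD m) g (pull X (WD m) u \<gamma>) = pull Y (WD m) u (prolong Y (WD n) g \<gamma>)"
proof -
  note gm = tensor_WD_map[OF \<gamma>]
  have "prolong Y (WD m) g (pull X (WD m) u \<gamma>) = wclass Y (WD m) (\<lambda>x. g (\<gamma> (u x)))"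
    unfolding pull_def o_def by (rule prolong_WD[OF smooth_maps_comp'[OF inf_map_WD_map[OF u] gm] g])
  also have "\<dots> = pull Y (WD m) u (prolong Y (WD n) g \<gamma>)"
    unfolding prolong_def o_def by (rule pull_WD[OF smooth_maps_comp'[OF gm g] u, symmetric])
  finally show ?thesis .
qed

lemma pull_points: "\<gamma> \<in> points (tensor X (WD n)) \<Longrightarrow> inf_map (Dobj m) (Dobj n) u \<Longrightarrow> pull X (WD m) u \<gamma> \<in> points (tensor X (WD m))"
  unfolding pull_def o_def by (intro tensor_WD_points smooth_maps_comp'[OF inf_map_WD_map tensor_WD_map])

lemma pull_fibre:
  assumes X: "coords X I i r" and \<gamma>: "\<gamma> \<in> points (fibre X (WD n) b)" and u: "inf_map (Dobj m) (Dobj n) u" "u (\<lambda>_. 0) = (\<lambda>_. 0)"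
  shows "pull X (WD m) u \<gamma> \<in> points (fibre X (WD m) b)"
proof -
  have g: "\<gamma> \<in> points (tensor X (WD n))" "\<gamma> (\<lambda>_. 0) = b" using \<gamma> by (simp_all add: fibre_points base_def)
  have "base (pull X (WD m) u \<gamma>) = b"
    unfolding pull_def o_def
    using base_wclass_WD[OF X smooth_maps_comp'[OF inf_map_WD_map[OF u(1)] tensor_WD_map[OF g(1)]]] u(2) g(2) by simp
  with pull_points[OF g(1) u(1)] show ?thesis by (simp add: fibre_points)
qed

lemma prolong_fibre:
  assumes Y: "coords Y I i r" and g: "g \<in> smooth_maps X Y" and \<gamma>: "\<gamma> \<in> points (fibre X (WD n) b)"
  shows "prolong Y (WD n) g \<gamma> \<in> points (fibre Y (WD n) (g b))"
proof -
  have gm: "\<gamma> \<in> smooth_maps (rn n) X" "\<gamma> (\<lambda>_. 0) = b" using \<gamma> tensor_WD_map by (auto simp: fibre_points base_def)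
  show ?thesis
    using tensor_WD_points[OF smooth_maps_comp'[OF gm(1) g]] base_wclass_WD[OF Y smooth_maps_comp'[OF gm(1) g]] gm(2)
    by (simp add: fibre_points prolong_def o_def)
qed

section \<open>Lifts induced by sections\<close>

text \<open>Composition with \<open>g\<close> as a lift over \<open>g b\<close>. With a jet space
  for \<open>Y\<close> and n = 1 this is the top level of the jet of a section, with the total space
  for \<open>Y\<close> its tangential; the axioms common to both are proved here once.\<close>

definition section_lift :: "nat \<Rightarrow> 'y space \<Rightarrow> nat \<Rightarrow> ((nat \<Rightarrow> real) \<Rightarrow> 'y) \<Rightarrow> (nat \<Rightarrow> real) \<Rightarrow> (nat \<Rightarrow> real, 'y) lift" where
  "section_lift p Y n g b = (g b, restrict (prolong Y (WD n) g) (points (fibre (rn p) (WD n) b)))"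

context
  fixes p :: nat and Y :: "'y space" and I :: "'i set" and i :: "'y \<Rightarrow> 'i \<Rightarrow> real" and r g \<rho> b
  assumes Y: "coords Y I i r" and g: "g \<in> smooth_maps (rn p) Y" and \<rho>: "\<rho> \<in> smooth_maps Y (rn p)"
    and \<rho>g: "\<And>x. x \<in> points (rn p) \<Longrightarrow> \<rho> (g x) = x" and b: "b \<in> points (rn p)"
begin

private lemma fib: "fibre (rn p) A (\<rho> (g b)) = fibre (rn p) A b"
  by (simp add: \<rho>g b)

lemma prolong_section:
  assumes "t \<in> points (tensor (rn p) (WD n))"
  shows "prolong (rn p) (WD n) \<rho> (prolong Y (WD n) g t) = t"
proof -
  note tm = tensor_WD_map[OF assms]
  have "prolong (rn p) (WD n) \<rho> (prolong Y (WD n) g t) = wclass (rn p) (WD n) (\<lambda>x. \<rho> (g (t x)))"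
    unfolding prolong_def[of Y] o_def by (rule prolong_WD[OF smooth_maps_comp'[OF tm g] \<rho>])
  also have "\<dots> = wclass (rn p) (WD n) t"
    by (rule wclass_WD_cong[symmetric, OF tm]) (simp add: \<rho>g smooth_maps_point[OF tm])
  finally show ?thesis using tensor_point_map(2)[OF assms] by simp
qed

lemma section_lift_smooth:
  "restrict (prolong Y (WD n) g) (points (fibre (rn p) (WD n) b)) \<in> smooth_maps (fibre (rn p) (WD n) b) (fibre Y (WD n) (g b))"
proof (rule smooth_mapsI)
  fix c assume c: "c \<in> curves (fibre (rn p) (WD n) b)"
  then have cp: "c t \<in> points (fibre (rn p) (WD n) b)" for t
    using coords_curve_points[OF coords_tensor[OF coords_rn]] by (auto simp: fibre_points fibre_curves)
  then show "(\<lambda>t. restrict (prolong Y (WD n) g) (points (fibre (rn p) (WD n) b)) (c t)) \<in> curves (fibre Y (WD n) (g b))"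
    using smooth_maps_curve[OF prolong_smooth[OF g]] c prolong_fibre[OF Y g cp]
    by (simp add: fibre_curves fibre_points)
qed (use prolong_fibre[OF Y g] in simp)

lemma section_lift_is_lift: "is_lift (rn p) Y \<rho> (WD n) (section_lift p Y n g b)"
  unfolding is_lift_def section_lift_def split_conv fib
  using smooth_maps_point[OF g b] section_lift_smooth[of n] prolong_section
  by (simp add: fibre_points)

lemma section_lift_homogeneous:
  assumes "k < n" shows "homogeneous (rn p) Y \<rho> n k (section_lift p Y n g b)"
  unfolding homogeneous_def section_lift_def split_conv fib
proof (intro allI ballI)
  fix \<alpha> t assume t: "t \<in> points (fibre (rn p) (WD n) b)"
  then have "scale (rn p) n k \<alpha> t \<in> points (fibre (rn p) (WD n) b)"
    unfolding scale_def by (rule pull_fibre[OF coords_rn _ inf_map_scale[OF assms]]) auto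
  with t show "restrict (prolong Y (WD n) g) (points (fibre (rn p) (WD n) b)) (scale (rn p) n k \<alpha> t) =
    scale Y n k \<alpha> (restrict (prolong Y (WD n) g) (points (fibre (rn p) (WD n) b)) t)"
    using prolong_pull[OF _ g inf_map_scale[OF assms]] by (simp add: scale_def fibre_points)
qed

lemma section_lift_permute:
  assumes "\<sigma> permutes {..<n}" and t: "t \<in> points (fibre (rn p) (WD n) b)"
  shows "snd (section_lift p Y n g b) (permute (rn p) n \<sigma> t) = permute Y n \<sigma> (snd (section_lift p Y n g b) t)"
proof -
  have "permute (rn p) n \<sigma> t \<in> points (fibre (rn p) (WD n) b)"
    unfolding permute_def by (rule pull_fibre[OF coords_rn t inf_map_permute[OF assms(1)]]) auto
  with t show ?thesis
    using prolong_pull[OF _ g inf_map_permute[OF assms(1)]] by (simp add: section_lift_def permute_def fibre_points)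
qed

text \<open>Both sides are the class of the family sending \<open>d\<close> and \<open>e\<close> to
  \<open>g (t (mu n k (vappend n d e)))\<close>. What needs care is that the curried argument is a
  map into the fibre, so that \<open>to_subspace\<close> applies.\<close>

lemma section_lift_inf_homogeneous:
  assumes k: "k < n" shows "inf_homogeneous (rn p) Y \<rho> n k m (section_lift p Y n g b)"
  unfolding inf_homogeneous_def section_lift_def split_conv fib
proof (rule ballI)
  fix t assume t: "t \<in> points (fibre (rn p) (WD n) b)"
  let ?M = "rn p" and ?ms = "Dobj n @ [m]" and ?S = "fibre (rn p) (WD n) b"
  let ?F = "restrict (prolong Y (WD n) g) (points ?S)"
  have taylor_form: "t \<in> points (tensor ?M (WD n))" and t0: "t (\<lambda>_. 0) = b" using t by (simp_all add: fibre_points base_def)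
  note tm = tensor_WD_map[OF taylor_form]
  note mu = inf_map_mu[OF k, of m]
  have mm: "mu n k \<in> smooth_maps (rn (n + length [m])) (rn n)"
    using inf_map_smooth_map[OF mu] by simp
  let ?f = "\<lambda>x. t (mu n k x)"
  have fm: "?f \<in> smooth_maps (rn (n + length [m])) ?M" by (rule smooth_maps_comp'[OF mm tm])
  have gfm: "(\<lambda>x. g (?f x)) \<in> smooth_maps (rn (n + length [m])) Y" by (rule smooth_maps_comp'[OF fm g])
  let ?\<Phi> = "\<lambda>e. wclass ?M (WD n) (\<lambda>d. ?f (vappend n d e))"
  have \<Phi>T: "?\<Phi> \<in> smooth_maps (rn (length [m])) (tensor ?M (WD n))"
    by (rule tensor_family[OF coords_rn fm])
  \<comment> \<open>At d = 0 the map \<open>mu\<close> vanishes for every value of the additional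
    variable, so the whole family stays in the fibre over \<open>b\<close>.\<close>
  have mu0: "mu n k (vappend n (\<lambda>_. 0) e) = (\<lambda>_. 0)" for e
    using k by (auto simp: mu_def vappend_def)
  have base: "base (?\<Phi> e) = b" if "e \<in> points (rn (length [m]))" for e
    using base_wclass_WD[OF coords_rn smooth_maps_vappend_left[OF coords_rn fm that]] by (simp add: mu0 t0)
  have \<Phi>: "?\<Phi> \<in> smooth_maps (rn (length [m])) ?S"
    using smooth_maps_point[OF \<Phi>T] smooth_maps_curve[OF \<Phi>T] base
    by (intro smooth_mapsI) (auto simp: fibre_points fibre_curves curves_rn)
  have F: "?F \<in> smooth_maps ?S (tensor Y (WD n))"
    using smooth_maps_point[OF section_lift_smooth[of n]] smooth_maps_curve[OF section_lift_smooth[of n]]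
    by (intro smooth_mapsI) (auto simp: fibre_points[of _ Y] fibre_curves[of _ Y])
  have "wcurry ?M (Dobj n) [m] (pull ?M (weil ?ms) (mu n k) t) = wclass (tensor ?M (WD n)) (weil [m]) ?\<Phi>"
    unfolding pull_def o_def by (rule wcurry_wclass[OF coords_rn fm])
  then have "prolong (tensor Y (WD n)) (weil [m]) ?F (to_subspace ?S (tensor ?M (WD n)) (weil [m])
      (wcurry ?M (Dobj n) [m] (pull ?M (weil ?ms) (mu n k) t))) = wclass (tensor Y (WD n)) (weil [m]) (\<lambda>e. ?F (?\<Phi> e))"
    using to_subspace_wclass[OF b \<Phi>] prolong_wclass[OF \<Phi> F] by simp
  also have "\<dots> = wclass (tensor Y (WD n)) (weil [m]) (\<lambda>e. wclass Y (WD n) (\<lambda>d. g (?f (vappend n d e))))"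
  proof (rule wclass_cong[OF smooth_maps_comp'[OF \<Phi> F]])
    fix e assume e: "e \<in> points (rn (length [m]))"
    show "?F (?\<Phi> e) = wclass Y (WD n) (\<lambda>d. g (?f (vappend n d e)))"
      using smooth_maps_point[OF \<Phi> e] prolong_WD[OF smooth_maps_vappend_left[OF coords_rn fm e] g] by simp
  qed
  also have "\<dots> = wcurry Y (Dobj n) [m] (wclass Y (weil ?ms) (\<lambda>x. g (?f x)))"
    by (rule wcurry_wclass[OF Y gfm, symmetric])
  also have "wclass Y (weil ?ms) (\<lambda>x. g (?f x)) = pull Y (weil ?ms) (mu n k) (?F t)"
    using pull_wclass[of "\<lambda>x. g (t x)" "Dobj n" Y ?ms "mu n k"] smooth_maps_comp'[OF tm g] mu t
    by (simp add: prolong_def o_def)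
  finally show "prolong (tensor Y (WD n)) (weil [m]) ?F (to_subspace ?S (tensor ?M (WD n)) (weil [m])
      (wcurry ?M (Dobj n) [m] (pull ?M (weil ?ms) (mu n k) t))) = wcurry Y (Dobj n) [m] (pull Y (weil ?ms) (mu n k) (?F t))" .
qed

end

subsection \<open>Taylor polynomials\<close>

lemma pds_shift:
  assumes "f \<in> sf k" "x \<in> points (rn k)" "y \<in> points (rn k)" "set L \<subseteq> {..<k}"
  shows "pds L (\<lambda>y. f (\<lambda>l. y l + x l)) y = pds L f (\<lambda>l. y l + x l)"
  using assms(3,4)
proof (induction L arbitrary: y)
  case (Cons i L)
  have "pds (i # L) (\<lambda>y. f (\<lambda>l. y l + x l)) y = pd i (\<lambda>y. pds L f (\<lambda>l. y l + x l)) y"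
    unfolding pds.simps by (rule pd_cong[OF Cons.IH]) (use Cons.prems in auto)
  also have "\<dots> = pds (i # L) f (\<lambda>l. y l + x l)"
    unfolding pds.simps by (rule pd_shift[OF pds_sf[OF assms(1)] assms(2)]) (use Cons.prems in auto)
  finally show ?case .
qed simp

text \<open>The homogeneous polynomial whose derivatives of order m are the numbers
  \<open>B \<alpha>\<close>, in case \<open>B\<close> is symmetric. The sum runs over all lists of
  indices, from the last entry to the first, and the divisions accumulate to the factorial of
  m.\<close>

primrec taylor_form :: "nat \<Rightarrow> nat \<Rightarrow> (nat list \<Rightarrow> real) \<Rightarrow> (nat \<Rightarrow> real) \<Rightarrow> real" where
  "taylor_form p 0 B x = B []"
| "taylor_form p (Suc m) B x = (\<Sum>k<p. x k * taylor_form p m (\<lambda>\<alpha>. B (\<alpha> @ [k])) x) / real (Suc m)"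

text \<open>Invariance under exchanges of neighbours is enough for invariance under permutations,
  and it is the form in which commuting derivatives and the symmetry condition on jets deliver
  it.\<close>

definition symm :: "nat \<Rightarrow> nat \<Rightarrow> (nat list \<Rightarrow> real) \<Rightarrow> bool" where
  "symm p N B \<longleftrightarrow> (\<forall>A k l C. set (A @ k # l # C) \<subseteq> {..<p} \<longrightarrow> length (A @ k # l # C) \<le> N \<longrightarrow>
    B (A @ k # l # C) = B (A @ l # k # C))"

lemma symmD: "symm p N B \<Longrightarrow> set (A @ k # l # C) \<subseteq> {..<p} \<Longrightarrow> length (A @ k # l # C) \<le> N \<Longrightarrow>
    B (A @ k # l # C) = B (A @ l # k # C)"
  unfolding symm_def by blast

lemma symm_append:
  assumes "symm p N B" "set \<alpha> \<subseteq> {..<p}" "length \<alpha> \<le> N"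
  shows "symm p (N - length \<alpha>) (\<lambda>\<beta>. B (\<beta> @ \<alpha>))"
  unfolding symm_def
proof (intro allI impI)
  fix A k l C assume "set (A @ k # l # C) \<subseteq> {..<p}" "length (A @ k # l # C) \<le> N - length \<alpha>"
  with symmD[OF assms(1), of A k l "C @ \<alpha>"] assms(2,3) show "B ((A @ k # l # C) @ \<alpha>) = B ((A @ l # k # C) @ \<alpha>)"
    by simp
qed

lemma symm_mono: "symm p N B \<Longrightarrow> M \<le> N \<Longrightarrow> symm p M B"
  unfolding symm_def by (meson le_trans)

lemma taylor_form_cong:
  assumes "\<And>\<alpha>. set \<alpha> \<subseteq> {..<p} \<Longrightarrow> length \<alpha> = m \<Longrightarrow> B \<alpha> = B' \<alpha>"
  shows "taylor_form p m B x = taylor_form p m B' x"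
  using assms
proof (induction m arbitrary: B B')
  case (Suc m)
  have "taylor_form p m (\<lambda>\<alpha>. B (\<alpha> @ [k])) x = taylor_form p m (\<lambda>\<alpha>. B' (\<alpha> @ [k])) x" if "k < p" for k
    by (rule Suc.IH) (use Suc.prems that in simp)
  then show ?case by simp
qed simp

lemma sf_taylor_form: "taylor_form p m B \<in> sf p"
proof (induction m arbitrary: B)
  case 0
  then show ?case using sf_const[of "B []"] by (simp add: taylor_form.simps(1)[abs_def])
next
  case (Suc m)
  have "(\<lambda>x. (\<Sum>k<p. x k * taylor_form p m (\<lambda>\<alpha>. B (\<alpha> @ [k])) x) * (1 / real (Suc m))) \<in> sf p"
    by (intro sf_mult sf_sum sf_coord sf_const Suc)
  then show ?case by (simp add: taylor_form.simps(2)[abs_def])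
qed

lemma taylor_form_smooth:
  assumes "\<And>\<alpha>. set \<alpha> \<subseteq> {..<p} \<Longrightarrow> length \<alpha> = m \<Longrightarrow> smooth (\<lambda>t. C t \<alpha>)" and c: "\<And>k. smooth (\<lambda>t. c t k)"
  shows "smooth (\<lambda>t. taylor_form p m (C t) (c t))"
  using assms(1)
proof (induction m arbitrary: C)
  case (Suc m)
  have "smooth (\<lambda>t. taylor_form p m (\<lambda>\<alpha>. C t (\<alpha> @ [k])) (c t))" if "k < p" for k
    by (rule Suc.IH) (use Suc.prems that in auto)
  then have "smooth (\<lambda>t. (\<Sum>k<p. c t k * taylor_form p m (\<lambda>\<alpha>. C t (\<alpha> @ [k])) (c t)) * (1 / real (Suc m)))"
    by (intro smooth_mult[OF smooth_sum smooth_const] smooth_mult[OF c]) auto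
  then show ?case by simp
qed simp

text \<open>By the product rule the derivative consists of the form \<open>g l\<close> of one degree
  less and of the sum of \<open>x k * pd l (g k) x\<close>. Symmetry and the induction hypothesis
  turn the latter into m copies of \<open>g l\<close>, and the denominator m + 1 cancels.\<close>

lemma pd_taylor_form:
  assumes "symm p m B" "l < p" "x \<in> points (rn p)"
  shows "pd l (taylor_form p m B) x = (case m of 0 \<Rightarrow> 0 | Suc m' \<Rightarrow> taylor_form p m' (\<lambda>\<alpha>. B (\<alpha> @ [l])) x)"
  using assms(1)
proof (induction m arbitrary: B)
  case 0
  then show ?case by (simp add: taylor_form.simps(1)[abs_def] pd_const)
next
  case (Suc m)
  define v where "v = 1 / real (Suc m)"
  define g where "g k = taylor_form p m (\<lambda>\<alpha>. B (\<alpha> @ [k]))" for k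
  have g: "g k \<in> sf p" for k unfolding g_def by (rule sf_taylor_form)
  have vg: "(\<lambda>x. v * g k x) \<in> sf p" for k by (intro sf_mult sf_const g)
  have "taylor_form p (Suc m) B = (\<lambda>x. \<Sum>k<p. x k * (v * g k x))"
    by (simp add: fun_eq_iff g_def v_def sum_divide_distrib)
  then have "pd l (taylor_form p (Suc m) B) x = pd l (\<lambda>x. \<Sum>k<p. x k * (v * g k x)) x" by simp
  also have "\<dots> = (\<Sum>k<p. pd l (\<lambda>x. x k * (v * g k x)) x)"
    by (rule pd_sum[OF _ assms(2,3)]) (intro sf_mult[OF sf_coord vg])
  also have "\<dots> = (\<Sum>k<p. (if l = k then v * g k x else 0) + v * (x k * pd l (g k) x))"
  proof (rule sum.cong)
    fix k
    have "pd l (\<lambda>x. v * g k x) x = v * pd l (g k) x"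
      using pd_mult[OF sf_const g assms(2,3), of v] by (simp add: pd_const)
    then show "pd l (\<lambda>x. x k * (v * g k x)) x = (if l = k then v * g k x else 0) + v * (x k * pd l (g k) x)"
      using pd_mult[OF sf_coord vg assms(2,3), of k k] by (simp add: pd_coord)
  qed simp
  also have "\<dots> = v * (g l x + (\<Sum>k<p. x k * pd l (g k) x))"
    using assms(2) by (simp add: sum.distrib sum.delta sum_distrib_left distrib_left)
  \<comment> \<open>Euler's relation for forms of degree m. By symmetry the derivative along
    \<open>l\<close> of \<open>g k\<close> is the contraction along \<open>k\<close> of
    \<open>g l\<close>.\<close>
  also have "(\<Sum>k<p. x k * pd l (g k) x) = real m * g l x"
  proof (cases m)
    case 0
    then show ?thesis by (simp add: g_def taylor_form.simps(1)[abs_def] pd_const)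
  next
    case (Suc m')
    have "pd l (g k) x = taylor_form p m' (\<lambda>\<alpha>. B ((\<alpha> @ [k]) @ [l])) x" if k: "k < p" for k
    proof -
      have "symm p m (\<lambda>\<alpha>. B (\<alpha> @ [k]))"
        using symm_append[OF Suc.prems, of "[k]"] k by simp
      from Suc.IH[OF this] have "pd l (g k) x = taylor_form p m' (\<lambda>\<alpha>. B (\<alpha> @ [l] @ [k])) x"
        by (simp add: g_def Suc del: taylor_form.simps)
      also have "\<dots> = taylor_form p m' (\<lambda>\<alpha>. B ((\<alpha> @ [k]) @ [l])) x"
      proof (rule taylor_form_cong)
        fix \<alpha> assume "set \<alpha> \<subseteq> {..<p}" "length \<alpha> = m'"
        with symmD[OF Suc.prems, of \<alpha> l k "[]"] k assms(2) Suc
        show "B (\<alpha> @ [l] @ [k]) = B ((\<alpha> @ [k]) @ [l])" by simp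
      qed
      finally show ?thesis .
    qed
    then have "(\<Sum>k<p. x k * pd l (g k) x) = (\<Sum>k<p. x k * taylor_form p m' (\<lambda>\<alpha>. B ((\<alpha> @ [k]) @ [l])) x)" by simp
    then show ?thesis by (simp add: g_def Suc)
  qed
  also have "v * (g l x + real m * g l x) = g l x"
    by (simp add: v_def field_simps)
  finally show ?case by (simp add: g_def)
qed

lemma pds_taylor_form:
  assumes B: "symm p m B" and "set \<alpha> \<subseteq> {..<p}" "x \<in> points (rn p)"
  shows "pds \<alpha> (taylor_form p m B) x = (if length \<alpha> \<le> m then taylor_form p (m - length \<alpha>) (\<lambda>\<beta>. B (\<beta> @ \<alpha>)) x else 0)"
  using assms(2,3)
proof (induction \<alpha> arbitrary: x)
  case (Cons k \<alpha>)
  then have k: "k < p" "set \<alpha> \<subseteq> {..<p}" by auto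
  have "pds (k # \<alpha>) (taylor_form p m B) x = pd k (\<lambda>x. if length \<alpha> \<le> m then taylor_form p (m - length \<alpha>) (\<lambda>\<beta>. B (\<beta> @ \<alpha>)) x else 0) x"
    unfolding pds.simps by (rule pd_cong[OF Cons.IH[OF k(2)] k(1) Cons.prems(2)])
  also have "\<dots> = (if length (k # \<alpha>) \<le> m then taylor_form p (m - length (k # \<alpha>)) (\<lambda>\<beta>. B (\<beta> @ k # \<alpha>)) x else 0)"
  proof (cases "length \<alpha> \<le> m")
    case True
    have "pd k (\<lambda>x. taylor_form p (m - length \<alpha>) (\<lambda>\<beta>. B (\<beta> @ \<alpha>)) x) x =
        (case m - length \<alpha> of 0 \<Rightarrow> 0 | Suc m' \<Rightarrow> taylor_form p m' (\<lambda>\<beta>. B ((\<beta> @ [k]) @ \<alpha>)) x)"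
      using pd_taylor_form[OF symm_append[OF B k(2) True] k(1) Cons.prems(2)] by simp
    with True show ?thesis by (auto split: nat.split simp: Suc_le_eq diff_Suc)
  qed (simp add: pd_const)
  finally show ?case .
qed simp

lemma taylor_form_at_0: "taylor_form p m B (\<lambda>_. 0) = (if m = 0 then B [] else 0)"
  by (cases m) auto

text \<open>After as many derivatives as \<open>\<alpha>\<close> has entries, lower degrees are gone
  and higher ones vanish at the origin.\<close>

lemma pds_tps_at_0:
  assumes B: "symm p n B" and \<alpha>: "set \<alpha> \<subseteq> {..<p}" "length \<alpha> \<le> n"
  shows "pds \<alpha> (\<lambda>x. \<Sum>m\<le>n. taylor_form p m B x) (\<lambda>_. 0) = B \<alpha>"
proof -
  have "pds \<alpha> (\<lambda>x. \<Sum>m\<le>n. taylor_form p m B x) (\<lambda>_. 0) = (\<Sum>m\<le>n. pds \<alpha> (taylor_form p m B) (\<lambda>_. 0))"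
    by (rule pds_sum[OF sf_taylor_form \<alpha>(1) zero_points])
  also have "\<dots> = (\<Sum>m\<le>n. if m = length \<alpha> then B \<alpha> else 0)"
  proof (rule sum.cong)
    fix m assume "m \<in> {..n}"
    then have "symm p m B" using symm_mono[OF B] by simp
    from pds_taylor_form[OF this \<alpha>(1) zero_points] show "pds \<alpha> (taylor_form p m B) (\<lambda>_. 0) = (if m = length \<alpha> then B \<alpha> else 0)"
      by (auto simp: taylor_form_at_0)
  qed simp
  finally show ?thesis using \<alpha>(2) by simp
qed

subsection \<open>Polynomial sections\<close>

lemma proj_points: "proj p x \<in> points (rn p)"
  by (simp add: proj_def points_rn)

lemma proj_smooth: "proj p \<in> smooth_maps (rn (p + q)) (rn p)"
proof (rule smooth_mapsI)
  fix c assume c: "c \<in> curves (rn (p + q))"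
  have "smooth (\<lambda>t. proj p (c t) j)" for j
    using c by (cases "j < p") (simp_all add: proj_def curves_rn smooth_const)
  then show "(\<lambda>t. proj p (c t)) \<in> curves (rn p)" by (simp add: curves_rn proj_points)
qed (rule proj_points)

definition sect :: "nat \<Rightarrow> nat \<Rightarrow> ((nat \<Rightarrow> real) \<Rightarrow> (nat \<Rightarrow> real)) \<Rightarrow> bool" where
  "sect p q s \<longleftrightarrow> s \<in> smooth_maps (rn p) (rn (p + q)) \<and> (\<forall>x\<in>points (rn p). proj p (s x) = x)"

lemma sect_map: "sect p q s \<Longrightarrow> s \<in> smooth_maps (rn p) (rn (p + q))"
  by (simp add: sect_def)

lemma sect_proj: "sect p q s \<Longrightarrow> x \<in> points (rn p) \<Longrightarrow> proj p (s x) = x"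
  by (simp add: sect_def)

lemma sect_sf: "sect p q s \<Longrightarrow> (\<lambda>x. s x j) \<in> sf p"
proof (cases "j < p + q")
  case False
  assume "sect p q s"
  then show ?thesis using smooth_maps_point[OF sect_map, of p q s] False
    by (intro sf_cong[OF sf_const[of 0]]) (auto simp: points_rn)
qed (use coords_smooth_map[OF coords_rn sect_map] in blast)

definition base_pt :: "nat \<Rightarrow> (nat list \<times> nat \<Rightarrow> real) \<Rightarrow> nat \<Rightarrow> real" where
  "base_pt p c = (\<lambda>j. if j < p then c ([], j) else 0)"

lemma base_pt_points: "base_pt p c \<in> points (rn p)"
  by (simp add: base_pt_def points_rn)

text \<open>The section whose Taylor coefficients at \<open>base_pt p c\<close> are given by \<open>c\<close>.\<close>

definition sec :: "nat \<Rightarrow> nat \<Rightarrow> nat \<Rightarrow> (nat list \<times> nat \<Rightarrow> real) \<Rightarrow> (nat \<Rightarrow> real) \<Rightarrow> nat \<Rightarrow> real" where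
  "sec p q n c x = (\<lambda>j. if j < p then x j else if j < p + q then
     \<Sum>m\<le>n. taylor_form p m (\<lambda>\<alpha>. c (\<alpha>, j)) (\<lambda>l. x l - base_pt p c l) else 0)"

text \<open>The index \<open>(\<alpha>, j)\<close> stands for the iterated partial derivative along \<open>\<alpha>\<close> of the component
  \<open>j\<close>. The components below \<open>p\<close> of a section are those of its argument, so they only contribute the base point.\<close>

definition jet_indices :: "nat \<Rightarrow> nat \<Rightarrow> nat \<Rightarrow> (nat list \<times> nat) set" where
  "jet_indices p q n = {(\<alpha>, j). set \<alpha> \<subseteq> {..<p} \<and> length \<alpha> \<le> n \<and> j < p + q \<and> (\<alpha> \<noteq> [] \<longrightarrow> p \<le> j)}"

lemma finite_jet_indices: "finite (jet_indices p q n)"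
proof (rule finite_subset)
  show "jet_indices p q n \<subseteq> {\<alpha>. set \<alpha> \<subseteq> {..<p} \<and> length \<alpha> \<le> n} \<times> {..<p + q}"
    by (auto simp: jet_indices_def)
  show "finite ({\<alpha>. set \<alpha> \<subseteq> {..<p} \<and> length \<alpha> \<le> n} \<times> {..<p + q})"
    by (intro finite_cartesian_product finite_lists_length_le) auto
qed

lemma sec_cong:
  assumes "\<And>k. k \<in> jet_indices p q n \<Longrightarrow> c k = c' k"
  shows "sec p q n c = sec p q n c'" "base_pt p c = base_pt p c'"
proof -
  show b: "base_pt p c = base_pt p c'" using assms by (auto simp: base_pt_def jet_indices_def)
  show "sec p q n c = sec p q n c'"
    unfolding sec_def b using assms
    by (auto simp: fun_eq_iff jet_indices_def intro!: sum.cong taylor_form_cong)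
qed

lemma sf_shift_minus: "f \<in> sf k \<Longrightarrow> x \<in> points (rn k) \<Longrightarrow> (\<lambda>y. f (\<lambda>l. y l - x l)) \<in> sf k"
  using sf_shift[of f k "\<lambda>l. - x l"] by (simp add: points_rn)

lemma sect_sec: "sect p q (sec p q n c)"
  unfolding sect_def coords_smooth_maps_iff[OF coords_rn]
proof (intro conjI ballI)
  fix j
  have "(\<lambda>x. \<Sum>m\<le>n. taylor_form p m (\<lambda>\<alpha>. c (\<alpha>, j)) (\<lambda>l. x l - base_pt p c l)) \<in> sf p"
    by (intro sf_sum sf_shift_minus sf_taylor_form base_pt_points)
  then show "(\<lambda>x. sec p q n c x j) \<in> sf p"
    by (cases "j < p"; cases "j < p + q") (simp_all add: sec_def sf_coord sf_const)
qed (auto simp: sec_def points_rn proj_def)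

definition sym_coeffs :: "nat \<Rightarrow> nat \<Rightarrow> nat \<Rightarrow> (nat list \<times> nat \<Rightarrow> real) \<Rightarrow> bool" where
  "sym_coeffs p q n c \<longleftrightarrow> (\<forall>j. p \<le> j \<longrightarrow> j < p + q \<longrightarrow> symm p n (\<lambda>\<alpha>. c (\<alpha>, j)))"

text \<open>Symmetry is the integrability condition on the coefficients. Conversely,
  \<open>sym_coeffs_pds\<close> shows that the derivatives of a section satisfy it.\<close>

lemma pds_sec:
  assumes c: "sym_coeffs p q n c" and \<alpha>: "(\<alpha>, j) \<in> jet_indices p q n"
  shows "pds \<alpha> (\<lambda>x. sec p q n c x j) (base_pt p c) = c (\<alpha>, j)"
proof (cases "j < p")
  case True
  with \<alpha> have "\<alpha> = []" by (auto simp: jet_indices_def)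
  with True show ?thesis by (simp add: sec_def base_pt_def)
next
  case False
  then have B: "symm p n (\<lambda>\<alpha>. c (\<alpha>, j))" and a: "set \<alpha> \<subseteq> {..<p}" "length \<alpha> \<le> n" "j < p + q"
    using c \<alpha> by (auto simp: sym_coeffs_def jet_indices_def)
  let ?f = "\<lambda>x. \<Sum>m\<le>n. taylor_form p m (\<lambda>\<alpha>. c (\<alpha>, j)) x"
  have f: "?f \<in> sf p" by (intro sf_sum sf_taylor_form)
  have nb: "(\<lambda>l. - base_pt p c l) \<in> points (rn p)" using base_pt_points[of p c] by (simp add: points_rn)
  have "(\<lambda>x. sec p q n c x j) = (\<lambda>x. ?f (\<lambda>l. x l + (- base_pt p c l)))"
    using False a by (simp add: sec_def)
  then have "pds \<alpha> (\<lambda>x. sec p q n c x j) (base_pt p c) = pds \<alpha> ?f (\<lambda>l. base_pt p c l + (- base_pt p c l))"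
    using pds_shift[OF f nb base_pt_points a(1)] by simp
  then show ?thesis using pds_tps_at_0[OF B a(1,2)] by simp
qed

lemma sym_coeffs_pds:
  assumes s: "sect p q s" and b: "b \<in> points (rn p)"
    and c: "\<And>\<alpha> j. (\<alpha>, j) \<in> jet_indices p q n \<Longrightarrow> c (\<alpha>, j) = pds \<alpha> (\<lambda>x. s x j) b"
  shows "sym_coeffs p q n c"
  unfolding sym_coeffs_def symm_def
proof (intro allI impI)
  fix j A k l C assume j: "p \<le> j" "j < p + q" and sl: "set (A @ k # l # C) \<subseteq> {..<p}" "length (A @ k # l # C) \<le> n"
  then have "(A @ k # l # C, j) \<in> jet_indices p q n" "(A @ l # k # C, j) \<in> jet_indices p q n" by (auto simp: jet_indices_def)
  with c show "c (A @ k # l # C, j) = c (A @ l # k # C, j)"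
    using pds_swap[OF sect_sf[OF s], of A C k l b j] sl b by auto
qed

subsection \<open>Families of sections\<close>

text \<open>The argument of the section and the \<open>l\<close> parameters are variables of one
  function, with the argument first. So derivatives in the argument can be formed by
  \<open>pds\<close> and remain smooth in the parameters.\<close>

definition fam :: "nat \<Rightarrow> nat \<Rightarrow> nat \<Rightarrow> ((nat \<Rightarrow> real) \<Rightarrow> (nat \<Rightarrow> real) \<Rightarrow> (nat \<Rightarrow> real)) \<Rightarrow> bool" where
  "fam p q l S \<longleftrightarrow> (\<forall>e\<in>points (rn l). sect p q (S e)) \<and>
     (\<forall>j. (\<lambda>y. S (\<lambda>i. y (p + i)) (\<lambda>i. if i < p then y i else 0) j) \<in> sf (p + l))"

lemma fam_sect: "fam p q l S \<Longrightarrow> e \<in> points (rn l) \<Longrightarrow> sect p q (S e)"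
  by (simp add: fam_def)

lemma sf_left: "f \<in> sf p \<Longrightarrow> (\<lambda>y. f (\<lambda>i. if i < p then y i else 0)) \<in> sf (p + l)"
proof (rule sf_compose[where u = "\<lambda>y i. if i < p then y i else 0"])
  show "(\<lambda>y. if i < p then y i else 0) \<in> sf (p + l)" for i
    by (cases "i < p") (simp_all add: sf_coord sf_const)
qed (auto simp: points_rn)

lemma sf_right: "f \<in> sf l \<Longrightarrow> (\<lambda>y. f (\<lambda>i. y (p + i))) \<in> sf (p + l)"
  by (rule sf_compose[where u = "\<lambda>y i. y (p + i)"]) (auto simp: points_rn sf_coord)

lemma fam_const: "sect p q s \<Longrightarrow> fam p q l (\<lambda>_. s)"
  using sf_left[OF sect_sf] by (simp add: fam_def)

lemma fam_reparam:
  assumes S: "fam p q l S" and u: "u \<in> smooth_maps (rn l') (rn l)"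
  shows "fam p q l' (\<lambda>e. S (u e))"
  unfolding fam_def
proof (intro conjI ballI allI)
  show "sect p q (S (u e))" if "e \<in> points (rn l')" for e
    using fam_sect[OF S smooth_maps_point[OF u that]] .
  fix j
  let ?\<Psi> = "\<lambda>y. S (\<lambda>i. y (p + i)) (\<lambda>i. if i < p then y i else 0) j"
  let ?u = "\<lambda>y. vappend p (\<lambda>i. if i < p then y i else 0) (u (\<lambda>i. y (p + i)))"
  have "?\<Psi> \<in> sf (p + l)" using S by (simp add: fam_def)
  then have "(\<lambda>y. ?\<Psi> (?u y)) \<in> sf (p + l')"
  proof (rule sf_compose)
    show "?u y \<in> points (rn (p + l))" if "y \<in> points (rn (p + l'))" for y
      using that by (intro vappend_points smooth_maps_point[OF u]) (auto simp: points_rn)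
    show "(\<lambda>y. ?u y i) \<in> sf (p + l')" for i
    proof (cases "i < p")
      case True
      then show ?thesis by (simp add: vappend_def sf_coord)
    next
      case False
      have "(\<lambda>e. u e (i - p)) \<in> sf l'"
      proof (rule sfI)
        fix c assume "c \<in> curves (rn l')"
        from smooth_maps_curve[OF u this] show "smooth (\<lambda>t. u (c t) (i - p))" by (simp add: curves_rn)
      qed
      from sf_right[OF this] show ?thesis using False by (simp add: vappend_def)
    qed
  qed
  moreover have "(\<lambda>i. if i < p then ?u y i else 0) = (\<lambda>i. if i < p then y i else 0)" "(\<lambda>i. ?u y (p + i)) = u (\<lambda>i. y (p + i))" for y
    by (auto simp: vappend_def)
  ultimately show "(\<lambda>y. S (u (\<lambda>i. y (p + i))) (\<lambda>i. if i < p then y i else 0) j) \<in> sf (p + l')" by simp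
qed

text \<open>Among the coefficients that vary is the centre of the Taylor expansion.\<close>

lemma fam_sec:
  assumes C: "\<And>k. k \<in> jet_indices p q n \<Longrightarrow> (\<lambda>e. C e k) \<in> sf l"
  shows "fam p q l (\<lambda>e. sec p q n (C e))"
  unfolding fam_def
proof (intro conjI ballI allI sect_sec)
  fix j
  show "(\<lambda>y. sec p q n (C (\<lambda>i. y (p + i))) (\<lambda>i. if i < p then y i else 0) j) \<in> sf (p + l)"
  proof (rule sfI)
    fix c assume c: "c \<in> curves (rn (p + l))"
    have ce: "smooth (\<lambda>t. C (\<lambda>i. c t (p + i)) k)" if "k \<in> jet_indices p q n" for k
      using sfD[OF sf_right[OF C[OF that]] c] .
    have cc: "smooth (\<lambda>t. c t i)" for i using c by (simp add: curves_rn)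
    have d: "smooth (\<lambda>t. (if i < p then c t i else 0) - base_pt p (C (\<lambda>i. c t (p + i))) i)" for i
      using ce[of "([], i)"] cc[of i]
      by (cases "i < p") (auto simp: base_pt_def jet_indices_def intro!: smooth_diff smooth_const)
    have "smooth (\<lambda>t. \<Sum>m\<le>n. taylor_form p m (\<lambda>\<alpha>. C (\<lambda>i. c t (p + i)) (\<alpha>, j))
        (\<lambda>i. (if i < p then c t i else 0) - base_pt p (C (\<lambda>i. c t (p + i))) i))" if "p \<le> j" "j < p + q"
    proof (rule smooth_sum, rule taylor_form_smooth)
      fix m \<alpha> assume "m \<in> {..n}" "set \<alpha> \<subseteq> {..<p}" "length \<alpha> = m"
      with that show "smooth (\<lambda>t. C (\<lambda>i. c t (p + i)) (\<alpha>, j))" by (intro ce) (auto simp: jet_indices_def)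
    qed (rule d)
    then show "smooth (\<lambda>t. sec p q n (C (\<lambda>i. c t (p + i))) (\<lambda>i. if i < p then c t i else 0) j)"
      using cc[of j] by (cases "j < p"; cases "j < p + q") (simp_all add: sec_def smooth_const)
  qed
qed

text \<open>The derivative of the joint function is smooth in all variables; the moving base point
  and the parameter are inserted afterwards.\<close>

lemma fam_pds:
  assumes S: "fam p q l S" and B: "B \<in> smooth_maps (rn l) (rn p)" and \<alpha>: "set \<alpha> \<subseteq> {..<p}"
  shows "(\<lambda>e. pds \<alpha> (\<lambda>x. S e x j) (B e)) \<in> sf l"
proof -
  let ?\<Psi> = "\<lambda>y. S (\<lambda>i. y (p + i)) (\<lambda>i. if i < p then y i else 0) j"
  have \<Psi>: "?\<Psi> \<in> sf (p + l)" using S by (simp add: fam_def)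
  have e: "?\<Psi> (vappend p x e) = S e x j" if "x \<in> points (rn p)" for x e
  proof -
    have "(\<lambda>i. vappend p x e (p + i)) = e" "(\<lambda>i. if i < p then vappend p x e i else 0) = x"
      using that by (auto simp: vappend_def points_rn)
    then show ?thesis by simp
  qed
  have "(\<lambda>e. pds \<alpha> ?\<Psi> (vappend p (B e) e)) \<in> sf l"
  proof (rule sf_compose[OF pds_sf[OF \<Psi>]])
    show "vappend p (B e) e \<in> points (rn (p + l))" if "e \<in> points (rn l)" for e
      by (intro vappend_points smooth_maps_point[OF B] that)
    show "(\<lambda>e. vappend p (B e) e i) \<in> sf l" for i
      using coords_smooth_map[OF coords_rn B] by (cases "i < p") (simp_all add: vappend_def sf_coord)
  qed (use \<alpha> in auto)
  then show ?thesis
  proof (rule sf_cong)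
    fix e' assume e': "e' \<in> points (rn l)"
    have "pds \<alpha> (\<lambda>x. S e' x j) (B e') = pds \<alpha> (\<lambda>x. ?\<Psi> (vappend p x e')) (B e')"
      by (rule pds_cong[OF _ \<alpha> smooth_maps_point[OF B e']]) (simp only: e)
    also have "\<dots> = pds \<alpha> ?\<Psi> (vappend p (B e') e')"
      by (rule pds_vappend[OF \<Psi> \<alpha> smooth_maps_point[OF B e'] e'])
    finally show "pds \<alpha> ?\<Psi> (vappend p (B e') e') = pds \<alpha> (\<lambda>x. S e' x j) (B e')" by simp
  qed
qed

section \<open>Iterated jets of sections\<close>

abbreviation JS :: "nat \<Rightarrow> nat \<Rightarrow> nat \<Rightarrow> (nat \<Rightarrow> real, nat \<Rightarrow> real) jet space" where
  "JS p q n \<equiv> jets (rn p) (rn (p + q)) (proj p) n"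

abbreviation pb :: "nat \<Rightarrow> (nat \<Rightarrow> real, nat \<Rightarrow> real) jet \<Rightarrow> nat \<Rightarrow> real" where
  "pb p \<equiv> proj p \<circ> bottom"

text \<open>The conditions (i) and (ii) on iterated jets. They are void over order 0, which gives
  all orders above 0 a common description in \<open>jets_Suc\<close>.\<close>

definition holon :: "nat \<Rightarrow> nat \<Rightarrow> nat \<Rightarrow> (nat \<Rightarrow> real, nat \<Rightarrow> real) jet \<Rightarrow>
    (((nat \<Rightarrow> real) \<Rightarrow> nat \<Rightarrow> real) \<Rightarrow> ((nat \<Rightarrow> real) \<Rightarrow> (nat \<Rightarrow> real, nat \<Rightarrow> real) jet)) \<Rightarrow> bool" where
  "holon p q n x F \<longleftrightarrow> (case n of 0 \<Rightarrow> True | Suc n' \<Rightarrow>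
    (\<forall>t\<in>points (fibre (rn p) (WD 1) (proj p (bottom x))).
       prolong (JS p q n') (WD 1) jet_base (F t) = jet_fun x t) \<and>
    (\<forall>\<gamma>\<in>points (fibre (rn p) (WD 2) (proj p (bottom x))).
       second_lift (rn p) (JS p q n') (JS p q (Suc n')) (pb p) F \<gamma> =
       swap (JS p q n') (second_lift (rn p) (JS p q n') (JS p q (Suc n')) (pb p) F (swap (rn p) \<gamma>))))"

lemma jets_Suc: "JS p q (Suc n) = transport (\<lambda>(x, F). Jet x F)
    (subspace {(x, F). holon p q n x F} (J1 (rn p) (JS p q n) (pb p)))"
proof (cases n)
  case 0
  have "subspace {(x, F). holon p q 0 x F} X = X" for X :: "((nat \<Rightarrow> real, nat \<Rightarrow> real) jet \<times> _) space"
    by (cases X) (auto simp: subspace_def holon_def)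
  with 0 show ?thesis by simp
qed (simp add: holon_def)

lemma J1_points: "(x, F) \<in> points (J1 M Y \<rho>) \<longleftrightarrow>
    is_lift M Y \<rho> (WD 1) (x, F) \<and> homogeneous M Y \<rho> 1 0 (x, F) \<and> (\<forall>m. inf_homogeneous M Y \<rho> 1 0 m (x, F))"
  by (simp add: J1_def lift_space_def)

lemma jets_Suc_points: "j \<in> points (JS p q (Suc n)) \<longleftrightarrow>
    (\<exists>x F. j = Jet x F \<and> (x, F) \<in> points (J1 (rn p) (JS p q n) (pb p)) \<and> holon p q n x F)"
  unfolding jets_Suc by (auto simp: transport_def subspace_def)

lemma jets_Suc_curves:
  "c \<in> curves (JS p q (Suc n)) \<longleftrightarrow> (\<forall>t. c t \<in> points (JS p q (Suc n))) \<and>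
    (\<lambda>t. jet_base (c t)) \<in> curves (JS p q n) \<and>
    (\<forall>g t. smooth g \<longrightarrow> t \<in> curves (tensor (rn p) (WD 1)) \<longrightarrow> (\<forall>r. base (t r) = pb p (jet_base (c (g r)))) \<longrightarrow>
      (\<lambda>r. jet_fun (c (g r)) (t r)) \<in> curves (tensor (JS p q n) (WD 1)))" (is "?L \<longleftrightarrow> ?R")
proof
  assume ?L
  then obtain c' where c0: "c = (\<lambda>(x, F). Jet x F) \<circ> c'"
    "c' \<in> curves (subspace {(x, F). holon p q n x F} (J1 (rn p) (JS p q n) (pb p)))"
    unfolding jets_Suc transport_def by auto
  then have c': "c = (\<lambda>(x, F). Jet x F) \<circ> c'" "c' \<in> curves (J1 (rn p) (JS p q n) (pb p))"
    "\<And>t. holon p q n (fst (c' t)) (snd (c' t))"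
    by (auto simp: subspace_def image_subset_iff split_beta)
  then have "c t = Jet (fst (c' t)) (snd (c' t))" for t by (simp add: split_beta)
  with c'(2,3) show ?R
    unfolding J1_def lift_space_def by (fastforce simp: jets_Suc_points J1_points o_def)
next
  assume R: ?R
  let ?c = "\<lambda>t. (jet_base (c t), jet_fun (c t))"
  have ct: "c t = Jet (jet_base (c t)) (jet_fun (c t)) \<and> ?c t \<in> points (J1 (rn p) (JS p q n) (pb p)) \<and>
      holon p q n (jet_base (c t)) (jet_fun (c t))" for t
    using conjunct1[OF R] unfolding jets_Suc_points by (metis jet.sel)
  have "?c \<in> curves (J1 (rn p) (JS p q n) (pb p))"
    using R ct unfolding J1_def lift_space_def by (auto simp: o_def)
  then have "?c \<in> curves (subspace {(x, F). holon p q n x F} (J1 (rn p) (JS p q n) (pb p)))"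
    using ct by (auto simp: subspace_def)
  moreover have "c = (\<lambda>(x, F). Jet x F) \<circ> ?c" using ct by (auto simp: fun_eq_iff)
  ultimately show ?L unfolding jets_Suc transport_def by (simp add: image_iff) blast
qed

lemma J1_lift:
  assumes "(x, F) \<in> points (J1 (rn p) Y \<rho>)"
  shows "x \<in> points Y" "F \<in> smooth_maps (fibre (rn p) (WD 1) (\<rho> x)) (fibre Y (WD 1) x)"
    "F \<in> extensional (points (fibre (rn p) (WD 1) (\<rho> x)))"
    "\<And>t. t \<in> points (fibre (rn p) (WD 1) (\<rho> x)) \<Longrightarrow> prolong (rn p) (WD 1) \<rho> (F t) = t"
    "\<And>\<alpha> t. t \<in> points (fibre (rn p) (WD 1) (\<rho> x)) \<Longrightarrow> F (scale (rn p) 1 0 \<alpha> t) = scale Y 1 0 \<alpha> (F t)"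
  using assms unfolding J1_points is_lift_def homogeneous_def by auto

section \<open>Coordinates on the spaces of iterated jets\<close>

definition tangent_vec :: "nat \<Rightarrow> (nat \<Rightarrow> real) \<Rightarrow> (nat \<Rightarrow> real) \<Rightarrow> (nat \<Rightarrow> real) \<Rightarrow> nat \<Rightarrow> real" where
  "tangent_vec p b v = wclass (rn p) (WD 1) (\<lambda>d l. b l + d 0 * v l)"

definition unit_vec :: "nat \<Rightarrow> nat \<Rightarrow> real" where
  "unit_vec k = (\<lambda>l. if l = k then 1 else 0)"

text \<open>The candidate for the partial derivative along the list. Derivatives of lower order are
  those of the underlying jet; one of top order is found by applying the lift to the unit tangent
  vector of the first index and differentiating the coordinate that belongs to the remaining
  indices.\<close>

primrec jcoord :: "nat \<Rightarrow> nat \<Rightarrow> (nat \<Rightarrow> real, nat \<Rightarrow> real) jet \<Rightarrow> nat list \<times> nat \<Rightarrow> real" where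
  "jcoord p 0 x k = bottom x (snd k)"
| "jcoord p (Suc n) x k = (if length (fst k) \<le> n then jcoord p n (jet_base x) k
    else pd 0 (\<lambda>d. jcoord p n (jet_fun x (tangent_vec p (proj p (bottom (jet_base x))) (unit_vec (hd (fst k)))) d) (tl (fst k), snd k)) (\<lambda>_. 0))"

primrec jet_of :: "nat \<Rightarrow> nat \<Rightarrow> nat \<Rightarrow> ((nat \<Rightarrow> real) \<Rightarrow> (nat \<Rightarrow> real)) \<Rightarrow> (nat \<Rightarrow> real) \<Rightarrow> (nat \<Rightarrow> real, nat \<Rightarrow> real) jet" where
  "jet_of p q 0 s b = Pt (s b)"
| "jet_of p q (Suc n) s b = Jet (jet_of p q n s b) (snd (section_lift p (JS p q n) 1 (jet_of p q n s) b))"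

lemma bottom_jet_of: "bottom (jet_of p q n s b) = s b"
  by (induction n) simp_all

lemma jet_base_jet_of: "jet_base (jet_of p q (Suc n) s b) = jet_of p q n s b"
  by simp

lemma jet_fun_jet_of: "t \<in> points (fibre (rn p) (WD 1) b) \<Longrightarrow> jet_fun (jet_of p q (Suc n) s b) t = prolong (JS p q n) (WD 1) (jet_of p q n s) t"
  by (simp add: section_lift_def)

text \<open>The statement of the induction on the order: the coordinates of the jet of a section are
  its derivatives, and taking the jet of the Taylor polynomial is a retraction. In particular every
  jet is the jet of a section.\<close>

definition good :: "nat \<Rightarrow> nat \<Rightarrow> nat \<Rightarrow> bool" where
  "good p q n \<longleftrightarrow>
    (\<forall>s b. sect p q s \<longrightarrow> b \<in> points (rn p) \<longrightarrow> jet_of p q n s b \<in> points (JS p q n) \<and>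
      (\<forall>\<alpha> j. (\<alpha>, j) \<in> jet_indices p q n \<longrightarrow> jcoord p n (jet_of p q n s b) (\<alpha>, j) = pds \<alpha> (\<lambda>x. s x j) b)) \<and>
    coords (JS p q n) (jet_indices p q n) (jcoord p n) (\<lambda>c. jet_of p q n (sec p q n c) (base_pt p c)) \<and>
    bottom \<in> smooth_maps (JS p q n) (rn (p + q))"

lemma mixed_empty: "mixed n {} f = f (\<lambda>_. 0)"
  by (simp add: mixed_def desc_list_def)

lemma mixed_1: "mixed 1 {0} f = pd 0 f (\<lambda>_. 0)"
  by (simp add: mixed_def desc_list_def One_nat_def)

lemma subsets_1: "(\<forall>S\<subseteq>{..<1::nat}. P S) \<longleftrightarrow> P {} \<and> P {0}"
proof -
  have "{..<1::nat} = {0}" by (auto simp: One_nat_def)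
  then show ?thesis by (metis empty_subsetI subset_singletonD subset_refl)
qed

context
  fixes p q n :: nat
  assumes good: "good p q n"
begin

lemma good_coords: "coords (JS p q n) (jet_indices p q n) (jcoord p n) (\<lambda>c. jet_of p q n (sec p q n c) (base_pt p c))"
  using good by (simp add: good_def)

lemma jet_of_points: "sect p q s \<Longrightarrow> b \<in> points (rn p) \<Longrightarrow> jet_of p q n s b \<in> points (JS p q n)"
  using good by (simp add: good_def)

lemma jcoord_jet_of: "sect p q s \<Longrightarrow> b \<in> points (rn p) \<Longrightarrow> (\<alpha>, j) \<in> jet_indices p q n \<Longrightarrow>
    jcoord p n (jet_of p q n s b) (\<alpha>, j) = pds \<alpha> (\<lambda>x. s x j) b"
  using good by (simp add: good_def)

lemma pb_smooth: "pb p \<in> smooth_maps (JS p q n) (rn p)"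
  using good smooth_maps_comp[OF _ proj_smooth] by (auto simp: good_def)

text \<open>Smoothness into the jet space is tested on coordinates, and these are derivatives at a
  moving point, covered by \<open>fam_pds\<close>.\<close>

lemma fam_jet_of:
  assumes S: "fam p q l S" and B: "B \<in> smooth_maps (rn l) (rn p)"
  shows "(\<lambda>e. jet_of p q n (S e) (B e)) \<in> smooth_maps (rn l) (JS p q n)"
  unfolding coords_smooth_maps_iff[OF good_coords]
proof (intro conjI ballI)
  show "jet_of p q n (S e) (B e) \<in> points (JS p q n)" if "e \<in> points (rn l)" for e
    by (intro jet_of_points fam_sect[OF S] smooth_maps_point[OF B] that)
  fix k assume "k \<in> jet_indices p q n"
  then obtain \<alpha> j where k: "k = (\<alpha>, j)" "(\<alpha>, j) \<in> jet_indices p q n" by (cases k) auto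
  have "(\<lambda>e. pds \<alpha> (\<lambda>x. S e x j) (B e)) \<in> sf l"
    by (rule fam_pds[OF S B]) (use k in \<open>auto simp: jet_indices_def\<close>)
  then show "(\<lambda>e. jcoord p n (jet_of p q n (S e) (B e)) k) \<in> sf l"
    unfolding k(1)
    by (rule sf_cong) (simp add: jcoord_jet_of[OF fam_sect[OF S] smooth_maps_point[OF B] k(2)])
qed

lemma id_smooth: "(\<lambda>x. x) \<in> smooth_maps X X"
  by (rule smooth_mapsI)

lemma jet_of_smooth: "sect p q s \<Longrightarrow> jet_of p q n s \<in> smooth_maps (rn p) (JS p q n)"
  using fam_jet_of[OF fam_const id_smooth] by simp

lemma pb_jet_of: "sect p q s \<Longrightarrow> b \<in> points (rn p) \<Longrightarrow> pb p (jet_of p q n s b) = b"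
  by (simp add: bottom_jet_of sect_proj)

lemma jets_retract: "x \<in> points (JS p q n) \<Longrightarrow> jet_of p q n (sec p q n (jcoord p n x)) (base_pt p (jcoord p n x)) = x"
  using coords_retract[OF good_coords] .

lemma base_pt_jcoord: "x \<in> points (JS p q n) \<Longrightarrow> base_pt p (jcoord p n x) = pb p x"
  using pb_jet_of[OF sect_sec base_pt_points] jets_retract by metis

text \<open>The jet is that of a section, and the derivatives of a section commute.\<close>

lemma sym_coeffs_jcoord:
  assumes "x \<in> points (JS p q n)" shows "sym_coeffs p q n (jcoord p n x)"
proof (rule sym_coeffs_pds[OF sect_sec base_pt_points])
  fix \<alpha> j assume "(\<alpha>, j) \<in> jet_indices p q n"
  from jcoord_jet_of[OF sect_sec base_pt_points this, of n "jcoord p n x" "jcoord p n x"] jets_retract[OF assms]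
  show "jcoord p n x (\<alpha>, j) = pds \<alpha> (\<lambda>y. sec p q n (jcoord p n x) y j) (base_pt p (jcoord p n x))" by simp
qed

lemma jets_WD1_eq_iff:
  assumes "f \<in> smooth_maps (rn 1) (JS p q n)" "g \<in> smooth_maps (rn 1) (JS p q n)"
  shows "wclass (JS p q n) (WD 1) f = wclass (JS p q n) (WD 1) g \<longleftrightarrow>
    (\<forall>k\<in>jet_indices p q n. jcoord p n (f (\<lambda>_. 0)) k = jcoord p n (g (\<lambda>_. 0)) k \<and>
      pd 0 (\<lambda>d. jcoord p n (f d) k) (\<lambda>_. 0) = pd 0 (\<lambda>d. jcoord p n (g d) k) (\<lambda>_. 0))"
  unfolding wclass_WD_eq_iff[OF good_coords assms] subsets_1 mixed_empty mixed_1 ..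

end

lemma rn_WD1_eq_iff:
  assumes "f \<in> smooth_maps (rn 1) (rn p)" "g \<in> smooth_maps (rn 1) (rn p)"
  shows "wclass (rn p) (WD 1) f = wclass (rn p) (WD 1) g \<longleftrightarrow>
    (\<forall>k<p. f (\<lambda>_. 0) k = g (\<lambda>_. 0) k \<and> pd 0 (\<lambda>d. f d k) (\<lambda>_. 0) = pd 0 (\<lambda>d. g d k) (\<lambda>_. 0))"
  unfolding wclass_WD_eq_iff[OF coords_rn assms] subsets_1 mixed_empty mixed_1 by auto

lemma line_map: "b \<in> points (rn p) \<Longrightarrow> v \<in> points (rn p) \<Longrightarrow> 0 < m \<Longrightarrow> (\<lambda>d l. b l + d 0 * v l) \<in> smooth_maps (rn m) (rn p)"
  unfolding coords_smooth_maps_iff[OF coords_rn]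
  by (auto simp: points_rn intro!: sf_add sf_mult sf_const sf_coord)

lemma tangent_vec_fibre: "b \<in> points (rn p) \<Longrightarrow> v \<in> points (rn p) \<Longrightarrow> tangent_vec p b v \<in> points (fibre (rn p) (WD 1) b)"
  unfolding tangent_vec_def fibre_points
  using tensor_WD_points[OF line_map[of b p v 1]] base_wclass_WD[OF coords_rn line_map[of b p v 1]] by simp

lemma unit_vec_points: "k < p \<Longrightarrow> unit_vec k \<in> points (rn p)"
  by (simp add: unit_vec_def points_rn)

lemma pd_line: "pd 0 (\<lambda>d. b + d 0 * v) (\<lambda>_. 0) = v"
proof (rule pd_eqI)
  show "((\<lambda>t. b + ((\<lambda>_. 0)(0 := t)) 0 * v) has_real_derivative v) (at 0)"
    by (auto intro!: derivative_eq_intros)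
qed

lemma fibre_WD1_tangent_vec:
  assumes t: "t \<in> points (fibre (rn p) (WD 1) b)"
  obtains v where "v \<in> points (rn p)" "t = tangent_vec p b v"
proof
  have taylor_form: "t \<in> points (tensor (rn p) (WD 1))" and t0: "t (\<lambda>_. 0) = b" using t by (simp_all add: fibre_points base_def)
  note tm = tensor_WD_map[OF taylor_form]
  have b: "b \<in> points (rn p)" using smooth_maps_point[OF tm zero_points] t0 by simp
  let ?v = "\<lambda>l. if l < p then pd 0 (\<lambda>d. t d l) (\<lambda>_. 0) else 0"
  show v: "?v \<in> points (rn p)" by (simp add: points_rn)
  have "wclass (rn p) (WD 1) t = tangent_vec p b ?v"
    unfolding tangent_vec_def rn_WD1_eq_iff[OF tm line_map[OF b v zero_less_one]] using t0 by (simp add: pd_line)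
  then show "t = tangent_vec p b ?v" using tensor_point_map(2)[OF taylor_form] by simp
qed

lemma tangent_vec_curve:
  assumes b: "b \<in> curves (rn p)" and v: "v \<in> curves (rn p)"
  shows "(\<lambda>r. tangent_vec p (b r) (v r)) \<in> curves (tensor (rn p) (WD 1))"
  unfolding tangent_vec_def
proof (rule tensor_WD_curve, rule mapping_curveI[OF coords_rn])
  show "(\<lambda>l. b t l + d 0 * v t l) \<in> points (rn p)" for t d
    using b v by (simp add: curves_rn points_rn)
  fix k
  have "(\<lambda>y. b (y 1) k) \<in> sf (Suc 1)" "(\<lambda>y. v (y 1) k) \<in> sf (Suc 1)"
    using b v smooth_compose[of "\<lambda>r. b r k"] smooth_compose[of "\<lambda>r. v r k"]
    by (auto intro!: sfI simp: curves_rn)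
  then have "(\<lambda>y. b (y 1) k + y 0 * v (y 1) k) \<in> sf (Suc 1)"
    by (intro sf_add sf_mult sf_coord)
  then show "(\<lambda>y. b (y 1) k + (y(1 := 0)) 0 * v (y 1) k) \<in> sf (Suc 1)" by simp
qed

lemma good_0: "good p q 0"
  unfolding good_def
proof (intro conjI allI impI)
  fix s b assume s: "sect p q s" and b: "b \<in> points (rn p)"
  show "jet_of p q 0 s b \<in> points (JS p q 0)"
    using smooth_maps_point[OF sect_map[OF s] b] by (simp add: transport_def)
  fix \<alpha> j assume "(\<alpha>, j) \<in> jet_indices p q 0"
  then show "jcoord p 0 (jet_of p q 0 s b) (\<alpha>, j) = pds \<alpha> (\<lambda>x. s x j) b"
    by (simp add: jet_indices_def)
next
  show "bottom \<in> smooth_maps (JS p q 0) (rn (p + q))"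
    by (rule smooth_mapsI) (auto simp: transport_def o_def)
  have sec0: "sec p q 0 c (base_pt p c) = (\<lambda>j. if j < p + q then c ([], j) else 0)" for c
    by (auto simp: sec_def base_pt_def fun_eq_iff)
  show "coords (JS p q 0) (jet_indices p q 0) (jcoord p 0) (\<lambda>c. jet_of p q 0 (sec p q 0 c) (base_pt p c))"
    unfolding coords_def
  proof (intro conjI ballI allI impI finite_jet_indices)
    fix C :: "real \<Rightarrow> nat list \<times> nat \<Rightarrow> real" assume "\<forall>k\<in>jet_indices p q 0. smooth (\<lambda>t. C t k)"
    then have C: "smooth (\<lambda>t. C t ([], j))" if "j < p + q" for j using that by (simp add: jet_indices_def)
    have "smooth (\<lambda>t. if j < p + q then C t ([], j) else 0)" for j
      by (cases "j < p + q") (simp_all add: C smooth_const)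
    then have "(\<lambda>t j. if j < p + q then C t ([], j) else 0) \<in> curves (rn (p + q))"
      by (simp add: curves_rn points_rn)
    then show "(\<lambda>t. jet_of p q 0 (sec p q 0 (C t)) (base_pt p (C t))) \<in> curves (JS p q 0)"
      by (auto simp: transport_def o_def sec0)
  next
    fix x assume "x \<in> points (JS p q 0)"
    then show "jet_of p q 0 (sec p q 0 (jcoord p 0 x)) (base_pt p (jcoord p 0 x)) = x"
      by (auto simp: transport_def sec0 points_rn fun_eq_iff)
  next
    fix c c' :: "nat list \<times> nat \<Rightarrow> real" assume "\<forall>k\<in>jet_indices p q 0. c k = c' k"
    then show "jet_of p q 0 (sec p q 0 c) (base_pt p c) = jet_of p q 0 (sec p q 0 c') (base_pt p c')"
      by (simp add: sec0 jet_indices_def fun_eq_iff)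
  qed (auto simp: transport_def jet_indices_def curves_rn)
qed

text \<open>The structure on jet spaces is designed for this: along curves, the smoothness of
  evaluation is a clause of \<open>jets_Suc_curves\<close>, taken with the identity for
  \<open>g\<close>.\<close>

lemma jet_eval_smooth:
  assumes "good p q n"
  shows "(\<lambda>(x, t). jet_fun x t) \<in> smooth_maps (fibre_product (JS p q (Suc n)) (tensor (rn p) (WD 1)) (pb p) base) (tensor (JS p q n) (WD 1))"
proof (rule smooth_mapsI)
  fix z assume "z \<in> points (fibre_product (JS p q (Suc n)) (tensor (rn p) (WD 1)) (pb p) base)"
  then obtain x F t where z: "z = (Jet x F, t)" "(x, F) \<in> points (J1 (rn p) (JS p q n) (pb p))"
    "t \<in> points (fibre (rn p) (WD 1) (pb p x))"
    by (auto simp: fibre_product_def jets_Suc_points fibre_points)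
  from smooth_maps_point[OF J1_lift(2)[OF z(2)] z(3)]
  show "(case z of (x, t) \<Rightarrow> jet_fun x t) \<in> points (tensor (JS p q n) (WD 1))"
    by (simp add: z(1) fibre_points)
next
  fix c assume c: "c \<in> curves (fibre_product (JS p q (Suc n)) (tensor (rn p) (WD 1)) (pb p) base)"
  then have 1: "(\<lambda>t. fst (c t)) \<in> curves (JS p q (Suc n))" and 2: "(\<lambda>t. snd (c t)) \<in> curves (tensor (rn p) (WD 1))"
    and 3: "\<And>r. pb p (fst (c r)) = base (snd (c r))"
    by (auto simp: fibre_product_def o_def)
  have "pb p (jet_base (fst (c r))) = base (snd (c r))" for r
  proof -
    have "fst (c r) \<in> points (JS p q (Suc n))" using 1 unfolding jets_Suc_curves by blast
    then obtain x F where "fst (c r) = Jet x F" unfolding jets_Suc_points by blast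
    with 3[of r] show ?thesis by simp
  qed
  then have "(\<lambda>r. jet_fun (fst (c r)) (snd (c r))) \<in> curves (tensor (JS p q n) (WD 1))"
    using 1 2 smooth_ident unfolding jets_Suc_curves by simp
  then show "(\<lambda>t. case c t of (x, t) \<Rightarrow> jet_fun x t) \<in> curves (tensor (JS p q n) (WD 1))"
    by (simp add: split_beta)
qed

lemma Dobj_append: "Dobj m @ Dobj n = Dobj (m + n)"
  by (simp add: replicate_add)

lemma swap_permutes: "Transposition.transpose 0 1 permutes {..<2::nat}"
  by (rule permutes_swap_id) auto

lemma swap_wclass:
  assumes "f \<in> smooth_maps (rn 2) X"
  shows "swap X (wclass X (WD 2) f) = wclass X (WD 2) (\<lambda>d. f (\<lambda>j. d (Transposition.transpose 0 1 j)))"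
  unfolding permute_def by (rule pull_WD[OF assms inf_map_permute[OF swap_permutes]])

lemma swap_map: "f \<in> smooth_maps (rn 2) X \<Longrightarrow> (\<lambda>d. f (\<lambda>j. d (Transposition.transpose 0 1 j))) \<in> smooth_maps (rn 2) X"
  by (rule smooth_maps_comp'[OF inf_map_WD_map[OF inf_map_permute[OF swap_permutes]]])

text \<open>Evaluates the expression of condition (ii) when the lift of the first edge is given by a
  family \<open>S\<close> of sections over that edge: the family provides the jet for each value of
  the first variable, and this jet is evaluated on the second direction. It is used with a constant
  family for jets of sections and with an interpolating family for arbitrary jets.\<close>

lemma second_lift_family:
  assumes gn: "good p q n" and gS: "good p q (Suc n)"
    and g: "g \<in> smooth_maps (rn 2) (rn p)" and S: "fam p q 1 S"
    and F: "F (wclass (rn p) (WD 1) (\<lambda>e. g (e(1 := 0)))) = wclass (JS p q (Suc n)) (WD 1) (\<lambda>e. jet_of p q (Suc n) (S e) (g (e(1 := 0))))"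
  shows "second_lift (rn p) (JS p q n) (JS p q (Suc n)) (pb p) F (wclass (rn p) (WD 2) g) =
    wclass (JS p q n) (WD 2) (\<lambda>d. jet_of p q n (S (d(1 := 0))) (g d))"
proof -
  let ?M = "rn p" and ?\<tau> = "\<lambda>d j. d (Transposition.transpose 0 1 j) :: real"
  let ?P = "fibre_product (JS p q (Suc n)) (tensor ?M (WD 1)) (pb p) base"
  note one = len_Dobj[of 1]
  have inc: "(\<lambda>d. d(1 := 0)) \<in> smooth_maps (rn 1) (rn 2)"
    using inf_map_WD_map[OF inf_map_include[of 1]] by (simp add: numeral_2_eq_2 One_nat_def)
  have incp: "(\<lambda>d. d(1 := 0)) \<in> smooth_maps (rn 2) (rn 1)"
    using inf_map_WD_map[OF inf_map_project[of 1]] by (simp add: numeral_2_eq_2 One_nat_def)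
  have wi: "inf_map (Dobj 1) (Dobj 2) (\<lambda>d. d(1 := 0))"
    using inf_map_include[of 1] by (simp add: numeral_2_eq_2 One_nat_def)
  have B: "(\<lambda>e. g (e(1 := 0))) \<in> smooth_maps (rn 1) ?M" by (rule smooth_maps_comp'[OF inc g])
  have F1: "F (pull ?M (WD 1) (\<lambda>d. d(1 := 0)) (wclass ?M (WD 2) g)) =
      wclass (JS p q (Suc n)) (WD 1) (\<lambda>e. jet_of p q (Suc n) (S e) (g (e(1 := 0))))"
    unfolding pull_WD[OF g wi] by (rule F)
  \<comment> \<open>The first variable must become the outer one, but the outer variables of
    \<open>wcurry\<close> come last; hence the exchange, which is undone at the end.\<close>
  define h where "h = (\<lambda>y. g (?\<tau> y))"
  have h: "h \<in> smooth_maps (rn (1 + length (Dobj 1))) ?M"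
    unfolding h_def one by (simp only: one_add_one) (rule swap_map[OF g])
  let ?\<Phi> = "\<lambda>e. wclass ?M (WD 1) (\<lambda>d. h (vappend 1 d e))"
  have c: "wcurry ?M (Dobj 1) (Dobj 1) (swap ?M (wclass ?M (WD 2) g)) = wclass (tensor ?M (WD 1)) (WD 1) ?\<Phi>"
    using wcurry_wclass[OF coords_rn h] unfolding swap_wclass[OF g] Dobj_append one_add_one h_def .
  have tau: "?\<tau> (vappend 1 d e) = (\<lambda>i. if i = 0 then e 0 else if i = 1 then d 0 else e (i - 1))" for d e
    by (auto simp: vappend_def fun_eq_iff Transposition.transpose_def)
  have h0: "h (vappend 1 (\<lambda>_. 0) e) = g (e(1 := 0))" if "e \<in> points (rn 1)" for e
  proof -
    have "?\<tau> (vappend 1 (\<lambda>_. 0) e) = e(1 := 0)"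
      unfolding tau using that by (auto simp: points_rn fun_eq_iff)
    then show ?thesis by (simp only: h_def)
  qed
  have f: "(\<lambda>e. jet_of p q (Suc n) (S e) (g (e(1 := 0)))) \<in> smooth_maps (rn 1) (JS p q (Suc n))"
    by (rule fam_jet_of[OF gS S B])
  have \<Phi>: "?\<Phi> \<in> smooth_maps (rn 1) (tensor ?M (WD 1))"
    using tensor_family[OF coords_rn h] unfolding one .
  have \<Phi>b: "base (?\<Phi> e) = g (e(1 := 0))" if e: "e \<in> points (rn 1)" for e
    using base_wclass_WD[OF coords_rn smooth_maps_vappend_left[OF coords_rn h]] e h0[OF e] by simp
  have pbf: "pb p (jet_of p q (Suc n) (S e) (g (e(1 := 0)))) = base (?\<Phi> e)" if e: "e \<in> points (rn 1)" for e
    using pb_jet_of[OF gS fam_sect[OF S e] smooth_maps_point[OF B e]] \<Phi>b[OF e] by simp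
  let ?f = "\<lambda>e. jet_of p q (Suc n) (S e) (g (e(1 := 0)))"
  have wp: "wpair (JS p q (Suc n)) (tensor ?M (WD 1)) (pb p) base (WD 1) (wclass (JS p q (Suc n)) (WD 1) ?f)
      (wclass (tensor ?M (WD 1)) (WD 1) ?\<Phi>) = wclass ?P (WD 1) (\<lambda>e. (?f e, ?\<Phi> e))"
    "(\<lambda>e. (?f e, ?\<Phi> e)) \<in> smooth_maps (rn 1) ?P"
    using wpair_wclass[where ms = "Dobj 1" and n = 1 and f = ?f and g = ?\<Phi>, OF good_coords[OF gS] pb_smooth[OF gS]]
    unfolding one using f \<Phi> pbf by blast+
  let ?F' = "\<lambda>y. jet_of p q n (S (\<lambda>i. y (1 + i))) (h y)"
  have F': "?F' \<in> smooth_maps (rn (1 + length (Dobj 1))) (JS p q n)"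
  proof (rule fam_jet_of[OF gn fam_reparam[OF S] h])
    show "(\<lambda>y i. y (1 + i)) \<in> smooth_maps (rn (1 + length (Dobj 1))) (rn 1)"
      unfolding coords_smooth_maps_iff[OF coords_rn] by (auto simp: points_rn sf_coord)
  qed
  have sl: "second_lift ?M (JS p q n) (JS p q (Suc n)) (pb p) F (wclass ?M (WD 2) g) =
    swap (JS p q n) (wuncurry (JS p q n) (Dobj 1) (Dobj 1)
      (prolong (tensor (JS p q n) (WD 1)) (WD 1) (\<lambda>(x, t). jet_fun x t)
        (wclass ?P (WD 1) (\<lambda>e. (jet_of p q (Suc n) (S e) (g (e(1 := 0))), ?\<Phi> e)))))"
    unfolding second_lift_def F1 c wp(1) by (rule refl)
  have "prolong (tensor (JS p q n) (WD 1)) (WD 1) (\<lambda>(x, t). jet_fun x t)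
      (wclass ?P (WD 1) (\<lambda>e. (jet_of p q (Suc n) (S e) (g (e(1 := 0))), ?\<Phi> e))) =
    wclass (tensor (JS p q n) (WD 1)) (WD 1) (\<lambda>e. jet_fun (jet_of p q (Suc n) (S e) (g (e(1 := 0)))) (?\<Phi> e))"
    using prolong_WD[OF wp(2) jet_eval_smooth[OF gn]] by simp
  also have "\<dots> = wclass (tensor (JS p q n) (WD 1)) (WD 1) (\<lambda>e. wclass (JS p q n) (WD 1) (\<lambda>d. ?F' (vappend 1 d e)))"
  proof (rule wclass_WD_cong)
    show "(\<lambda>e. jet_fun (jet_of p q (Suc n) (S e) (g (e(1 := 0)))) (?\<Phi> e)) \<in> smooth_maps (rn 1) (tensor (JS p q n) (WD 1))"
      using smooth_maps_comp'[OF wp(2) jet_eval_smooth[OF gn]] by simp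
    fix e assume e: "e \<in> points (rn 1)"
    have "?\<Phi> e \<in> points (fibre ?M (WD 1) (g (e(1 := 0))))"
      using smooth_maps_point[OF \<Phi> e] \<Phi>b[OF e] by (simp add: fibre_points)
    then have "jet_fun (jet_of p q (Suc n) (S e) (g (e(1 := 0)))) (?\<Phi> e) = prolong (JS p q n) (WD 1) (jet_of p q n (S e)) (?\<Phi> e)"
      by (rule jet_fun_jet_of)
    also have "\<dots> = wclass (JS p q n) (WD 1) (\<lambda>d. jet_of p q n (S e) (h (vappend 1 d e)))"
      by (rule prolong_WD[OF smooth_maps_vappend_left[OF coords_rn h] jet_of_smooth[OF gn fam_sect[OF S e]]])
        (use e in simp)
    also have "(\<lambda>d. jet_of p q n (S e) (h (vappend 1 d e))) = (\<lambda>d. ?F' (vappend 1 d e))"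
      by (simp add: vappend_def)
    finally show "jet_fun (jet_of p q (Suc n) (S e) (g (e(1 := 0)))) (?\<Phi> e) = wclass (JS p q n) (WD 1) (\<lambda>d. ?F' (vappend 1 d e))" .
  qed
  finally have "second_lift ?M (JS p q n) (JS p q (Suc n)) (pb p) F (wclass ?M (WD 2) g) =
    swap (JS p q n) (wclass (JS p q n) (WD 2) ?F')"
    unfolding sl by (simp only: wuncurry_wclass[OF good_coords[OF gn] F'] Dobj_append one_add_one)
  also have "\<dots> = wclass (JS p q n) (WD 2) (\<lambda>d. ?F' (?\<tau> d))"
    by (rule swap_wclass) (use F' in simp)
  also have "\<dots> = wclass (JS p q n) (WD 2) (\<lambda>d. jet_of p q n (S (d(1 := 0))) (g d))"
  proof (rule wclass_WD_cong)
    show "(\<lambda>d. ?F' (?\<tau> d)) \<in> smooth_maps (rn 2) (JS p q n)"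
      by (rule swap_map) (use F' in simp)
    fix d :: "nat \<Rightarrow> real" assume d: "d \<in> points (rn 2)"
    have "(\<lambda>i. ?\<tau> d (1 + i)) = d(1 := 0)"
      using d by (auto simp: points_rn fun_eq_iff Transposition.transpose_def)
    moreover have "?\<tau> (?\<tau> d) = d" by (simp add: fun_eq_iff)
    ultimately show "?F' (?\<tau> d) = jet_of p q n (S (d(1 := 0))) (g d)" by (simp only: h_def)
  qed
  finally show ?thesis .
qed

section \<open>The induction step for iterated jets\<close>

lemma jet_base_smooth: "jet_base \<in> smooth_maps (JS p q (Suc n)) (JS p q n)"
proof (rule smooth_mapsI)
  fix x assume "x \<in> points (JS p q (Suc n))"
  then show "jet_base x \<in> points (JS p q n)"
    unfolding jets_Suc_points using J1_lift(1) by fastforce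
qed (simp add: jets_Suc_curves)

lemma mixed_2:
  assumes "f \<in> sf 2" shows "mixed 2 {0, 1} f = pd 0 (pd 1 f) (\<lambda>_. 0)"
proof -
  have "desc_list 2 {0, 1} = [1, 0]" by (simp add: desc_list_def numeral_2_eq_2 One_nat_def)
  then show ?thesis using pd_commute[OF assms _ _ zero_points, of 0 1] by (simp add: mixed_def)
qed

lemma mixed_2_swap:
  assumes f: "f \<in> sf 2" shows "mixed 2 {0, 1} (\<lambda>d. f (\<lambda>j. d (Transposition.transpose 0 1 j))) = mixed 2 {0, 1} f"
proof -
  let ?T = "Transposition.transpose 0 (1::nat)"
  let ?A = "\<lambda>(d::nat \<Rightarrow> real) j. d (?T j)"
  have A: "?A d \<in> points (rn 2)" if "d \<in> points (rn 2)" for d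
    using that by (auto simp: points_rn Transposition.transpose_def)
  have upd: "?A (d(i := t)) = (?A d)(?T i := ?A d (?T i) + (t - d i))" for d i t
    by (auto simp: fun_eq_iff)
  have ch: "pd i (\<lambda>d. h (?A d)) d = pd (?T i) h (?A d)" if "h \<in> sf 2" "i < 2" "d \<in> points (rn 2)" for h i d
    by (rule pd_chain1[OF that(1) _ A[OF that(3)] upd]) (use that(2) in \<open>auto simp: Transposition.transpose_def\<close>)
  have fA: "(\<lambda>d. f (?A d)) \<in> sf 2"
    by (rule sf_compose[OF f A]) (auto intro: sf_coord)
  have "mixed 2 {0, 1} (\<lambda>d. f (?A d)) = pd 0 (pd 1 (\<lambda>d. f (?A d))) (\<lambda>_. 0)"
    by (rule mixed_2[OF fA])
  also have "\<dots> = pd 0 (\<lambda>d. pd 0 f (?A d)) (\<lambda>_. 0)"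
    by (rule pd_cong[of 2]) (simp_all add: ch[OF f] zero_points)
  also have "\<dots> = pd 1 (pd 0 f) (\<lambda>_. 0)"
    by (subst ch) (simp_all add: pd_sf[OF f] zero_points)
  also have "\<dots> = mixed 2 {0, 1} f"
    using mixed_2[OF f] pd_commute[OF f _ _ zero_points, of 1 0] by simp
  finally show ?thesis .
qed

lemma pd_scale_0:
  assumes "\<phi> \<in> sf 1" shows "pd 0 (\<lambda>d. \<phi> (d(0 := a * d 0))) (\<lambda>_. 0) = a * pd 0 \<phi> (\<lambda>_. 0)"
proof (rule pd_eqI)
  have "((\<lambda>t. \<phi> ((\<lambda>_. 0)(0 := a * t))) has_real_derivative pd 0 \<phi> (\<lambda>_. 0) * a) (at 0)"
    by (rule DERIV_chain2[of "\<lambda>s. \<phi> ((\<lambda>_. 0)(0 := s))"])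
      (use pd_has_derivative[OF assms _ zero_points, of 0] in \<open>auto intro!: derivative_eq_intros\<close>)
  then show "((\<lambda>t. \<phi> (((\<lambda>_. 0)(0 := t))(0 := a * ((\<lambda>_. 0)(0 := t)) 0))) has_real_derivative a * pd 0 \<phi> (\<lambda>_. 0)) (at 0)"
    by (simp add: mult.commute)
qed

lemma jet_indices_mono: "m \<le> n \<Longrightarrow> k \<in> jet_indices p q m \<Longrightarrow> k \<in> jet_indices p q n"
  by (auto simp: jet_indices_def)

context
  fixes p q n :: nat
  assumes good: "good p q n"
begin

text \<open>As a function of \<open>v\<close> the left side is smooth, since a lift maps smooth
  curves to smooth curves, and it is homogeneous since a lift commutes with scalings. So
  \<open>homogeneous_linear\<close> applies.\<close>

lemma lift_linear:
  assumes F: "(x, F) \<in> points (J1 (rn p) (JS p q n) (pb p))" and k: "k \<in> jet_indices p q n"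
    and b: "b = pb p x" and v: "v \<in> points (rn p)"
  shows "pd 0 (\<lambda>d. jcoord p n (F (tangent_vec p b v) d) k) (\<lambda>_. 0) =
    (\<Sum>l<p. v l * pd 0 (\<lambda>d. jcoord p n (F (tangent_vec p b (unit_vec l)) d) k) (\<lambda>_. 0))"
proof -
  have bp: "b \<in> points (rn p)" using b by (simp add: proj_points)
  let ?L = "\<lambda>v. pd 0 (\<lambda>d. jcoord p n (F (tangent_vec p b v) d) k) (\<lambda>_. 0)"
  note lift = J1_lift[OF F, folded b]
  have T: "F (tangent_vec p b v) \<in> points (tensor (JS p q n) (WD 1))" if "v \<in> points (rn p)" for v
    using smooth_maps_point[OF lift(2) tangent_vec_fibre[OF bp that]] by (simp add: fibre_points)
  have "?L \<in> sf p"
  proof (rule sfI)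
    fix c assume c: "c \<in> curves (rn p)"
    have "(\<lambda>r. tangent_vec p b (c r)) \<in> curves (fibre (rn p) (WD 1) b)"
      using tangent_vec_curve[OF const_curve[OF bp] c] tangent_vec_fibre[OF bp] c by (simp add: fibre_curves fibre_points curves_rn)
    from smooth_maps_curve[OF lift(2) this] have "(\<lambda>r. F (tangent_vec p b (c r))) \<in> curves (tensor (JS p q n) (WD 1))"
      by (simp add: fibre_curves)
    from coords_curve_smooth[OF coords_tensor[OF good_coords[OF good]] this, of "({0}, k)"] k
    show "smooth (\<lambda>t. ?L (c t))" by (simp add: weil_coord_def mixed_1)
  qed
  moreover have "?L (\<lambda>i. a * v i) = a * ?L v" if v: "v \<in> points (rn p)" for v a
  proof -
    have w: "inf_map (Dobj 1) (Dobj 1) (\<lambda>d. d(0 := a * d 0))" by (rule inf_map_scale) simp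
    have "tangent_vec p b (\<lambda>i. a * v i) = scale (rn p) 1 0 a (tangent_vec p b v)"
      unfolding scale_def tangent_vec_def pull_WD[OF line_map[OF bp v zero_less_one] w] by (simp add: mult.left_commute mult.assoc)
    then have e: "F (tangent_vec p b (\<lambda>i. a * v i)) = wclass (JS p q n) (WD 1) (\<lambda>d. F (tangent_vec p b v) (d(0 := a * d 0)))"
      using lift(5)[OF tangent_vec_fibre[OF bp v]] by (simp add: scale_def pull_def o_def)
    note m = tensor_WD_map[OF T[OF v]]
    have "?L (\<lambda>i. a * v i) = mixed 1 {0} (\<lambda>d. jcoord p n (F (tangent_vec p b v) (d(0 := a * d 0))) k)"
      unfolding e mixed_1[symmetric]
      by (rule mixed_wclass[OF good_coords[OF good] smooth_maps_comp'[OF inf_map_WD_map[OF w] m] k]) simp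
    also have "\<dots> = a * ?L v"
      unfolding mixed_1 by (rule pd_scale_0[OF coords_smooth_map[OF good_coords[OF good] m k]])
    finally show ?thesis .
  qed
  ultimately show ?thesis
    using homogeneous_linear[of ?L p v] v by (simp add: unit_vec_def[abs_def])
qed

text \<open>The jet of \<open>s\<close> along the line in direction \<open>k\<close> has the
  derivatives of \<open>s\<close> as coordinates, and differentiating once more prepends
  \<open>k\<close>. This matches the recursion of \<open>jcoord\<close>.\<close>

lemma prolong_jet_of_tangent_vec:
  assumes s: "sect p q s" and b: "b \<in> points (rn p)" and k: "k < p" and \<alpha>: "(\<alpha>, j) \<in> jet_indices p q n"
  shows "pd 0 (\<lambda>d. jcoord p n (prolong (JS p q n) (WD 1) (jet_of p q n s) (tangent_vec p b (unit_vec k)) d) (\<alpha>, j)) (\<lambda>_. 0) =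
    pds (k # \<alpha>) (\<lambda>x. s x j) b"
proof -
  note l = line_map[OF b unit_vec_points[OF k] zero_less_one]
  note J = jet_of_smooth[OF good s]
  have a: "set \<alpha> \<subseteq> {..<p}" using \<alpha> by (auto simp: jet_indices_def)
  let ?A = "\<lambda>d l. b l + d 0 * unit_vec k l"
  have "pd 0 (\<lambda>d. jcoord p n (prolong (JS p q n) (WD 1) (jet_of p q n s) (tangent_vec p b (unit_vec k)) d) (\<alpha>, j)) (\<lambda>_. 0) =
      mixed 1 {0} (\<lambda>d. jcoord p n (jet_of p q n s (?A d)) (\<alpha>, j))"
    unfolding tangent_vec_def prolong_WD[OF l J] mixed_1[symmetric]
    by (rule mixed_wclass[OF good_coords[OF good] smooth_maps_comp'[OF l J] \<alpha>]) simp
  also have "\<dots> = mixed 1 {0} (\<lambda>d. pds \<alpha> (\<lambda>x. s x j) (?A d))"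
    by (rule mixed_cong) (rule jcoord_jet_of[OF good s smooth_maps_point[OF l] \<alpha>])
  also have "\<dots> = pd k (pds \<alpha> (\<lambda>x. s x j)) (?A (\<lambda>_. 0))"
    unfolding mixed_1
    by (rule pd_chain1[where A = ?A, OF pds_sf[OF sect_sf[OF s, of j] a] k smooth_maps_point[OF l zero_points]])
      (auto simp: unit_vec_def fun_eq_iff)
  finally show ?thesis by simp
qed

lemma jcoord_jet_of_Suc:
  assumes s: "sect p q s" and b: "b \<in> points (rn p)" and \<alpha>: "(\<alpha>, j) \<in> jet_indices p q (Suc n)"
  shows "jcoord p (Suc n) (jet_of p q (Suc n) s b) (\<alpha>, j) = pds \<alpha> (\<lambda>x. s x j) b"
proof (cases "length \<alpha> \<le> n")
  case True
  then show ?thesis using jcoord_jet_of[OF good s b, of \<alpha> j] \<alpha> by (simp add: jet_indices_def)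
next
  case False
  then obtain k \<alpha>' where k: "\<alpha> = k # \<alpha>'" by (cases \<alpha>) auto
  then have k': "k < p" "(\<alpha>', j) \<in> jet_indices p q n" using \<alpha> by (auto simp: jet_indices_def)
  show ?thesis
    using prolong_jet_of_tangent_vec[OF s b k'] False tangent_vec_fibre[OF b unit_vec_points[OF k'(1)]]
    by (simp add: k bottom_jet_of sect_proj[OF s b] section_lift_def)
qed

text \<open>The axioms of a lift are those of \<open>section_lift\<close>. Condition (i) holds
  because the underlying jet of the jet of \<open>s\<close> is the jet of \<open>s\<close> of one
  order less; condition (ii) follows from \<open>second_lift_family\<close>.\<close>

lemma jet_of_Suc_points:
  assumes s: "sect p q s" and b: "b \<in> points (rn p)" and pred: "\<And>m. n = Suc m \<Longrightarrow> good p q m"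
  shows "jet_of p q (Suc n) s b \<in> points (JS p q (Suc n))"
proof -
  note J = jet_of_smooth[OF good s]
  let ?F = "snd (section_lift p (JS p q n) 1 (jet_of p q n s) b)"
  have sl: "section_lift p (JS p q n) 1 (jet_of p q n s) b = (jet_of p q n s b, ?F)"
    by (simp add: section_lift_def)
  have "(jet_of p q n s b, ?F) \<in> points (J1 (rn p) (JS p q n) (pb p))"
    unfolding J1_points unfolding sl[symmetric]
  proof (intro conjI allI)
    note C = good_coords[OF good] and P = pb_smooth[OF good]
    show "is_lift (rn p) (JS p q n) (pb p) (WD 1) (section_lift p (JS p q n) 1 (jet_of p q n s) b)"
      by (rule section_lift_is_lift[OF C J P _ b]) (rule pb_jet_of[OF good s])
    show "homogeneous (rn p) (JS p q n) (pb p) 1 0 (section_lift p (JS p q n) 1 (jet_of p q n s) b)"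
      by (rule section_lift_homogeneous[OF C J P _ b zero_less_one]) (rule pb_jet_of[OF good s])
    show "inf_homogeneous (rn p) (JS p q n) (pb p) 1 0 m (section_lift p (JS p q n) 1 (jet_of p q n s) b)" for m
      by (rule section_lift_inf_homogeneous[OF C J P _ b zero_less_one]) (rule pb_jet_of[OF good s])
  qed
  moreover have "holon p q n (jet_of p q n s b) ?F"
  proof (cases n)
    case 0
    then show ?thesis by (simp add: holon_def)
  next
    case (Suc m)
    note gm = pred[OF Suc]
    have bb: "proj p (bottom (jet_of p q n s b)) = b" using pb_jet_of[OF good s b] by simp
    have Ft: "?F t = wclass (JS p q n) (WD 1) (\<lambda>d. jet_of p q n s (t d))" if "t \<in> points (fibre (rn p) (WD 1) b)" for t
      using that by (simp add: section_lift_def prolong_def o_def)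
    have "prolong (JS p q m) (WD 1) jet_base (?F t) = jet_fun (jet_of p q n s b) t" if t: "t \<in> points (fibre (rn p) (WD 1) b)" for t
    proof -
      have tm: "t \<in> smooth_maps (rn 1) (rn p)" using t tensor_WD_map by (auto simp: fibre_points)
      have jb: "jet_base \<in> smooth_maps (JS p q n) (JS p q m)" unfolding Suc by (rule jet_base_smooth)
      have "prolong (JS p q m) (WD 1) jet_base (?F t) = wclass (JS p q m) (WD 1) (\<lambda>d. jet_base (jet_of p q n s (t d)))"
        unfolding Ft[OF t] by (rule prolong_WD[OF smooth_maps_comp'[OF tm J] jb])
      also have "\<dots> = jet_fun (jet_of p q n s b) t"
        unfolding Suc jet_fun_jet_of[OF t] jet_base_jet_of by (simp add: prolong_def o_def)
      finally show ?thesis .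
    qed
    moreover have "second_lift (rn p) (JS p q m) (JS p q (Suc m)) (pb p) ?F \<gamma> =
       swap (JS p q m) (second_lift (rn p) (JS p q m) (JS p q (Suc m)) (pb p) ?F (swap (rn p) \<gamma>))"
      if \<gamma>: "\<gamma> \<in> points (fibre (rn p) (WD 2) b)" for \<gamma>
    proof -
      let ?A = "\<lambda>(d::nat \<Rightarrow> real) j. d (Transposition.transpose 0 1 j)"
      have gt: "\<gamma> \<in> points (tensor (rn p) (WD 2))" and g0: "\<gamma> (\<lambda>_. 0) = b" using \<gamma> by (auto simp: fibre_points base_def)
      have gm': "\<gamma> \<in> smooth_maps (rn 2) (rn p)" by (rule tensor_WD_map[OF gt])
      have inc: "(\<lambda>d. d(1 := 0)) \<in> smooth_maps (rn 1) (rn 2)"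
        using inf_map_WD_map[OF inf_map_include[of 1]] by (simp add: numeral_2_eq_2 One_nat_def)
      \<comment> \<open>For the jet of a section the family is constant, so the result is the jet of
        \<open>s\<close> along \<open>g\<close>, and exchanging the variables of \<open>g\<close>
        exchanges those of the result.\<close>
      have gen: "second_lift (rn p) (JS p q m) (JS p q (Suc m)) (pb p) ?F (wclass (rn p) (WD 2) g) =
          wclass (JS p q m) (WD 2) (\<lambda>d. jet_of p q m s (g d))"
        if g: "g \<in> smooth_maps (rn 2) (rn p)" and g0: "g (\<lambda>_. 0) = b" for g
      proof (rule second_lift_family[OF gm good[unfolded Suc] g fam_const[OF s]])
        have B: "(\<lambda>e. g (e(1 := 0))) \<in> smooth_maps (rn 1) (rn p)" by (rule smooth_maps_comp'[OF inc g])
        have z: "(\<lambda>_. 0)(1 := 0) = (\<lambda>_. 0::real)" by auto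
        have "wclass (rn p) (WD 1) (\<lambda>e. g (e(1 := 0))) \<in> points (fibre (rn p) (WD 1) b)"
          using tensor_WD_points[OF B] base_wclass_WD[OF coords_rn B] g0 unfolding z by (simp add: fibre_points)
        then have "?F (wclass (rn p) (WD 1) (\<lambda>e. g (e(1 := 0)))) = prolong (JS p q n) (WD 1) (jet_of p q n s) (wclass (rn p) (WD 1) (\<lambda>e. g (e(1 := 0))))"
          by (simp add: section_lift_def)
        then show "?F (wclass (rn p) (WD 1) (\<lambda>e. g (e(1 := 0)))) = wclass (JS p q (Suc m)) (WD 1) (\<lambda>e. jet_of p q (Suc m) s (g (e(1 := 0))))"
          unfolding Suc prolong_WD[OF B J[unfolded Suc]] .
      qed
      have 1: "second_lift (rn p) (JS p q m) (JS p q (Suc m)) (pb p) ?F \<gamma> = wclass (JS p q m) (WD 2) (\<lambda>d. jet_of p q m s (\<gamma> d))"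
        using gen[OF gm' g0] tensor_point_map(2)[OF gt] by simp
      have sw: "swap (rn p) \<gamma> = wclass (rn p) (WD 2) (\<lambda>d. \<gamma> (?A d))"
        using swap_wclass[OF gm'] tensor_point_map(2)[OF gt] by simp
      have 2: "second_lift (rn p) (JS p q m) (JS p q (Suc m)) (pb p) ?F (swap (rn p) \<gamma>) = wclass (JS p q m) (WD 2) (\<lambda>d. jet_of p q m s (\<gamma> (?A d)))"
        unfolding sw by (rule gen[OF swap_map[OF gm']]) (use g0 in simp)
      show ?thesis
        unfolding 1 2 by (subst swap_wclass[OF smooth_maps_comp'[OF swap_map[OF gm'] jet_of_smooth[OF gm s]]]) simp
    qed
    ultimately show ?thesis using bb by (simp add: holon_def Suc)
  qed
  ultimately show ?thesis
    unfolding jets_Suc_points by (intro exI[of _ "jet_of p q n s b"] exI[of _ ?F]) simp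
qed

lemma jet_of_Suc_curve:
  assumes pred: "\<And>m. n = Suc m \<Longrightarrow> good p q m"
    and C: "\<And>k. k \<in> jet_indices p q (Suc n) \<Longrightarrow> smooth (\<lambda>t. C t k)"
  shows "(\<lambda>t. jet_of p q (Suc n) (sec p q (Suc n) (C t)) (base_pt p (C t))) \<in> curves (JS p q (Suc n))"
  unfolding jets_Suc_curves
proof (intro conjI allI impI)
  let ?S = "\<lambda>t. sec p q (Suc n) (C t)" and ?b = "\<lambda>t. base_pt p (C t)"
  show "jet_of p q (Suc n) (?S t) (?b t) \<in> points (JS p q (Suc n))" for t
    by (rule jet_of_Suc_points[OF sect_sec base_pt_points pred])
  have Csf: "(\<lambda>e. C (u e) k) \<in> sf l" if "u \<in> sf l" "k \<in> jet_indices p q (Suc n)" for u l k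
    using smooth_compose[OF C[OF that(2)] sfD[OF that(1)]] by (rule sfI)
  have F1: "fam p q l (\<lambda>e. ?S (u e))" if "u \<in> sf l" for u l
    by (rule fam_sec[OF Csf[OF that]])
  have B1: "(\<lambda>e. ?b (u e)) \<in> smooth_maps (rn l) (rn p)" if "u \<in> sf l" for u l
    unfolding coords_smooth_maps_iff[OF coords_rn]
    using Csf[OF that] base_pt_points by (auto simp: base_pt_def jet_indices_def)
  \<comment> \<open>A curve of coefficients is treated as a family with one parameter; this curve
    runs through the parameter space.\<close>
  have "(\<lambda>t. (\<lambda>_. 0)(0 := t)) \<in> curves (rn 1)"
    using append_last_curve[OF const_curve[OF zero_points[of 0]] smooth_ident] by (simp add: One_nat_def)
  from smooth_maps_curve[OF fam_jet_of[OF good F1[OF sf_coord[of 0]] B1[OF sf_coord[of 0]]] this]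
  show "(\<lambda>t. jet_base (jet_of p q (Suc n) (?S t) (?b t))) \<in> curves (JS p q n)" by simp
  fix g t
  assume g: "smooth g" and t: "t \<in> curves (tensor (rn p) (WD 1))"
    and bt: "\<forall>r. base (t r) = pb p (jet_base (jet_of p q (Suc n) (?S (g r)) (?b (g r))))"
  have bt': "base (t r) = ?b (g r)" for r
    using bt pb_jet_of[OF good sect_sec base_pt_points] by simp
  \<comment> \<open>A curve of classes lifts to a smooth family of maps; its values under the jets
    are then classes of a joint family with the time as last variable.\<close>
  obtain f where f: "f \<in> curves (mapping_space 1 (rn p))" "\<And>r. t r = wclass (rn p) (WD 1) (f r)"
    using tensor_curve_lift[OF coords_rn t] by blast
  have "jet_fun (jet_of p q (Suc n) (?S (g r)) (?b (g r))) (t r) = wclass (JS p q n) (WD 1) (\<lambda>d. jet_of p q n (?S (g r)) (f r d))" for r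
  proof -
    have "t r \<in> points (fibre (rn p) (WD 1) (?b (g r)))"
      using coords_curve_points[OF coords_tensor[OF coords_rn] t] bt' by (simp add: fibre_points)
    from jet_fun_jet_of[OF this, of q n "?S (g r)"] show ?thesis
      unfolding f(2) prolong_WD[OF mapping_curve_map[OF f(1)] jet_of_smooth[OF good sect_sec]] .
  qed
  moreover have "(\<lambda>r. wclass (JS p q n) (WD 1) (\<lambda>d. jet_of p q n (?S (g r)) (f r d))) \<in> curves (tensor (JS p q n) (WD 1))"
  proof (rule tensor_WD_curve, rule mapping_curveI[OF good_coords[OF good]])
    show "jet_of p q n (?S (g r)) (f r d) \<in> points (JS p q n)" if "d \<in> points (rn 1)" for r d
      by (intro jet_of_points[OF good] sect_sec smooth_maps_point[OF mapping_curve_map[OF f(1)] that])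
    fix k assume k: "k \<in> jet_indices p q n"
    have gs: "(\<lambda>y. g (y 1)) \<in> sf (Suc 1)"
      by (rule sfI, rule smooth_compose[OF g]) (simp add: curves_rn)
    have "(\<lambda>y. f (y 1) (y(1 := 0))) \<in> smooth_maps (rn (Suc 1)) (rn p)"
      unfolding coords_smooth_maps_iff[OF coords_rn]
    proof (intro conjI ballI)
      fix y :: "nat \<Rightarrow> real" assume "y \<in> points (rn (Suc 1))"
      then show "f (y 1) (y(1 := 0)) \<in> points (rn p)"
        by (intro smooth_maps_point[OF mapping_curve_map[OF f(1)]]) (auto simp: points_rn One_nat_def)
    qed (rule mapping_curveD[OF coords_rn f(1)])
    from coords_smooth_map[OF good_coords[OF good] fam_jet_of[OF good F1[OF gs] this] k]
    show "(\<lambda>y. jcoord p n (jet_of p q n (?S (g (y 1))) (f (y 1) (y(1 := 0)))) k) \<in> sf (Suc 1)" .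
  qed
  ultimately show "(\<lambda>r. jet_fun (jet_of p q (Suc n) (?S (g r)) (?b (g r))) (t r)) \<in> curves (tensor (JS p q n) (WD 1))" by simp
qed

end

text \<open>Condition (ii) is evaluated on the affine square with edges along the axes
  \<open>k\<close> and \<open>l\<close>. The coefficient of the product of both variables in
  coordinate \<open>(\<alpha>, j)\<close> is the derivative along \<open>k\<close> of the coordinate
  \<open>(l # \<alpha>, j)\<close>, so the symmetry of (ii) exchanges \<open>k\<close> and
  \<open>l\<close>.\<close>

lemma holon_symmetric:
  assumes gm: "good p q m" and good: "good p q (Suc m)"
    and F: "(x, F) \<in> points (J1 (rn p) (JS p q (Suc m)) (pb p))" and hol: "holon p q (Suc m) x F"
    and b: "b = pb p x" and kl: "k < p" "l < p"
    and \<alpha>: "set \<alpha> \<subseteq> {..<p}" "length \<alpha> = m" and j: "p \<le> j" "j < p + q"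
  shows "pd 0 (\<lambda>d. jcoord p (Suc m) (F (tangent_vec p b (unit_vec k)) d) (l # \<alpha>, j)) (\<lambda>_. 0) =
    pd 0 (\<lambda>d. jcoord p (Suc m) (F (tangent_vec p b (unit_vec l)) d) (k # \<alpha>, j)) (\<lambda>_. 0)"
proof -
  let ?n = "Suc m"
  have bp: "b \<in> points (rn p)" using b by (simp add: proj_points)
  note lift = J1_lift[OF F, folded b]
  note co = good_coords[OF good]
  let ?A = "\<lambda>(d::nat \<Rightarrow> real) j. d (Transposition.transpose 0 1 j)"
  define g where "g k l d = (\<lambda>i. b i + d 0 * unit_vec k i + d 1 * unit_vec l i)" for k l :: nat and d :: "nat \<Rightarrow> real"
  have gmap: "g k l \<in> smooth_maps (rn 2) (rn p)" if "k < p" "l < p" for k l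
    unfolding coords_smooth_maps_iff[OF coords_rn] g_def
    using bp unit_vec_points[OF that(1)] unit_vec_points[OF that(2)]
    by (auto simp: points_rn intro!: sf_add sf_mult sf_const sf_coord)
  \<comment> \<open>Coefficients of sections that interpolate the values of the lift along the first
    edge. The base point is replaced by the exact line: \<open>second_lift_family\<close> requires
    the jets to lie over the edge on the nose, whereas a representative lies over it only modulo the
    ideal.\<close>
  define ct where "ct k e = (\<lambda>(\<beta>, i). if \<beta> = [] \<and> i < p then b i + e 0 * unit_vec k i
    else jcoord p ?n (F (tangent_vec p b (unit_vec k)) e) (\<beta>, i))" for k and e :: "nat \<Rightarrow> real"
  let ?W = "\<lambda>k l. second_lift (rn p) (JS p q m) (JS p q ?n) (pb p) F (wclass (rn p) (WD 2) (g k l))"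
  let ?H = "\<lambda>k l d. jet_of p q m (sec p q ?n (ct k (d(1 := 0)))) (g k l d)"
  have inc: "(\<lambda>d. d(1 := 0)) \<in> smooth_maps (rn 2) (rn 1)"
    using inf_map_WD_map[OF inf_map_project[of 1]] by (simp add: numeral_2_eq_2 One_nat_def)
  have main: "?W k l = wclass (JS p q m) (WD 2) (?H k l) \<and> ?H k l \<in> smooth_maps (rn 2) (JS p q m) \<and>
      mixed 2 {0, 1} (\<lambda>d. jcoord p m (?H k l d) (\<alpha>, j)) =
      pd 0 (\<lambda>d. jcoord p ?n (F (tangent_vec p b (unit_vec k)) d) (l # \<alpha>, j)) (\<lambda>_. 0)" if k: "k < p" and l: "l < p" for k l
  proof -
    let ?t = "tangent_vec p b (unit_vec k)"
    note tf = tangent_vec_fibre[OF bp unit_vec_points[OF k]]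
    note lm = line_map[OF bp unit_vec_points[OF k] zero_less_one]
    have Ft: "F ?t \<in> points (tensor (JS p q ?n) (WD 1))" "F ?t (\<lambda>_. 0) = x"
      using smooth_maps_point[OF lift(2) tf] by (simp_all add: fibre_points base_def)
    note Fm = tensor_WD_map[OF Ft(1)]
    have cs: "sym_coeffs p q ?n (ct k e)" if "e \<in> points (rn 1)" for e
      using sym_coeffs_jcoord[OF good smooth_maps_point[OF Fm that]] by (simp add: sym_coeffs_def ct_def)
    have bc: "base_pt p (ct k e) = (\<lambda>i. b i + e 0 * unit_vec k i)" for e
      using bp k by (auto simp: base_pt_def ct_def unit_vec_def points_rn fun_eq_iff)
    have fam: "fam p q 1 (\<lambda>e. sec p q ?n (ct k e))"
    proof (rule fam_sec)
      fix \<kappa> assume "\<kappa> \<in> jet_indices p q ?n"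
      then show "(\<lambda>e. ct k e \<kappa>) \<in> sf 1"
        using coords_smooth_map[OF co Fm, of \<kappa>]
        by (cases \<kappa>; cases "fst \<kappa> = [] \<and> snd \<kappa> < p") (auto simp: ct_def intro!: sf_add sf_mult sf_const sf_coord)
    qed
    have jc: "jcoord p ?n (jet_of p q ?n (sec p q ?n (ct k e)) (\<lambda>i. b i + e 0 * unit_vec k i)) \<kappa> = ct k e \<kappa>"
      if e: "e \<in> points (rn 1)" and \<kappa>: "\<kappa> \<in> jet_indices p q ?n" for e \<kappa>
    proof -
      obtain \<beta> i where "\<kappa> = (\<beta>, i)" by fastforce
      then show ?thesis
        using jcoord_jet_of[OF good sect_sec base_pt_points, of \<beta> i ?n "ct k e" "ct k e"] pds_sec[OF cs[OF e], of \<beta> i] \<kappa>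
        by (simp add: bc)
    qed
    \<comment> \<open>The replacement does not change the class, because the lift projects to the
      class of that line.\<close>
    have "wclass (JS p q ?n) (WD 1) (F ?t) =
        wclass (JS p q ?n) (WD 1) (\<lambda>e. jet_of p q ?n (sec p q ?n (ct k e)) (\<lambda>i. b i + e 0 * unit_vec k i))"
      unfolding jets_WD1_eq_iff[OF good Fm fam_jet_of[OF good fam lm]]
    proof (intro ballI conjI)
      fix \<kappa> assume \<kappa>: "\<kappa> \<in> jet_indices p q ?n"
      have pj: "pb p (F ?t e) i = jcoord p ?n (F ?t e) ([], i)" if "e \<in> points (rn 1)" "i < p" for e i
        using base_pt_jcoord[OF good smooth_maps_point[OF Fm that(1)]] that(2) by (metis base_pt_def)
      have "wclass (rn p) (WD 1) (\<lambda>e. pb p (F ?t e)) = wclass (rn p) (WD 1) (\<lambda>d l. b l + d 0 * unit_vec k l)"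
        using lift(4)[OF tf] by (simp add: prolong_def o_def tangent_vec_def)
      then have pr: "pb p (F ?t (\<lambda>_. 0)) i = b i" "pd 0 (\<lambda>e. pb p (F ?t e) i) (\<lambda>_. 0) = unit_vec k i" if "i < p" for i
        using that unfolding rn_WD1_eq_iff[OF smooth_maps_comp'[OF Fm pb_smooth[OF good]] lm] by (simp_all add: pd_line)
      show "jcoord p ?n (F ?t (\<lambda>_. 0)) \<kappa> =
          jcoord p ?n (jet_of p q ?n (sec p q ?n (ct k (\<lambda>_. 0))) (\<lambda>i. b i + (\<lambda>_. 0) 0 * unit_vec k i)) \<kappa>"
        unfolding jc[OF zero_points \<kappa>]
        using pj[OF zero_points] pr(1) by (cases \<kappa>) (auto simp: ct_def)
      have "pd 0 (\<lambda>e. jcoord p ?n (jet_of p q ?n (sec p q ?n (ct k e)) (\<lambda>i. b i + e 0 * unit_vec k i)) \<kappa>) (\<lambda>_. 0) =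
          pd 0 (\<lambda>e. ct k e \<kappa>) (\<lambda>_. 0)"
        by (rule pd_cong[OF jc[OF _ \<kappa>] zero_less_one zero_points])
      also have "\<dots> = pd 0 (\<lambda>e. jcoord p ?n (F ?t e) \<kappa>) (\<lambda>_. 0)"
      proof (cases "fst \<kappa> = [] \<and> snd \<kappa> < p")
        case True
        then obtain i where i: "\<kappa> = ([], i)" "i < p" by (cases \<kappa>) auto
        then have "pd 0 (\<lambda>e. ct k e \<kappa>) (\<lambda>_. 0) = pd 0 (\<lambda>e. pb p (F ?t e) i) (\<lambda>_. 0)"
          using pr(2) by (simp add: ct_def pd_line)
        also have "\<dots> = pd 0 (\<lambda>e. jcoord p ?n (F ?t e) \<kappa>) (\<lambda>_. 0)"
          unfolding i(1) by (rule pd_cong[OF pj[OF _ i(2)] zero_less_one zero_points])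
        finally show ?thesis .
      next
        case False
        then have "(\<lambda>e. ct k e \<kappa>) = (\<lambda>e. jcoord p ?n (F ?t e) \<kappa>)"
          by (cases \<kappa>) (auto simp: ct_def)
        then show ?thesis by simp
      qed
      finally show "pd 0 (\<lambda>e. jcoord p ?n (F ?t e) \<kappa>) (\<lambda>_. 0) =
        pd 0 (\<lambda>e. jcoord p ?n (jet_of p q ?n (sec p q ?n (ct k e)) (\<lambda>i. b i + e 0 * unit_vec k i)) \<kappa>) (\<lambda>_. 0)" by simp
    qed
    then have Fe: "F ?t = wclass (JS p q ?n) (WD 1) (\<lambda>e. jet_of p q ?n (sec p q ?n (ct k e)) (\<lambda>i. b i + e 0 * unit_vec k i))"
      using tensor_point_map(2)[OF Ft(1)] by simp
    have g0: "g k l (e(1 := 0)) = (\<lambda>i. b i + e 0 * unit_vec k i)" for e by (simp add: g_def)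
    have W: "?W k l = wclass (JS p q m) (WD 2) (?H k l)"
      by (rule second_lift_family[OF gm good gmap[OF k l] fam]) (unfold g0, use Fe in \<open>simp only: tangent_vec_def\<close>)
    have H: "?H k l \<in> smooth_maps (rn 2) (JS p q m)"
      by (rule fam_jet_of[OF gm fam_reparam[OF fam inc] gmap[OF k l]])
    let ?\<Psi> = "\<lambda>d. jcoord p m (?H k l d) (\<alpha>, j)"
    have ai: "(\<alpha>, j) \<in> jet_indices p q m" "(l # \<alpha>, j) \<in> jet_indices p q ?n" using \<alpha> j l by (auto simp: jet_indices_def)
    have \<Psi>: "?\<Psi> \<in> sf 2" by (rule coords_smooth_map[OF good_coords[OF gm] H ai(1)])
    have \<Psi>e: "?\<Psi> d = pds \<alpha> (\<lambda>y. sec p q ?n (ct k (d(1 := 0))) y j) (g k l d)" if "d \<in> points (rn 2)" for d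
      by (rule jcoord_jet_of[OF gm sect_sec smooth_maps_point[OF gmap[OF k l] that] ai(1)])
    \<comment> \<open>Moving variable 1 leaves the section fixed and moves the point along the axis
      \<open>l\<close>. Where variable 1 vanishes, this point is the centre of the expansion, and
      the derivatives are the coefficients.\<close>
    have p1: "pd 1 ?\<Psi> d = jcoord p ?n (F ?t d) (l # \<alpha>, j)" if d: "d \<in> points (rn 1)" for d
    proof -
      have d2: "d \<in> points (rn 2)" "d(1 := 0) = d" using d by (auto simp: points_rn fun_eq_iff)
      let ?f = "\<lambda>y. sec p q ?n (ct k d) y j"
      have "pd 1 ?\<Psi> d = pd 1 (\<lambda>d'. pds \<alpha> ?f (g k l d')) d"
        unfolding pd_def
        by (rule arg_cong[of _ _ "\<lambda>f. deriv f (d 1)"], rule ext)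
          (subst \<Psi>e, use d2 in \<open>auto simp: upd_points\<close>)
      also have "\<dots> = pd l (pds \<alpha> ?f) (g k l d)"
        by (rule pd_chain1[where A = "g k l", OF pds_sf[OF sect_sf[OF sect_sec] \<alpha>(1)] l smooth_maps_point[OF gmap[OF k l] d2(1)]])
          (auto simp: g_def unit_vec_def fun_eq_iff algebra_simps)
      also have "g k l d = base_pt p (ct k d)"
        using g0[of d] unfolding d2(2) bc .
      also have "pd l (pds \<alpha> ?f) (base_pt p (ct k d)) = ct k d (l # \<alpha>, j)"
        using pds_sec[OF cs[OF d] ai(2)] by simp
      also have "\<dots> = jcoord p ?n (F ?t d) (l # \<alpha>, j)"
        by (simp add: ct_def del: jcoord.simps)
      finally show ?thesis .
    qed
    have "mixed 2 {0, 1} ?\<Psi> = pd 0 (pd 1 ?\<Psi>) (\<lambda>_. 0)" by (rule mixed_2[OF \<Psi>])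
    also have "\<dots> = pd 0 (\<lambda>d. jcoord p ?n (F ?t d) (l # \<alpha>, j)) (\<lambda>_. 0)"
      by (rule pd_cong[OF p1 zero_less_one zero_points])
    finally show ?thesis using W H by blast
  qed
  have gsw: "swap (rn p) (wclass (rn p) (WD 2) (g k l)) = wclass (rn p) (WD 2) (g l k)"
  proof -
    have "(\<lambda>d. g k l (?A d)) = g l k" by (simp add: g_def fun_eq_iff)
    then show ?thesis using swap_wclass[OF gmap[OF kl]] by simp
  qed
  have "wclass (rn p) (WD 2) (g k l) \<in> points (fibre (rn p) (WD 2) b)"
    using tensor_WD_points[OF gmap[OF kl]] base_wclass_WD[OF coords_rn gmap[OF kl]]
    by (simp add: fibre_points g_def)
  then have "?W k l = swap (JS p q m) (?W l k)"
    using hol b unfolding gsw[symmetric] by (simp add: holon_def)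
  moreover have H1: "?H k l \<in> smooth_maps (rn 2) (JS p q m)" and H2: "?H l k \<in> smooth_maps (rn 2) (JS p q m)"
    by (rule conjunct1[OF conjunct2[OF main[OF kl]]], rule conjunct1[OF conjunct2[OF main[OF kl(2,1)]]])
  ultimately have e: "wclass (JS p q m) (WD 2) (?H k l) = wclass (JS p q m) (WD 2) (\<lambda>d. ?H l k (?A d))"
    unfolding conjunct1[OF main[OF kl]] conjunct1[OF main[OF kl(2,1)]] swap_wclass[OF H2] by (simp only:)
  have ai: "(\<alpha>, j) \<in> jet_indices p q m" using \<alpha> j by (auto simp: jet_indices_def)
  have s01: "{0, 1} \<subseteq> {..<2::nat}" by auto
  have "mixed 2 {0, 1} (\<lambda>d. jcoord p m (?H k l d) (\<alpha>, j)) = mixed 2 {0, 1} (\<lambda>d. jcoord p m (?H l k (?A d)) (\<alpha>, j))"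
    using e unfolding wclass_WD_eq_iff[OF good_coords[OF gm] H1 swap_map[OF H2]] using ai s01 by blast
  also have "\<dots> = mixed 2 {0, 1} (\<lambda>d. jcoord p m (?H l k d) (\<alpha>, j))"
    by (rule mixed_2_swap[OF coords_smooth_map[OF good_coords[OF gm] H2 ai]])
  finally show ?thesis using main[OF kl] main[OF kl(2,1)] by simp
qed

text \<open>The coordinates of the jet are symmetric and therefore belong to a section
  \<open>s\<close>. The underlying jet is that of \<open>s\<close> because the coordinates of lower
  order agree; the lift is that of \<open>s\<close> because both have the same values on tangent
  vectors, which is checked coordinate by coordinate.\<close>

lemma jets_Suc_retract:
  assumes good: "good p q n" and pred: "\<And>m. n = Suc m \<Longrightarrow> good p q m" and J: "J \<in> points (JS p q (Suc n))"
  shows "jet_of p q (Suc n) (sec p q (Suc n) (jcoord p (Suc n) J)) (base_pt p (jcoord p (Suc n) J)) = J"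
proof -
  obtain x F where JF: "J = Jet x F" and F: "(x, F) \<in> points (J1 (rn p) (JS p q n) (pb p))" and hol: "holon p q n x F"
    using J jets_Suc_points by blast
  note co = good_coords[OF good]
  define b where "b = pb p x"
  define C where "C = jcoord p (Suc n) J"
  have bp: "b \<in> points (rn p)" by (simp add: b_def proj_points)
  note lift = J1_lift[OF F, folded b_def]
  have Ft: "F t \<in> points (tensor (JS p q n) (WD 1))" "F t (\<lambda>_. 0) = x" if "t \<in> points (fibre (rn p) (WD 1) b)" for t
    using smooth_maps_point[OF lift(2) that] by (simp_all add: fibre_points base_def)
  have C0: "C k = jcoord p n x k" if "length (fst k) \<le> n" for k
    using that by (simp add: C_def JF)
  have C1: "C (k # \<alpha>, j) = pd 0 (\<lambda>d. jcoord p n (F (tangent_vec p b (unit_vec k)) d) (\<alpha>, j)) (\<lambda>_. 0)" if "length \<alpha> = n" for k \<alpha> j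
    using that by (simp add: C_def JF b_def)
  have bC: "base_pt p C = b"
    using base_pt_jcoord[OF good lift(1)] by (simp add: base_pt_def C0 b_def cong: if_cong)
  have "sym_coeffs p q (Suc n) C"
    unfolding sym_coeffs_def symm_def
  proof (intro allI impI)
    fix j A k l D
    assume j: "p \<le> j" "j < p + q" and sl: "set (A @ k # l # D) \<subseteq> {..<p}" "length (A @ k # l # D) \<le> Suc n"
    \<comment> \<open>If the pair does not come first, the symmetry is inherited from jets of lower
      order: for short lists from the underlying jet, otherwise from the values of the lift. Only a
      pair at the head of a list of full length calls for condition (ii).\<close>
    show "C (A @ k # l # D, j) = C (A @ l # k # D, j)"
    proof (cases "length (A @ k # l # D) \<le> n")
      case True
      have sy: "symm p n (\<lambda>\<alpha>. jcoord p n x (\<alpha>, j))"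
        using sym_coeffs_jcoord[OF good lift(1)] j by (simp add: sym_coeffs_def)
      from symmD[OF sy, of A k l D] True sl show ?thesis by (simp add: C0)
    next
      case False
      then have len: "length (A @ k # l # D) = Suc n" using sl by simp
      show ?thesis
      proof (cases A)
        case (Cons a A')
        then have a: "a < p" using sl by simp
        note tf = tangent_vec_fibre[OF bp unit_vec_points[OF a]]
        have "jcoord p n (F (tangent_vec p b (unit_vec a)) d) (A' @ k # l # D, j) = jcoord p n (F (tangent_vec p b (unit_vec a)) d) (A' @ l # k # D, j)"
          if d: "d \<in> points (rn 1)" for d
        proof -
          have "symm p n (\<lambda>\<alpha>. jcoord p n (F (tangent_vec p b (unit_vec a)) d) (\<alpha>, j))"
            using sym_coeffs_jcoord[OF good smooth_maps_point[OF tensor_WD_map[OF Ft(1)[OF tf]] d]] j by (simp add: sym_coeffs_def)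
          from symmD[OF this, of A' k l D] sl len Cons show ?thesis by simp
        qed
        then have "pd 0 (\<lambda>d. jcoord p n (F (tangent_vec p b (unit_vec a)) d) (A' @ k # l # D, j)) (\<lambda>_. 0) =
            pd 0 (\<lambda>d. jcoord p n (F (tangent_vec p b (unit_vec a)) d) (A' @ l # k # D, j)) (\<lambda>_. 0)"
          by (rule pd_cong[OF _ zero_less_one zero_points])
        then show ?thesis using len Cons C1[of "A' @ k # l # D" a j] C1[of "A' @ l # k # D" a j] by simp
      next
        case Nil
        then obtain m where n: "n = Suc m" using len by (cases n) auto
        have D: "set D \<subseteq> {..<p}" "length D = m" "k < p" "l < p" using sl len Nil n by auto
        from holon_symmetric[OF pred[OF n] good[unfolded n] F[unfolded n] hol[unfolded n] b_def D(3,4,1,2) j]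
        show ?thesis using Nil len C1[of "l # D" k j] C1[of "k # D" l j] n by (simp del: jcoord.simps)
      qed
    qed
  qed
  note cs = this
  define s where "s = sec p q (Suc n) C"
  have s: "sect p q s" unfolding s_def by (rule sect_sec)
  have sC: "pds \<alpha> (\<lambda>y. s y j) b = C (\<alpha>, j)" if "(\<alpha>, j) \<in> jet_indices p q (Suc n)" for \<alpha> j
    using pds_sec[OF cs that] by (simp add: s_def bC)
  have xs: "jet_of p q n s b = x"
  proof (rule coords_eqI[OF co jet_of_points[OF good s bp] lift(1)])
    fix k assume k: "k \<in> jet_indices p q n"
    obtain \<alpha> j where kk: "k = (\<alpha>, j)" by fastforce
    have k': "(\<alpha>, j) \<in> jet_indices p q (Suc n)" using jet_indices_mono[OF _ k, of "Suc n"] kk by simp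
    show "jcoord p n (jet_of p q n s b) k = jcoord p n x k"
      using jcoord_jet_of[OF good s bp, of \<alpha> j] sC[OF k'] C0[of "(\<alpha>, j)"] k unfolding kk by (simp add: jet_indices_def)
  qed
  have J': "jet_of p q (Suc n) s b \<in> points (JS p q (Suc n))" by (rule jet_of_Suc_points[OF good s bp pred])
  define F' where "F' = snd (section_lift p (JS p q n) 1 (jet_of p q n s) b)"
  have F': "(x, F') \<in> points (J1 (rn p) (JS p q n) (pb p))"
    using J' xs unfolding jets_Suc_points by (simp add: F'_def)
  have F't: "F' t = prolong (JS p q n) (WD 1) (jet_of p q n s) t" if "t \<in> points (fibre (rn p) (WD 1) b)" for t
    using that by (simp add: F'_def section_lift_def)
  have "F t = F' t" if t: "t \<in> points (fibre (rn p) (WD 1) b)" for t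
  proof -
    have tm: "t \<in> smooth_maps (rn 1) (rn p)" "t (\<lambda>_. 0) = b" using t tensor_WD_map by (auto simp: fibre_points base_def)
    note Fm = tensor_WD_map[OF Ft(1)[OF t]]
    have jm: "(\<lambda>d. jet_of p q n s (t d)) \<in> smooth_maps (rn 1) (JS p q n)"
      by (rule smooth_maps_comp'[OF tm(1) jet_of_smooth[OF good s]])
    have F'w: "F' t = wclass (JS p q n) (WD 1) (\<lambda>d. jet_of p q n s (t d))"
      by (simp add: F't[OF t] prolong_def o_def)
    have F'pd: "pd 0 (\<lambda>d. jcoord p n (F' t d) k) (\<lambda>_. 0) = pd 0 (\<lambda>d. jcoord p n (jet_of p q n s (t d)) k) (\<lambda>_. 0)" if "k \<in> jet_indices p q n" for k
      unfolding F'w mixed_1[symmetric] by (rule mixed_wclass[OF co jm that]) simp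
    have "wclass (JS p q n) (WD 1) (F t) = wclass (JS p q n) (WD 1) (\<lambda>d. jet_of p q n s (t d))"
      unfolding jets_WD1_eq_iff[OF good Fm jm]
    proof (intro ballI conjI)
      fix k assume k: "k \<in> jet_indices p q n"
      show "jcoord p n (F t (\<lambda>_. 0)) k = jcoord p n (jet_of p q n s (t (\<lambda>_. 0))) k"
        by (simp add: Ft(2)[OF t] tm(2) xs)
      obtain \<alpha> j where kk: "k = (\<alpha>, j)" by fastforce
      show "pd 0 (\<lambda>d. jcoord p n (F t d) k) (\<lambda>_. 0) = pd 0 (\<lambda>d. jcoord p n (jet_of p q n s (t d)) k) (\<lambda>_. 0)"
      \<comment> \<open>The derivatives of coordinates of lower order are governed by condition (i)
        through \<open>jet_base\<close>; those of top order by linearity and the coordinates of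
        \<open>J\<close>, which record the unit vectors.\<close>
      proof (cases "length \<alpha> < n")
        case True
        then obtain m where n: "n = Suc m" by (cases n) auto
        note gm = pred[OF n]
        have km: "k \<in> jet_indices p q m" "length (fst k) \<le> m" using k True n kk by (auto simp: jet_indices_def)
        have jb: "jet_base \<in> smooth_maps (JS p q n) (JS p q m)" unfolding n by (rule jet_base_smooth)
        have bm: "(\<lambda>d. jet_base (F t d)) \<in> smooth_maps (rn 1) (JS p q m)" by (rule smooth_maps_comp'[OF Fm jb])
        have jm': "(\<lambda>d. jet_of p q m s (t d)) \<in> smooth_maps (rn 1) (JS p q m)"
          by (rule smooth_maps_comp'[OF tm(1) jet_of_smooth[OF gm s]])
        have "wclass (JS p q m) (WD 1) (\<lambda>d. jet_base (F t d)) = jet_fun x t"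
          using hol t by (simp add: holon_def n prolong_def o_def b_def)
        also have "\<dots> = wclass (JS p q m) (WD 1) (\<lambda>d. jet_of p q m s (t d))"
          using jet_fun_jet_of[OF t, of q m s] by (simp add: xs[symmetric] n prolong_def o_def del: jet_of.simps)
        finally have "pd 0 (\<lambda>d. jcoord p m (jet_base (F t d)) k) (\<lambda>_. 0) = pd 0 (\<lambda>d. jcoord p m (jet_of p q m s (t d)) k) (\<lambda>_. 0)"
          using km(1) unfolding jets_WD1_eq_iff[OF gm bm jm'] by blast
        then show ?thesis using km(2) by (simp add: n)
      next
        case False
        then have la: "length \<alpha> = n" using k kk by (auto simp: jet_indices_def)
        obtain v where v: "v \<in> points (rn p)" "t = tangent_vec p b v" using fibre_WD1_tangent_vec[OF t] by blast
        have "pd 0 (\<lambda>d. jcoord p n (F (tangent_vec p b (unit_vec l)) d) k) (\<lambda>_. 0) = pd 0 (\<lambda>d. jcoord p n (F' (tangent_vec p b (unit_vec l)) d) k) (\<lambda>_. 0)"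
          if l: "l < p" for l
        proof (cases "\<alpha> = [] \<and> j < p")
          case True
          note tf = tangent_vec_fibre[OF bp unit_vec_points[OF l]]
          \<comment> \<open>Components below \<open>p\<close> only occur with the empty list, that
            is, for n = 0. There every lift has the value prescribed by the projection to the
            base.\<close>
          have "pd 0 (\<lambda>d. jcoord p n (G (tangent_vec p b (unit_vec l)) d) k) (\<lambda>_. 0) = unit_vec l j"
            if G: "(x, G) \<in> points (J1 (rn p) (JS p q n) (pb p))" for G
          proof -
            note lG = J1_lift[OF G, folded b_def]
            have Gm: "G (tangent_vec p b (unit_vec l)) \<in> smooth_maps (rn 1) (JS p q n)"
              using smooth_maps_point[OF lG(2) tf] tensor_WD_map by (auto simp: fibre_points)
            have "wclass (rn p) (WD 1) (\<lambda>e. pb p (G (tangent_vec p b (unit_vec l)) e)) = wclass (rn p) (WD 1) (\<lambda>d i. b i + d 0 * unit_vec l i)"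
              using lG(4)[OF tf] by (simp add: prolong_def o_def tangent_vec_def)
            then have "pd 0 (\<lambda>e. pb p (G (tangent_vec p b (unit_vec l)) e) j) (\<lambda>_. 0) = unit_vec l j"
              using True unfolding rn_WD1_eq_iff[OF smooth_maps_comp'[OF Gm pb_smooth[OF good]] line_map[OF bp unit_vec_points[OF l] zero_less_one]]
              by (simp add: pd_line)
            moreover have "pd 0 (\<lambda>e. pb p (G (tangent_vec p b (unit_vec l)) e) j) (\<lambda>_. 0) = pd 0 (\<lambda>d. jcoord p n (G (tangent_vec p b (unit_vec l)) d) k) (\<lambda>_. 0)"
            proof (rule pd_cong[OF _ zero_less_one zero_points])
              fix e :: "nat \<Rightarrow> real" assume "e \<in> points (rn 1)"
              from base_pt_jcoord[OF good smooth_maps_point[OF Gm this]] True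
              show "pb p (G (tangent_vec p b (unit_vec l)) e) j = jcoord p n (G (tangent_vec p b (unit_vec l)) e) k"
                unfolding kk by (metis base_pt_def)
            qed
            ultimately show ?thesis by simp
          qed
          from this[OF F] this[OF F'] show ?thesis by simp
        next
          case False
          then have li: "(l # \<alpha>, j) \<in> jet_indices p q (Suc n)" using k kk la l by (auto simp: jet_indices_def)
          have "pd 0 (\<lambda>d. jcoord p n (F' (tangent_vec p b (unit_vec l)) d) k) (\<lambda>_. 0) = pds (l # \<alpha>) (\<lambda>y. s y j) b"
            unfolding F't[OF tangent_vec_fibre[OF bp unit_vec_points[OF l]]] kk
            by (rule prolong_jet_of_tangent_vec[OF good s bp l]) (use k kk in simp)
          also have "\<dots> = pd 0 (\<lambda>d. jcoord p n (F (tangent_vec p b (unit_vec l)) d) k) (\<lambda>_. 0)"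
            unfolding sC[OF li] C1[OF la] kk ..
          finally show ?thesis by simp
        qed
        then have "pd 0 (\<lambda>d. jcoord p n (F t d) k) (\<lambda>_. 0) = pd 0 (\<lambda>d. jcoord p n (F' t d) k) (\<lambda>_. 0)"
          unfolding v(2) lift_linear[OF good F k b_def v(1)] lift_linear[OF good F' k b_def v(1)] by simp
        then show ?thesis using F'pd[OF k] by simp
      qed
    qed
    then show ?thesis using F'w tensor_point_map(2)[OF Ft(1)[OF t]] by simp
  qed
  then have "F = F'"
    by (rule extensionalityI[OF lift(3) J1_lift(3)[OF F', folded b_def]])
  then have "jet_of p q (Suc n) s b = J"
    using xs by (simp add: JF F'_def)
  then show ?thesis unfolding C_def[symmetric] bC s_def .
qed

lemma good_Suc:
  assumes good: "good p q n" and pred: "\<And>m. n = Suc m \<Longrightarrow> good p q m"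
  shows "good p q (Suc n)"
  unfolding good_def
proof (intro conjI allI impI)
  fix s b assume s: "sect p q s" and b: "b \<in> points (rn p)"
  show "jet_of p q (Suc n) s b \<in> points (JS p q (Suc n))" by (rule jet_of_Suc_points[OF good s b pred])
  show "jcoord p (Suc n) (jet_of p q (Suc n) s b) (\<alpha>, j) = pds \<alpha> (\<lambda>x. s x j) b" if "(\<alpha>, j) \<in> jet_indices p q (Suc n)" for \<alpha> j
    by (rule jcoord_jet_of_Suc[OF good s b that])
next
  have bb: "bottom x = bottom (jet_base x)" if "x \<in> points (JS p q (Suc n))" for x
    using that unfolding jets_Suc_points by auto
  have bs: "bottom \<in> smooth_maps (JS p q n) (rn (p + q))" using good by (simp add: good_def)
  note cb = smooth_maps_comp'[OF jet_base_smooth bs]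
  have cp: "c t \<in> points (JS p q (Suc n))" if "c \<in> curves (JS p q (Suc n))" for c t
    using that by (simp add: jets_Suc_curves)
  show "bottom \<in> smooth_maps (JS p q (Suc n)) (rn (p + q))"
    using smooth_maps_point[OF cb] smooth_maps_curve[OF cb] bb cp by (intro smooth_mapsI) simp_all
  show "coords (JS p q (Suc n)) (jet_indices p q (Suc n)) (jcoord p (Suc n)) (\<lambda>c. jet_of p q (Suc n) (sec p q (Suc n) c) (base_pt p c))"
    unfolding coords_def
  proof (intro conjI ballI allI impI finite_jet_indices)
    fix c k assume c: "c \<in> curves (JS p q (Suc n))" and k: "k \<in> jet_indices p q (Suc n)"
    show "smooth (\<lambda>t. jcoord p (Suc n) (c t) k)"
    proof (cases "length (fst k) \<le> n")
      case True
      then have "k \<in> jet_indices p q n" using k by (auto simp: jet_indices_def)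
      from coords_curve_smooth[OF good_coords[OF good] smooth_maps_curve[OF jet_base_smooth c] this] True
      show ?thesis by simp
    next
      case False
      then obtain l \<alpha> j where kk: "k = (l # \<alpha>, j)" by (cases k; cases "fst k") auto
      then have l: "l < p" "(\<alpha>, j) \<in> jet_indices p q n" using k by (auto simp: jet_indices_def)
      let ?b = "\<lambda>t. pb p (jet_base (c t))"
      have b: "?b \<in> curves (rn p)"
        using smooth_maps_curve[OF pb_smooth[OF good] smooth_maps_curve[OF jet_base_smooth c]] .
      have t: "(\<lambda>r. tangent_vec p (?b r) (unit_vec l)) \<in> curves (tensor (rn p) (WD 1))"
        by (rule tangent_vec_curve[OF b const_curve[OF unit_vec_points[OF l(1)]]])
      have "base (tangent_vec p (?b r) (unit_vec l)) = ?b r" for r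
        using tangent_vec_fibre[OF _ unit_vec_points[OF l(1)], of "?b r"] b by (simp add: fibre_points curves_rn)
      with c t smooth_ident have "(\<lambda>r. jet_fun (c r) (tangent_vec p (?b r) (unit_vec l))) \<in> curves (tensor (JS p q n) (WD 1))"
        unfolding jets_Suc_curves by blast
      from coords_curve_smooth[OF coords_tensor[OF good_coords[OF good]] this, of "({0}, (\<alpha>, j))"] l(2)
      show ?thesis using False by (simp add: kk weil_coord_def mixed_1)
    qed
  next
    fix C :: "real \<Rightarrow> nat list \<times> nat \<Rightarrow> real" assume "\<forall>k\<in>jet_indices p q (Suc n). smooth (\<lambda>t. C t k)"
    then show "(\<lambda>t. jet_of p q (Suc n) (sec p q (Suc n) (C t)) (base_pt p (C t))) \<in> curves (JS p q (Suc n))"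
      by (intro jet_of_Suc_curve[OF good pred]) blast+
  next
    fix x assume "x \<in> points (JS p q (Suc n))"
    then show "jet_of p q (Suc n) (sec p q (Suc n) (jcoord p (Suc n) x)) (base_pt p (jcoord p (Suc n) x)) = x"
      by (intro jets_Suc_retract[OF good] pred)
  next
    fix c c' :: "nat list \<times> nat \<Rightarrow> real" assume "\<forall>k\<in>jet_indices p q (Suc n). c k = c' k"
    then have "sec p q (Suc n) c = sec p q (Suc n) c'" "base_pt p c = base_pt p c'" by (auto intro: sec_cong)
    then show "jet_of p q (Suc n) (sec p q (Suc n) c) (base_pt p c) = jet_of p q (Suc n) (sec p q (Suc n) c') (base_pt p c')" by simp
  qed (rule cp)
qed

text \<open>Strong induction, because condition (ii) relates three successive orders: the new one
  and the two below it.\<close>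

theorem good_jets: "good p q n"
proof (induction n rule: less_induct)
  case (less n)
  then show ?case
    by (cases n) (auto intro: good_0 good_Suc)
qed

section \<open>Tangentials\<close>

text \<open>By the scaling rule the derivative of \<open>G t\<close> at 0 is the same for all t
  different from 0. Being smooth in \<open>t\<close>, it has this value at t = 0 too, where
  \<open>G\<close> vanishes.\<close>

lemma smooth2_scaled_zero:
  assumes G: "smooth2 G" and h: "\<And>t \<epsilon>. G t (t\<^sup>2 * \<epsilon>) = t\<^sup>2 * G 1 \<epsilon>" and z: "\<And>\<epsilon>. G 0 \<epsilon> = 0"
  shows "deriv (G 1) 0 = 0"
proof -
  let ?g = "\<lambda>t. deriv (G t) 0"
  have g: "smooth ?g" by (rule smooth_partial_at_0[OF G])
  have "?g t = ?g 1" if t: "t \<noteq> 0" for t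
  proof -
    have "((\<lambda>\<epsilon>. G t (t\<^sup>2 * \<epsilon>)) has_real_derivative ?g t * t\<^sup>2) (at 0)"
      by (rule DERIV_chain2[of "G t"])
        (use smoothD[OF smooth2_right[OF G], of t 0] in \<open>auto intro!: derivative_eq_intros\<close>)
    moreover have "((\<lambda>\<epsilon>. t\<^sup>2 * G 1 \<epsilon>) has_real_derivative t\<^sup>2 * ?g 1) (at 0)"
      by (rule DERIV_cmult[OF smoothD[OF smooth2_right[OF G]]])
    ultimately have "?g t * t\<^sup>2 = t\<^sup>2 * ?g 1"
      unfolding h by (rule DERIV_unique)
    then show ?thesis using t by simp
  qed
  from smooth_const_off_0[OF g this] have "?g 0 = ?g 1" .
  moreover have "G 0 = (\<lambda>_. 0)" using z by auto
  ultimately show ?thesis by simp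
qed

text \<open>Scaling the variables \<open>i\<close> and \<open>j\<close> by \<open>t\<close> and letting \<open>t\<close> tend to 0 shows that the
  derivative of \<open>\<delta>\<close> in the direction of a coefficient of a monomial containing both variables only
  depends on configurations on which \<open>\<delta>\<close> vanishes. Hence \<open>\<delta>\<close> is a multilinear function of the
  coefficients of the variables alone.\<close>

lemma multihomogeneous_zero:
  fixes \<delta> :: "(nat set \<times> nat \<Rightarrow> real) \<Rightarrow> real"
  assumes sm: "\<And>A. (\<And>S k. S \<subseteq> {..<N} \<Longrightarrow> S \<noteq> {} \<Longrightarrow> k < p \<Longrightarrow> smooth (\<lambda>t. A t (S, k))) \<Longrightarrow> smooth (\<lambda>t::real. \<delta> (A t))"
    and cong: "\<And>a a'. (\<And>S k. S \<subseteq> {..<N} \<Longrightarrow> S \<noteq> {} \<Longrightarrow> k < p \<Longrightarrow> a (S, k) = a' (S, k)) \<Longrightarrow> \<delta> a = \<delta> a'"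
    and hom: "\<And>i t a. i < N \<Longrightarrow> \<delta> (\<lambda>(S, k). (if i \<in> S then t else 1) * a (S, k)) = t * \<delta> a"
    and kap: "\<And>i j a. i < N \<Longrightarrow> j < N \<Longrightarrow> i \<noteq> j \<Longrightarrow>
      (\<And>S k. S \<subseteq> {..<N} \<Longrightarrow> a (S, k) \<noteq> 0 \<Longrightarrow> i \<in> S \<longleftrightarrow> j \<in> S) \<Longrightarrow> \<delta> a = 0"
    and bas: "\<And>\<beta>. length \<beta> = N \<Longrightarrow> set \<beta> \<subseteq> {..<p} \<Longrightarrow> \<delta> (\<lambda>(S, k). if \<exists>i<N. S = {i} \<and> k = \<beta> ! i then 1 else 0) = 0"
  shows "\<delta> a = 0"
proof -
  have kill: "\<delta> a = \<delta> (\<lambda>(S', k). if S' = S then 0 else a (S', k))"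
    if ij: "i < N" "j < N" "i \<noteq> j" "i \<in> S" "j \<in> S" for a S i j
  proof -
    \<comment> \<open>The coefficients at \<open>S\<close> run along the segment from 0 to those of
      \<open>a\<close>; it suffices that \<open>\<delta>\<close> has derivative 0 along it.\<close>
    define c where "c \<epsilon> = (\<lambda>(S', k). if S' = S then \<epsilon> * a (S', k) else a (S', k))" for \<epsilon>
    define w where "w t S' = (if i \<in> S' then t else 1) * (if j \<in> S' then t else 1)" for t :: real and S'
    have "((\<lambda>\<epsilon>. \<delta> (c \<epsilon>)) has_real_derivative 0) (at \<epsilon>0)" for \<epsilon>0
    proof -
      \<comment> \<open>The weight \<open>w\<close> scales the configuration but not the increment.
        As \<open>S\<close> contains both \<open>i\<close> and \<open>j\<close>, homogeneity in
        these two variables gives the increment the weight t^2.\<close>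
      define G where "G t \<epsilon> = \<delta> (\<lambda>(S', k). w t S' * c \<epsilon>0 (S', k) + (if S' = S then \<epsilon> * a (S', k) else 0))" for t \<epsilon>
      have w: "smooth (\<lambda>t. w (f t) S')" if "smooth f" for f S'
        unfolding w_def using that by (cases "i \<in> S'"; cases "j \<in> S'") (auto intro: smooth_mult smooth_const)
      have "smooth2 G"
        unfolding smooth2_def G_def
      proof (intro allI impI sm)
        fix f g S' k assume f: "smooth f" and g: "smooth g"
        have "smooth (\<lambda>t. if S' = S then g t * a (S', k) else 0)"
          using g by (cases "S' = S") (auto intro: smooth_mult smooth_const)
        then show "smooth (\<lambda>t. case (S', k) of (S', k) \<Rightarrow> w (f t) S' * c \<epsilon>0 (S', k) + (if S' = S then g t * a (S', k) else 0))"
          unfolding split_conv by (intro smooth_add smooth_mult[OF w[OF f] smooth_const])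
      qed
      moreover have "G t (t\<^sup>2 * \<epsilon>) = t\<^sup>2 * G 1 \<epsilon>" for t \<epsilon>
      proof -
        let ?b = "\<lambda>(S', k). w 1 S' * c \<epsilon>0 (S', k) + (if S' = S then \<epsilon> * a (S', k) else 0)"
        have "t\<^sup>2 * G 1 \<epsilon> = \<delta> (\<lambda>(S, k). (if i \<in> S then t else 1) * (\<lambda>(S, k). (if j \<in> S then t else 1) * ?b (S, k)) (S, k))"
          unfolding hom[OF ij(1)] hom[OF ij(2)] G_def by (simp add: power2_eq_square)
        also have "\<dots> = G t (t\<^sup>2 * \<epsilon>)"
          unfolding G_def
          by (rule arg_cong[of _ _ \<delta>]) (use ij in \<open>auto simp: fun_eq_iff w_def power2_eq_square algebra_simps\<close>)
        finally show ?thesis by simp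
      qed
      \<comment> \<open>At t = 0 the coefficients of all sets containing \<open>i\<close> or
        \<open>j\<close> are erased, except for the increment at \<open>S\<close>, which contains
        both. So \<open>kap\<close> applies.\<close>
      moreover have "G 0 \<epsilon> = 0" for \<epsilon>
        unfolding G_def by (rule kap[OF ij(1,2,3)]) (use ij in \<open>auto simp: w_def split: if_splits\<close>)
      ultimately have d0: "deriv (G 1) 0 = 0" by (rule smooth2_scaled_zero)
      have G1: "G 1 \<epsilon> = \<delta> (c (\<epsilon>0 + \<epsilon>))" for \<epsilon>
        unfolding G_def by (rule arg_cong[of _ _ \<delta>]) (auto simp: fun_eq_iff w_def c_def algebra_simps)
      have "(G 1 has_real_derivative 0) (at 0)"
        using smoothD[OF smooth2_right[OF \<open>smooth2 G\<close>], of 1 0] d0 by simp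
      then have "((\<lambda>\<epsilon>. \<delta> (c (\<epsilon>0 + \<epsilon>))) has_real_derivative 0) (at 0)"
        by (simp add: G1[abs_def])
      from DERIV_shift[of "\<lambda>\<epsilon>. \<delta> (c \<epsilon>)" 0 0 \<epsilon>0] this show ?thesis by (simp add: add.commute)
    qed
    then have "\<delta> (c 1) = \<delta> (c 0)" by (intro DERIV_isconst_all) blast
    moreover have "c 1 = a" "c 0 = (\<lambda>(S', k). if S' = S then 0 else a (S', k))"
      by (auto simp: c_def fun_eq_iff)
    ultimately show ?thesis by simp
  qed
  have kill_all: "\<delta> a = \<delta> (\<lambda>(S', k). if S' \<in> T then 0 else a (S', k))"
    if "finite T" "\<And>S. S \<in> T \<Longrightarrow> \<exists>i j. i < N \<and> j < N \<and> i \<noteq> j \<and> i \<in> S \<and> j \<in> S" for T a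
    using that
  proof (induction T)
    case (insert S T)
    obtain i j where ij: "i < N" "j < N" "i \<noteq> j" "i \<in> S" "j \<in> S" using insert.prems by blast
    have "\<delta> a = \<delta> (\<lambda>(S', k). if S' \<in> T then 0 else a (S', k))" using insert by blast
    also have "\<dots> = \<delta> (\<lambda>(S', k). if S' = S then 0 else (\<lambda>(S', k). if S' \<in> T then 0 else a (S', k)) (S', k))"
      by (rule kill[OF ij])
    also have "\<dots> = \<delta> (\<lambda>(S', k). if S' \<in> insert S T then 0 else a (S', k))"
      by (rule arg_cong[of _ _ \<delta>]) (auto simp: fun_eq_iff)
    finally show ?case .
  qed simp
  \<comment> \<open>A configuration supported on single variables; row \<open>r i\<close> is the
    axis of variable \<open>i\<close>.\<close>
  define row where "row r = (\<lambda>(S, k). if \<exists>i<N. S = {i} then r (the_elem S) k else (0::real))" for r :: "nat \<Rightarrow> nat \<Rightarrow> real"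
  \<comment> \<open>Induction on the number of rows that are still arbitrary. Row \<open>m\<close>
    is expanded into unit vectors by \<open>homogeneous_linear\<close>; once all rows are unit
    vectors, \<open>bas\<close> applies.\<close>
  have rows: "\<delta> (row r) = 0" if "m \<le> N" "\<And>i. m \<le> i \<Longrightarrow> i < N \<Longrightarrow> \<exists>k<p. r i = unit_vec k" for m r
    using that
  proof (induction m arbitrary: r)
    case 0
    then have "\<forall>i\<in>{..<N}. \<exists>k. k < p \<and> r i = unit_vec k" by auto
    then obtain f where f: "\<And>i. i < N \<Longrightarrow> f i < p \<and> r i = unit_vec (f i)" by (metis lessThan_iff)
    have e: "row r = (\<lambda>(S, k). if \<exists>i<N. S = {i} \<and> k = map f [0..<N] ! i then 1 else 0)"
      using f by (auto simp: row_def fun_eq_iff unit_vec_def)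
    show ?case unfolding e by (rule bas) (use f in auto)
  next
    case (Suc m)
    define h where "h v = \<delta> (row (r(m := v)))" for v
    have m: "m < N" using Suc.prems by simp
    have "h \<in> sf p"
    proof (rule sfI)
      fix c assume c: "c \<in> curves (rn p)"
      show "smooth (\<lambda>t. h (c t))"
        unfolding h_def
      proof (rule sm)
        fix S k
        have "smooth (\<lambda>t. (r(m := c t)) (the_elem S) k)"
          using c by (cases "the_elem S = m") (auto simp: curves_rn smooth_const)
        then show "smooth (\<lambda>t. row (r(m := c t)) (S, k))"
        proof (cases "\<exists>i<N. S = {i}")
          case False
          then have "row (r(m := c t)) (S, k) = 0" for t by (auto simp: row_def)
          then show ?thesis by (simp add: smooth_const)
        next
          case True
          then have "row (r(m := c t)) (S, k) = (r(m := c t)) (the_elem S) k" for t by (auto simp: row_def)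
          with \<open>smooth (\<lambda>t. (r(m := c t)) (the_elem S) k)\<close> show ?thesis by simp
        qed
      qed
    qed
    moreover have "h (\<lambda>i. t * v i) = t * h v" for v t
    proof -
      have "t * h v = \<delta> (\<lambda>(S, k). (if m \<in> S then t else 1) * row (r(m := v)) (S, k))"
        unfolding h_def by (rule hom[OF m, symmetric])
      also have "\<dots> = h (\<lambda>i. t * v i)"
        unfolding h_def by (rule arg_cong[of _ _ \<delta>]) (auto simp: row_def fun_eq_iff)
      finally show ?thesis by simp
    qed
    ultimately have "h v = (\<Sum>k<p. v k * h (unit_vec k))" if "v \<in> points (rn p)" for v
      using homogeneous_linear[of h p v] that by (simp add: unit_vec_def[abs_def])
    moreover have "h (unit_vec k) = 0" if "k < p" for k
      unfolding h_def
    proof (rule Suc.IH)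
      show "\<exists>k'<p. (r(m := unit_vec k)) i = unit_vec k'" if "m \<le> i" "i < N" for i
        using that \<open>k < p\<close> Suc.prems(2)[of i] by (cases "i = m") auto
    qed (use m in simp)
    ultimately have "h v = 0" if "v \<in> points (rn p)" for v using that by simp
    then have "h (\<lambda>k. if k < p then r m k else 0) = 0" by (simp add: points_rn)
    moreover have "\<delta> (row r) = h (\<lambda>k. if k < p then r m k else 0)"
      unfolding h_def by (rule cong) (auto simp: row_def)
    ultimately show ?case by simp
  qed
  let ?T = "{S. S \<subseteq> {..<N} \<and> (\<exists>i j. i < N \<and> j < N \<and> i \<noteq> j \<and> i \<in> S \<and> j \<in> S)}"
  have "finite ?T" by (rule finite_subset[of _ "Pow {..<N}"]) auto
  then have "\<delta> a = \<delta> (\<lambda>(S', k). if S' \<in> ?T then 0 else a (S', k))" by (rule kill_all) blast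
  also have "\<dots> = \<delta> (row (\<lambda>i k. a ({i}, k)))"
  proof (rule cong)
    fix S k assume S: "S \<subseteq> {..<N}" "S \<noteq> {}"
    show "(case (S, k) of (S', k) \<Rightarrow> if S' \<in> ?T then 0 else a (S', k)) = row (\<lambda>i k. a ({i}, k)) (S, k)"
    proof (cases "S \<in> ?T")
      case True
      then have "\<not> (\<exists>i<N. S = {i})" by auto
      with True show ?thesis unfolding row_def split_conv by (simp only: if_True if_False)
    next
      case False
      obtain i where i: "i \<in> S" using S by blast
      have "S = {i}"
      proof (rule ccontr)
        assume "S \<noteq> {i}"
        then obtain j where "j \<in> S" "j \<noteq> i" using i by blast
        with i S False show False by blast
      qed
      with False S show ?thesis by (auto simp: row_def)
    qed
  qed
  also have "\<dots> = 0" by (rule rows[of N]) auto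
  finally show ?thesis .
qed

subsection \<open>Mixed derivatives and changes of variables\<close>

lemma pds_permute:
  assumes f: "f \<in> sf n" and s: "\<sigma> permutes {..<n}" and L: "set L \<subseteq> {..<n}" and d: "d \<in> points (rn n)"
  shows "pds L (\<lambda>d. f (\<lambda>j. d (\<sigma> j))) d = pds (map (inv \<sigma>) L) f (\<lambda>j. d (\<sigma> j))"
  using L d
proof (induction L arbitrary: d)
  case (Cons i L)
  let ?A = "\<lambda>d j. d (\<sigma> j) :: real"
  have si: "set (map (inv \<sigma>) L) \<subseteq> {..<n}" "inv \<sigma> i < n"
    using Cons.prems permutes_in_image[OF permutes_inv[OF s]] by auto
  have A: "?A d \<in> points (rn n)" using Cons.prems permutes_not_in[OF s] by (auto simp: points_rn)
  have "pds (i # L) (\<lambda>d. f (?A d)) d = pd i (\<lambda>d. pds (map (inv \<sigma>) L) f (?A d)) d"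
    unfolding pds.simps by (rule pd_cong[OF Cons.IH]) (use Cons.prems in auto)
  also have "\<dots> = pds (map (inv \<sigma>) (i # L)) f (?A d)"
    unfolding pds.simps list.map
    by (rule pd_chain1[where A = ?A, OF pds_sf[OF f si(1)] si(2) A])
      (auto simp: fun_eq_iff permutes_inverses[OF s])
  finally show ?case .
qed simp

text \<open>Each derivative moves to the inverse image of its variable. The resulting list is in
  general not descending any more, which \<open>pds_perm\<close> repairs.\<close>

lemma mixed_permute:
  assumes f: "f \<in> sf n" and s: "\<sigma> permutes {..<n}" and S: "S \<subseteq> {..<n}"
  shows "mixed n S (\<lambda>d. f (\<lambda>j. d (\<sigma> j))) = mixed n (inv \<sigma> ` S) f"
proof -
  have i: "inv \<sigma> permutes {..<n}" by (rule permutes_inv[OF s])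
  have S': "inv \<sigma> ` S \<subseteq> {..<n}" using S permutes_in_image[OF i] by auto
  have "mset (map (inv \<sigma>) (desc_list n S)) = mset (desc_list n (inv \<sigma> ` S))"
    using permutes_inj[OF i] by (intro set_eq_iff_mset_eq_distinct[THEN iffD1])
      (auto simp: distinct_map distinct_desc_list set_desc_list[OF S] set_desc_list[OF S'] inj_on_def)
  moreover have "set (map (inv \<sigma>) (desc_list n S)) \<subseteq> {..<n}" using S' by (simp add: set_desc_list[OF S])
  ultimately show ?thesis
    unfolding mixed_def pds_permute[OF f s set_desc_list_subset zero_points] by (intro pds_perm[OF f] zero_points)
qed

lemma pds_scale:
  assumes f: "f \<in> sf n" and L: "set L \<subseteq> {..<n}" and d: "d \<in> points (rn n)"
  shows "pds L (\<lambda>d. f (d(i := t * d i))) d = (\<Prod>l\<leftarrow>L. if l = i then t else 1) * pds L f (d(i := t * d i))"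
  using L d
proof (induction L arbitrary: d)
  case (Cons l L)
  let ?A = "\<lambda>d. d(i := t * d i)" and ?c = "\<Prod>l\<leftarrow>L. if l = i then t else 1"
  have A: "?A d \<in> points (rn n)" using Cons.prems by (auto simp: points_rn)
  have lL: "l < n" "set L \<subseteq> {..<n}" using Cons.prems by auto
  have g: "pds L f \<in> sf n" by (rule pds_sf[OF f lL(2)])
  have "pds (l # L) (\<lambda>d. f (?A d)) d = pd l (\<lambda>d. ?c * pds L f (?A d)) d"
    unfolding pds.simps by (rule pd_cong[OF Cons.IH]) (use Cons.prems in auto)
  also have "\<dots> = (\<Prod>l\<leftarrow>(l # L). if l = i then t else 1) * pds (l # L) f (?A d)"
  proof (rule pd_eqI)
    let ?u = "if l = i then t else 1"
    have "((\<lambda>s. pds L f ((?A d)(l := ?u * s))) has_real_derivative pds (l # L) f (?A d) * ?u) (at (d l))"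
      by (rule DERIV_chain2[of "\<lambda>s. pds L f ((?A d)(l := s))"])
        (use pd_has_derivative[OF g lL(1) A] in \<open>auto intro!: derivative_eq_intros\<close>)
    then have "((\<lambda>s. ?c * pds L f ((?A d)(l := ?u * s))) has_real_derivative ?c * (pds (l # L) f (?A d) * ?u)) (at (d l))"
      by (rule DERIV_cmult)
    moreover have "?A (d(l := s)) = (?A d)(l := ?u * s)" for s by (auto simp: fun_eq_iff)
    ultimately show "((\<lambda>s. ?c * pds L f (?A (d(l := s)))) has_real_derivative
        (\<Prod>l\<leftarrow>(l # L). if l = i then t else 1) * pds (l # L) f (?A d)) (at (d l))"
      by (simp add: mult_ac)
  qed
  finally show ?case .
qed simp

lemma mixed_scale:
  assumes f: "f \<in> sf n" and S: "S \<subseteq> {..<n}"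
  shows "mixed n S (\<lambda>d. f (d(i := t * d i))) = (if i \<in> S then t else 1) * mixed n S f"
proof -
  have "(\<Prod>l\<leftarrow>L. if l = i then t else 1) = (if i \<in> set L then t else 1)" if "distinct L" for L :: "nat list"
    using that by (induction L) auto
  then have "(\<Prod>l\<leftarrow>desc_list n S. if l = i then t else 1) = (if i \<in> S then t else 1)"
    using distinct_desc_list set_desc_list[OF S] by metis
  moreover have "(\<lambda>_. 0)(i := t * 0) = (\<lambda>_. 0)" by auto
  ultimately show ?thesis
    unfolding mixed_def pds_scale[OF f set_desc_list_subset zero_points] by simp
qed

lemma pds_coord_map:
  assumes f: "f \<in> sf p" and \<alpha>: "set \<alpha> \<subseteq> {..<p}" "length \<alpha> = n" and L: "set L \<subseteq> {..<n}"
    and A: "A \<in> smooth_maps (rn n) (rn p)"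
    and upd: "\<And>d i t. i < n \<Longrightarrow> A (d(i := t)) = (A d)(\<alpha> ! i := A d (\<alpha> ! i) + (t - d i))"
    and d: "d \<in> points (rn n)"
  shows "pds L (\<lambda>d. f (A d)) d = pds (map (\<lambda>i. \<alpha> ! i) L) f (A d)"
  using L d
proof (induction L arbitrary: d)
  case (Cons i L)
  then have i: "i < n" "set L \<subseteq> {..<n}" by auto
  have an: "\<alpha> ! i < p" if "i < n" for i
  proof -
    have "\<alpha> ! i \<in> set \<alpha>" by (rule nth_mem) (use \<alpha>(2) that in simp)
    then show ?thesis using \<alpha>(1) by blast
  qed
  have a: "set (map (\<lambda>i. \<alpha> ! i) L) \<subseteq> {..<p}" "\<alpha> ! i < p"
    using i an by auto
  have "pds (i # L) (\<lambda>d. f (A d)) d = pd i (\<lambda>d. pds (map (\<lambda>i. \<alpha> ! i) L) f (A d)) d"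
    unfolding pds.simps by (rule pd_cong[OF Cons.IH]) (use Cons.prems in auto)
  also have "\<dots> = pds (map (\<lambda>i. \<alpha> ! i) (i # L)) f (A d)"
    unfolding pds.simps list.map
    by (rule pd_chain1[where A = A, OF pds_sf[OF f a(1)] a(2) smooth_maps_point[OF A Cons.prems(2)] upd[OF i(1)]])
  finally show ?case .
qed simp

text \<open>The cube at \<open>b\<close> with edges along the axes listed in
  \<open>\<alpha>\<close>. The coefficient of the product of all its variables under a function is
  the derivative along \<open>\<alpha>\<close>, so evaluating a tangential on it reads off a Taylor
  coefficient of top order.\<close>

definition axis_cube :: "nat \<Rightarrow> (nat \<Rightarrow> real) \<Rightarrow> nat list \<Rightarrow> (nat \<Rightarrow> real) \<Rightarrow> nat \<Rightarrow> real" where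
  "axis_cube n b \<alpha> d = (\<lambda>l. b l + (\<Sum>i<n. d i * unit_vec (\<alpha> ! i) l))"

definition axis_class :: "nat \<Rightarrow> nat \<Rightarrow> (nat \<Rightarrow> real) \<Rightarrow> nat list \<Rightarrow> (nat \<Rightarrow> real) \<Rightarrow> nat \<Rightarrow> real" where
  "axis_class p n b \<alpha> = wclass (rn p) (WD n) (axis_cube n b \<alpha>)"

lemma axis_cube_map:
  assumes "b \<in> points (rn p)" "set \<alpha> \<subseteq> {..<p}" "length \<alpha> = n"
  shows "axis_cube n b \<alpha> \<in> smooth_maps (rn n) (rn p)"
  unfolding coords_smooth_maps_iff[OF coords_rn] axis_cube_def
proof (intro conjI ballI)
  have "unit_vec (\<alpha> ! i) l = 0" if "i < n" "l \<ge> p" for i l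
  proof -
    have "\<alpha> ! i < p" using assms(2,3) that(1) by (auto simp: subset_iff in_set_conv_nth)
    then show ?thesis using that(2) by (simp add: unit_vec_def)
  qed
  then show "(\<lambda>l. b l + (\<Sum>i<n. d i * unit_vec (\<alpha> ! i) l)) \<in> points (rn p)" for d
    using assms(1) by (simp add: points_rn)
  show "(\<lambda>d. b k + (\<Sum>i<n. d i * unit_vec (\<alpha> ! i) k)) \<in> sf n" for k
    by (intro sf_add sf_sum sf_mult sf_const sf_coord)
qed

lemma axis_class_fibre:
  assumes "b \<in> points (rn p)" "set \<alpha> \<subseteq> {..<p}" "length \<alpha> = n"
  shows "axis_class p n b \<alpha> \<in> points (fibre (rn p) (WD n) b)"
  using tensor_WD_points[OF axis_cube_map[OF assms]] base_wclass_WD[OF coords_rn axis_cube_map[OF assms]]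
  by (simp add: fibre_points axis_class_def axis_cube_def)

lemma mixed_full_axis_cube:
  assumes f: "f \<in> sf p" and b: "b \<in> points (rn p)" and \<alpha>: "set \<alpha> \<subseteq> {..<p}" "length \<alpha> = n"
  shows "mixed n {..<n} (\<lambda>d. f (axis_cube n b \<alpha> d)) = pds \<alpha> f b"
proof -
  have upd: "axis_cube n b \<alpha> (d(i := t)) = (axis_cube n b \<alpha> d)(\<alpha> ! i := axis_cube n b \<alpha> d (\<alpha> ! i) + (t - d i))" if i: "i < n" for d i t
  proof
    fix l
    have "(\<Sum>k<n. (d(i := t)) k * unit_vec (\<alpha> ! k) l) = (\<Sum>k<n. d k * unit_vec (\<alpha> ! k) l + (if k = i then (t - d i) * unit_vec (\<alpha> ! i) l else 0))"
      by (rule sum.cong) (auto simp: algebra_simps)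
    also have "\<dots> = (\<Sum>k<n. d k * unit_vec (\<alpha> ! k) l) + (t - d i) * unit_vec (\<alpha> ! i) l"
      using i by (simp add: sum.distrib sum.delta)
    finally show "axis_cube n b \<alpha> (d(i := t)) l = ((axis_cube n b \<alpha> d)(\<alpha> ! i := axis_cube n b \<alpha> d (\<alpha> ! i) + (t - d i))) l"
      by (simp add: axis_cube_def unit_vec_def)
  qed
  \<comment> \<open>\<open>mixed\<close> differentiates in descending order and therefore meets
    \<open>\<alpha>\<close> reversed; commuting derivatives undo this.\<close>
  have "desc_list n {..<n} = rev [0..<n]" by (simp add: desc_list_def)
  then have "map (\<lambda>i. \<alpha> ! i) (desc_list n {..<n}) = rev \<alpha>"
    using \<alpha>(2) map_nth[of \<alpha>] by (simp add: rev_map[symmetric])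
  then have "mixed n {..<n} (\<lambda>d. f (axis_cube n b \<alpha> d)) = pds (rev \<alpha>) f (axis_cube n b \<alpha> (\<lambda>_. 0))"
    using pds_coord_map[OF f \<alpha> set_desc_list_subset axis_cube_map[OF b \<alpha>] upd zero_points] by (simp add: mixed_def)
  also have "axis_cube n b \<alpha> (\<lambda>_. 0) = b" by (simp add: axis_cube_def)
  also have "pds (rev \<alpha>) f b = pds \<alpha> f b" by (rule pds_perm[OF f]) (use \<alpha> b in auto)
  finally show ?thesis .
qed

subsection \<open>Tangentials of sections\<close>

abbreviation PS :: "nat \<Rightarrow> nat \<Rightarrow> nat \<Rightarrow> (nat \<Rightarrow> real, nat \<Rightarrow> real) lift \<Rightarrow> bool" where
  "PS p q n \<equiv> pseudotangential (rn p) (rn (p + q)) (proj p) n"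

abbreviation TN :: "nat \<Rightarrow> nat \<Rightarrow> nat \<Rightarrow> (nat \<Rightarrow> real, nat \<Rightarrow> real) lift \<Rightarrow> bool" where
  "TN p q n \<equiv> tangential (rn p) (rn (p + q)) (proj p) n"

abbreviation ph :: "nat \<Rightarrow> nat \<Rightarrow> nat \<Rightarrow> (nat \<Rightarrow> real, nat \<Rightarrow> real) lift \<Rightarrow> (nat \<Rightarrow> real, nat \<Rightarrow> real) lift" where
  "ph p q n \<equiv> pihat (rn p) (rn (p + q)) (proj p) n"

abbreviation tang :: "nat \<Rightarrow> nat \<Rightarrow> nat \<Rightarrow> ((nat \<Rightarrow> real) \<Rightarrow> (nat \<Rightarrow> real)) \<Rightarrow> (nat \<Rightarrow> real) \<Rightarrow> (nat \<Rightarrow> real, nat \<Rightarrow> real) lift" where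
  "tang p q n s b \<equiv> section_lift p (rn (p + q)) n s b"

lemma pseudotangentialI:
  assumes "is_lift M E \<pi> (WD n) T" "\<And>i. i < n \<Longrightarrow> homogeneous M E \<pi> n i T"
    "\<And>i m. i < n \<Longrightarrow> inf_homogeneous M E \<pi> n i m T"
    "\<And>\<sigma> \<gamma>. \<sigma> permutes {..<n} \<Longrightarrow> \<gamma> \<in> points (fibre M (WD n) (\<pi> (fst T))) \<Longrightarrow>
      snd T (permute M n \<sigma> \<gamma>) = permute E n \<sigma> (snd T \<gamma>)"
  shows "pseudotangential M E \<pi> n T"
proof -
  obtain x F where T: "T = (x, F)" by (cases T)
  show ?thesis using assms unfolding T pseudotangential_def split_conv fst_conv snd_conv by blast
qed

lemma fst_pihat: "fst (ph p q n T) = fst T"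
  by (simp add: pihat_def split_beta)

lemma tan_pseudo:
  assumes s: "sect p q s" and b: "b \<in> points (rn p)"
  shows "PS p q n (tang p q n s b)"
proof -
  note ctx = coords_rn sect_map[OF s] proj_smooth _ b
  have fT: "fst (tang p q n s b) = s b" by (simp add: section_lift_def)
  have "is_lift (rn p) (rn (p + q)) (proj p) (WD n) (tang p q n s b)"
    by (rule section_lift_is_lift[OF ctx]) (rule sect_proj[OF s])
  moreover have "homogeneous (rn p) (rn (p + q)) (proj p) n i (tang p q n s b)" if "i < n" for i
    by (rule section_lift_homogeneous[OF ctx that]) (rule sect_proj[OF s])
  moreover have "inf_homogeneous (rn p) (rn (p + q)) (proj p) n i m (tang p q n s b)" if "i < n" for i m
    by (rule section_lift_inf_homogeneous[OF ctx that]) (rule sect_proj[OF s])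
  moreover have "snd (tang p q n s b) (permute (rn p) n \<sigma> \<gamma>) = permute (rn (p + q)) n \<sigma> (snd (tang p q n s b) \<gamma>)"
    if "\<sigma> permutes {..<n}" "\<gamma> \<in> points (fibre (rn p) (WD n) (proj p (s b)))" for \<sigma> \<gamma>
    by (rule section_lift_permute[OF ctx that(1)]) (use that(2) sect_proj[OF s] b in auto)
  ultimately show ?thesis by (intro pseudotangentialI) (simp_all add: fT)
qed

text \<open>Both sides compose with \<open>s\<close>, and the projection to D^n followed by the
  inclusion back cancels.\<close>

lemma pihat_tan:
  assumes s: "sect p q s" and b: "b \<in> points (rn p)"
  shows "ph p q n (tang p q (Suc n) s b) = tang p q n s b"
proof -
  have "pull (rn (p + q)) (WD n) (\<lambda>d. d(n := 0)) (snd (tang p q (Suc n) s b) (pull (rn p) (WD (Suc n)) (\<lambda>d. d(n := 0)) \<gamma>)) =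
      prolong (rn (p + q)) (WD n) s \<gamma>" if \<gamma>: "\<gamma> \<in> points (fibre (rn p) (WD n) b)" for \<gamma>
  proof -
    have gt: "\<gamma> \<in> points (tensor (rn p) (WD n))" using \<gamma> by (simp add: fibre_points)
    note gm = tensor_WD_map[OF gt]
    have z: "(\<lambda>_. 0)(n := 0) = (\<lambda>_. 0::real)" by auto
    have pf: "pull (rn p) (WD (Suc n)) (\<lambda>d. d(n := 0)) \<gamma> \<in> points (fibre (rn p) (WD (Suc n)) b)"
      by (rule pull_fibre[OF coords_rn \<gamma> inf_map_project z])
    then have "snd (tang p q (Suc n) s b) (pull (rn p) (WD (Suc n)) (\<lambda>d. d(n := 0)) \<gamma>) =
        pull (rn (p + q)) (WD (Suc n)) (\<lambda>d. d(n := 0)) (prolong (rn (p + q)) (WD n) s \<gamma>)"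
      using prolong_pull[OF gt sect_map[OF s] inf_map_project] by (simp add: section_lift_def)
    also have "\<dots> = wclass (rn (p + q)) (WD (Suc n)) (\<lambda>d. s (\<gamma> (d(n := 0))))"
      unfolding prolong_def o_def by (rule pull_WD[OF smooth_maps_comp'[OF gm sect_map[OF s]] inf_map_project])
    finally have "pull (rn (p + q)) (WD n) (\<lambda>d. d(n := 0)) (snd (tang p q (Suc n) s b) (pull (rn p) (WD (Suc n)) (\<lambda>d. d(n := 0)) \<gamma>)) =
        pull (rn (p + q)) (WD n) (\<lambda>d. d(n := 0)) (wclass (rn (p + q)) (WD (Suc n)) (\<lambda>d. s (\<gamma> (d(n := 0)))))" by simp
    also have "\<dots> = wclass (rn (p + q)) (WD n) (\<lambda>d. s (\<gamma> ((d(n := 0))(n := 0))))"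
      by (rule pull_WD[OF smooth_maps_comp'[OF inf_map_WD_map[OF inf_map_project] smooth_maps_comp'[OF gm sect_map[OF s]]] inf_map_include])
    also have "\<dots> = wclass (rn (p + q)) (WD n) (\<lambda>d. s (\<gamma> d))"
    proof (rule wclass_WD_cong[symmetric, OF smooth_maps_comp'[OF gm sect_map[OF s]]])
      fix x :: "nat \<Rightarrow> real" assume "x \<in> points (rn n)"
      then have "x(n := 0) = x" by (auto simp: points_rn)
      then show "s (\<gamma> x) = s (\<gamma> ((x(n := 0))(n := 0)))" by simp
    qed
    finally show ?thesis by (simp add: prolong_def o_def)
  qed
  then have "ph p q n (tang p q (Suc n) s b) = (s b, \<lambda>\<gamma>\<in>points (fibre (rn p) (WD n) b). prolong (rn (p + q)) (WD n) s \<gamma>)"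
    unfolding pihat_def split_beta using sect_proj[OF s b] by (auto simp: section_lift_def intro!: restrict_ext)
  then show ?thesis by (simp add: section_lift_def restrict_def)
qed

lemma tan_tangential:
  assumes s: "sect p q s" and b: "b \<in> points (rn p)" and "n \<ge> 1"
  shows "TN p q n (tang p q n s b)"
  using assms(3)
proof (induction n rule: dec_induct)
  case base
  show ?case by (rule tangential.one[OF tan_pseudo[OF s b]])
next
  case (step n)
  define F where "F = snd (tang p q (Suc n) s b)"
  have T: "tang p q (Suc n) s b = (s b, F)" by (simp add: section_lift_def F_def)
  show ?case
    unfolding T
  proof (rule tangential.step[OF step(1)])
    show "PS p q (Suc n) (s b, F)" unfolding T[symmetric] by (rule tan_pseudo[OF s b])
    show "TN p q n (ph p q n (s b, F))" unfolding T[symmetric] pihat_tan[OF s b] by (rule step.IH)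
    show "\<forall>\<gamma>\<in>points (fibre (rn p) (WD n) (proj p (s b))). F (pull (rn p) (WD (Suc n)) (kappa n) \<gamma>) =
      pull (rn (p + q)) (WD (Suc n)) (kappa n) (snd (ph p q n (s b, F)) \<gamma>)"
    proof
      fix \<gamma> assume "\<gamma> \<in> points (fibre (rn p) (WD n) (proj p (s b)))"
      then have \<gamma>: "\<gamma> \<in> points (fibre (rn p) (WD n) b)" using sect_proj[OF s b] by simp
      have w: "inf_map (Dobj (Suc n)) (Dobj n) (kappa n)" using inf_map_kappa step(1) by simp
      have z: "kappa n (\<lambda>_. 0) = (\<lambda>_. 0)" by (auto simp: kappa_def fun_eq_iff)
      have "pull (rn p) (WD (Suc n)) (kappa n) \<gamma> \<in> points (fibre (rn p) (WD (Suc n)) b)"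
        by (rule pull_fibre[OF coords_rn \<gamma> w z])
      moreover have "snd (ph p q n (s b, F)) \<gamma> = prolong (rn (p + q)) (WD n) s \<gamma>"
        unfolding T[symmetric] pihat_tan[OF s b] using \<gamma> by (simp add: section_lift_def)
      moreover have "\<gamma> \<in> points (tensor (rn p) (WD n))" using \<gamma> by (simp add: fibre_points)
      note prolong_pull[OF this sect_map[OF s] w]
      moreover have "F \<zeta> = prolong (rn (p + q)) (WD (Suc n)) s \<zeta>" if "\<zeta> \<in> points (fibre (rn p) (WD (Suc n)) b)" for \<zeta>
        using that by (simp add: F_def section_lift_def)
      ultimately show "F (pull (rn p) (WD (Suc n)) (kappa n) \<gamma>) =
        pull (rn (p + q)) (WD (Suc n)) (kappa n) (snd (ph p q n (s b, F)) \<gamma>)" by metis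
    qed
  qed
qed

lemma tangential_pseudo: "TN p q n T \<Longrightarrow> PS p q n T"
  by (cases rule: tangential.cases) auto

lemma tangential_Suc:
  assumes "TN p q (Suc n) (x, F)" "n \<ge> 1"
  shows "TN p q n (ph p q n (x, F))"
    "\<And>\<gamma>. \<gamma> \<in> points (fibre (rn p) (WD n) (proj p x)) \<Longrightarrow> F (pull (rn p) (WD (Suc n)) (kappa n) \<gamma>) =
      pull (rn (p + q)) (WD (Suc n)) (kappa n) (snd (ph p q n (x, F)) \<gamma>)"
  using assms by (auto elim: tangential.cases simp: One_nat_def)

text \<open>The counterpart of \<open>jcoord\<close>, over the same indices: lower orders through
  \<open>pihat\<close>, the top order by evaluation on the cube along the given axes.\<close>

primrec tang_coord :: "nat \<Rightarrow> nat \<Rightarrow> nat \<Rightarrow> (nat \<Rightarrow> real, nat \<Rightarrow> real) lift \<Rightarrow> nat list \<times> nat \<Rightarrow> real" where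
  "tang_coord p q 0 T k = fst T (snd k)"
| "tang_coord p q (Suc n) T k = (if length (fst k) \<le> n then tang_coord p q n (ph p q n T) k
    else mixed (Suc n) {..<Suc n} (\<lambda>d. snd T (axis_class p (Suc n) (proj p (fst T)) (fst k)) d (snd k)))"

lemma tang_coord_Nil: "tang_coord p q n T ([], j) = fst T j"
  by (induction n arbitrary: T) (simp_all add: fst_pihat)

lemma tang_coord_tan:
  assumes s: "sect p q s" and b: "b \<in> points (rn p)" and "(\<alpha>, j) \<in> jet_indices p q n"
  shows "tang_coord p q n (tang p q n s b) (\<alpha>, j) = pds \<alpha> (\<lambda>x. s x j) b"
  using assms(3)
proof (induction n)
  case 0
  then show ?case by (simp add: jet_indices_def section_lift_def)
next
  case (Suc n)
  show ?case
  proof (cases "length \<alpha> \<le> n")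
    case True
    then show ?thesis using Suc by (simp add: jet_indices_def pihat_tan[OF s b])
  next
    case False
    let ?N = "Suc n"
    have a: "set \<alpha> \<subseteq> {..<p}" "length \<alpha> = ?N" "j < p + q" using Suc.prems False by (auto simp: jet_indices_def)
    note mm = axis_cube_map[OF b a(1,2)]
    have "snd (tang p q ?N s b) (axis_class p ?N b \<alpha>) = wclass (rn (p + q)) (WD ?N) (\<lambda>d. s (axis_cube ?N b \<alpha> d))"
      using axis_class_fibre[OF b a(1,2)] prolong_WD[OF mm sect_map[OF s]] by (simp add: section_lift_def axis_class_def)
    then have "mixed ?N {..<?N} (\<lambda>d. snd (tang p q ?N s b) (axis_class p ?N b \<alpha>) d j) = mixed ?N {..<?N} (\<lambda>d. s (axis_cube ?N b \<alpha> d) j)"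
      using mixed_wclass[OF coords_rn smooth_maps_comp'[OF mm sect_map[OF s]], of j "{..<?N}"] a(3) by simp
    also have "\<dots> = pds \<alpha> (\<lambda>x. s x j) b" by (rule mixed_full_axis_cube[OF sect_sf[OF s] b a(1,2)])
    finally show ?thesis using False sect_proj[OF s b] by (simp add: section_lift_def)
  qed
qed

subsection \<open>Tangentials are determined by their coordinates\<close>

lemma mixed_scale_lift:
  assumes "\<zeta> \<in> points (tensor (rn m) (WD n))" "i < n" "S \<subseteq> {..<n}" "j < m"
  shows "mixed n S (\<lambda>d. scale (rn m) n i t \<zeta> d j) = (if i \<in> S then t else 1) * mixed n S (\<lambda>d. \<zeta> d j)"
proof -
  note zm = tensor_WD_map[OF assms(1)]
  have "mixed n S (\<lambda>d. scale (rn m) n i t \<zeta> d j) = mixed n S (\<lambda>d. \<zeta> (d(i := t * d i)) j)"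
    unfolding scale_def pull_def o_def
    by (rule mixed_wclass[OF coords_rn smooth_maps_comp'[OF inf_map_WD_map[OF inf_map_scale[OF assms(2)]] zm]])
      (use assms in auto)
  also have "\<dots> = (if i \<in> S then t else 1) * mixed n S (\<lambda>d. \<zeta> d j)"
    by (rule mixed_scale[OF coords_smooth_map[OF coords_rn zm]]) (use assms in auto)
  finally show ?thesis .
qed

lemma mixed_permute_lift:
  assumes "\<zeta> \<in> points (tensor (rn m) (WD n))" "\<sigma> permutes {..<n}" "S \<subseteq> {..<n}" "j < m"
  shows "mixed n S (\<lambda>d. permute (rn m) n \<sigma> \<zeta> d j) = mixed n (inv \<sigma> ` S) (\<lambda>d. \<zeta> d j)"
proof -
  note zm = tensor_WD_map[OF assms(1)]
  have "mixed n S (\<lambda>d. permute (rn m) n \<sigma> \<zeta> d j) = mixed n S (\<lambda>d. \<zeta> (\<lambda>l. d (\<sigma> l)) j)"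
    unfolding permute_def pull_def o_def
    by (rule mixed_wclass[OF coords_rn smooth_maps_comp'[OF inf_map_WD_map[OF inf_map_permute[OF assms(2)]] zm]])
      (use assms in auto)
  also have "\<dots> = mixed n (inv \<sigma> ` S) (\<lambda>d. \<zeta> d j)"
    by (rule mixed_permute[OF coords_smooth_map[OF coords_rn zm] assms(2,3)]) (use assms in auto)
  finally show ?thesis .
qed

section \<open>Polynomial cubes as arguments of tangentials\<close>

text \<open>The coefficients at the empty set are overridden by \<open>b\<close>, so that any
  configuration \<open>a\<close> yields an element of the fibre over \<open>b\<close>. This lets a
  function on the fibre be treated as a function of free coefficients.\<close>

definition cube_poly :: "nat \<Rightarrow> nat \<Rightarrow> (nat \<Rightarrow> real) \<Rightarrow> (nat set \<times> nat \<Rightarrow> real) \<Rightarrow> (nat \<Rightarrow> real) \<Rightarrow> nat \<Rightarrow> real" where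
  "cube_poly n p b a d = (\<lambda>l. if l < p then wpoly n (\<lambda>(S, l). if S = {} then b l else a (S, l)) d l else 0)"

lemma cube_poly_mapping_curve:
  assumes "\<And>S k. S \<subseteq> {..<n} \<Longrightarrow> S \<noteq> {} \<Longrightarrow> k < p \<Longrightarrow> smooth (\<lambda>t. A t (S, k))"
  shows "(\<lambda>t. cube_poly n p b (A t)) \<in> curves (mapping_space n (rn p))"
  unfolding cube_poly_def[abs_def]
proof (rule wpoly_mapping_curve[OF coords_rn])
  fix S k assume "S \<subseteq> {..<n}" "k \<in> {..<p}"
  then show "smooth (\<lambda>t. (\<lambda>(S, l). if S = {} then b l else A t (S, l)) (S, k))"
    using assms[of S k] by (cases "S = {}") (auto simp: smooth_const)
qed

lemma cube_poly_map: "cube_poly n p b a \<in> smooth_maps (rn n) (rn p)"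
  by (rule mapping_curve_map[OF cube_poly_mapping_curve[of n p "\<lambda>_. a"]]) (rule smooth_const)

lemma wpoly_0: "wpoly n c (\<lambda>_. 0) k = c ({}, k)"
proof -
  have "(\<Prod>j\<in>S. (0::real)) = (if S = {} then 1 else 0)" if "S \<in> Pow {..<n}" for S
    using that finite_subset[of S "{..<n}"] by (auto simp: prod_zero_iff)
  then have "wpoly n c (\<lambda>_. 0) k = (\<Sum>S\<in>Pow {..<n}. if S = {} then c (S, k) else 0)"
    unfolding wpoly_def by (intro sum.cong) auto
  then show ?thesis by simp
qed

lemma cube_poly_0:
  assumes "b \<in> points (rn p)" shows "cube_poly n p b a (\<lambda>_. 0) = b"
  using assms by (auto simp: cube_poly_def wpoly_0 points_rn)

lemma cube_poly_cong:
  assumes "\<And>S k. S \<subseteq> {..<n} \<Longrightarrow> S \<noteq> {} \<Longrightarrow> k < p \<Longrightarrow> a (S, k) = a' (S, k)"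
  shows "cube_poly n p b a = cube_poly n p b a'"
  unfolding cube_poly_def wpoly_def fun_eq_iff using assms by (auto intro!: sum.cong)

lemma cube_poly_fibre:
  assumes "b \<in> points (rn p)" shows "wclass (rn p) (WD n) (cube_poly n p b a) \<in> points (fibre (rn p) (WD n) b)"
  using tensor_WD_points[OF cube_poly_map] base_wclass_WD[OF coords_rn cube_poly_map] cube_poly_0[OF assms]
  by (simp add: fibre_points)

lemma cube_poly_curve:
  assumes "b \<in> points (rn p)" "\<And>S k. S \<subseteq> {..<n} \<Longrightarrow> S \<noteq> {} \<Longrightarrow> k < p \<Longrightarrow> smooth (\<lambda>t. A t (S, k))"
  shows "(\<lambda>t. wclass (rn p) (WD n) (cube_poly n p b (A t))) \<in> curves (fibre (rn p) (WD n) b)"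
proof -
  have "(\<lambda>t. wclass (rn p) (WD n) (cube_poly n p b (A t))) \<in> curves (tensor (rn p) (WD n))"
    by (rule tensor_WD_curve[OF cube_poly_mapping_curve]) (rule assms(2))
  then show ?thesis using cube_poly_fibre[OF assms(1)] by (simp add: fibre_curves fibre_points)
qed

lemma cube_poly_surj:
  assumes "\<gamma> \<in> points (fibre (rn p) (WD n) b)"
  shows "\<gamma> = wclass (rn p) (WD n) (cube_poly n p b (weil_coord n (\<lambda>x j. x j) \<gamma>))"
proof -
  have g: "\<gamma> \<in> points (tensor (rn p) (WD n))" "\<gamma> (\<lambda>_. 0) = b" using assms by (simp_all add: fibre_points base_def)
  note gm = tensor_WD_map[OF g(1)]
  have "(\<lambda>d l. if l < p then wpoly n (weil_coord n (\<lambda>x j. x j) \<gamma>) d l else 0) = cube_poly n p b (weil_coord n (\<lambda>x j. x j) \<gamma>)"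
    unfolding cube_poly_def wpoly_def fun_eq_iff
    by (auto intro!: sum.cong simp: weil_coord_def mixed_empty g(2))
  with wpoly_weil_coord[OF coords_rn gm] have "wclass (rn p) (WD n) (cube_poly n p b (weil_coord n (\<lambda>x j. x j) \<gamma>)) = wclass (rn p) (WD n) \<gamma>"
    by simp
  also have "\<dots> = \<gamma>" using tensor_point_map(2)[of \<gamma> "rn p" "Dobj n"] g(1) by simp
  finally show ?thesis by simp
qed

lemma cube_poly_scale:
  assumes "i < n"
  shows "scale (rn p) n i t (wclass (rn p) (WD n) (cube_poly n p b a)) =
    wclass (rn p) (WD n) (cube_poly n p b (\<lambda>(S, k). (if i \<in> S then t else 1) * a (S, k)))"
proof -
  have P: "(\<Prod>j\<in>S. (d(i := t * d i)) j) = (if i \<in> S then t else 1) * (\<Prod>j\<in>S. d j)" if "S \<subseteq> {..<n}" for S d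
  proof -
    have f: "finite S" using that finite_subset by blast
    show ?thesis
    proof (cases "i \<in> S")
      case True
      have "(\<Prod>j\<in>S - {i}. (d(i := t * d i)) j) = (\<Prod>j\<in>S - {i}. d j)" by (rule prod.cong) auto
      then show ?thesis using True by (simp add: prod.remove[OF f True])
    next
      case False
      then have "(\<Prod>j\<in>S. (d(i := t * d i)) j) = (\<Prod>j\<in>S. d j)" by (intro prod.cong) auto
      with False show ?thesis by simp
    qed
  qed
  have "cube_poly n p b a (d(i := t * d i)) = cube_poly n p b (\<lambda>(S, k). (if i \<in> S then t else 1) * a (S, k)) d" for d
    unfolding cube_poly_def wpoly_def fun_eq_iff by (auto intro!: sum.cong simp: P simp del: fun_upd_apply)
  then show ?thesis
    unfolding scale_def pull_WD[OF cube_poly_map inf_map_scale[OF assms]] by simp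
qed

lemma cube_poly_basis:
  assumes "b \<in> points (rn p)" "set \<beta> \<subseteq> {..<p}" "length \<beta> = n"
  shows "cube_poly n p b (\<lambda>(S, k). if \<exists>i<n. S = {i} \<and> k = \<beta> ! i then 1 else 0) = axis_cube n b \<beta>"
proof (intro ext)
  fix d l
  let ?c = "\<lambda>(S, l). if S = {} then b l else (\<lambda>(S, k). if \<exists>i<n. S = {i} \<and> k = \<beta> ! i then 1 else 0) (S, l)"
  have "wpoly n ?c d l = (\<Sum>S\<in>insert {} ((\<lambda>i. {i}) ` {..<n}). ?c (S, l) * (\<Prod>j\<in>S. d j))"
    unfolding wpoly_def by (rule sum.mono_neutral_right) auto
  also have "\<dots> = b l + (\<Sum>i<n. ?c ({i}, l) * d i)"
    by (subst sum.insert) (auto simp: sum.reindex inj_on_def)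
  also have "(\<Sum>i<n. ?c ({i}, l) * d i) = (\<Sum>i<n. d i * unit_vec (\<beta> ! i) l)"
    by (rule sum.cong) (auto simp: unit_vec_def)
  finally have w: "wpoly n ?c d l = axis_cube n b \<beta> d l" by (simp add: axis_cube_def)
  show "cube_poly n p b (\<lambda>(S, k). if \<exists>i<n. S = {i} \<and> k = \<beta> ! i then 1 else 0) d l = axis_cube n b \<beta> d l"
  proof (cases "l < p")
    case True
    then show ?thesis unfolding cube_poly_def w by simp
  next
    case False
    have "\<beta> ! i \<noteq> l" if "i < n" for i
    proof -
      have "\<beta> ! i \<in> set \<beta>" by (rule nth_mem) (use assms(3) that in simp)
      then show ?thesis using assms(2) False by auto
    qed
    then have "(\<Sum>i<n. d i * unit_vec (\<beta> ! i) l) = 0" by (intro sum.neutral) (auto simp: unit_vec_def)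
    then show ?thesis using False assms(1) by (simp add: cube_poly_def axis_cube_def points_rn)
  qed
qed

lemma move_to_end:
  assumes "i < Suc n" "j < Suc n" "i \<noteq> j"
  obtains \<sigma> where "\<sigma> permutes {..<Suc n}" "\<sigma> i = n - 1" "\<sigma> j = n"
proof
  let ?t = "Transposition.transpose j n"
  let ?s = "Transposition.transpose (?t i) (n - 1) \<circ> ?t"
  have ti: "?t i < Suc n" "?t i \<noteq> n" "n \<noteq> 0" using assms by (auto simp: Transposition.transpose_def)
  show "?s permutes {..<Suc n}"
    by (intro permutes_compose permutes_swap_id) (use assms ti in auto)
  show "?s i = n - 1" by simp
  show "?s j = n" using ti by (simp add: Transposition.transpose_def)
qed

text \<open>If variables \<open>i\<close> and \<open>j\<close> only occur together, the cube depends
  on their product alone. After a permutation that moves them to the last two places, it factors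
  through \<open>kappa\<close>.\<close>

lemma cube_poly_kappa:
  assumes b: "b \<in> points (rn p)" and ij: "i < Suc n" "j < Suc n" "i \<noteq> j"
    and a: "\<And>S k. S \<subseteq> {..<Suc n} \<Longrightarrow> a (S, k) \<noteq> 0 \<Longrightarrow> i \<in> S \<longleftrightarrow> j \<in> S"
  obtains \<sigma> \<eta> where "\<sigma> permutes {..<Suc n}" "\<eta> \<in> points (fibre (rn p) (WD n) b)"
    "permute (rn p) (Suc n) \<sigma> (wclass (rn p) (WD (Suc n)) (cube_poly (Suc n) p b a)) = pull (rn p) (WD (Suc n)) (kappa n) \<eta>"
proof -
  obtain \<sigma> where s: "\<sigma> permutes {..<Suc n}" "\<sigma> i = n - 1" "\<sigma> j = n" by (rule move_to_end[OF ij])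
  have n: "n \<ge> 1" using ij by simp
  \<comment> \<open>A section of the substitution: variable \<open>j\<close>, which
    \<open>\<sigma>\<close> sends to \<open>n\<close>, is set to 1, and variable \<open>i\<close>
    takes the last coordinate of the smaller cube, in which \<open>kappa\<close> puts the
    product.\<close>
  define K where "K e = (\<lambda>l. (e(n := 1::real)) (\<sigma> l))" for e :: "nat \<Rightarrow> real"
  define h where "h e = cube_poly (Suc n) p b a (K e)" for e
  have K: "K \<in> smooth_maps (rn n) (rn (Suc n))"
    unfolding coords_smooth_maps_iff[OF coords_rn]
  proof (intro conjI ballI)
    fix e :: "nat \<Rightarrow> real" assume "e \<in> points (rn n)"
    then show "K e \<in> points (rn (Suc n))"
      using permutes_not_in[OF s(1)] by (auto simp: K_def points_rn)
  next
    fix l show "(\<lambda>e. K e l) \<in> sf n" unfolding K_def by (cases "\<sigma> l = n") (simp_all add: sf_const sf_coord)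
  qed
  have hm: "h \<in> smooth_maps (rn n) (rn p)"
    unfolding h_def[abs_def] by (rule smooth_maps_comp'[OF K cube_poly_map])
  \<comment> \<open>A monomial with both or neither of \<open>i\<close> and \<open>j\<close> has the
    same value whether the product is distributed over the two variables or carried by
    \<open>i\<close> with \<open>j\<close> set to 1.\<close>
  have P: "(\<Prod>l\<in>S. K (kappa n d) l) = (\<Prod>l\<in>S. d (\<sigma> l))" if S: "S \<subseteq> {..<Suc n}" "i \<in> S \<longleftrightarrow> j \<in> S" for S d
  proof -
    have f: "finite S" using S finite_subset by blast
    have e: "K (kappa n d) l = d (\<sigma> l)" if "l \<noteq> i" "l \<noteq> j" for l
    proof -
      have "\<sigma> l \<noteq> n - 1" "\<sigma> l \<noteq> n"
        using that s(2,3) inj_eq[OF permutes_inj[OF s(1)], of l] by metis+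
      then show ?thesis by (simp add: K_def kappa_def)
    qed
    show ?thesis
    proof (cases "i \<in> S")
      case True
      then have f': "finite (S - {i})" "j \<in> S - {i}" using S f ij by auto
      have "(\<Prod>l\<in>S - {i} - {j}. K (kappa n d) l) = (\<Prod>l\<in>S - {i} - {j}. d (\<sigma> l))"
        by (rule prod.cong) (auto intro: e)
      moreover have "K (kappa n d) i = d (\<sigma> i) * d (\<sigma> j)" "K (kappa n d) j = 1"
        using s n by (simp_all add: K_def kappa_def)
      ultimately show ?thesis by (simp add: prod.remove[OF f True] prod.remove[OF f'])
    next
      case False
      show ?thesis by (intro prod.cong refl e) (use False S in auto)
    qed
  qed
  have hk: "h (kappa n d) = cube_poly (Suc n) p b a (\<lambda>l. d (\<sigma> l))" for d
  proof -
    have "(if S = {} then b k else a (S, k)) * (\<Prod>l\<in>S. K (kappa n d) l) =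
      (if S = {} then b k else a (S, k)) * (\<Prod>l\<in>S. d (\<sigma> l))" if "S \<subseteq> {..<Suc n}" for S k
    proof (cases "S = {} \<or> a (S, k) \<noteq> 0")
      case True
      then have "i \<in> S \<longleftrightarrow> j \<in> S" using a[OF that] by auto
      then show ?thesis using P[OF that] by simp
    qed auto
    then show ?thesis unfolding h_def cube_poly_def wpoly_def fun_eq_iff split_conv by (auto intro!: sum.cong)
  qed
  have k0: "kappa n (\<lambda>_. 0) = (\<lambda>_. 0)" by (auto simp: kappa_def fun_eq_iff)
  have "h (\<lambda>_. 0) = b" using hk[of "\<lambda>_. 0"] cube_poly_0[OF b] unfolding k0 by simp
  then have "wclass (rn p) (WD n) h \<in> points (fibre (rn p) (WD n) b)"
    using tensor_WD_points[OF hm] base_wclass_WD[OF coords_rn hm] by (simp add: fibre_points)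
  moreover have "permute (rn p) (Suc n) \<sigma> (wclass (rn p) (WD (Suc n)) (cube_poly (Suc n) p b a)) =
      pull (rn p) (WD (Suc n)) (kappa n) (wclass (rn p) (WD n) h)"
    unfolding permute_def pull_WD[OF cube_poly_map inf_map_permute[OF s(1)]] pull_WD[OF hm inf_map_kappa[OF n]] hk ..
  ultimately show thesis using that s(1) by blast
qed

lemma PS_D:
  assumes "PS p q n (x, F)"
  shows "x \<in> points (rn (p + q))"
    "F \<in> smooth_maps (fibre (rn p) (WD n) (proj p x)) (fibre (rn (p + q)) (WD n) x)"
    "F \<in> extensional (points (fibre (rn p) (WD n) (proj p x)))"
    "\<And>t. t \<in> points (fibre (rn p) (WD n) (proj p x)) \<Longrightarrow> prolong (rn p) (WD n) (proj p) (F t) = t"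
    "\<And>i \<alpha> t. i < n \<Longrightarrow> t \<in> points (fibre (rn p) (WD n) (proj p x)) \<Longrightarrow>
      F (scale (rn p) n i \<alpha> t) = scale (rn (p + q)) n i \<alpha> (F t)"
    "\<And>\<sigma> t. \<sigma> permutes {..<n} \<Longrightarrow> t \<in> points (fibre (rn p) (WD n) (proj p x)) \<Longrightarrow>
      F (permute (rn p) n \<sigma> t) = permute (rn (p + q)) n \<sigma> (F t)"
  using assms unfolding pseudotangential_def is_lift_def homogeneous_def split_conv by blast+

lemma scale_fibre:
  assumes "\<gamma> \<in> points (fibre (rn p) (WD n) b)" "i < n"
  shows "scale (rn p) n i t \<gamma> \<in> points (fibre (rn p) (WD n) b)"
  unfolding scale_def by (rule pull_fibre[OF coords_rn assms(1) inf_map_scale[OF assms(2)]]) auto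

lemma permute_fibre:
  assumes "\<gamma> \<in> points (fibre (rn p) (WD n) b)" "\<sigma> permutes {..<n}"
  shows "permute (rn p) n \<sigma> \<gamma> \<in> points (fibre (rn p) (WD n) b)"
  unfolding permute_def by (rule pull_fibre[OF coords_rn assms(1) inf_map_permute[OF assms(2)]]) auto

lemma PS_tensor:
  assumes "PS p q n (x, F)" "\<gamma> \<in> points (fibre (rn p) (WD n) (proj p x))"
  shows "F \<gamma> \<in> points (tensor (rn (p + q)) (WD n))"
  using smooth_maps_point[OF PS_D(2)[OF assms(1)] assms(2)] by (simp add: fibre_points)

lemma PS_base_coord:
  assumes "PS p q n (x, F)" and \<gamma>: "\<gamma> \<in> points (fibre (rn p) (WD n) (proj p x))"
    and S: "S \<subseteq> {..<n}" and j: "j < p"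
  shows "mixed n S (\<lambda>d. F \<gamma> d j) = mixed n S (\<lambda>d. \<gamma> d j)"
proof -
  note fm = tensor_WD_map[OF PS_tensor[OF assms(1,2)]]
  have "mixed n S (\<lambda>d. \<gamma> d j) = mixed n S (\<lambda>d. prolong (rn p) (WD n) (proj p) (F \<gamma>) d j)"
    using PS_D(4)[OF assms(1,2)] by simp
  also have "\<dots> = mixed n S (\<lambda>d. proj p (F \<gamma> d) j)"
    unfolding prolong_def o_def
    by (rule mixed_wclass[OF coords_rn smooth_maps_comp'[OF fm proj_smooth] _ S]) (use j in simp)
  finally show ?thesis using j by (simp add: proj_def)
qed

text \<open>Scaling the last variable by 0 does not affect coefficients without it. The scaled
  argument comes from D^n by projection, so its value is described by \<open>pihat\<close>;
  homogeneity in the last variable makes the connection.\<close>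

lemma PS_lower_coord:
  assumes T: "PS p q (Suc n) (x, F)" and \<gamma>: "\<gamma> \<in> points (fibre (rn p) (WD (Suc n)) (proj p x))"
    and S: "S \<subseteq> {..<n}" and j: "j < p + q"
  shows "mixed (Suc n) S (\<lambda>d. F \<gamma> d j) =
    mixed n S (\<lambda>d. snd (ph p q n (x, F)) (pull (rn p) (WD n) (\<lambda>d. d(n := 0)) \<gamma>) d j)"
proof -
  let ?N = "Suc n" and ?u = "\<lambda>d. d(n := 0::real)" and ?b = "proj p x"
  have z: "?u (\<lambda>_. 0) = (\<lambda>_. 0)" by auto
  have gt: "\<gamma> \<in> points (tensor (rn p) (WD ?N))" using \<gamma> by (simp add: fibre_points)
  note gm = tensor_WD_map[OF gt]
  let ?g = "pull (rn p) (WD n) ?u \<gamma>"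
  have g: "?g \<in> points (fibre (rn p) (WD n) ?b)" by (rule pull_fibre[OF coords_rn \<gamma> inf_map_include z])
  have sg: "scale (rn p) ?N n 0 \<gamma> = pull (rn p) (WD ?N) ?u ?g"
    unfolding pull_def[of _ "WD n"] o_def
    unfolding pull_WD[OF smooth_maps_comp'[OF inf_map_WD_map[OF inf_map_include] gm] inf_map_project]
    by (simp add: scale_def pull_def o_def)
  let ?f = "F (scale (rn p) ?N n 0 \<gamma>)"
  have ft: "?f \<in> points (tensor (rn (p + q)) (WD ?N))"
    by (rule PS_tensor[OF T scale_fibre[OF \<gamma>]]) simp
  have S': "S \<subseteq> {..<?N}" "n \<notin> S" using S by auto
  have "mixed ?N S (\<lambda>d. F \<gamma> d j) = mixed ?N S (\<lambda>d. ?f d j)"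
    using mixed_scale_lift[OF PS_tensor[OF T \<gamma>], of n S j 0] PS_D(5)[OF T _ \<gamma>, of n] S' j by simp
  also have "\<dots> = mixed n S (\<lambda>d. ?f d j)" using S' by (simp add: mixed_def desc_list_Suc)
  also have "\<dots> = mixed n S (\<lambda>d. ?f (d(n := 0)) j)"
  proof (rule mixed_cong)
    fix d assume "d \<in> points (rn n)"
    then have "d(n := 0) = d" by (auto simp: points_rn)
    then show "?f d j = ?f (d(n := 0)) j" by simp
  qed
  also have "\<dots> = mixed n S (\<lambda>d. pull (rn (p + q)) (WD n) ?u ?f d j)"
    unfolding pull_def o_def
    by (rule mixed_wclass[symmetric, OF coords_rn smooth_maps_comp'[OF inf_map_WD_map[OF inf_map_include] tensor_WD_map[OF ft]] _ S])
      (use j in simp)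
  finally show ?thesis using g by (simp add: pihat_def sg)
qed

text \<open>The difference of the two top coefficients, as a function of the coefficients of a
  polynomial cube, satisfies the hypotheses of \<open>multihomogeneous_zero\<close>. These
  correspond in turn to smoothness of the lifts, homogeneity, agreement on the image of
  \<open>kappa\<close>, and agreement on the cubes along the axes.\<close>

lemma PS_top_zero:
  assumes T: "PS p q (Suc n) (x, F)" "PS p q (Suc n) (x, F')"
    and kap: "\<And>\<gamma>. \<gamma> \<in> points (fibre (rn p) (WD n) (proj p x)) \<Longrightarrow> n \<ge> 1 \<Longrightarrow>
      F (pull (rn p) (WD (Suc n)) (kappa n) \<gamma>) = F' (pull (rn p) (WD (Suc n)) (kappa n) \<gamma>)"
    and top: "\<And>\<beta>. length \<beta> = Suc n \<Longrightarrow> set \<beta> \<subseteq> {..<p} \<Longrightarrow>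
      mixed (Suc n) {..<Suc n} (\<lambda>d. F (axis_class p (Suc n) (proj p x) \<beta>) d j) = mixed (Suc n) {..<Suc n} (\<lambda>d. F' (axis_class p (Suc n) (proj p x) \<beta>) d j)"
    and j: "j < p + q" and \<gamma>: "\<gamma> \<in> points (fibre (rn p) (WD (Suc n)) (proj p x))"
  shows "mixed (Suc n) {..<Suc n} (\<lambda>d. F \<gamma> d j) = mixed (Suc n) {..<Suc n} (\<lambda>d. F' \<gamma> d j)"
proof -
  let ?N = "Suc n" and ?b = "proj p x"
  let ?A = "{..<?N}"
  note b = proj_points[of p x]
  define G where "G a = wclass (rn p) (WD ?N) (cube_poly ?N p ?b a)" for a
  have G: "G a \<in> points (fibre (rn p) (WD ?N) ?b)" for a
    unfolding G_def by (rule cube_poly_fibre[OF b])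
  define \<delta> where "\<delta> a = mixed ?N ?A (\<lambda>d. F (G a) d j) - mixed ?N ?A (\<lambda>d. F' (G a) d j)" for a
  have "\<delta> a = 0" for a
  proof (rule multihomogeneous_zero[of ?N p \<delta>])
    fix A :: "real \<Rightarrow> nat set \<times> nat \<Rightarrow> real"
    assume A: "\<And>S k. S \<subseteq> {..<?N} \<Longrightarrow> S \<noteq> {} \<Longrightarrow> k < p \<Longrightarrow> smooth (\<lambda>t. A t (S, k))"
    have c: "(\<lambda>t. G (A t)) \<in> curves (fibre (rn p) (WD ?N) ?b)"
      unfolding G_def by (rule cube_poly_curve[OF b]) (rule A)
    have "smooth (\<lambda>t. mixed ?N ?A (\<lambda>d. H (G (A t)) d j))" if "PS p q ?N (x, H)" for H
    proof -
      have "(\<lambda>t. H (G (A t))) \<in> curves (tensor (rn (p + q)) (WD ?N))"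
        using smooth_maps_curve[OF PS_D(2)[OF that] c] by (simp add: fibre_curves)
      from coords_curve_smooth[OF coords_tensor[OF coords_rn] this, of "(?A, j)"] j
      show ?thesis by (simp add: weil_coord_def)
    qed
    then show "smooth (\<lambda>t. \<delta> (A t))"
      unfolding \<delta>_def using T by (intro smooth_diff) auto
  next
    fix a a' :: "nat set \<times> nat \<Rightarrow> real"
    assume "\<And>S k. S \<subseteq> {..<?N} \<Longrightarrow> S \<noteq> {} \<Longrightarrow> k < p \<Longrightarrow> a (S, k) = a' (S, k)"
    then have "G a = G a'" unfolding G_def by (intro arg_cong[of _ _ "wclass (rn p) (WD ?N)"] cube_poly_cong)
    then show "\<delta> a = \<delta> a'" by (simp add: \<delta>_def)
  next
    fix i t and a :: "nat set \<times> nat \<Rightarrow> real" assume i: "i < ?N"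
    have "G (\<lambda>(S, k). (if i \<in> S then t else 1) * a (S, k)) = scale (rn p) ?N i t (G a)"
      unfolding G_def by (rule cube_poly_scale[OF i, symmetric])
    moreover have "mixed ?N ?A (\<lambda>d. H (scale (rn p) ?N i t (G a)) d j) = t * mixed ?N ?A (\<lambda>d. H (G a) d j)" if "PS p q ?N (x, H)" for H
      using mixed_scale_lift[OF PS_tensor[OF that G] i subset_refl j] PS_D(5)[OF that i G] i by simp
    ultimately show "\<delta> (\<lambda>(S, k). (if i \<in> S then t else 1) * a (S, k)) = t * \<delta> a"
      using T by (simp add: \<delta>_def right_diff_distrib)
  next
    fix i k and a :: "nat set \<times> nat \<Rightarrow> real"
    assume ik: "i < ?N" "k < ?N" "i \<noteq> k" and a: "\<And>S l. S \<subseteq> {..<?N} \<Longrightarrow> a (S, l) \<noteq> 0 \<Longrightarrow> i \<in> S \<longleftrightarrow> k \<in> S"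
    obtain \<sigma> \<eta> where s: "\<sigma> permutes {..<?N}" and e: "\<eta> \<in> points (fibre (rn p) (WD n) ?b)"
      and p: "permute (rn p) ?N \<sigma> (G a) = pull (rn p) (WD ?N) (kappa n) \<eta>"
      unfolding G_def by (rule cube_poly_kappa[OF b ik a])
    \<comment> \<open>The coefficient of the product of all variables is invariant under
      permutations, so the two variables may be moved into the position that \<open>kappa\<close>
      expects.\<close>
    have "mixed ?N ?A (\<lambda>d. H (permute (rn p) ?N \<sigma> (G a)) d j) = mixed ?N ?A (\<lambda>d. H (G a) d j)" if "PS p q ?N (x, H)" for H
      using mixed_permute_lift[OF PS_tensor[OF that G] s subset_refl j] PS_D(6)[OF that s G]
        permutes_image[OF permutes_inv[OF s]] by simp
    from this[OF T(1)] this[OF T(2)] have "\<delta> a = mixed ?N ?A (\<lambda>d. F (pull (rn p) (WD ?N) (kappa n) \<eta>) d j) -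
        mixed ?N ?A (\<lambda>d. F' (pull (rn p) (WD ?N) (kappa n) \<eta>) d j)"
      by (simp add: \<delta>_def p)
    then show "\<delta> a = 0" using kap[OF e] ik by simp
  next
    fix \<beta> :: "nat list" assume \<beta>: "length \<beta> = ?N" "set \<beta> \<subseteq> {..<p}"
    show "\<delta> (\<lambda>(S, k). if \<exists>i<?N. S = {i} \<and> k = \<beta> ! i then 1 else 0) = 0"
      unfolding \<delta>_def G_def cube_poly_basis[OF b \<beta>(2,1)] axis_class_def[symmetric] using top[OF \<beta>] by simp
  qed
  from this[of "weil_coord ?N (\<lambda>x j. x j) \<gamma>"] show ?thesis
    unfolding \<delta>_def G_def cube_poly_surj[OF \<gamma>, symmetric] by simp
qed

text \<open>A value is determined by its coefficients. Those of components below \<open>p\<close>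
  are fixed by the projection, the one of all variables by \<open>PS_top_zero\<close>; any other one
  misses a variable, and symmetry lets it be the last, so that it is determined in lower
  order.\<close>

lemma tangential_unique:
  assumes T: "PS p q (Suc n) (x, F)" "PS p q (Suc n) (x, F')"
    and low: "n \<ge> 1 \<Longrightarrow> ph p q n (x, F) = ph p q n (x, F')"
    and kap: "\<And>\<gamma>. \<gamma> \<in> points (fibre (rn p) (WD n) (proj p x)) \<Longrightarrow> n \<ge> 1 \<Longrightarrow>
      F (pull (rn p) (WD (Suc n)) (kappa n) \<gamma>) = F' (pull (rn p) (WD (Suc n)) (kappa n) \<gamma>)"
    and top: "\<And>\<beta> j. length \<beta> = Suc n \<Longrightarrow> set \<beta> \<subseteq> {..<p} \<Longrightarrow> p \<le> j \<Longrightarrow> j < p + q \<Longrightarrow>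
      mixed (Suc n) {..<Suc n} (\<lambda>d. F (axis_class p (Suc n) (proj p x) \<beta>) d j) = mixed (Suc n) {..<Suc n} (\<lambda>d. F' (axis_class p (Suc n) (proj p x) \<beta>) d j)"
  shows "F = F'"
proof (rule extensionalityI[OF PS_D(3)[OF T(1)] PS_D(3)[OF T(2)]])
  let ?N = "Suc n" and ?b = "proj p x"
  fix \<gamma> assume \<gamma>: "\<gamma> \<in> points (fibre (rn p) (WD ?N) ?b)"
  have low': "mixed ?N S (\<lambda>d. F \<gamma> d j) = mixed ?N S (\<lambda>d. F' \<gamma> d j)"
    if "n \<ge> 1" "S \<subseteq> {..<n}" "j < p + q" "\<gamma> \<in> points (fibre (rn p) (WD ?N) ?b)" for S j \<gamma>
    unfolding PS_lower_coord[OF T(1) that(4,2,3)] PS_lower_coord[OF T(2) that(4,2,3)] low[OF that(1)] ..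
  have "mixed ?N S (\<lambda>d. F \<gamma> d j) = mixed ?N S (\<lambda>d. F' \<gamma> d j)" if j: "j < p + q" and S: "S \<subseteq> {..<?N}" for S j
  proof (cases "j < p")
    case True
    show ?thesis unfolding PS_base_coord[OF T(1) \<gamma> S True] PS_base_coord[OF T(2) \<gamma> S True] ..
  next
    case jp: False
    show ?thesis
    proof (cases "S = {..<?N}")
      case True
      show ?thesis unfolding True
        by (rule PS_top_zero[OF T kap top j \<gamma>]) (use jp j in auto)
    next
      case False
      then obtain i where i: "i < ?N" "i \<notin> S" using S by auto
      show ?thesis
      proof (cases "n \<ge> 1")
        case n: True
        \<comment> \<open>Exchanging the missing variable with the last one leads to a coefficient
          without variable \<open>n\<close>, to which \<open>PS_lower_coord\<close> applies.\<close>
        let ?s = "Transposition.transpose i n"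
        have s: "?s permutes {..<?N}" by (rule permutes_swap_id) (use i in auto)
        have inv: "inv ?s = ?s" by (rule inv_transpose_eq)
        have S': "?s ` S \<subseteq> {..<n}"
        proof
          fix k assume "k \<in> ?s ` S"
          then obtain m where m: "m \<in> S" "k = ?s m" by blast
          with i have "m \<noteq> i" by auto
          with m S i show "k \<in> {..<n}" by (cases "m = n") (auto simp: Transposition.transpose_def less_Suc_eq)
        qed
        have ss: "?s ` ?s ` S = S" by (simp add: image_image)
        have "mixed ?N S (\<lambda>d. H \<gamma> d j) = mixed ?N (?s ` S) (\<lambda>d. H (permute (rn p) ?N ?s \<gamma>) d j)" if "PS p q ?N (x, H)" for H
          using mixed_permute_lift[OF PS_tensor[OF that \<gamma>] s _ j, of "?s ` S"] PS_D(6)[OF that s \<gamma>] S' ss inv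
          by (simp add: subset_iff less_Suc_eq)
        from this[OF T(1)] this[OF T(2)] low'[OF n S' j permute_fibre[OF \<gamma> s]] show ?thesis by simp
      next
        case False
        \<comment> \<open>Here n = 0 and \<open>i\<close> is the only variable, so the coefficient
          is the one of the empty set, which is the base point.\<close>
        then have "S \<subseteq> {i}" using i S by (auto simp: less_Suc_eq)
        then have "S = {}" using i by blast
        moreover have "H \<gamma> (\<lambda>_. 0) = x" if "PS p q ?N (x, H)" for H
          using smooth_maps_point[OF PS_D(2)[OF that] \<gamma>] by (simp add: fibre_points base_def)
        ultimately show ?thesis using T by (simp add: mixed_empty)
      qed
    qed
  qed
  then show "F \<gamma> = F' \<gamma>"
    using coords_eqI[OF coords_tensor[OF coords_rn] PS_tensor[OF T(1) \<gamma>] PS_tensor[OF T(2) \<gamma>]]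
    by (auto simp: weil_coord_def)
qed

lemma axis_class_permute:
  assumes b: "b \<in> points (rn p)" and \<alpha>: "set \<alpha> \<subseteq> {..<p}" "length \<alpha> = n" and s: "\<sigma> permutes {..<n}"
    and \<beta>: "\<And>i. i < n \<Longrightarrow> \<beta> ! \<sigma> i = \<alpha> ! i"
  shows "permute (rn p) n \<sigma> (axis_class p n b \<alpha>) = axis_class p n b \<beta>"
proof -
  have "axis_cube n b \<alpha> (\<lambda>j. d (\<sigma> j)) = axis_cube n b \<beta> d" for d
  proof
    fix l
    have "(\<Sum>i<n. d i * unit_vec (\<beta> ! i) l) = (\<Sum>i<n. d (\<sigma> i) * unit_vec (\<beta> ! \<sigma> i) l)"
      using sum.permute[OF s, of "\<lambda>i. d i * unit_vec (\<beta> ! i) l"] by (simp add: o_def)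
    then show "axis_cube n b \<alpha> (\<lambda>j. d (\<sigma> j)) l = axis_cube n b \<beta> d l" using \<beta> by (simp add: axis_cube_def)
  qed
  then show ?thesis
    unfolding axis_class_def permute_def pull_WD[OF axis_cube_map[OF b \<alpha>] inf_map_permute[OF s]] by simp
qed

text \<open>Exchanging two neighbouring entries of the list amounts to exchanging two variables of
  the cube, and the coefficient of the product of all variables is invariant under this. It supplies
  the symmetry of the coordinates of top order.\<close>

lemma PS_top_swap:
  assumes T: "PS p q n (x, F)" and \<alpha>: "set (A @ k # l # C) \<subseteq> {..<p}" "length (A @ k # l # C) = n" and j: "j < p + q"
  shows "mixed n {..<n} (\<lambda>d. F (axis_class p n (proj p x) (A @ k # l # C)) d j) =
    mixed n {..<n} (\<lambda>d. F (axis_class p n (proj p x) (A @ l # k # C)) d j)"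
proof -
  let ?i = "length A" and ?\<alpha> = "A @ k # l # C" and ?b = "proj p x"
  let ?s = "Transposition.transpose ?i (Suc ?i)"
  have s: "?s permutes {..<n}" by (rule permutes_swap_id) (use \<alpha>(2) in auto)
  note \<gamma> = axis_class_fibre[OF proj_points \<alpha>, of x]
  have m: "permute (rn p) n ?s (axis_class p n ?b ?\<alpha>) = axis_class p n ?b (A @ l # k # C)"
    by (rule axis_class_permute[OF proj_points \<alpha> s]) (auto simp: Transposition.transpose_def nth_append nth_Cons split: nat.split)
  have "mixed n {..<n} (\<lambda>d. F (permute (rn p) n ?s (axis_class p n ?b ?\<alpha>)) d j) = mixed n {..<n} (\<lambda>d. F (axis_class p n ?b ?\<alpha>) d j)"
    using mixed_permute_lift[OF PS_tensor[OF T \<gamma>] s subset_refl j] PS_D(6)[OF T s \<gamma>]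
      permutes_image[OF permutes_inv[OF s]] by simp
  then show ?thesis unfolding m by simp
qed

lemma base_pt_tang_coord: "base_pt p (tang_coord p q n T) = proj p (fst T)"
  by (simp add: base_pt_def proj_def tang_coord_Nil cong: if_cong)

lemma PS_fst: "PS p q n T \<Longrightarrow> fst T \<in> points (rn (p + q))"
  by (cases T) (auto dest: PS_D(1))

lemma sec_tang_coord_base:
  assumes T: "PS p q n T" and c: "sym_coeffs p q n (tang_coord p q n T)"
  shows "sec p q n (tang_coord p q n T) (proj p (fst T)) = fst T"
proof
  fix j
  show "sec p q n (tang_coord p q n T) (proj p (fst T)) j = fst T j"
  proof (cases "j < p + q")
    case True
    then have "([], j) \<in> jet_indices p q n" by (simp add: jet_indices_def)
    from pds_sec[OF c this] show ?thesis by (simp add: base_pt_tang_coord tang_coord_Nil)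
  next
    case False
    then show ?thesis using PS_fst[OF T] by (simp add: sec_def points_rn)
  qed
qed

text \<open>The tangential is compared with the one of the section built from its own coordinates;
  they agree by \<open>tangential_unique\<close>. The assumptions on lower order are guarded by
  \<open>n \<ge> 1\<close>, so that the case n = 0 covers tangentials of order 1.\<close>

lemma tangential_step:
  assumes T: "PS p q (Suc n) (x, F)"
    and low: "n \<ge> 1 \<Longrightarrow> sym_coeffs p q n (tang_coord p q n (ph p q n (x, F)))"
      "\<And>s. n \<ge> 1 \<Longrightarrow> sect p q s \<Longrightarrow> s (proj p x) = x \<Longrightarrow>
        (\<And>\<alpha> j. (\<alpha>, j) \<in> jet_indices p q n \<Longrightarrow> pds \<alpha> (\<lambda>y. s y j) (proj p x) = tang_coord p q n (ph p q n (x, F)) (\<alpha>, j)) \<Longrightarrow>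
        ph p q n (x, F) = tang p q n s (proj p x)"
    and kap: "\<And>\<gamma>. n \<ge> 1 \<Longrightarrow> \<gamma> \<in> points (fibre (rn p) (WD n) (proj p x)) \<Longrightarrow>
      F (pull (rn p) (WD (Suc n)) (kappa n) \<gamma>) = pull (rn (p + q)) (WD (Suc n)) (kappa n) (snd (ph p q n (x, F)) \<gamma>)"
  defines "c \<equiv> tang_coord p q (Suc n) (x, F)"
  shows "sym_coeffs p q (Suc n) c" "(x, F) = tang p q (Suc n) (sec p q (Suc n) c) (proj p x)"
proof -
  let ?N = "Suc n" and ?b = "proj p x"
  have top: "c (\<alpha>, j) = mixed ?N {..<?N} (\<lambda>d. F (axis_class p ?N ?b \<alpha>) d j)" if "length \<alpha> = ?N" for \<alpha> j
    using that by (simp add: c_def)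
  show cs: "sym_coeffs p q ?N c"
    unfolding sym_coeffs_def symm_def
  proof (intro allI impI)
    fix j A k l C
    assume a: "p \<le> j" "j < p + q" "set (A @ k # l # C) \<subseteq> {..<p}" "length (A @ k # l # C) \<le> ?N"
    show "c (A @ k # l # C, j) = c (A @ l # k # C, j)"
    proof (cases "length (A @ k # l # C) = ?N")
      case True
      then show ?thesis using PS_top_swap[OF T a(3) True a(2)] by (simp add: top)
    next
      case False
      then have le: "length (A @ k # l # C) \<le> n" "n \<ge> 1" using a(4) by auto
      have "symm p n (\<lambda>\<alpha>. tang_coord p q n (ph p q n (x, F)) (\<alpha>, j))" using low(1)[OF le(2)] a(1,2) by (simp add: sym_coeffs_def)
      from symmD[OF this a(3) le(1)] show ?thesis using le by (simp add: c_def)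
    qed
  qed
  define s where "s = sec p q ?N c"
  have s: "sect p q s" unfolding s_def by (rule sect_sec)
  have sb: "s ?b = x" using sec_tang_coord_base[OF T] cs by (simp add: s_def c_def)
  have pds: "pds \<alpha> (\<lambda>y. s y j) ?b = c (\<alpha>, j)" if "(\<alpha>, j) \<in> jet_indices p q ?N" for \<alpha> j
    using pds_sec[OF cs that] by (simp add: s_def c_def base_pt_tang_coord)
  define F' where "F' = snd (tang p q ?N s ?b)"
  have T'eq: "tang p q ?N s ?b = (x, F')" by (simp add: F'_def section_lift_def sb)
  have T': "PS p q ?N (x, F')" unfolding T'eq[symmetric] by (rule tan_pseudo[OF s proj_points])
  have ph: "ph p q n (x, F) = ph p q n (x, F')" if n: "n \<ge> 1"
  proof -
    have "ph p q n (x, F) = tang p q n s ?b"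
    proof (rule low(2)[OF n s sb])
      fix \<alpha> j assume i: "(\<alpha>, j) \<in> jet_indices p q n"
      then have "(\<alpha>, j) \<in> jet_indices p q ?N" "length \<alpha> \<le> n" by (auto simp: jet_indices_def)
      with pds[of \<alpha> j] show "pds \<alpha> (\<lambda>y. s y j) ?b = tang_coord p q n (ph p q n (x, F)) (\<alpha>, j)" by (simp add: c_def)
    qed
    moreover have "ph p q n (tang p q ?N s ?b) = tang p q n s ?b" by (rule pihat_tan[OF s proj_points])
    ultimately show ?thesis by (simp add: T'eq)
  qed
  have "F = F'"
  proof (rule tangential_unique[OF T T' ph])
    fix \<gamma> assume g: "\<gamma> \<in> points (fibre (rn p) (WD n) ?b)" and n: "n \<ge> 1"
    have "TN p q ?N (x, F')" unfolding T'eq[symmetric] by (rule tan_tangential[OF s proj_points]) simp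
    from tangential_Suc(2)[OF this n g] kap[OF n g] ph[OF n]
    show "F (pull (rn p) (WD ?N) (kappa n) \<gamma>) = F' (pull (rn p) (WD ?N) (kappa n) \<gamma>)" by simp
  next
    fix \<beta> j assume \<beta>: "length \<beta> = ?N" "set \<beta> \<subseteq> {..<p}" and j: "p \<le> j" "j < p + q"
    then have i: "(\<beta>, j) \<in> jet_indices p q ?N" by (simp add: jet_indices_def)
    have "tang_coord p q ?N (tang p q ?N s ?b) (\<beta>, j) = c (\<beta>, j)"
      using tang_coord_tan[OF s proj_points i] pds[OF i] by simp
    then show "mixed ?N {..<?N} (\<lambda>d. F (axis_class p ?N ?b \<beta>) d j) = mixed ?N {..<?N} (\<lambda>d. F' (axis_class p ?N ?b \<beta>) d j)"
      unfolding T'eq top[OF \<beta>(1)] by (simp add: \<beta>(1))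
  qed
  then show "(x, F) = tang p q ?N (sec p q ?N c) ?b" using T'eq by (simp add: s_def)
qed

theorem tangential_is_tang:
  assumes "TN p q n T"
  shows "sym_coeffs p q n (tang_coord p q n T)" "T = tang p q n (sec p q n (tang_coord p q n T)) (proj p (fst T))"
proof -
  have n: "n \<ge> 1" using assms by (cases rule: tangential.cases) auto
  have "TN p q n T \<longrightarrow> sym_coeffs p q n (tang_coord p q n T) \<and> T = tang p q n (sec p q n (tang_coord p q n T)) (proj p (fst T))"
    using n
  proof (induction n arbitrary: T rule: dec_induct)
    case base
    show ?case
    proof
      assume "TN p q 1 T"
      \<comment> \<open>Order 1 is the step from n = 0, where all guarded assumptions are
        vacuous.\<close>
      then have T: "PS p q (Suc 0) (fst T, snd T)" using tangential_pseudo by (simp add: One_nat_def)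
      show "sym_coeffs p q 1 (tang_coord p q 1 T) \<and> T = tang p q 1 (sec p q 1 (tang_coord p q 1 T)) (proj p (fst T))"
        using tangential_step[OF T] by (simp add: One_nat_def)
    qed
  next
    case (step n)
    show ?case
    proof
      assume TN: "TN p q (Suc n) T"
      obtain x F where T: "T = (x, F)" by (cases T)
      note T1 = tangential_pseudo[OF TN[unfolded T]] and T2 = tangential_Suc[OF TN[unfolded T] step(1)]
      let ?P = "ph p q n (x, F)"
      have IH: "sym_coeffs p q n (tang_coord p q n ?P)" "?P = tang p q n (sec p q n (tang_coord p q n ?P)) (proj p (fst ?P))"
        using step.IH[of ?P] T2(1) by blast+
      \<comment> \<open>The induction hypothesis also applies to the tangential of \<open>s\<close>:
        two tangentials with equal coordinates and base point are induced by the same polynomial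
        section.\<close>
      have un: "?P = tang p q n s (proj p x)"
        if s: "sect p q s" "s (proj p x) = x"
          and c: "\<And>\<alpha> j. (\<alpha>, j) \<in> jet_indices p q n \<Longrightarrow> pds \<alpha> (\<lambda>y. s y j) (proj p x) = tang_coord p q n ?P (\<alpha>, j)" for s
      proof -
        let ?Q = "tang p q n s (proj p x)"
        have fQ: "fst ?Q = x" "fst ?P = x" by (simp_all add: section_lift_def s(2) fst_pihat)
        have "tang_coord p q n ?Q k = tang_coord p q n ?P k" if "k \<in> jet_indices p q n" for k
          using that tang_coord_tan[OF s(1) proj_points] c by (cases k) auto
        then have "sec p q n (tang_coord p q n ?Q) = sec p q n (tang_coord p q n ?P)" by (rule sec_cong(1))
        moreover have "?Q = tang p q n (sec p q n (tang_coord p q n ?Q)) (proj p (fst ?Q))"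
          using step.IH[of ?Q] tan_tangential[OF s(1) proj_points step(1)] by blast
        ultimately show ?thesis using IH(2) unfolding fQ by simp
      qed
      show "sym_coeffs p q (Suc n) (tang_coord p q (Suc n) T) \<and> T = tang p q (Suc n) (sec p q (Suc n) (tang_coord p q (Suc n) T)) (proj p (fst T))"
        unfolding T fst_conv
        by (intro conjI tangential_step[OF T1 IH(1) un T2(2)])
    qed
  qed
  then show "sym_coeffs p q n (tang_coord p q n T)" "T = tang p q n (sec p q n (tang_coord p q n T)) (proj p (fst T))"
    using assms by blast+
qed

subsection \<open>Coordinates on the space of tangentials\<close>

abbreviation TS :: "nat \<Rightarrow> nat \<Rightarrow> nat \<Rightarrow> (nat \<Rightarrow> real, nat \<Rightarrow> real) lift space" where
  "TS p q n \<equiv> tangentials (rn p) (rn (p + q)) (proj p) n"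

lemma TS_points: "T \<in> points (TS p q n) \<longleftrightarrow> TN p q n T"
  by (simp add: tangentials_def lift_space_def)

lemma pull_smooth:
  assumes X: "coords X I i r" and u: "inf_map (Dobj m) (Dobj n) u"
  shows "pull X (WD m) u \<in> smooth_maps (tensor X (WD n)) (tensor X (WD m))"
proof (rule smooth_mapsI)
  show "pull X (WD m) u \<gamma> \<in> points (tensor X (WD m))" if "\<gamma> \<in> points (tensor X (WD n))" for \<gamma>
    by (rule pull_points[OF that u])
  fix c assume "c \<in> curves (tensor X (WD n))"
  then obtain f where f: "f \<in> curves (mapping_space n X)" "\<And>t. c t = wclass X (WD n) (f t)"
    using tensor_curve_lift[OF X] by blast
  note um = inf_map_WD_map[OF u]
  have "(\<lambda>t d. f t (u d)) \<in> curves (mapping_space m X)"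
    using f(1) smooth_maps_comp'[OF um] smooth_maps_curve[OF um]
    by (auto simp: mapping_space_def image_subset_iff)
  from tensor_WD_curve[OF this] show "(\<lambda>t. pull X (WD m) u (c t)) \<in> curves (tensor X (WD m))"
    unfolding f(2) pull_WD[OF mapping_curve_map[OF f(1)] u] .
qed

text \<open>Stated for curves of arbitrary lifts, so that the induction can pass to
  \<open>pihat\<close> and descend to order 0, where no tangentials exist.\<close>

lemma lift_curve_tang_coord:
  assumes "c \<in> curves (lift_space (rn p) (rn (p + q)) (proj p) (WD n) UNIV)"
    and "set \<alpha> \<subseteq> {..<p}" "j < p + q" and "length \<alpha> \<le> n"
  shows "smooth (\<lambda>t. tang_coord p q n (c t) (\<alpha>, j))"
  using assms(1,4)
proof (induction n arbitrary: c)
  case 0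
  then have "(\<lambda>t. fst (c t)) \<in> curves (rn (p + q))" by (simp add: lift_space_def o_def)
  then show ?case using assms(3) by (simp add: curves_rn)
next
  case (Suc n)
  let ?N = "Suc n"
  have c1: "(\<lambda>t. fst (c t)) \<in> curves (rn (p + q))"
    and c2: "\<And>g t. smooth g \<Longrightarrow> t \<in> curves (tensor (rn p) (WD ?N)) \<Longrightarrow> (\<And>r. base (t r) = proj p (fst (c (g r)))) \<Longrightarrow>
      (\<lambda>r. snd (c (g r)) (t r)) \<in> curves (tensor (rn (p + q)) (WD ?N))"
    using Suc.prems by (auto simp: lift_space_def o_def)
  show ?case
  proof (cases "length \<alpha> \<le> n")
    case True
    have "(\<lambda>t. ph p q n (c t)) \<in> curves (lift_space (rn p) (rn (p + q)) (proj p) (WD n) UNIV)"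
      unfolding lift_space_def
    proof (simp add: o_def fst_pihat c1, intro allI impI)
      fix g t assume g: "smooth g" and t: "t \<in> curves (tensor (rn p) (WD n))" and b: "\<forall>r. base (t r) = proj p (fst (c (g r)))"
      let ?u = "\<lambda>d. d(n := 0::real)"
      have z: "?u (\<lambda>_. 0) = (\<lambda>_. 0)" by auto
      have tf: "t r \<in> points (fibre (rn p) (WD n) (proj p (fst (c (g r)))))" for r
        using coords_curve_points[OF coords_tensor[OF coords_rn] t] b by (simp add: fibre_points)
      have t': "(\<lambda>r. pull (rn p) (WD ?N) ?u (t r)) \<in> curves (tensor (rn p) (WD ?N))"
        by (rule smooth_maps_curve[OF pull_smooth[OF coords_rn inf_map_project] t])
      have "(\<lambda>r. snd (c (g r)) (pull (rn p) (WD ?N) ?u (t r))) \<in> curves (tensor (rn (p + q)) (WD ?N))"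
        by (rule c2[OF g t']) (use pull_fibre[OF coords_rn tf inf_map_project z] in \<open>unfold fibre_points, blast\<close>)
      from smooth_maps_curve[OF pull_smooth[OF coords_rn inf_map_include] this]
      show "(\<lambda>r. snd (ph p q n (c (g r))) (t r)) \<in> curves (tensor (rn (p + q)) (WD n))"
        using tf by (simp add: pihat_def split_beta)
    qed
    from Suc.IH[OF this True] True show ?thesis by simp
  next
    case False
    let ?b = "\<lambda>t. proj p (fst (c t))"
    have len: "length \<alpha> = ?N" using False Suc.prems by simp
    have bc: "?b \<in> curves (rn p)" by (rule smooth_maps_curve[OF proj_smooth c1])
    have bp: "?b t \<in> points (rn p)" for t by (rule proj_points)
    have "(\<lambda>t. axis_cube ?N (?b t) \<alpha>) \<in> curves (mapping_space ?N (rn p))"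
    proof (rule mapping_curveI[OF coords_rn])
      show "axis_cube ?N (?b t) \<alpha> d \<in> points (rn p)" if "d \<in> points (rn ?N)" for t d
        by (rule smooth_maps_point[OF axis_cube_map[OF bp assms(2) len] that])
      show "(\<lambda>y. axis_cube ?N (?b (y ?N)) \<alpha> (y(?N := 0)) k) \<in> sf (Suc ?N)" for k
        unfolding axis_cube_def
      proof (intro sf_add sf_sum sf_mult sf_const)
        show "(\<lambda>y. ?b (y ?N) k) \<in> sf (Suc ?N)"
          by (rule sfI, rule smooth_compose[of "\<lambda>t. ?b t k"]) (use bc in \<open>simp_all add: curves_rn\<close>)
        show "(\<lambda>y. (y(?N := 0)) i) \<in> sf (Suc ?N)" for i by (cases "i = ?N") (simp_all add: sf_const sf_coord)
      qed
    qed
    then have m: "(\<lambda>t. axis_class p ?N (?b t) \<alpha>) \<in> curves (tensor (rn p) (WD ?N))"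
      unfolding axis_class_def by (rule tensor_WD_curve)
    have "(\<lambda>t. snd (c t) (axis_class p ?N (?b t) \<alpha>)) \<in> curves (tensor (rn (p + q)) (WD ?N))"
      by (rule c2[OF smooth_ident m]) (use axis_class_fibre[OF bp assms(2) len] in \<open>simp add: fibre_points\<close>)
    from coords_curve_smooth[OF coords_tensor[OF coords_rn] this, of "({..<?N}, j)"] assms(3) False
    show ?thesis by (simp add: weil_coord_def)
  qed
qed

lemma TS_curves:
  "c \<in> curves (TS p q n) \<longleftrightarrow> (\<forall>t. TN p q n (c t)) \<and> c \<in> curves (lift_space (rn p) (rn (p + q)) (proj p) (WD n) UNIV)"
  by (auto simp: tangentials_def lift_space_def)

lemma tang_curve:
  assumes C: "\<And>k. k \<in> jet_indices p q n \<Longrightarrow> smooth (\<lambda>t. C t k)"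
  shows "(\<lambda>t. tang p q n (sec p q n (C t)) (base_pt p (C t))) \<in> curves (lift_space (rn p) (rn (p + q)) (proj p) (WD n) UNIV)"
proof -
  let ?S = "\<lambda>t. sec p q n (C t)" and ?b = "\<lambda>t. base_pt p (C t)"
  have Csf: "(\<lambda>e. C (u e) k) \<in> sf l" if "u \<in> sf l" "k \<in> jet_indices p q n" for u l k
    using smooth_compose[OF C[OF that(2)] sfD[OF that(1)]] by (rule sfI)
  have F1: "fam p q l (\<lambda>e. ?S (u e))" if "u \<in> sf l" for u l
    by (rule fam_sec[OF Csf[OF that]])
  have unit_vec: "(\<lambda>e. ?S (u e) (B e) j) \<in> sf l" if "u \<in> sf l" "B \<in> smooth_maps (rn l) (rn p)" for u B l j
    using fam_pds[OF F1[OF that(1)] that(2), of "[]" j] by simp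
  have B1: "(\<lambda>e. ?b (u e)) \<in> smooth_maps (rn l) (rn p)" if "u \<in> sf l" for u l
    unfolding coords_smooth_maps_iff[OF coords_rn]
    using Csf[OF that] base_pt_points by (auto simp: base_pt_def jet_indices_def)
  have "(\<lambda>t. (\<lambda>_. 0)(0 := t)) \<in> curves (rn 1)"
    using append_last_curve[OF const_curve[OF zero_points[of 0]] smooth_ident] by (simp add: One_nat_def)
  from sfD[OF unit_vec[OF sf_coord[of 0] B1[OF sf_coord[of 0]]] this]
  have "smooth (\<lambda>t. ?S t (?b t) j)" for j by simp
  then have c1: "(\<lambda>t. ?S t (?b t)) \<in> curves (rn (p + q))"
    using smooth_maps_point[OF sect_map[OF sect_sec] base_pt_points] by (simp add: curves_rn points_rn)
  have "(\<lambda>r. snd (tang p q n (?S (g r)) (?b (g r))) (t r)) \<in> curves (tensor (rn (p + q)) (WD n))"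
    if g: "smooth g" and t: "t \<in> curves (tensor (rn p) (WD n))"
      and bt: "\<And>r. base (t r) = proj p (?S (g r) (?b (g r)))" for g t
  proof -
    obtain f where f: "f \<in> curves (mapping_space n (rn p))" "\<And>r. t r = wclass (rn p) (WD n) (f r)"
      using tensor_curve_lift[OF coords_rn t] by blast
    have "snd (tang p q n (?S (g r)) (?b (g r))) (t r) = wclass (rn (p + q)) (WD n) (\<lambda>d. ?S (g r) (f r d))" for r
    proof -
      have "t r \<in> points (fibre (rn p) (WD n) (?b (g r)))"
        using coords_curve_points[OF coords_tensor[OF coords_rn] t] bt sect_proj[OF sect_sec base_pt_points] by (simp add: fibre_points)
      then have "snd (tang p q n (?S (g r)) (?b (g r))) (t r) = prolong (rn (p + q)) (WD n) (?S (g r)) (t r)"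
        by (simp add: section_lift_def)
      then show ?thesis
        unfolding f(2) prolong_WD[OF mapping_curve_map[OF f(1)] sect_map[OF sect_sec]] .
    qed
    moreover have "(\<lambda>r. wclass (rn (p + q)) (WD n) (\<lambda>d. ?S (g r) (f r d))) \<in> curves (tensor (rn (p + q)) (WD n))"
    proof (rule tensor_WD_curve, rule mapping_curveI[OF coords_rn])
      show "?S (g r) (f r d) \<in> points (rn (p + q))" if "d \<in> points (rn n)" for r d
        by (intro smooth_maps_point[OF sect_map[OF sect_sec]] smooth_maps_point[OF mapping_curve_map[OF f(1)] that])
      fix k
      have gs: "(\<lambda>y. g (y n)) \<in> sf (Suc n)"
        by (rule sfI, rule smooth_compose[OF g]) (simp add: curves_rn)
      have "(\<lambda>y. f (y n) (y(n := 0))) \<in> smooth_maps (rn (Suc n)) (rn p)"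
        unfolding coords_smooth_maps_iff[OF coords_rn]
      proof (intro conjI ballI)
        fix y :: "nat \<Rightarrow> real" assume "y \<in> points (rn (Suc n))"
        then show "f (y n) (y(n := 0)) \<in> points (rn p)"
          by (intro smooth_maps_point[OF mapping_curve_map[OF f(1)]]) (auto simp: points_rn)
      qed (rule mapping_curveD[OF coords_rn f(1)])
      from unit_vec[OF gs this]
      show "(\<lambda>y. ?S (g (y n)) (f (y n) (y(n := 0))) k) \<in> sf (Suc n)" .
    qed
    ultimately show ?thesis by simp
  qed
  then show ?thesis
    using c1 unfolding lift_space_def by (simp add: o_def section_lift_def)
qed

text \<open>Tangentials occur as a factor of a fibre product that is prolonged in the definition of
  \<open>phi\<close>; these coordinates make \<open>wpair\<close> computable there.\<close>

lemma coords_TS: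
  assumes n: "n \<ge> 1"
  shows "coords (TS p q n) (jet_indices p q n) (tang_coord p q n) (\<lambda>c. tang p q n (sec p q n c) (base_pt p c))"
  unfolding coords_def
proof (intro conjI ballI allI impI)
  show "finite (jet_indices p q n)" by (rule finite_jet_indices)
  fix c assume c: "c \<in> curves (TS p q n)"
  show "c t \<in> points (TS p q n)" for t using c by (simp add: TS_curves TS_points)
  fix k assume "k \<in> jet_indices p q n"
  then obtain \<alpha> j where "k = (\<alpha>, j)" "set \<alpha> \<subseteq> {..<p}" "j < p + q" "length \<alpha> \<le> n" by (cases k) (auto simp: jet_indices_def)
  then show "smooth (\<lambda>t. tang_coord p q n (c t) k)" using lift_curve_tang_coord[of c p q n \<alpha> j] c by (simp add: TS_curves)
next
  fix C :: "real \<Rightarrow> nat list \<times> nat \<Rightarrow> real" assume "\<forall>k\<in>jet_indices p q n. smooth (\<lambda>t. C t k)"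
  then show "(\<lambda>t. tang p q n (sec p q n (C t)) (base_pt p (C t))) \<in> curves (TS p q n)"
    unfolding TS_curves using tang_curve[of p q n C] tan_tangential[OF sect_sec base_pt_points n] by blast
next
  fix T assume "T \<in> points (TS p q n)"
  then have "TN p q n T" by (simp add: TS_points)
  from tangential_is_tang(2)[OF this]
  show "tang p q n (sec p q n (tang_coord p q n T)) (base_pt p (tang_coord p q n T)) = T" by (simp add: base_pt_tang_coord)
next
  fix c c' :: "nat list \<times> nat \<Rightarrow> real" assume "\<forall>k\<in>jet_indices p q n. c k = c' k"
  then show "tang p q n (sec p q n c) (base_pt p c) = tang p q n (sec p q n c') (base_pt p c')"
    using sec_cong[of p q n c c'] by simp
qed

lemma fam_tang:
  assumes n: "n \<ge> 1" and S: "fam p q l S" and B: "B \<in> smooth_maps (rn l) (rn p)"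
  shows "(\<lambda>e. tang p q n (S e) (B e)) \<in> smooth_maps (rn l) (TS p q n)"
  unfolding coords_smooth_maps_iff[OF coords_TS[OF n]]
proof (intro conjI ballI)
  show "tang p q n (S e) (B e) \<in> points (TS p q n)" if "e \<in> points (rn l)" for e
    unfolding TS_points by (intro tan_tangential[OF fam_sect[OF S that] smooth_maps_point[OF B that] n])
  fix k assume "k \<in> jet_indices p q n"
  then obtain \<alpha> j where k: "k = (\<alpha>, j)" "(\<alpha>, j) \<in> jet_indices p q n" by (cases k) auto
  have "(\<lambda>e. pds \<alpha> (\<lambda>x. S e x j) (B e)) \<in> sf l"
    by (rule fam_pds[OF S B]) (use k in \<open>auto simp: jet_indices_def\<close>)
  then show "(\<lambda>e. tang_coord p q n (tang p q n (S e) (B e)) k) \<in> sf l"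
    unfolding k(1)
    by (rule sf_cong) (simp add: tang_coord_tan[OF fam_sect[OF S] smooth_maps_point[OF B] k(2)])
qed

lemma TS_proj_smooth: "proj p \<circ> fst \<in> smooth_maps (TS p q n) (rn p)"
proof (rule smooth_mapsI)
  show "(proj p \<circ> fst) T \<in> points (rn p)" for T :: "(nat \<Rightarrow> real, nat \<Rightarrow> real) lift" by (simp add: proj_points)
  fix c assume "c \<in> curves (TS p q n)"
  then have "(\<lambda>t. fst (c t)) \<in> curves (rn (p + q))" by (simp add: TS_curves lift_space_def o_def)
  from smooth_maps_curve[OF proj_smooth this] show "(\<lambda>t. (proj p \<circ> fst) (c t)) \<in> curves (rn p)" by simp
qed

lemma tang_eval_smooth:
  "(\<lambda>(T, t). snd T t) \<in> smooth_maps (fibre_product (TS p q n) (tensor (rn p) (WD n)) (proj p \<circ> fst) base) (tensor (rn (p + q)) (WD n))"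
proof (rule smooth_mapsI)
  fix z assume "z \<in> points (fibre_product (TS p q n) (tensor (rn p) (WD n)) (proj p \<circ> fst) base)"
  then obtain x F t where z: "z = ((x, F), t)" "TN p q n (x, F)" "t \<in> points (fibre (rn p) (WD n) (proj p x))"
    by (auto simp: fibre_product_def TS_points fibre_points)
  from PS_tensor[OF tangential_pseudo[OF z(2)] z(3)]
  show "(case z of (T, t) \<Rightarrow> snd T t) \<in> points (tensor (rn (p + q)) (WD n))" by (simp add: z(1))
next
  fix c assume c: "c \<in> curves (fibre_product (TS p q n) (tensor (rn p) (WD n)) (proj p \<circ> fst) base)"
  then have "(\<lambda>t. fst (c t)) \<in> curves (TS p q n)" and 2: "(\<lambda>t. snd (c t)) \<in> curves (tensor (rn p) (WD n))"
    and 3: "\<And>r. base (snd (c r)) = proj p (fst (fst (c r)))"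
    by (auto simp: fibre_product_def o_def)
  then have "(\<lambda>r. snd (fst (c r)) (snd (c r))) \<in> curves (tensor (rn (p + q)) (WD n))"
    using smooth_ident by (simp add: TS_curves lift_space_def)
  then show "(\<lambda>t. case c t of (T, t) \<Rightarrow> snd T t) \<in> curves (tensor (rn (p + q)) (WD n))"
    by (simp add: split_beta)
qed

section \<open>The comparison map\<close>

abbreviation PH :: "nat \<Rightarrow> nat \<Rightarrow> nat \<Rightarrow> (nat \<Rightarrow> real, nat \<Rightarrow> real) jet \<Rightarrow> (nat \<Rightarrow> real, nat \<Rightarrow> real) lift" where
  "PH p q n \<equiv> phi (rn p) (rn (p + q)) (proj p) n"

lemma bottom_smooth: "bottom \<in> smooth_maps (JS p q n) (rn (p + q))"
  using good_jets[of p q n] by (simp add: good_def)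

text \<open>On jets of sections the map is known, and every jet is one. So it is the reading of the
  coordinates of a jet followed by the retraction onto tangentials, and both are smooth.\<close>

lemma phi_smooth:
  assumes n: "n \<ge> 1"
    and \<phi>: "\<And>s b. sect p q s \<Longrightarrow> b \<in> points (rn p) \<Longrightarrow> PH p q n (jet_of p q n s b) = tang p q n s b"
  shows "PH p q n \<in> smooth_maps (JS p q n) (TS p q n)"
proof -
  note J = good_coords[OF good_jets[of p q n]]
  have e: "PH p q n x = tang p q n (sec p q n (jcoord p n x)) (base_pt p (jcoord p n x))" if "x \<in> points (JS p q n)" for x
    using \<phi>[OF sect_sec base_pt_points] jets_retract[OF good_jets that] by metis
  show ?thesis
  proof (rule smooth_mapsI)
    show "PH p q n x \<in> points (TS p q n)" if "x \<in> points (JS p q n)" for x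
      unfolding e[OF that] by (rule coords_point[OF coords_TS[OF n]])
    fix c assume c: "c \<in> curves (JS p q n)"
    have "(\<lambda>t. tang p q n (sec p q n (jcoord p n (c t))) (base_pt p (jcoord p n (c t)))) \<in> curves (TS p q n)"
      by (rule coords_retract_curve[OF coords_TS[OF n]]) (rule coords_curve_smooth[OF J c])
    then show "(\<lambda>t. PH p q n (c t)) \<in> curves (TS p q n)"
      using e[OF coords_curve_points[OF J c]] by simp
  qed
qed

lemma phi_tang_1:
  assumes s: "sect p q s" and b: "b \<in> points (rn p)"
  shows "PH p q 1 (jet_of p q 1 s b) = tang p q 1 s b"
proof -
  have "prolong (rn (p + q)) (WD 1) bottom (jet_fun (jet_of p q (Suc 0) s b) \<gamma>) = prolong (rn (p + q)) (WD 1) s \<gamma>"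
    if \<gamma>: "\<gamma> \<in> points (fibre (rn p) (WD 1) b)" for \<gamma>
  proof -
    have gm: "\<gamma> \<in> smooth_maps (rn 1) (rn p)" using \<gamma> by (simp add: fibre_points tensor_WD_map)
    have "prolong (JS p q 0) (WD 1) (jet_of p q 0 s) \<gamma> = wclass (JS p q 0) (WD 1) (\<lambda>x. jet_of p q 0 s (\<gamma> x))"
      unfolding prolong_def o_def ..
    then have "prolong (rn (p + q)) (WD 1) bottom (jet_fun (jet_of p q (Suc 0) s b) \<gamma>) =
        wclass (rn (p + q)) (WD 1) (\<lambda>x. bottom (jet_of p q 0 s (\<gamma> x)))"
      unfolding jet_fun_jet_of[OF \<gamma>]
      by (simp only: prolong_WD[OF smooth_maps_comp'[OF gm jet_of_smooth[OF good_jets s]] bottom_smooth])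
    then show ?thesis unfolding bottom_jet_of by (simp only: prolong_def o_def)
  qed
  then show ?thesis
    unfolding One_nat_def phi.simps bottom_jet_of sect_proj[OF s b] section_lift_def
    by (auto simp: One_nat_def intro!: restrict_ext)
qed

lemma vappend_zero:
  assumes "e \<in> points (rn 1)"
  shows "vappend n (\<lambda>_. 0) e = (\<lambda>i. if i = n then e 0 else 0)"
  using assms by (auto simp: vappend_def points_rn fun_eq_iff One_nat_def)

text \<open>Both sides send \<open>\<gamma>\<close> to the class of \<open>s\<close> composed with
  \<open>\<gamma>\<close>. For each value of the last variable the lift gives the jet of
  \<open>s\<close> at the corresponding point of the last edge; by hypothesis this becomes the
  tangential of \<open>s\<close> there, and it is evaluated on the slice of \<open>\<gamma>\<close>
  over the same value.\<close>

lemma phi_tang_Suc: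
  assumes n: "n = Suc m"
    and IH: "\<And>s b. sect p q s \<Longrightarrow> b \<in> points (rn p) \<Longrightarrow> PH p q n (jet_of p q n s b) = tang p q n s b"
    and s: "sect p q s" and b: "b \<in> points (rn p)"
  shows "PH p q (Suc n) (jet_of p q (Suc n) s b) = tang p q (Suc n) s b"
proof -
  let ?M = "rn p" and ?E = "rn (p + q)"
  let ?l = "\<lambda>d i. if i = n then d 0 else 0 :: real"
  let ?P = "fibre_product (TS p q n) (tensor ?M (WD n)) (proj p \<circ> fst) base"
  have n1: "n \<ge> 1" using n by simp
  note one = len_Dobj[of 1]
  have ph: "PH p q n \<in> smooth_maps (JS p q n) (TS p q n)" by (rule phi_smooth[OF n1 IH])
  have "wuncurry ?E (Dobj n) (Dobj 1)
      (prolong (tensor ?E (WD n)) (WD 1) (\<lambda>(T, t). snd T t)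
        (wpair (TS p q n) (tensor ?M (WD n)) (proj p \<circ> fst) base (WD 1)
          (prolong (TS p q n) (WD 1) (PH p q n) (jet_fun (jet_of p q (Suc n) s b) (pull ?M (WD 1) ?l \<gamma>)))
          (wcurry ?M (Dobj n) (Dobj 1) \<gamma>))) = prolong ?E (WD (Suc n)) s \<gamma>"
    if \<gamma>: "\<gamma> \<in> points (fibre ?M (WD (Suc n)) b)" for \<gamma>
  proof -
    have gt: "\<gamma> \<in> points (tensor ?M (WD (Suc n)))" using \<gamma> by (simp add: fibre_points)
    note gm = tensor_WD_map[OF gt]
    have gc: "wclass ?M (WD (Suc n)) \<gamma> = \<gamma>" using tensor_point_map(2)[of \<gamma> ?M "Dobj (Suc n)"] gt by simp
    have gm': "\<gamma> \<in> smooth_maps (rn (n + length (Dobj 1))) ?M" using gm by (simp add: one One_nat_def)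
    note lm = inf_map_WD_map[OF inf_map_last[of n]]
    have l0: "?l (\<lambda>_. 0) = (\<lambda>_. 0)" by auto
    let ?f = "\<lambda>e. tang p q n s (\<gamma> (?l e))" and ?\<Phi> = "\<lambda>e. wclass ?M (WD n) (\<lambda>d. \<gamma> (vappend n d e))"
    note gl = smooth_maps_comp'[OF lm gm]
    have "pull ?M (WD 1) ?l \<gamma> = wclass ?M (WD 1) (\<lambda>e. \<gamma> (?l e))"
      by (simp add: pull_def o_def)
    moreover have "pull ?M (WD 1) ?l \<gamma> \<in> points (fibre ?M (WD 1) b)"
      by (rule pull_fibre[OF coords_rn \<gamma> inf_map_last l0])
    ultimately have "jet_fun (jet_of p q (Suc n) s b) (pull ?M (WD 1) ?l \<gamma>) =
        wclass (JS p q n) (WD 1) (\<lambda>e. jet_of p q n s (\<gamma> (?l e)))"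
      using jet_fun_jet_of prolong_WD[OF gl jet_of_smooth[OF good_jets s]] by simp
    then have "prolong (TS p q n) (WD 1) (PH p q n) (jet_fun (jet_of p q (Suc n) s b) (pull ?M (WD 1) ?l \<gamma>)) =
        wclass (TS p q n) (WD 1) (\<lambda>e. PH p q n (jet_of p q n s (\<gamma> (?l e))))"
      using prolong_WD[OF smooth_maps_comp'[OF gl jet_of_smooth[OF good_jets s]] ph] by simp
    also have "\<dots> = wclass (TS p q n) (WD 1) ?f"
      by (rule wclass_WD_cong[OF smooth_maps_comp'[OF smooth_maps_comp'[OF gl jet_of_smooth[OF good_jets s]] ph]])
        (rule IH[OF s smooth_maps_point[OF gl]])
    finally have A: "prolong (TS p q n) (WD 1) (PH p q n) (jet_fun (jet_of p q (Suc n) s b) (pull ?M (WD 1) ?l \<gamma>)) =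
        wclass (TS p q n) (WD 1) ?f" .
    have app: "Dobj n @ Dobj 1 = Dobj (Suc n)" by (simp only: Dobj_append Suc_eq_plus1)
    have B: "wcurry ?M (Dobj n) (Dobj 1) \<gamma> = wclass (tensor ?M (WD n)) (WD 1) ?\<Phi>"
      using wcurry_wclass[OF coords_rn gm'] unfolding app gc .
    have f: "?f \<in> smooth_maps (rn 1) (TS p q n)" by (rule fam_tang[OF n1 fam_const[OF s] gl])
    have \<Phi>: "?\<Phi> \<in> smooth_maps (rn 1) (tensor ?M (WD n))"
      using tensor_family[OF coords_rn gm'] unfolding one .
    have \<Phi>b: "base (?\<Phi> e) = \<gamma> (?l e)" if e: "e \<in> points (rn 1)" for e
      using base_wclass_WD[OF coords_rn smooth_maps_vappend_left[OF coords_rn gm']] e vappend_zero[OF e] by simp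
    have fb: "(proj p \<circ> fst) (?f e) = base (?\<Phi> e)" if e: "e \<in> points (rn 1)" for e
      using \<Phi>b[OF e] sect_proj[OF s smooth_maps_point[OF gl e]] by (simp add: section_lift_def)
    have wp: "wpair (TS p q n) (tensor ?M (WD n)) (proj p \<circ> fst) base (WD 1) (wclass (TS p q n) (WD 1) ?f)
        (wclass (tensor ?M (WD n)) (WD 1) ?\<Phi>) = wclass ?P (WD 1) (\<lambda>e. (?f e, ?\<Phi> e))"
      "(\<lambda>e. (?f e, ?\<Phi> e)) \<in> smooth_maps (rn 1) ?P"
      using wpair_wclass[where ms = "Dobj 1" and n = n and f = ?f and g = ?\<Phi>, OF coords_TS[OF n1] TS_proj_smooth]
      unfolding one using f \<Phi> fb by blast+
    let ?F = "\<lambda>y. s (\<gamma> y)"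
    have F: "?F \<in> smooth_maps (rn (n + length (Dobj 1))) ?E" by (rule smooth_maps_comp'[OF gm' sect_map[OF s]])
    have "prolong (tensor ?E (WD n)) (WD 1) (\<lambda>(T, t). snd T t) (wclass ?P (WD 1) (\<lambda>e. (?f e, ?\<Phi> e))) =
        wclass (tensor ?E (WD n)) (WD 1) (\<lambda>e. snd (?f e) (?\<Phi> e))"
      using prolong_WD[OF wp(2) tang_eval_smooth] by simp
    also have "\<dots> = wclass (tensor ?E (WD n)) (WD 1) (\<lambda>e. wclass ?E (WD n) (\<lambda>d. ?F (vappend n d e)))"
    proof (rule wclass_WD_cong)
      show "(\<lambda>e. snd (?f e) (?\<Phi> e)) \<in> smooth_maps (rn 1) (tensor ?E (WD n))"
        using smooth_maps_comp'[OF wp(2) tang_eval_smooth] by simp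
      fix e assume e: "e \<in> points (rn 1)"
      have "?\<Phi> e \<in> points (fibre ?M (WD n) (\<gamma> (?l e)))"
        using smooth_maps_point[OF \<Phi> e] \<Phi>b[OF e] by (simp add: fibre_points)
      then have "snd (?f e) (?\<Phi> e) = prolong ?E (WD n) s (?\<Phi> e)" by (simp add: section_lift_def)
      also have "\<dots> = wclass ?E (WD n) (\<lambda>d. ?F (vappend n d e))"
        by (rule prolong_WD[OF smooth_maps_vappend_left[OF coords_rn gm'] sect_map[OF s]]) (use e in simp)
      finally show "snd (?f e) (?\<Phi> e) = wclass ?E (WD n) (\<lambda>d. ?F (vappend n d e))" .
    qed
    finally show ?thesis
      unfolding A B wp(1) using wuncurry_wclass[OF coords_rn F] unfolding app by (simp add: prolong_def o_def)
  qed
  then show ?thesis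
    unfolding n phi.simps Let_def bottom_jet_of sect_proj[OF s b] section_lift_def
    by (auto intro!: restrict_ext)
qed

lemma phi_tang:
  assumes "n \<ge> 1" "sect p q s" "b \<in> points (rn p)"
  shows "PH p q n (jet_of p q n s b) = tang p q n s b"
  using assms
proof (induction n arbitrary: s b rule: dec_induct)
  case base
  then show ?case by (intro phi_tang_1)
next
  case (step n)
  then obtain m where "n = Suc m" by (cases n) auto
  from phi_tang_Suc[OF this step.IH step.prems] show ?case .
qed

theorem corollary85:
  fixes p q n :: nat
  assumes "n \<ge> 1"
  shows "bij_betw (phi (rn p) (rn (p + q)) (proj p) n)
           (points (jets (rn p) (rn (p + q)) (proj p) n))
           (points (tangentials (rn p) (rn (p + q)) (proj p) n))"
proof (rule bij_betwI')
  have ph: "PH p q n \<in> smooth_maps (JS p q n) (TS p q n)" by (rule phi_smooth[OF assms phi_tang[OF assms]])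
  then show "PH p q n x \<in> points (TS p q n)" if "x \<in> points (JS p q n)" for x
    using that by (rule smooth_maps_point)
  fix x y assume x: "x \<in> points (JS p q n)" and y: "y \<in> points (JS p q n)"
  have t: "PH p q n z = tang p q n (sec p q n (jcoord p n z)) (base_pt p (jcoord p n z))" if "z \<in> points (JS p q n)" for z
    using phi_tang[OF assms sect_sec base_pt_points] jets_retract[OF good_jets that] by metis
  \<comment> \<open>\<open>phi\<close> preserves coordinates, since on both sides they are the
    derivatives of the same section; injectivity is then the fact that coordinates separate
    jets.\<close>
  have c: "tang_coord p q n (PH p q n z) k = jcoord p n z k" if z: "z \<in> points (JS p q n)" and k: "k \<in> jet_indices p q n" for z k
    unfolding t[OF z]
    using tang_coord_tan[OF sect_sec base_pt_points] pds_sec[OF sym_coeffs_jcoord[OF good_jets z]] k by (cases k) auto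
  show "PH p q n x = PH p q n y \<longleftrightarrow> x = y"
    using coords_eqI[OF good_coords[OF good_jets] x y] c[OF x] c[OF y] by metis
next
  fix T assume "T \<in> points (TS p q n)"
  then have "TN p q n T" by (simp add: TS_points)
  from tangential_is_tang(2)[OF this]
  have "T = PH p q n (jet_of p q n (sec p q n (tang_coord p q n T)) (proj p (fst T)))"
    unfolding phi_tang[OF assms sect_sec proj_points] .
  then show "\<exists>x\<in>points (JS p q n). T = PH p q n x"
    using jet_of_points[OF good_jets sect_sec proj_points] by blast
qed

end
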